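(* Let $n\ge1$ and $u\in D^{-1}(\mathbb{R}^n)$. An element $v\in D^{-1}(\mathbb{R}^n)$ belongs to the subdifferential $\partial TV(u)$ of $TV$ in $D^{-1}(\mathbb{R}^n)$ if and only if there is $Z\in L^\infty(\mathbb{R}^n;\mathbb{R}^n)$ with $\operatorname{div}Z\in D^1_0(\mathbb{R}^n)$ such that (i) $|Z|\le1$ a.e., (ii) $v=\Delta\operatorname{div}Z$, (iii) $-\langle u,\operatorname{div}Z\rangle=TV(u)$.
   Context: $D^1_0=D^1_0(\mathbb{R}^n)$ is the completion of $C_c^\infty(\mathbb{R}^n)$ in the norm $\|\nabla u\|_{L^2}$, with inner product $\int\nabla u\cdot\nabla v$; for $n\ge3$ it is identified with $\{u\in L^{2n/(n-2)}(\mathbb{R}^n):\nabla u\in L^2\}$, for $n\le2$ with $D^1/\mathbb{R}$, where $D^1=\{u\in L^1_{loc}(\mathbb{R}^n):\nabla u\in L^2\}$. For $n\le2$, "$f\in D^1_0$" for a function $f$ means $f\in D^1$, and in $\Delta f$ and $\langle u,f\rangle$ the function $f$ stands for its class modulo constants. $D^{-1}$ is the dual of $D^1_0$ with pairing $\langle\cdot,\cdot\rangle$; $-\Delta:D^1_0\to D^{-1}$, $u\mapsto\int\nabla u\cdot\nabla(\cdot)$, is an isometric isomorphism, and the inner product on $D^{-1}$ is $(u,v)_{D^{-1}}=\langle u,(-\Delta)^{-1}v\rangle$. $TV:D^{-1}\to[0,\infty]$ is $TV(u)=\sup\{\langle u,\operatorname{div}\varphi\rangle:\varphi\in C_c^\infty(\mathbb{R}^n;\mathbb{R}^n),\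 \|\varphi\|_{L^\infty}\le1\}$. The subdifferential is taken in the Hilbert space $D^{-1}$: $v\in\partial TV(u)$ iff $TV(u)<\infty$ and $TV(g)\ge TV(u)+(v,g-u)_{D^{-1}}$ for all $g\in D^{-1}$. *)

theory Defs
  imports "HOL-Analysis.Analysis"
begin

text \<open>
  Functions on $R^n$ are functions on \<open>real ^ 'n\<close> with $n$ = \<open>CARD('n)\<close>. Equivalence classes of
  functions are handled through Borel representatives; every notion below that is evaluated on
  classes is invariant under change of representative.
\<close>

subsection \<open>Test functions\<close>

definition partial_deriv :: "'n::finite \<Rightarrow> (real ^ 'n \<Rightarrow> real) \<Rightarrow> real ^ 'n \<Rightarrow> real" where
  "partial_deriv i f x = frechet_derivative f (at x) (axis i 1)"

text \<open>
  All iterated partial derivatives exist and are differentiable everywhere, hence continuous: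
  this is $C^\infty$.
\<close>

definition smooth :: "(real ^ 'n::finite \<Rightarrow> real) \<Rightarrow> bool" where
  "smooth f \<longleftrightarrow> (\<forall>is x. foldr partial_deriv is f differentiable (at x))"

definition test_function :: "(real ^ 'n::finite \<Rightarrow> real) \<Rightarrow> bool" where
  "test_function \<phi> \<longleftrightarrow> smooth \<phi> \<and> compact (closure {x. \<phi> x \<noteq> 0})"

definition test_field :: "(real ^ 'n::finite \<Rightarrow> real ^ 'n) \<Rightarrow> bool" where
  "test_field \<phi> \<longleftrightarrow> (\<forall>i. test_function (\<lambda>x. \<phi> x $ i))"

definition gradient :: "(real ^ 'n::finite \<Rightarrow> real) \<Rightarrow> real ^ 'n \<Rightarrow> real ^ 'n" where
  "gradient \<phi> x = (\<chi> i. partial_deriv i \<phi> x)"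

definition divergence :: "(real ^ 'n::finite \<Rightarrow> real ^ 'n) \<Rightarrow> real ^ 'n \<Rightarrow> real" where
  "divergence \<phi> x = (\<Sum>i\<in>UNIV. partial_deriv i (\<lambda>y. \<phi> y $ i) x)"

subsection \<open>Function spaces and distributional derivatives\<close>

definition locally_integrable ::
    "(real ^ 'n::finite \<Rightarrow> 'b::{banach, second_countable_topology}) \<Rightarrow> bool" where
  "locally_integrable f \<longleftrightarrow>
     f \<in> borel_measurable lborel \<and> (\<forall>K. compact K \<longrightarrow> set_integrable lborel K f)"

definition Lp :: "real \<Rightarrow> (real ^ 'n::finite \<Rightarrow> 'b::{banach, second_countable_topology}) set" where
  "Lp p = {f \<in> borel_measurable lborel. integrable lborel (\<lambda>x. norm (f x) powr p)}"

definition Linfty :: "(real ^ 'n::finite \<Rightarrow> 'b::{banach, second_countable_topology}) set" where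
  "Linfty = {f \<in> borel_measurable lborel. \<exists>C. AE x in lborel. norm (f x) \<le> C}"

definition has_weak_gradient ::
    "(real ^ 'n::finite \<Rightarrow> real) \<Rightarrow> (real ^ 'n \<Rightarrow> real ^ 'n) \<Rightarrow> bool" where
  "has_weak_gradient f F \<longleftrightarrow> locally_integrable f \<and> locally_integrable F \<and>
     (\<forall>\<phi>. test_function \<phi> \<longrightarrow>
        (\<forall>i. (\<integral>x. f x * partial_deriv i \<phi> x \<partial>lborel) = - (\<integral>x. F x $ i * \<phi> x \<partial>lborel)))"

definition weak_gradient :: "(real ^ 'n::finite \<Rightarrow> real) \<Rightarrow> real ^ 'n \<Rightarrow> real ^ 'n" where
  "weak_gradient f = (SOME F. has_weak_gradient f F)"

definition has_weak_divergence ::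
    "(real ^ 'n::finite \<Rightarrow> real ^ 'n) \<Rightarrow> (real ^ 'n \<Rightarrow> real) \<Rightarrow> bool" where
  "has_weak_divergence Z f \<longleftrightarrow> locally_integrable Z \<and> locally_integrable f \<and>
     (\<forall>\<phi>. test_function \<phi> \<longrightarrow>
        (\<integral>x. f x * \<phi> x \<partial>lborel) = - (\<integral>x. Z x \<bullet> gradient \<phi> x \<partial>lborel))"

subsection \<open>The space $D^1_0$ and its dual $D^{-1}$\<close>

definition D1 :: "(real ^ 'n::finite \<Rightarrow> real) set" where
  "D1 = {f. locally_integrable f \<and> (\<exists>F\<in>Lp 2. has_weak_gradient f F)}"

text \<open>
  Representatives of the elements of $D^1_0$. For $n \ge 3$ the local integrability built into
  \<open>D1\<close> is implied by membership in the Lebesgue space. Two representatives define the same element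
  (equality almost everywhere for $n \ge 3$, equality up to an additive constant almost everywhere
  for $n \le 2$) iff their weak gradients agree almost everywhere, i.e. iff \<open>D10_norm\<close> of their
  difference vanishes.
\<close>

definition D10 :: "(real ^ 'n::finite \<Rightarrow> real) set" where
  "D10 = (if CARD('n) \<ge> 3
          then {f \<in> D1. f \<in> Lp (2 * real CARD('n) / (real CARD('n) - 2))}
          else D1)"

definition D10_inner :: "(real ^ 'n::finite \<Rightarrow> real) \<Rightarrow> (real ^ 'n \<Rightarrow> real) \<Rightarrow> real" where
  "D10_inner f g = (\<integral>x. weak_gradient f x \<bullet> weak_gradient g x \<partial>lborel)"

definition D10_norm :: "(real ^ 'n::finite \<Rightarrow> real) \<Rightarrow> real" where
  "D10_norm f = sqrt (D10_inner f f)"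

text \<open>
  Bounded linear functionals. The bound by \<open>D10_norm\<close> makes each functional constant on the classes
  of representatives, so it lives on the quotient. The value 0 off \<open>D10\<close> is a normalisation that
  turns equality of functionals into equality of functions.
\<close>

definition Dm1 :: "((real ^ 'n::finite \<Rightarrow> real) \<Rightarrow> real) set" where
  "Dm1 = {u. (\<forall>f\<in>D10. \<forall>g\<in>D10. u (\<lambda>x. f x + g x) = u f + u g) \<and>
             (\<forall>c. \<forall>f\<in>D10. u (\<lambda>x. c * f x) = c * u f) \<and>
             (\<exists>C. \<forall>f\<in>D10. \<bar>u f\<bar> \<le> C * D10_norm f) \<and>
             (\<forall>f. f \<notin> D10 \<longrightarrow> u f = 0)}"

definition neg_laplacian :: "(real ^ 'n::finite \<Rightarrow> real) \<Rightarrow> (real ^ 'n \<Rightarrow> real) \<Rightarrow> real" where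
  "neg_laplacian f = (\<lambda>g. if g \<in> D10 then D10_inner f g else 0)"

definition laplacian :: "(real ^ 'n::finite \<Rightarrow> real) \<Rightarrow> (real ^ 'n \<Rightarrow> real) \<Rightarrow> real" where
  "laplacian f = (\<lambda>g. - neg_laplacian f g)"

text \<open>
  \<open>inv_into\<close> picks some representative of $(-\Delta)^{-1} v$; functionals in \<open>Dm1\<close> do not
  depend on the choice.
\<close>

definition Dm1_inner ::
    "((real ^ 'n::finite \<Rightarrow> real) \<Rightarrow> real) \<Rightarrow> ((real ^ 'n \<Rightarrow> real) \<Rightarrow> real) \<Rightarrow> real" where
  "Dm1_inner u v = u (inv_into D10 neg_laplacian v)"

subsection \<open>Total variation and its subdifferential\<close>

definition TV :: "((real ^ 'n::finite \<Rightarrow> real) \<Rightarrow> real) \<Rightarrow> ereal" where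
  "TV u = (SUP \<phi>\<in>{\<phi>. test_field \<phi> \<and> (AE x in lborel. norm (\<phi> x) \<le> 1)}. ereal (u (divergence \<phi>)))"

definition subdifferential ::
    "(((real ^ 'n::finite \<Rightarrow> real) \<Rightarrow> real) \<Rightarrow> ereal) \<Rightarrow> ((real ^ 'n \<Rightarrow> real) \<Rightarrow> real) \<Rightarrow>
     ((real ^ 'n \<Rightarrow> real) \<Rightarrow> real) set" where
  "subdifferential J u =
     {v \<in> Dm1. J u < \<infinity> \<and> (\<forall>g\<in>Dm1. J g \<ge> J u + ereal (Dm1_inner v (\<lambda>f. g f - u f)))}"

end

theory Submission
  imports Defs
begin

text \<open>
  \<open>TV\<close> is the support function of the divergences of test fields bounded by one, so up to
  the Riesz isomorphism its subgradients at \<open>u\<close> are the points of the closure of this convex set of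
  divergences at which \<open>u\<close> is maximal.

  If \<open>v\<close> is a subgradient, project \<open>v\<close>, read as an element of $D^1_0$ up to sign, onto this closure,
  i.e. minimise a quadratic functional over the divergences of admissible test fields. A minimising
  sequence of divergences is Cauchy in $D^1_0$; choosing the fields so as to nearly minimise a
  weighted $L^2$ norm as well makes the fields themselves converge almost everywhere, to some \<open>Z\<close>.
  The variational inequality for the limit, tested against the subgradient inequality, gives
  \<open>v = laplacian (div Z)\<close>.

  The converse amounts to $-\langle g, \mathrm{div} Z\rangle \le TV(g)$ for every admissible \<open>Z\<close>. Mollifying
  makes \<open>Z\<close> smooth; it is then cut off logarithmically, which in the critical scaling makes the
  gradient of the cutoff small in $L^n$, and the remaining term, the product of \<open>Z\<close> with this
  gradient, is absorbed in the divergence of a small radial field.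
\<close>

text \<open>What decides the shape of the converse is a mismatch of exponents. After mollification
  the derivatives of \<open>Z\<close> are bounded but need not decay, while the gradient of the
  cutoff is small in L^n only. The product \<open>f\<close> times this gradient is harmless, since
  \<open>f\<close> lies in the dual Sobolev exponent; but the gradient of the commutator
  \<open>h\<close> contains all derivatives of \<open>Z\<close>, and for n \<ge> 3 it has no small
  bound in L^2. So \<open>h\<close> is cancelled instead of estimated. The cancelling field is
  bounded uniformly only for n \<ge> 2; on the line the divergence is the whole derivative and a
  direct estimate works.

  In the forward direction a projection alone yields only a function in D^1_0, not a field of which
  it is the divergence. The strictly convex second norm takes the place of weak-star compactness: it
  makes the fields converge pointwise.

  D^1_0 is given here by functions, not as an abstract completion, so its completeness has to be
  proved: means over the unit ball and a Poincare inequality give local limits, and for n \<ge> 3 a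
  Sobolev inequality puts the limit into the Lebesgue space.\<close>

section \<open>Continuously differentiable functions and their gradients\<close>

text \<open>The gradient is an explicit argument, so that gradients of compound expressions are
  assembled by rules; the cutoffs below are only finitely often differentiable, hence the separation
  from \<open>smooth\<close>.\<close>

definition C1_grad :: "(real ^ 'n::finite \<Rightarrow> real) \<Rightarrow> (real ^ 'n \<Rightarrow> real ^ 'n) \<Rightarrow> bool" where
  "C1_grad h G \<longleftrightarrow> (\<forall>x. (h has_derivative (\<lambda>v. G x \<bullet> v)) (at x)) \<and> continuous_on UNIV G"

lemma C1_gradD: "C1_grad h G \<Longrightarrow> (h has_derivative (\<lambda>v. G x \<bullet> v)) (at x)"
  by (simp add: C1_grad_def)

lemma C1_grad_continuous_grad: "C1_grad h G \<Longrightarrow> continuous_on A G"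
  using continuous_on_subset by (auto simp: C1_grad_def)

lemma C1_grad_continuous: "C1_grad h G \<Longrightarrow> continuous_on A h"
  by (meson C1_gradD continuous_at_imp_continuous_on has_derivative_continuous)

lemma C1_grad_partial:
  assumes "C1_grad h G" shows "partial_deriv i h x = G x $ i"
proof -
  have "frechet_derivative h (at x) = (\<lambda>v. G x \<bullet> v)"
    using frechet_derivative_at[OF C1_gradD[OF assms]] by simp
  then show ?thesis by (simp add: partial_deriv_def inner_axis)
qed

lemma C1_grad_gradient: "C1_grad h G \<Longrightarrow> gradient h = G"
  by (rule ext) (simp add: gradient_def C1_grad_partial vec_eq_iff)

lemma C1_grad_measurable:
  assumes "C1_grad h G"
  shows "h \<in> borel_measurable borel" "G \<in> borel_measurable borel"
  using assms C1_grad_continuous C1_grad_continuous_grad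
  by (auto intro!: borel_measurable_continuous_onI)

lemma C1_grad_const: "C1_grad (\<lambda>x. c) (\<lambda>x. 0)"
  by (auto simp: C1_grad_def)

lemma C1_grad_nth: "C1_grad (\<lambda>x. x $ i) (\<lambda>x. axis i 1)"
  by (auto simp: C1_grad_def inner_axis' bounded_linear_vec_nth bounded_linear_imp_has_derivative)

lemma C1_grad_add:
  assumes "C1_grad f F" "C1_grad g G" shows "C1_grad (\<lambda>x. f x + g x) (\<lambda>x. F x + G x)"
  using assms by (auto simp: C1_grad_def inner_add_left intro!: continuous_intros has_derivative_add)

lemma C1_grad_cmult:
  assumes "C1_grad f F" shows "C1_grad (\<lambda>x. c * f x) (\<lambda>x. c *\<^sub>R F x)"
  using assms by (auto simp: C1_grad_def intro!: continuous_intros has_derivative_mult_right)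

lemma C1_grad_diff:
  assumes "C1_grad f F" "C1_grad g G" shows "C1_grad (\<lambda>x. f x - g x) (\<lambda>x. F x - G x)"
  using assms by (auto simp: C1_grad_def inner_diff_left intro!: continuous_intros has_derivative_diff)

lemma C1_grad_mult:
  assumes "C1_grad f F" "C1_grad g G"
  shows "C1_grad (\<lambda>x. f x * g x) (\<lambda>x. f x *\<^sub>R G x + g x *\<^sub>R F x)"
proof -
  have "((\<lambda>x. f x * g x) has_derivative (\<lambda>v. (f x *\<^sub>R G x + g x *\<^sub>R F x) \<bullet> v)) (at x)" for x
    using has_derivative_mult[OF C1_gradD[OF assms(1), of x] C1_gradD[OF assms(2), of x]]
    by (simp add: inner_add_left algebra_simps)
  then show ?thesis
    using assms C1_grad_continuous[OF assms(1)] C1_grad_continuous[OF assms(2)]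
    by (auto simp: C1_grad_def intro!: continuous_intros)
qed

lemma C1_grad_sum:
  assumes "finite I" "\<And>i. i \<in> I \<Longrightarrow> C1_grad (f i) (F i)"
  shows "C1_grad (\<lambda>x. \<Sum>i\<in>I. f i x) (\<lambda>x. \<Sum>i\<in>I. F i x)"
  using assms by (induction I) (auto intro: C1_grad_add simp: C1_grad_const)

lemma C1_grad_compose:
  assumes "C1_grad f F" "\<And>y. (u has_real_derivative u' y) (at y)" "continuous_on UNIV u'"
  shows "C1_grad (\<lambda>x. u (f x)) (\<lambda>x. u' (f x) *\<^sub>R F x)"
proof -
  have "((\<lambda>x. u (f x)) has_derivative (\<lambda>v. (u' (f x) *\<^sub>R F x) \<bullet> v)) (at x)" for x
    using has_derivative_compose[OF C1_gradD[OF assms(1), of x], of u "\<lambda>t. u' (f x) * t"]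
      assms(2)[of "f x"]
    by (simp add: has_field_derivative_def)
  moreover have "continuous_on UNIV (\<lambda>x. u' (f x))"
    by (rule continuous_on_compose2[OF assms(3) C1_grad_continuous[OF assms(1)]]) auto
  ultimately show ?thesis
    using assms(1) by (auto simp: C1_grad_def intro!: continuous_intros)
qed

lemma C1_grad_affine:
  assumes "C1_grad f F"
  shows "C1_grad (\<lambda>x. f (a + c *\<^sub>R x)) (\<lambda>x. c *\<^sub>R F (a + c *\<^sub>R x))"
proof -
  have "((\<lambda>x. f (a + c *\<^sub>R x)) has_derivative (\<lambda>v. (c *\<^sub>R F (a + c *\<^sub>R x)) \<bullet> v)) (at x)" for x
  proof -
    have "((\<lambda>x. a + c *\<^sub>R x) has_derivative (\<lambda>v. c *\<^sub>R v)) (at x)"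
      by (auto intro!: derivative_eq_intros)
    from has_derivative_compose[OF this C1_gradD[OF assms]]
    show ?thesis by simp
  qed
  moreover have "continuous_on UNIV (\<lambda>x. F (a + c *\<^sub>R x))"
    by (rule continuous_on_compose2[OF C1_grad_continuous_grad[OF assms, of UNIV]])
      (auto intro!: continuous_intros)
  ultimately show ?thesis
    by (auto simp: C1_grad_def intro!: continuous_intros)
qed

section \<open>Smooth functions and test functions\<close>

text \<open>Smoothness at the empty list gives the total derivative, and at one-element lists
  differentiable, hence continuous, partial derivatives; expanding a vector in the basis identifies
  the former with the latter.\<close>

lemma smooth_C1_grad: assumes "smooth f" shows "C1_grad f (gradient f)"
proof -
  have d: "f differentiable (at x)" for x
    using assms[unfolded smooth_def, rule_format, of "[]"] by simp
  have p: "partial_deriv i f differentiable (at x)" for i x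
    using assms[unfolded smooth_def, rule_format, of "[i]"] by simp
  have "frechet_derivative f (at x) v = gradient f x \<bullet> v" for x v
  proof -
    have lin: "linear (frechet_derivative f (at x))"
      using d linear_frechet_derivative by blast
    have "frechet_derivative f (at x) v = frechet_derivative f (at x) (\<Sum>i\<in>UNIV. v $ i *\<^sub>R axis i 1)"
      by (simp add: basis_expansion scalar_mult_eq_scaleR[symmetric])
    also have "\<dots> = (\<Sum>i\<in>UNIV. v $ i * frechet_derivative f (at x) (axis i 1))"
      by (simp add: linear_sum[OF lin] linear_scale[OF lin])
    finally show ?thesis
      by (simp add: inner_vec_def gradient_def partial_deriv_def mult.commute)
  qed
  then have "(f has_derivative (\<lambda>v. gradient f x \<bullet> v)) (at x)" for x
    using frechet_derivative_works[THEN iffD1, OF d[of x]] by presburger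
  moreover have "continuous_on UNIV (gradient f)"
    unfolding gradient_def
    by (intro continuous_intros continuous_at_imp_continuous_on ballI
        differentiable_imp_continuous_within p)
  ultimately show ?thesis by (simp add: C1_grad_def)
qed

text \<open>Lets smoothness be proved by exhibiting a class closed under partial derivatives, with
  no formula for iterated derivatives.\<close>

lemma smooth_coinduct:
  assumes "X f" "\<And>f x. X f \<Longrightarrow> f differentiable (at x)" "\<And>f i. X f \<Longrightarrow> X (partial_deriv i f)"
  shows "smooth f"
proof -
  have "X (foldr partial_deriv is f)" for "is"
    by (induction "is") (auto intro: assms)
  then show ?thesis by (auto simp: smooth_def intro: assms(2))
qed

lemma smooth_partial_deriv:
  assumes "smooth f" shows "smooth (partial_deriv i f)"
  unfolding smooth_def
proof (intro allI)
  fix "is" x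
  show "foldr partial_deriv is (partial_deriv i f) differentiable (at x)"
    \<comment> \<open>\<open>foldr\<close> applies the last entry of the list first, so the extra
      index is appended at the end.\<close>
    using assms[unfolded smooth_def, rule_format, of "is @ [i]"] by simp
qed

lemma C1_grad_differentiable: "C1_grad f F \<Longrightarrow> f differentiable (at x)"
  using C1_gradD by (auto simp: differentiable_def)

lemma smooth_add:
  fixes f g :: "real ^ 'n::finite \<Rightarrow> real"
  assumes "smooth f" "smooth g" shows "smooth (\<lambda>x. f x + g x)"
proof (rule smooth_coinduct[where X="\<lambda>h. \<exists>f g :: real ^ 'n \<Rightarrow> real. smooth f \<and> smooth g \<and> h = (\<lambda>x. f x + g x)"])
  fix h :: "real ^ 'n \<Rightarrow> real" and i x
  assume "\<exists>f g. smooth f \<and> smooth g \<and> h = (\<lambda>x. f x + g x)"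
  then obtain f g where fg: "smooth f" "smooth g" "h = (\<lambda>x. f x + g x)" by blast
  have c: "C1_grad h (\<lambda>x. gradient f x + gradient g x)"
    unfolding fg by (intro C1_grad_add smooth_C1_grad fg)
  show "h differentiable (at x)" using c by (rule C1_grad_differentiable)
  have "partial_deriv i h = (\<lambda>x. partial_deriv i f x + partial_deriv i g x)"
    using C1_grad_partial[OF c] by (auto simp: gradient_def)
  then show "\<exists>f g. smooth f \<and> smooth g \<and> partial_deriv i h = (\<lambda>x. f x + g x)"
    using fg smooth_partial_deriv by blast
qed (use assms in auto)

lemma smooth_affine:
  fixes f :: "real ^ 'n::finite \<Rightarrow> real"
  assumes "smooth f" shows "smooth (\<lambda>x. k * f (a + c *\<^sub>R x))"
\<comment> \<open>The scalar \<open>k\<close> is part of the class because each derivative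
  contributes another factor \<open>c\<close>.\<close>
proof (rule smooth_coinduct[where X="\<lambda>h. \<exists>k. \<exists>f :: real ^ 'n \<Rightarrow> real. smooth f \<and> h = (\<lambda>x. k * f (a + c *\<^sub>R x))"])
  fix h :: "real ^ 'n \<Rightarrow> real" and i x
  assume "\<exists>k f. smooth f \<and> h = (\<lambda>x. k * f (a + c *\<^sub>R x))"
  then obtain f k where fg: "smooth f" "h = (\<lambda>x. k * f (a + c *\<^sub>R x))" by blast
  have c: "C1_grad h (\<lambda>x. k *\<^sub>R c *\<^sub>R gradient f (a + c *\<^sub>R x))"
    unfolding fg by (intro C1_grad_cmult C1_grad_affine smooth_C1_grad fg)
  show "h differentiable (at x)" using c by (rule C1_grad_differentiable)
  have "partial_deriv i h = (\<lambda>x. (k * c) * partial_deriv i f (a + c *\<^sub>R x))"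
    using C1_grad_partial[OF c] by (auto simp: gradient_def)
  then show "\<exists>k f. smooth f \<and> partial_deriv i h = (\<lambda>x. k * f (a + c *\<^sub>R x))"
    using fg smooth_partial_deriv by blast
qed (use assms in auto)

lemma test_functionI:
  assumes "smooth f" "\<And>x. f x \<noteq> 0 \<Longrightarrow> norm x \<le> R" shows "test_function f"
proof -
  have "closure {x. f x \<noteq> 0} \<subseteq> cball 0 R"
    by (rule closure_minimal) (use assms in auto)
  then show ?thesis
    using assms(1) bounded_subset by (auto simp: test_function_def compact_eq_bounded_closed)
qed

lemma test_functionE:
  assumes "test_function f"
  obtains R where "R > 0" "\<And>x. f x \<noteq> 0 \<Longrightarrow> norm x \<le> R"
proof -
  obtain R where "R > 0" "\<forall>x\<in>closure {x. f x \<noteq> 0}. norm x \<le> R"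
    using assms bounded_pos compact_imp_bounded by (metis test_function_def)
  then show ?thesis using that[of R] closure_subset[of "{x. f x \<noteq> 0}"] by auto
qed

lemma test_function_smooth: "test_function f \<Longrightarrow> smooth f"
  by (simp add: test_function_def)

text \<open>The complement of the closed ball is open, so \<open>f\<close> coincides with 0 near
  \<open>x\<close>, and derivatives are unique.\<close>

lemma C1_grad_support:
  assumes "C1_grad f F" "\<And>x. f x \<noteq> 0 \<Longrightarrow> norm x \<le> R" "norm x > R"
  shows "F x = 0"
proof -
  have "eventually (\<lambda>y. f y = 0) (nhds x)"
    using assms(2,3) by (intro eventually_nhds[THEN iffD2] exI[of _ "- cball 0 R"]) force
  then have "eventually (\<lambda>y. 0 = f y) (at x)"
    by (auto simp: eventually_at_filter elim: eventually_mono)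
  moreover have "0 = f x" using assms(2,3) by force
  ultimately have "(f has_derivative (\<lambda>v. 0)) (at x)"
    by (rule has_derivative_transform_eventually[OF has_derivative_const]) simp
  then have "(\<lambda>v. F x \<bullet> v) = (\<lambda>v. 0)"
    using C1_gradD[OF assms(1)] has_derivative_unique by blast
  then show ?thesis by (metis inner_eq_zero_iff)
qed

lemma test_function_partial_deriv:
  assumes "test_function f" shows "test_function (partial_deriv i f)"
proof -
  obtain R where R: "\<And>x. f x \<noteq> 0 \<Longrightarrow> norm x \<le> R" using test_functionE[OF assms] by metis
  have c: "C1_grad f (gradient f)" using assms by (simp add: smooth_C1_grad test_function_smooth)
  show ?thesis
  proof (rule test_functionI)
    fix x show "partial_deriv i f x \<noteq> 0 \<Longrightarrow> norm x \<le> R"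
      using C1_grad_support[OF c R, of x] C1_grad_partial[OF c, of i x] by force
  qed (use assms in \<open>simp add: smooth_partial_deriv test_function_smooth\<close>)
qed

lemma test_function_add:
  assumes "test_function f" "test_function g" shows "test_function (\<lambda>x. f x + g x)"
proof -
  obtain R where R: "\<And>x. f x \<noteq> 0 \<Longrightarrow> norm x \<le> R" using test_functionE[OF assms(1)] by metis
  obtain R' where R': "\<And>x. g x \<noteq> 0 \<Longrightarrow> norm x \<le> R'" using test_functionE[OF assms(2)] by metis
  show ?thesis
  proof (rule test_functionI[where R="max R R'"])
    fix x assume "f x + g x \<noteq> 0"
    then have "f x \<noteq> 0 \<or> g x \<noteq> 0" by auto
    then show "norm x \<le> max R R'" using R R' by fastforce
  qed (use assms in \<open>simp add: smooth_add test_function_smooth\<close>)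
qed

lemma test_function_affine:
  assumes "test_function f" "c \<noteq> 0" shows "test_function (\<lambda>x. k * f (a + c *\<^sub>R x))"
proof -
  obtain R where R: "\<And>x. f x \<noteq> 0 \<Longrightarrow> norm x \<le> R" using test_functionE[OF assms(1)] by metis
  show ?thesis
  proof (rule test_functionI[where R="(R + norm a) / \<bar>c\<bar>"])
    fix x assume "k * f (a + c *\<^sub>R x) \<noteq> 0"
    then have "norm (a + c *\<^sub>R x) \<le> R" using R by auto
    moreover have "norm (c *\<^sub>R x) \<le> norm (a + c *\<^sub>R x) + norm a"
      by (metis add_diff_cancel_left' norm_triangle_ineq4 add.commute)
    ultimately show "norm x \<le> (R + norm a) / \<bar>c\<bar>"
      using assms(2) by (simp add: field_simps)
  qed (use assms in \<open>simp add: smooth_affine test_function_smooth\<close>)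
qed

lemma test_function_cmult: "test_function f \<Longrightarrow> test_function (\<lambda>x. k * f x)"
  using test_function_affine[of f 1 k 0] by simp

subsection \<open>Bump functions\<close>

text \<open>The standard function exp(-1/t) divided by powers of \<open>t\<close>: with these powers
  the family is closed, up to linear combinations, under differentiation.\<close>

definition bumpE :: "nat \<Rightarrow> real \<Rightarrow> real" where
  "bumpE k t = (if t \<le> 0 then 0 else exp (- (1 / t)) / t ^ k)"

text \<open>With s = 1/t this is the decay of s^k exp(-s) at infinity.\<close>

lemma bumpE_tendsto_0: "((bumpE k) \<longlongrightarrow> 0) (at_right 0)"
proof -
  have "((\<lambda>s::real. s ^ k / exp s) \<longlongrightarrow> 0) at_top"
    by (rule tendsto_power_div_exp_0)
  then have "((\<lambda>t::real. inverse t ^ k / exp (inverse t)) \<longlongrightarrow> 0) (at_right 0)"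
    by (rule filterlim_compose[OF _ filterlim_inverse_at_top_right])
  then show ?thesis
    by (rule Lim_transform_eventually)
      (auto simp: eventually_at_right_field bumpE_def field_simps exp_minus intro!: exI[of _ 1])
qed

lemma bumpE_deriv: "(bumpE k has_real_derivative (bumpE (k + 2) t - k * bumpE (k + 1) t)) (at t)"
proof -
  consider "t > 0" | "t < 0" | "t = 0" by linarith
  then show ?thesis
  proof cases
    case 1
    have "((\<lambda>t. exp (- (1 / t)) / t ^ k) has_real_derivative
        (bumpE (k + 2) t - k * bumpE (k + 1) t)) (at t)"
      using 1 by (auto intro!: derivative_eq_intros simp: bumpE_def field_simps power2_eq_square)
        (cases k, auto simp: field_simps)
    moreover have "eventually (\<lambda>t. bumpE k t = exp (- (1 / t)) / t ^ k) (nhds t)"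
      using 1 by (intro eventually_nhds[THEN iffD2] exI[of _ "{0<..}"]) (auto simp: bumpE_def)
    ultimately show ?thesis
      using DERIV_cong_ev[OF refl _ refl, of "bumpE k" _ t] by simp
  next
    case 2
    have "((\<lambda>t. 0) has_real_derivative (bumpE (k + 2) t - k * bumpE (k + 1) t)) (at t)"
      using 2 by (simp add: bumpE_def)
    moreover have "eventually (\<lambda>t. bumpE k t = 0) (nhds t)"
      using 2 by (intro eventually_nhds[THEN iffD2] exI[of _ "{..<0}"]) (auto simp: bumpE_def)
    ultimately show ?thesis
      using DERIV_cong_ev[OF refl _ refl, of "bumpE k" _ t] by simp
  next
    case 3
    have "((\<lambda>h. bumpE k h / h) \<longlongrightarrow> 0) (at 0)"
      unfolding filterlim_at_split
    proof
      show "((\<lambda>h. bumpE k h / h) \<longlongrightarrow> 0) (at_left 0)"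
        by (rule tendsto_eventually) (auto simp: eventually_at_left_field bumpE_def intro!: exI[of _ "-1"])
      \<comment> \<open>For h > 0 the quotient is \<open>bumpE (k + 1) h\<close>, so
        differentiability at 0 is the previous limit with the next exponent.\<close>
      show "((\<lambda>h. bumpE k h / h) \<longlongrightarrow> 0) (at_right 0)"
        by (rule Lim_transform_eventually[OF bumpE_tendsto_0[of "k + 1"]])
          (auto simp: eventually_at_right_field bumpE_def field_simps intro!: exI[of _ 1])
    qed
    then show ?thesis
      using 3 by (simp add: DERIV_def bumpE_def)
  qed
qed

lemma bumpE_deriv_continuous: "continuous_on UNIV (\<lambda>t. bumpE (k + 2) t - k * bumpE (k + 1) t)"
  by (intro continuous_intros) (auto intro!: DERIV_isCont[OF bumpE_deriv] simp: continuous_on_eq_continuous_at)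

text \<open>A class of functions supported in a ball that contains a bump and is closed under partial
  derivatives, so that membership implies smoothness.\<close>

inductive bump_alg :: "real \<Rightarrow> (real ^ 'n::finite \<Rightarrow> real) \<Rightarrow> bool" for r where
  base: "bump_alg r (\<lambda>x. bumpE k (r - (\<Sum>i\<in>UNIV. x $ i * x $ i)))"
| add: "bump_alg r f \<Longrightarrow> bump_alg r g \<Longrightarrow> bump_alg r (\<lambda>x. f x + g x)"
| cmult: "bump_alg r f \<Longrightarrow> bump_alg r (\<lambda>x. c * f x)"
| coord: "bump_alg r f \<Longrightarrow> bump_alg r (\<lambda>x. x $ i * f x)"

text \<open>The rules of \<open>bump_alg\<close> are exactly what differentiation produces: the
  inner function has gradient -2x, which creates coordinate factors, and \<open>bumpE_deriv\<close>
  creates linear combinations of bumps.\<close>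

lemma bump_alg_deriv:
  fixes f :: "real ^ 'n::finite \<Rightarrow> real"
  assumes "bump_alg r f"
  shows "\<exists>F. C1_grad f F \<and> (\<forall>i. bump_alg r (\<lambda>x. F x $ i))"
  using assms
proof induction
  case (base k)
  let ?q = "\<lambda>x::real ^ 'n. r - (\<Sum>i\<in>UNIV. x $ i * x $ i)"
  have "C1_grad ?q (\<lambda>x. 0 - (\<Sum>i\<in>UNIV. x $ i *\<^sub>R axis i 1 + x $ i *\<^sub>R axis i 1))"
    by (intro C1_grad_diff C1_grad_const C1_grad_sum C1_grad_mult C1_grad_nth) auto
  moreover have "0 - (\<Sum>i\<in>UNIV. x $ i *\<^sub>R axis i 1 + x $ i *\<^sub>R axis i 1) = -2 *\<^sub>R x" for x :: "real ^ 'n"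
    using arg_cong[OF basis_expansion[of x], of "\<lambda>y. 2 *\<^sub>R y"]
    by (simp add: scalar_mult_eq_scaleR scaleR_sum_right flip: scaleR_2)
  ultimately have q: "C1_grad ?q (\<lambda>x. -2 *\<^sub>R x)" by simp
  have "C1_grad (\<lambda>x. bumpE k (?q x))
      (\<lambda>x. (bumpE (k + 2) (?q x) - k * bumpE (k + 1) (?q x)) *\<^sub>R (-2 *\<^sub>R x))"
    by (rule C1_grad_compose[OF q bumpE_deriv bumpE_deriv_continuous])
  moreover have "bump_alg r (\<lambda>x. ((bumpE (k + 2) (?q x) - k * bumpE (k + 1) (?q x)) *\<^sub>R (-2 *\<^sub>R x)) $ i)" for i
  proof -
    have "bump_alg r (\<lambda>x. x $ i * ((-2) * bumpE (k + 2) (?q x) + (2 * k) * bumpE (k + 1) (?q x)))"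
      by (intro bump_alg.intros)
    then show ?thesis by (rule back_subst) (auto simp: algebra_simps)
  qed
  ultimately show ?case by blast
next
  case (add f g)
  then obtain F G where "C1_grad f F" "\<forall>i. bump_alg r (\<lambda>x. F x $ i)"
    "C1_grad g G" "\<forall>i. bump_alg r (\<lambda>x. G x $ i)" by blast
  then show ?case
    by (intro exI[of _ "\<lambda>x. F x + G x"]) (auto intro: C1_grad_add bump_alg.add)
next
  case (cmult f c)
  then obtain F where "C1_grad f F" "\<forall>i. bump_alg r (\<lambda>x. F x $ i)" by blast
  then show ?case
    by (intro exI[of _ "\<lambda>x. c *\<^sub>R F x"]) (auto intro: C1_grad_cmult bump_alg.cmult)
next
  case (coord f j)
  then obtain F where F: "C1_grad f F" "\<forall>i. bump_alg r (\<lambda>x. F x $ i)" by blast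
  show ?case
  proof (intro exI[of _ "\<lambda>x. x $ j *\<^sub>R F x + f x *\<^sub>R axis j 1"] conjI allI)
    show "C1_grad (\<lambda>x. x $ j * f x) (\<lambda>x. x $ j *\<^sub>R F x + f x *\<^sub>R axis j 1)"
      by (rule C1_grad_mult[OF C1_grad_nth F(1)])
    fix i
    have "bump_alg r (\<lambda>x. x $ j * (F x $ i) + (axis j 1 $ i) * f x)"
      using F(2) coord by (intro bump_alg.intros) auto
    then show "bump_alg r (\<lambda>x. (x $ j *\<^sub>R F x + f x *\<^sub>R axis j 1) $ i)"
      by (rule back_subst) (auto simp: algebra_simps)
  qed
qed

lemma smooth_bump_alg:
  assumes "bump_alg r f" shows "smooth f"
proof (rule smooth_coinduct[where X="bump_alg r"])
  fix f :: "real ^ 'n \<Rightarrow> real" and i x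
  assume "bump_alg r f"
  then obtain F where F: "C1_grad f F" "\<forall>i. bump_alg r (\<lambda>x. F x $ i)" using bump_alg_deriv by blast
  show "f differentiable (at x)" using F C1_grad_differentiable by blast
  have "partial_deriv i f = (\<lambda>x. F x $ i)" using C1_grad_partial[OF F(1)] by auto
  then show "bump_alg r (partial_deriv i f)" using F by simp
qed fact

lemma continuous_compact_support_integrable:
  fixes f :: "real ^ 'n::finite \<Rightarrow> 'b::euclidean_space"
  assumes "continuous_on UNIV f" "\<And>x. f x \<noteq> 0 \<Longrightarrow> norm x \<le> R"
  shows "integrable lborel f"
proof -
  have "set_integrable lborel (cball 0 R) f"
    unfolding set_integrable_def
    using assms(1) continuous_on_subset by (intro borel_integrable_compact) auto
  moreover have "(\<lambda>x. indicator (cball 0 R) x *\<^sub>R f x) = f"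
    using assms(2) by (force simp: indicator_def)
  ultimately show ?thesis by (simp add: set_integrable_def)
qed

definition mollifier :: "real \<Rightarrow> (real ^ 'n::finite \<Rightarrow> real) \<Rightarrow> bool" where
  "mollifier e \<rho> \<longleftrightarrow> test_function \<rho> \<and> (\<forall>x. \<rho> x \<ge> 0) \<and> (\<forall>x. \<rho> x \<noteq> 0 \<longrightarrow> norm x \<le> e) \<and>
     integrable lborel \<rho> \<and> (\<integral>x. \<rho> x \<partial>lborel) = 1"

lemma ex_mollifier:
  assumes "e > 0" shows "\<exists>\<rho> :: real ^ 'n::finite \<Rightarrow> real. mollifier e \<rho>"
proof -
  define f :: "real ^ 'n \<Rightarrow> real" where "f = (\<lambda>x. bumpE 0 (e\<^sup>2 - (\<Sum>i\<in>UNIV. x $ i * x $ i)))"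
  have sq: "(\<Sum>i\<in>UNIV. x $ i * x $ i) = (norm x)\<^sup>2" for x :: "real ^ 'n"
    by (simp add: power2_norm_eq_inner inner_vec_def)
  have sm: "smooth f" unfolding f_def by (rule smooth_bump_alg[OF bump_alg.base])
  have nn: "f x \<ge> 0" for x by (simp add: f_def bumpE_def)
  have su: "norm x \<le> e" if "f x \<noteq> 0" for x
  proof -
    have "(norm x)\<^sup>2 < e\<^sup>2" using that unfolding f_def sq bumpE_def by (auto split: if_splits)
    then show ?thesis using assms by (simp add: power2_less_imp_less less_imp_le)
  qed
  have tf: "test_function f" using sm su by (rule test_functionI)
  have cont: "continuous_on UNIV f" using C1_grad_continuous[OF smooth_C1_grad[OF sm]] .
  have int: "integrable lborel f" using continuous_compact_support_integrable[OF cont su] .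
  have "(\<integral>x. f x \<partial>lborel) \<noteq> 0"
  proof
    assume "(\<integral>x. f x \<partial>lborel) = 0"
    then have "AE x in lborel. f x = 0"
      using integral_nonneg_eq_0_iff_AE[OF int] nn by simp
    \<comment> \<open>The zero set is closed, and a closed set of full measure is the whole
      space.\<close>
    then have "f x = 0" for x
      using mem_closed_if_AE_lebesgue[of "{x. f x = 0}" x] AE_completion closed_Collect_eq[OF cont continuous_on_const] by auto
    moreover have "f 0 > 0" using assms by (simp add: f_def bumpE_def)
    ultimately show False by (metis less_irrefl)
  qed
  moreover have "(\<integral>x. f x \<partial>lborel) \<ge> 0" using nn by simp
  ultimately have pos: "(\<integral>x. f x \<partial>lborel) > 0" by simp
  have "mollifier e (\<lambda>x. (1 / (\<integral>x. f x \<partial>lborel)) * f x)"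
    unfolding mollifier_def
  proof (intro conjI allI)
    show "test_function (\<lambda>x. (1 / (\<integral>x. f x \<partial>lborel)) * f x)"
      using tf by (rule test_function_cmult)
    show "integrable lborel (\<lambda>x. (1 / (\<integral>x. f x \<partial>lborel)) * f x)"
      using int by (intro integrable_mult_right) auto
    show "(\<integral>x. (1 / (\<integral>x. f x \<partial>lborel)) * f x \<partial>lborel) = 1"
      using pos by simp
  qed (use nn su pos in auto)
  then show ?thesis by blast
qed

subsection \<open>Change of variables and local integrability\<close>

lemma nn_integral_lborel_affine:
  fixes f :: "'a::euclidean_space \<Rightarrow> ennreal"
  assumes [measurable]: "f \<in> borel_measurable borel" and c: "c \<noteq> 0"
  shows "(\<integral>\<^sup>+x. f x \<partial>lborel) = ennreal (\<bar>c\<bar> ^ DIM('a)) * (\<integral>\<^sup>+x. f (t + c *\<^sub>R x) \<partial>lborel)"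
  by (subst lborel_affine[OF c, of t])
    (simp add: nn_integral_density nn_integral_distr nn_integral_cmult)

lemma integrable_lborel_affine:
  fixes f :: "'a::euclidean_space \<Rightarrow> 'b::{banach, second_countable_topology}"
  assumes f: "integrable lborel f" and c: "c \<noteq> 0"
  shows "integrable lborel (\<lambda>x. f (t + c *\<^sub>R x))"
proof -
  have [measurable]: "f \<in> borel_measurable borel" using f by auto
  have "(\<integral>\<^sup>+x. norm (f x) \<partial>lborel) < \<infinity>" using f by (simp add: integrable_iff_bounded)
  then have "(\<integral>\<^sup>+x. norm (f (t + c *\<^sub>R x)) \<partial>lborel) < \<infinity>"
    using c by (subst (asm) nn_integral_lborel_affine[OF _ c, where t=t])
      (auto simp: ennreal_mult_less_top)
  then show ?thesis by (simp add: integrable_iff_bounded)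
qed

lemma integral_lborel_affine:
  fixes f :: "'a::euclidean_space \<Rightarrow> 'b::{banach, second_countable_topology}"
  assumes c: "c \<noteq> 0"
  shows "(\<integral>x. f x \<partial>lborel) = (\<bar>c\<bar> ^ DIM('a)) *\<^sub>R (\<integral>x. f (t + c *\<^sub>R x) \<partial>lborel)"
proof (cases "integrable lborel f")
  case True
  then have [measurable]: "f \<in> borel_measurable borel" by auto
  show ?thesis
    using c integrable_lborel_affine[OF True c, of t]
    by (subst lborel_affine[OF c, of t]) (simp add: integral_density integral_distr)
next
  \<comment> \<open>Here both integrals have the default value 0: the inverse affine map would carry
    integrability of the right-hand integrand back to \<open>f\<close>.\<close>
  case False
  have "\<not> integrable lborel (\<lambda>x. f (t + c *\<^sub>R x))"
  proof
    assume "integrable lborel (\<lambda>x. f (t + c *\<^sub>R x))"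
    from integrable_lborel_affine[OF this, of "1 / c" "- (1 / c) *\<^sub>R t"]
    have "integrable lborel f" using c by (simp add: algebra_simps)
    then show False using False by simp
  qed
  then show ?thesis using False by (simp add: not_integrable_integral_eq)
qed

lemma integral_lborel_translate:
  fixes f :: "'a::euclidean_space \<Rightarrow> 'b::{banach, second_countable_topology}"
  shows "(\<integral>x. f (x + a) \<partial>lborel) = (\<integral>x. f x \<partial>lborel)"
  using integral_lborel_affine[of 1 f a] by (simp add: add.commute)

lemma integral_lborel_reflect:
  fixes f :: "'a::euclidean_space \<Rightarrow> 'b::{banach, second_countable_topology}"
  shows "(\<integral>x. f (a - x) \<partial>lborel) = (\<integral>x. f x \<partial>lborel)"
  using integral_lborel_affine[of "-1" f a] by simp

lemma integrable_lborel_reflect: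
  fixes f :: "'a::euclidean_space \<Rightarrow> 'b::{banach, second_countable_topology}"
  assumes "integrable lborel f" shows "integrable lborel (\<lambda>x. f (a - x))"
  using integrable_lborel_affine[OF assms, of "-1" a] by simp

lemma nn_integral_lborel_translate:
  fixes f :: "'a::euclidean_space \<Rightarrow> ennreal"
  assumes "f \<in> borel_measurable borel"
  shows "(\<integral>\<^sup>+x. f (x + a) \<partial>lborel) = (\<integral>\<^sup>+x. f x \<partial>lborel)"
  using nn_integral_lborel_affine[OF assms, of 1 a] by (simp add: add.commute)

lemma locally_integrable_measurable: "locally_integrable f \<Longrightarrow> f \<in> borel_measurable borel"
  by (simp add: locally_integrable_def)

lemma locally_integrable_cball: "locally_integrable f \<Longrightarrow> set_integrable lborel (cball x R) f"
  by (simp add: locally_integrable_def)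

lemma locally_integrable_from_cball:
  fixes f :: "real ^ 'n::finite \<Rightarrow> 'b::{banach, second_countable_topology}"
  assumes "f \<in> borel_measurable borel" "\<And>R. set_integrable lborel (cball 0 R) f"
  shows "locally_integrable f"
  unfolding locally_integrable_def
proof (intro conjI allI impI)
  fix K :: "(real ^ 'n) set" assume K: "compact K"
  then obtain R where "\<forall>x\<in>K. norm x \<le> R" using compact_imp_bounded[OF K] by (auto simp: bounded_iff)
  then have "K \<subseteq> cball 0 R" by auto
  then show "set_integrable lborel K f"
    using set_integrable_subset[OF assms(2)] borel_compact[OF K] by simp
qed (use assms in auto)

lemma locally_integrable_cong_bound:
  fixes f :: "real ^ 'n::finite \<Rightarrow> 'b::{banach, second_countable_topology}"
  assumes f: "f \<in> borel_measurable borel" and g: "locally_integrable g"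
    and "AE x in lborel. norm (f x) \<le> norm (g x)"
  shows "locally_integrable f"
proof (rule locally_integrable_from_cball[OF f])
  fix R
  have "integrable lborel (\<lambda>x. indicator (cball 0 R) x *\<^sub>R g x)"
    using locally_integrable_cball[OF g] by (simp add: set_integrable_def)
  then show "set_integrable lborel (cball 0 R) f"
    unfolding set_integrable_def
    by (rule Bochner_Integration.integrable_bound) (use assms in \<open>auto simp: indicator_def\<close>)
qed

lemma locally_integrable_continuous:
  fixes f :: "real ^ 'n::finite \<Rightarrow> 'b::euclidean_space"
  assumes "continuous_on UNIV f" shows "locally_integrable f"
proof (rule locally_integrable_from_cball)
  show "f \<in> borel_measurable borel" using assms by (rule borel_measurable_continuous_onI)
  fix R
  show "set_integrable lborel (cball 0 R) f"
    unfolding set_integrable_def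
    using assms continuous_on_subset by (intro borel_integrable_compact) auto
qed

lemma locally_integrable_bounded:
  fixes f :: "real ^ 'n::finite \<Rightarrow> 'b::{banach, second_countable_topology}"
  assumes "f \<in> borel_measurable borel" "AE x in lborel. norm (f x) \<le> C"
  shows "locally_integrable f"
  using assms(2)
  by (intro locally_integrable_cong_bound[OF assms(1), of "\<lambda>_. C"] locally_integrable_continuous)
    (auto elim!: eventually_mono)

lemma locally_integrable_integrable:
  fixes f :: "real ^ 'n::finite \<Rightarrow> 'b::{banach, second_countable_topology}"
  assumes "integrable lborel f" shows "locally_integrable f"
proof (rule locally_integrable_from_cball)
  fix R show "set_integrable lborel (cball 0 R) f"
    unfolding set_integrable_def using assms by (intro integrable_mult_indicator) auto
qed (use assms in auto)

lemma locally_integrable_add: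
  fixes f :: "real ^ 'n::finite \<Rightarrow> 'b::{banach, second_countable_topology}"
  assumes "locally_integrable f" "locally_integrable g" shows "locally_integrable (\<lambda>x. f x + g x)"
  using assms by (auto simp: locally_integrable_def intro: set_integral_add)

lemma locally_integrable_scaleR:
  fixes f :: "real ^ 'n::finite \<Rightarrow> 'b::{banach, second_countable_topology}"
  assumes "locally_integrable f" shows "locally_integrable (\<lambda>x. c *\<^sub>R f x)"
  using assms by (auto simp: locally_integrable_def)

lemma integrable_vec_nth:
  fixes f :: "'a \<Rightarrow> real ^ 'm::finite"
  assumes "integrable M f"
  shows "integrable M (\<lambda>x. f x $ i)" "(\<integral>x. f x \<partial>M) $ i = (\<integral>x. f x $ i \<partial>M)"
  using integrable_bounded_linear[OF bounded_linear_vec_nth assms, of i]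
    integral_bounded_linear[OF bounded_linear_vec_nth assms, of i] by auto

lemma locally_integrable_nth:
  fixes f :: "real ^ 'n::finite \<Rightarrow> real ^ 'm::finite"
  assumes "locally_integrable f" shows "locally_integrable (\<lambda>x. f x $ i)"
proof -
  have [measurable]: "f \<in> borel_measurable borel"
    using assms by (rule locally_integrable_measurable)
  have "(\<lambda>x. f x $ i) \<in> borel_measurable borel"
    using borel_measurable_continuous_onI[OF continuous_on_component[OF continuous_on_id]]
      measurable_compose[of f borel borel "\<lambda>y. y $ i" borel] by simp
  moreover have "set_integrable lborel K (\<lambda>x. f x $ i)" if "compact K" for K
    using integrable_vec_nth(1)[of lborel "\<lambda>x. indicator K x *\<^sub>R f x" i] assms that
    by (simp add: locally_integrable_def set_integrable_def)
  ultimately show ?thesis by (simp add: locally_integrable_def)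
qed

lemma integrable_locally_integrable_mult:
  fixes f :: "real ^ 'n::finite \<Rightarrow> real" and g :: "real ^ 'n \<Rightarrow> 'b::{banach, second_countable_topology}"
  assumes f: "locally_integrable f" and g: "g \<in> borel_measurable borel"
    and C: "\<And>x. norm (g x) \<le> C" and R: "\<And>x. g x \<noteq> 0 \<Longrightarrow> norm x \<le> R"
  shows "integrable lborel (\<lambda>x. f x *\<^sub>R g x)"
proof -
  have "integrable lborel (\<lambda>x. C * (indicator (cball 0 R) x *\<^sub>R f x))"
    using locally_integrable_cball[OF f] by (simp add: set_integrable_def)
  then show ?thesis
  proof (rule Bochner_Integration.integrable_bound)
    show "AE x in lborel. norm (f x *\<^sub>R g x) \<le> norm (C * (indicator (cball 0 R) x *\<^sub>R f x))"
    proof (rule AE_I2)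
      fix x
      have C0: "C \<ge> 0" using C[of x] norm_ge_zero order_trans by blast
      show "norm (f x *\<^sub>R g x) \<le> norm (C * (indicator (cball 0 R) x *\<^sub>R f x))"
      proof (cases "g x = 0")
        case False
        then have "x \<in> cball 0 R" using R by simp
        then show ?thesis
          using C0 mult_right_mono[OF C[of x], of "\<bar>f x\<bar>"] by (simp add: abs_mult mult.commute)
      qed simp
    qed
  qed (use g locally_integrable_measurable[OF f] in measurable)
qed

lemma continuous_compact_support_bounded:
  fixes g :: "real ^ 'n::finite \<Rightarrow> 'b::euclidean_space"
  assumes "continuous_on UNIV g" "\<And>x. g x \<noteq> 0 \<Longrightarrow> norm x \<le> R"
  obtains C where "C > 0" "\<And>x. norm (g x) \<le> C"
proof -
  have "compact (g ` cball 0 R)"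
    using assms(1) continuous_on_subset by (intro compact_continuous_image) auto
  then obtain C where C: "C > 0" "\<And>x. x \<in> cball 0 R \<Longrightarrow> norm (g x) \<le> C"
    using bounded_pos compact_imp_bounded by (metis imageI)
  have "norm (g x) \<le> C" for x
    using C assms(2)[of x] by (cases "g x = 0") auto
  then show ?thesis using that C by blast
qed

lemma integrable_locally_integrable_continuous:
  fixes f :: "real ^ 'n::finite \<Rightarrow> real" and g :: "real ^ 'n \<Rightarrow> 'b::euclidean_space"
  assumes f: "locally_integrable f" and g: "continuous_on UNIV g"
    and R: "\<And>x. g x \<noteq> 0 \<Longrightarrow> norm x \<le> R"
  shows "integrable lborel (\<lambda>x. f x *\<^sub>R g x)"
proof -
  obtain C where "\<And>x. norm (g x) \<le> C" using continuous_compact_support_bounded[OF g R] by metis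
  then show ?thesis
    using integrable_locally_integrable_mult[OF f borel_measurable_continuous_onI[OF g] _ R] by blast
qed

subsection \<open>Integration by parts\<close>

lemma C1_grad_lipschitz:
  assumes h: "C1_grad h G" and L: "\<And>x. norm (G x) \<le> L"
  shows "\<bar>h x - h y\<bar> \<le> L * norm (x - y)"
proof -
  have "onorm (\<lambda>v. G x \<bullet> v) \<le> L" for x
    by (rule order_trans[OF onorm_le[where b="norm (G x)"] L]) (simp add: Cauchy_Schwarz_ineq2)
  then have "norm (h x - h y) \<le> L * norm (x - y)"
    using C1_gradD[OF h] by (intro differentiable_bound[of UNIV h "\<lambda>x v. G x \<bullet> v"]) auto
  then show ?thesis by simp
qed

lemma C1_grad_direction:
  assumes "C1_grad h G"
  shows "((\<lambda>t. h (x + t *\<^sub>R v)) has_real_derivative (G (x + t *\<^sub>R v) \<bullet> v)) (at t)"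
proof -
  have "((\<lambda>t. x + t *\<^sub>R v) has_derivative (\<lambda>s. s *\<^sub>R v)) (at t)"
    by (auto intro!: derivative_eq_intros)
  from has_derivative_compose[OF this C1_gradD[OF assms]]
  show ?thesis by (simp add: has_field_derivative_def mult.commute[of _ "G _ \<bullet> _"] fun_eq_iff)
qed

text \<open>Difference quotients of \<open>h\<close> have integral 0 by translation invariance; they
  converge to the directional derivative and are dominated through the Lipschitz bound.\<close>

lemma integral_C1_grad_eq_0:
  fixes h :: "real ^ 'n::finite \<Rightarrow> real"
  assumes h: "C1_grad h G" and R: "\<And>x. h x \<noteq> 0 \<Longrightarrow> norm x \<le> R"
  shows "(\<integral>x. G x \<partial>lborel) = 0"
proof -
  have RG: "norm x \<le> R" if "G x \<noteq> 0" for x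
    using C1_grad_support[OF h R, of x] that by force
  obtain L where L: "L > 0" "\<And>x. norm (G x) \<le> L"
    using continuous_compact_support_bounded[OF C1_grad_continuous_grad[OF h] RG] by metis
  have intG: "integrable lborel G"
    using continuous_compact_support_integrable[OF C1_grad_continuous_grad[OF h] RG] .
  have inth: "integrable lborel h"
    using continuous_compact_support_integrable[OF C1_grad_continuous[OF h] R] .
  have [measurable]: "h \<in> borel_measurable borel" "G \<in> borel_measurable borel"
    using C1_grad_measurable[OF h] by auto
  have "(\<integral>x. G x \<partial>lborel) \<bullet> v = 0" for v
  proof -
    define t where "t = (\<lambda>k. 1 / real (Suc k))"
    have t: "t k > 0" "t k \<le> 1" for k by (auto simp: t_def)
    have t0: "t \<longlonglongrightarrow> 0" unfolding t_def using LIMSEQ_inverse_real_of_nat by (simp add: inverse_eq_divide)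
    define q where "q = (\<lambda>k x. (h (x + t k *\<^sub>R v) - h x) / t k)"
    have "(\<lambda>k. \<integral>x. q k x \<partial>lborel) \<longlonglongrightarrow> (\<integral>x. G x \<bullet> v \<partial>lborel)"
    proof (rule integral_dominated_convergence)
      \<comment> \<open>The increments are at most \<open>norm v\<close> because the step sizes are
        at most 1, so all quotients live in this one ball.\<close>
      show "integrable lborel (\<lambda>x::real ^ 'n. (L * norm v) * indicator (cball 0 (R + norm v)) x)"
        by (intro integrable_mult_right integrable_real_indicator)
          (use emeasure_lborel_cball_finite[of "0 :: real ^ 'n"] in auto)
      show "AE x in lborel. norm (q k x) \<le> (L * norm v) * indicator (cball 0 (R + norm v)) x" for k
      proof (rule AE_I2)
        fix x
        show "norm (q k x) \<le> (L * norm v) * indicator (cball 0 (R + norm v)) x"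
        proof (cases "norm x \<le> R + norm v")
          case True
          have "\<bar>h (x + t k *\<^sub>R v) - h x\<bar> \<le> L * norm (t k *\<^sub>R v)"
            using C1_grad_lipschitz[OF h L(2), of "x + t k *\<^sub>R v" x] by simp
          then show ?thesis using True t[of k] by (simp add: q_def field_simps)
        next
          case False
          have "norm x \<le> norm (x + t k *\<^sub>R v) + norm (t k *\<^sub>R v)"
            by (metis add_diff_cancel_right' norm_triangle_ineq4)
          moreover have "norm (t k *\<^sub>R v) \<le> norm v" using t[of k] by (simp add: mult_left_le_one_le)
          ultimately have "h (x + t k *\<^sub>R v) = 0" "h x = 0"
            using False R[of "x + t k *\<^sub>R v"] R[of x] norm_ge_zero[of v] by force+
          then show ?thesis using L by (simp add: q_def)
        qed
      qed
      show "AE x in lborel. (\<lambda>k. q k x) \<longlonglongrightarrow> G x \<bullet> v"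
      proof (rule AE_I2)
        fix x
        have "((\<lambda>s. (h (x + s *\<^sub>R v) - h x) / s) \<longlongrightarrow> G x \<bullet> v) (at 0)"
          using C1_grad_direction[OF h, of x v 0] by (simp add: DERIV_def)
        moreover have "filterlim t (at 0) sequentially"
          using t0 t(1) by (auto simp: filterlim_at less_imp_neq[symmetric])
        ultimately show "(\<lambda>k. q k x) \<longlonglongrightarrow> G x \<bullet> v"
          unfolding q_def by (rule filterlim_compose)
      qed
    qed (auto simp: q_def)
    moreover have "(\<integral>x. q k x \<partial>lborel) = 0" for k
    proof -
      have "integrable lborel (\<lambda>x. h (x + t k *\<^sub>R v))"
        using integrable_lborel_affine[OF inth, of 1 "t k *\<^sub>R v"] by (simp add: add.commute)
      then show ?thesis
        unfolding q_def using inth by (simp add: integral_lborel_translate)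
    qed
    ultimately have "(\<integral>x. G x \<bullet> v \<partial>lborel) = 0" by (simp add: LIMSEQ_const_iff)
    then show ?thesis using intG by simp
  qed
  then show ?thesis by (metis inner_eq_zero_iff)
qed

text \<open>Apply \<open>integral_C1_grad_eq_0\<close> to the product; compact support of
  \<open>f\<close> alone suffices for it.\<close>

lemma C1_grad_integration_by_parts:
  fixes w :: "real ^ 'n::finite \<Rightarrow> real"
  assumes w: "C1_grad w W" and f: "C1_grad f F" and R: "\<And>x. f x \<noteq> 0 \<Longrightarrow> norm x \<le> R"
  shows "(\<integral>x. w x *\<^sub>R F x \<partial>lborel) = - (\<integral>x. f x *\<^sub>R W x \<partial>lborel)"
proof -
  have RF: "norm x \<le> R" if "F x \<noteq> 0" for x
    using C1_grad_support[OF f R, of x] that by force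
  have 1: "integrable lborel (\<lambda>x. w x *\<^sub>R F x)"
    by (rule continuous_compact_support_integrable[where R=R])
      (use RF in \<open>auto intro!: continuous_intros C1_grad_continuous_grad[OF f] C1_grad_continuous[OF w]\<close>)
  have 2: "integrable lborel (\<lambda>x. f x *\<^sub>R W x)"
    by (rule continuous_compact_support_integrable[where R=R])
      (use R in \<open>auto intro!: continuous_intros C1_grad_continuous_grad[OF w] C1_grad_continuous[OF f]\<close>)
  have "(\<integral>x. w x *\<^sub>R F x + f x *\<^sub>R W x \<partial>lborel) = 0"
    by (rule integral_C1_grad_eq_0[OF C1_grad_mult[OF w f]]) (use R in auto)
  then show ?thesis using 1 2 by (simp add: eq_neg_iff_add_eq_0)
qed

subsection \<open>Convolution\<close>

text \<open>The translation acts on the second factor: \<open>f\<close> is the rough one, and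
  \<open>g\<close> is the one that receives derivatives and may be vector valued, so that
  \<open>g\<close> can also be a gradient.\<close>

definition conv :: "(real ^ 'n::finite \<Rightarrow> real) \<Rightarrow> (real ^ 'n \<Rightarrow> 'b::euclidean_space) \<Rightarrow> real ^ 'n \<Rightarrow> 'b" where
  "conv f g x = (\<integral>y. f y *\<^sub>R g (x - y) \<partial>lborel)"

lemma conv_integrable:
  fixes f :: "real ^ 'n::finite \<Rightarrow> real" and g :: "real ^ 'n \<Rightarrow> 'b::euclidean_space"
  assumes f: "locally_integrable f" and g: "continuous_on UNIV g"
    and R: "\<And>x. g x \<noteq> 0 \<Longrightarrow> norm x \<le> R"
  shows "integrable lborel (\<lambda>y. f y *\<^sub>R g (x - y))"
proof (rule integrable_locally_integrable_continuous[OF f, where R="R + norm x"])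
  show "continuous_on UNIV (\<lambda>y. g (x - y))"
    by (rule continuous_on_compose2[OF g]) (auto intro!: continuous_intros)
  fix y assume "g (x - y) \<noteq> 0"
  then have "norm (x - y) \<le> R" by (rule R)
  then show "norm y \<le> R + norm x" using norm_triangle_ineq2[of y x] by (simp add: norm_minus_commute)
qed

lemma conv_continuous:
  fixes f :: "real ^ 'n::finite \<Rightarrow> real"
  assumes f: "locally_integrable f" and g: "continuous_on UNIV g"
    and R: "\<And>x. g x \<noteq> 0 \<Longrightarrow> norm x \<le> R"
  shows "continuous_on UNIV (conv f g)"
  unfolding continuous_on_sequentially
proof (intro allI ballI impI)
  fix X :: "nat \<Rightarrow> real ^ 'n" and a
  assume "(\<forall>n. X n \<in> UNIV) \<and> X \<longlonglongrightarrow> a"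
  then have X: "X \<longlonglongrightarrow> a" by simp
  then obtain B where B: "\<And>k. norm (X k) \<le> B" using Bseq_def convergentI convergent_imp_Bseq by metis
  obtain C where C: "C > 0" "\<And>x. norm (g x) \<le> C" using continuous_compact_support_bounded[OF g R] by metis
  have [measurable]: "f \<in> borel_measurable borel" "g \<in> borel_measurable borel"
    using locally_integrable_measurable[OF f] borel_measurable_continuous_onI[OF g] by auto
  show "(conv f g \<circ> X) \<longlonglongrightarrow> conv f g a"
    unfolding conv_def o_def
  proof (rule integral_dominated_convergence)
    show "integrable lborel (\<lambda>y. norm (C * (indicator (cball 0 (R + B)) y *\<^sub>R f y)))"
      using locally_integrable_cball[OF f] by (intro integrable_norm integrable_mult_right) (simp add: set_integrable_def)
    show "AE y in lborel. (\<lambda>k. f y *\<^sub>R g (X k - y)) \<longlonglongrightarrow> f y *\<^sub>R g (a - y)"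
    proof (rule AE_I2)
      fix y
      have "isCont g (a - y)" using g by (simp add: continuous_on_eq_continuous_at)
      then show "(\<lambda>k. f y *\<^sub>R g (X k - y)) \<longlonglongrightarrow> f y *\<^sub>R g (a - y)"
        using X by (intro tendsto_intros isCont_tendsto_compose[of _ g]) auto
    qed
    show "AE y in lborel. norm (f y *\<^sub>R g (X k - y)) \<le> norm (C * (indicator (cball 0 (R + B)) y *\<^sub>R f y))" for k
    proof (rule AE_I2)
      fix y
      show "norm (f y *\<^sub>R g (X k - y)) \<le> norm (C * (indicator (cball 0 (R + B)) y *\<^sub>R f y))"
      proof (cases "g (X k - y) = 0")
        case False
        then have "norm (X k - y) \<le> R" by (rule R)
        then have "norm y \<le> R + B"
          using norm_triangle_ineq2[of y "X k"] B[of k] by (simp add: norm_minus_commute)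
        then show ?thesis
          using C(1) mult_right_mono[OF C(2)[of "X k - y"], of "\<bar>f y\<bar>"] by (simp add: abs_mult mult.commute)
      qed simp
    qed
  qed auto
qed

text \<open>The first-order Taylor remainder of \<open>g\<close>, divided by the increment, tends to
  0 pointwise and is at most 2L, so dominated convergence on a fixed ball differentiates under the
  integral.\<close>

lemma C1_grad_conv:
  fixes f :: "real ^ 'n::finite \<Rightarrow> real"
  assumes f: "locally_integrable f" and g: "C1_grad g G"
    and R: "\<And>x. g x \<noteq> 0 \<Longrightarrow> norm x \<le> R"
  shows "C1_grad (conv f g) (conv f G)"
proof -
  have RG: "norm x \<le> R" if "G x \<noteq> 0" for x
    using C1_grad_support[OF g R, of x] that by force
  note cg = C1_grad_continuous[OF g] and cG = C1_grad_continuous_grad[OF g]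
  obtain L where L: "L > 0" "\<And>x. norm (G x) \<le> L"
    using continuous_compact_support_bounded[OF cG RG] by metis
  have [measurable]: "f \<in> borel_measurable borel" "g \<in> borel_measurable borel" "G \<in> borel_measurable borel"
    using locally_integrable_measurable[OF f] C1_grad_measurable[OF g] by auto
  have "(conv f g has_derivative (\<lambda>v. conv f G x \<bullet> v)) (at x)" for x
    unfolding has_derivative_iff_norm
  proof (intro conjI)
    show "bounded_linear (\<lambda>v. conv f G x \<bullet> v)" by (rule bounded_linear_inner_right)
    show "((\<lambda>y. norm (conv f g y - conv f g x - conv f G x \<bullet> (y - x)) / norm (y - x)) \<longlongrightarrow> 0) (at x)"
      unfolding tendsto_at_iff_sequentially
    proof (intro allI impI)
      fix X assume XU: "\<forall>i. X i \<in> UNIV - {x}" and X: "X \<longlonglongrightarrow> x"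
      from X obtain B where B: "\<And>k. norm (X k) \<le> B" using Bseq_def convergentI convergent_imp_Bseq by metis
      have Bx: "norm x \<le> B" using Lim_bounded[OF tendsto_norm[OF X], of 0 B] B by auto
      define q where "q = (\<lambda>k y. (g (X k - y) - g (x - y) - G (x - y) \<bullet> (X k - x)) / norm (X k - x))"
      have "(\<lambda>k. \<integral>y. f y * q k y \<partial>lborel) \<longlonglongrightarrow> (\<integral>y. 0 \<partial>(lborel :: (real ^ 'n) measure))"
      proof (rule integral_dominated_convergence)
        show "integrable lborel (\<lambda>y. norm (2 * L * (indicator (cball 0 (R + B)) y *\<^sub>R f y)))"
          using locally_integrable_cball[OF f] by (intro integrable_norm integrable_mult_right) (simp add: set_integrable_def)
        show "AE y in lborel. (\<lambda>k. f y * q k y) \<longlonglongrightarrow> 0"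
        proof (rule AE_I2)
          fix y
          have "((\<lambda>z. (g z - g (x - y) - G (x - y) \<bullet> (z - (x - y))) / norm (z - (x - y))) \<longlongrightarrow> 0) (at (x - y))"
            using C1_gradD[OF g, of "x - y"] unfolding has_derivative_iff_norm
            by (subst tendsto_norm_zero_iff[symmetric]) simp
          moreover have "filterlim (\<lambda>k. X k - y) (at (x - y)) sequentially"
            using X XU by (auto simp: filterlim_at intro!: tendsto_intros)
          ultimately have "(\<lambda>k. (g (X k - y) - g (x - y) - G (x - y) \<bullet> (X k - y - (x - y))) / norm (X k - y - (x - y))) \<longlonglongrightarrow> 0"
            by (rule filterlim_compose)
          then have "(\<lambda>k. q k y) \<longlonglongrightarrow> 0" by (simp add: q_def)
          then show "(\<lambda>k. f y * q k y) \<longlonglongrightarrow> 0" by (rule tendsto_mult_right_zero)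
        qed
        show "AE y in lborel. norm (f y * q k y) \<le> norm (2 * L * (indicator (cball 0 (R + B)) y *\<^sub>R f y))" for k
        proof (rule AE_I2)
          fix y
          have "\<bar>q k y\<bar> \<le> 2 * L * indicator (cball 0 (R + B)) y"
          proof (cases "norm y \<le> R + B")
            case True
            have "\<bar>g (X k - y) - g (x - y)\<bar> \<le> L * norm (X k - x)"
              using C1_grad_lipschitz[OF g L(2), of "X k - y" "x - y"] by simp
            moreover have "\<bar>G (x - y) \<bullet> (X k - x)\<bar> \<le> L * norm (X k - x)"
              using Cauchy_Schwarz_ineq2[of "G (x - y)" "X k - x"] mult_right_mono[OF L(2)[of "x - y"], of "norm (X k - x)"]
              by simp
            ultimately have "\<bar>g (X k - y) - g (x - y) - G (x - y) \<bullet> (X k - x)\<bar> \<le> 2 * L * norm (X k - x)"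
              by linarith
            then show ?thesis using True XU by (simp add: q_def divide_le_eq)
          next
            case False
            have "norm (X k - y) > R" "norm (x - y) > R"
              using False norm_triangle_ineq2[of y "X k"] norm_triangle_ineq2[of y x] B[of k] Bx
              by (simp_all add: norm_minus_commute)
            then have "g (X k - y) = 0" "g (x - y) = 0" "G (x - y) = 0"
              using R RG by (metis not_le)+
            then show ?thesis using L by (simp add: q_def)
          qed
          from mult_right_mono[OF this, of "\<bar>f y\<bar>"]
          show "norm (f y * q k y) \<le> norm (2 * L * (indicator (cball 0 (R + B)) y *\<^sub>R f y))"
            using L(1) by (simp add: abs_mult ac_simps)
        qed
      qed (auto simp: q_def)
      moreover have "(\<integral>y. f y * q k y \<partial>lborel) = (conv f g (X k) - conv f g x - conv f G x \<bullet> (X k - x)) / norm (X k - x)" for k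
      proof -
        note i1 = conv_integrable[OF f cg R, of "X k"] and i2 = conv_integrable[OF f cg R, of x]
          and i3 = conv_integrable[OF f cG RG, of x]
        have i4: "integrable lborel (\<lambda>y. (f y *\<^sub>R G (x - y)) \<bullet> (X k - x))"
          using i3 by (intro integrable_inner_left)
        have "conv f g (X k) - conv f g x - conv f G x \<bullet> (X k - x) =
          (\<integral>y. f y *\<^sub>R g (X k - y) - f y *\<^sub>R g (x - y) - (f y *\<^sub>R G (x - y)) \<bullet> (X k - x) \<partial>lborel)"
          using Bochner_Integration.integral_diff[OF Bochner_Integration.integrable_diff[OF i1 i2] i4]
            Bochner_Integration.integral_diff[OF i1 i2] integral_inner_left[of "X k - x" lborel, OF i3]
          unfolding conv_def by simp
        also have "\<dots> / norm (X k - x) = (\<integral>y. f y * q k y \<partial>lborel)"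
          unfolding integral_divide_zero[symmetric]
          by (rule Bochner_Integration.integral_cong) (auto simp: q_def algebra_simps diff_divide_distrib)
        finally show ?thesis by simp
      qed
      ultimately have "(\<lambda>k. (conv f g (X k) - conv f g x - conv f G x \<bullet> (X k - x)) / norm (X k - x)) \<longlonglongrightarrow> 0"
        by simp
      then show "((\<lambda>y. norm (conv f g y - conv f g x - conv f G x \<bullet> (y - x)) / norm (y - x)) \<circ> X) \<longlonglongrightarrow> 0"
        by (subst (asm) tendsto_norm_zero_iff[symmetric]) (simp add: o_def)
    qed
  qed
  then show ?thesis using conv_continuous[OF f cG RG] by (simp add: C1_grad_def)
qed

lemma test_function_C1_grad: "test_function f \<Longrightarrow> C1_grad f (gradient f)"
  by (simp add: smooth_C1_grad test_function_smooth)

lemma conv_partial_deriv: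
  assumes f: "locally_integrable f" and g: "test_function g"
  shows "C1_grad (conv f g) (\<lambda>x. \<chi> i. conv f (partial_deriv i g) x)"
proof -
  obtain R where R: "\<And>x. g x \<noteq> 0 \<Longrightarrow> norm x \<le> R" using test_functionE[OF g] by metis
  note c = test_function_C1_grad[OF g]
  have RG: "norm x \<le> R" if "gradient g x \<noteq> 0" for x
    using C1_grad_support[OF c R, of x] that by force
  have "conv f (gradient g) x = (\<chi> i. conv f (partial_deriv i g) x)" for x
    using integrable_vec_nth(2)[OF conv_integrable[OF f C1_grad_continuous_grad[OF c] RG]]
    by (simp add: vec_eq_iff conv_def gradient_def)
  then show ?thesis using C1_grad_conv[OF f c R] by (metis (no_types, lifting) ext)
qed

lemma smooth_conv:
  assumes f: "locally_integrable f" and g: "test_function g"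
  shows "smooth (conv f g)"
proof (rule smooth_coinduct[where X="\<lambda>h. \<exists>g. test_function g \<and> h = conv f g"])
  fix h i x assume "\<exists>g. test_function g \<and> h = conv f g"
  then obtain g where g: "test_function g" "h = conv f g" by blast
  note c = conv_partial_deriv[OF f g(1), folded g(2)]
  show "h differentiable (at x)" using c by (rule C1_grad_differentiable)
  have "partial_deriv i h = conv f (partial_deriv i g)"
    using C1_grad_partial[OF c] by auto
  then show "\<exists>g. test_function g \<and> partial_deriv i h = conv f g"
    using test_function_partial_deriv[OF g(1)] by blast
qed (use g in blast)

lemma partial_deriv_reflect:
  assumes "test_function g"
  shows "test_function (\<lambda>y. g (x - y))" "gradient (\<lambda>y. g (x - y)) y = - gradient g (x - y)"
    "partial_deriv i (\<lambda>y. g (x - y)) y = - partial_deriv i g (x - y)"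
proof -
  have c: "C1_grad (\<lambda>y. g (x - y)) (\<lambda>y. - gradient g (x - y))"
    using C1_grad_affine[OF test_function_C1_grad[OF assms], of x "-1"] by simp
  show "test_function (\<lambda>y. g (x - y))"
    using test_function_affine[OF assms, of "-1" 1 x] by simp
  show "gradient (\<lambda>y. g (x - y)) y = - gradient g (x - y)" by (simp add: C1_grad_gradient[OF c])
  show "partial_deriv i (\<lambda>y. g (x - y)) y = - partial_deriv i g (x - y)"
    by (simp add: C1_grad_partial[OF c] gradient_def)
qed

text \<open>The reflected mollifier \<open>\<lambda>y. g (x - y)\<close> is itself a test function;
  the sign from the reflection cancels the sign in the weak gradient, so the derivative passes from
  \<open>g\<close> to \<open>f\<close>.\<close>

lemma C1_grad_conv_weak_gradient:
  assumes f: "has_weak_gradient f F" and g: "test_function g"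
  shows "C1_grad (conv f g) (\<lambda>x. \<chi> i. conv (\<lambda>y. F y $ i) g x)"
proof -
  have "conv f (partial_deriv i g) x = conv (\<lambda>y. F y $ i) g x" for i x
  proof -
    have "(\<integral>y. f y * partial_deriv i (\<lambda>y. g (x - y)) y \<partial>lborel) = - (\<integral>y. F y $ i * g (x - y) \<partial>lborel)"
      using f partial_deriv_reflect(1)[OF g] unfolding has_weak_gradient_def by blast
    then show ?thesis by (simp add: partial_deriv_reflect(3)[OF g] conv_def)
  qed
  then show ?thesis using conv_partial_deriv[OF _ g, of f] f by (simp add: has_weak_gradient_def)
qed

text \<open>The same reflection argument, with the derivatives first moved onto \<open>g\<close>
  componentwise and then recombined into the weak divergence.\<close>

lemma divergence_conv:
  fixes Z :: "real ^ 'n::finite \<Rightarrow> real ^ 'n"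
  assumes Z: "has_weak_divergence Z f" and g: "test_function g"
  shows "divergence (\<lambda>x. \<chi> i. conv (\<lambda>y. Z y $ i) g x) = conv f g"
proof
  fix x
  obtain R where R: "\<And>x. g x \<noteq> 0 \<Longrightarrow> norm x \<le> R" using test_functionE[OF g] by metis
  note c = test_function_C1_grad[OF g]
  have RP: "norm x \<le> R" if "partial_deriv i g x \<noteq> 0" for x i
    using C1_grad_support[OF c R, of x] C1_grad_partial[OF c, of i x] that by force
  have li: "locally_integrable (\<lambda>y. Z y $ i)" for i
    using Z locally_integrable_nth by (auto simp: has_weak_divergence_def)
  have "(\<integral>y. f y * g (x - y) \<partial>lborel) = (\<integral>y. Z y \<bullet> gradient g (x - y) \<partial>lborel)"
    using Z partial_deriv_reflect(1)[OF g, of x] unfolding has_weak_divergence_def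
    by (auto simp: partial_deriv_reflect(2)[OF g])
  also have "\<dots> = (\<Sum>i\<in>UNIV. \<integral>y. Z y $ i * partial_deriv i g (x - y) \<partial>lborel)"
    unfolding inner_vec_def gradient_def
    by (simp, rule Bochner_Integration.integral_sum)
      (use conv_integrable[OF li C1_grad_continuous[OF test_function_C1_grad[OF test_function_partial_deriv[OF g]]] RP] in auto)
  also have "\<dots> = (\<Sum>i\<in>UNIV. conv (\<lambda>y. Z y $ i) (partial_deriv i g) x)"
    by (simp add: conv_def)
  also have "\<dots> = divergence (\<lambda>x. \<chi> i. conv (\<lambda>y. Z y $ i) g x) x"
    by (simp add: divergence_def C1_grad_partial[OF conv_partial_deriv[OF li g]])
  finally show "divergence (\<lambda>x. \<chi> i. conv (\<lambda>y. Z y $ i) g x) x = conv f g x"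
    by (simp add: conv_def)
qed

lemma test_function_conv:
  assumes f: "locally_integrable f" "\<And>x. f x \<noteq> 0 \<Longrightarrow> norm x \<le> R'" and g: "test_function g"
  shows "test_function (conv f g)"
proof -
  obtain R where R: "\<And>x. g x \<noteq> 0 \<Longrightarrow> norm x \<le> R" using test_functionE[OF g] by metis
  show ?thesis
  proof (rule test_functionI[OF smooth_conv[OF f(1) g], where R="R + R'"])
    fix x assume "conv f g x \<noteq> 0"
    then obtain y where "f y \<noteq> 0" "g (x - y) \<noteq> 0"
      unfolding conv_def by (metis (mono_tags, lifting) Bochner_Integration.integral_cong integral_zero scale_eq_0_iff)
    then show "norm x \<le> R + R'"
      using R[of "x - y"] f(2)[of y] norm_triangle_sub[of x y] by linarith
  qed
qed

subsection \<open>Mollification\<close>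

text \<open>A density argument carried out as induction on integrable functions. For an open set, a
  point of the set stays in it under small translations, which together with equal measures gives
  L^1 convergence; outer regularity extends this to Borel sets of finite measure.\<close>

lemma L1_translation_continuous:
  fixes f :: "'a::euclidean_space \<Rightarrow> real"
  assumes "integrable lborel f"
  shows "\<forall>a. a \<longlonglongrightarrow> 0 \<longrightarrow> (\<lambda>k. \<integral>x. \<bar>f (x - a k) - f x\<bar> \<partial>lborel) \<longlonglongrightarrow> 0"
  using assms
proof (induction rule: integrable_induct)
  case (base A c)
  then have A[measurable]: "A \<in> sets borel" and fA: "emeasure lborel A < \<infinity>" by auto
  have op: "(\<lambda>k. \<integral>x. \<bar>indicator U (x - a k) - indicator U x :: real\<bar> \<partial>lborel) \<longlonglongrightarrow> 0"
    if a: "a \<longlonglongrightarrow> 0" and U: "open U" and fU: "emeasure lborel U < \<infinity>" for a and U :: "'a set"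
  proof -
    have [measurable]: "U \<in> sets borel" using U by simp
    have iU: "integrable lborel (indicator U :: 'a \<Rightarrow> real)" using fU by (intro integrable_real_indicator) auto
    have iUk: "integrable lborel (\<lambda>x. indicator U (x - b) :: real)" for b
      using integrable_lborel_affine[OF iU, of 1 "- b"] by simp
    have eqU: "(\<integral>x. indicator U (x - b) \<partial>lborel) = (\<integral>x. (indicator U x :: real) \<partial>lborel)" for b
      using integral_lborel_affine[of 1 "indicator U :: 'a \<Rightarrow> real" "- b"] by simp
    have im: "integrable lborel (\<lambda>x. max (indicator U x - indicator U (x - b)) 0 :: real)" for b
      by (intro integrable_max Bochner_Integration.integrable_diff iU iUk) auto
    \<comment> \<open>The absolute difference equals the signed difference plus twice the opposite
      positive part, and the signed difference has integral 0. Only the positive part is controlled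
      by openness.\<close>
    have "(\<integral>x. \<bar>indicator U (x - b) - indicator U x :: real\<bar> \<partial>lborel) =
        2 * (\<integral>x. max (indicator U x - indicator U (x - b)) (0::real) \<partial>lborel)" for b
    proof -
      have "(\<integral>x. \<bar>indicator U (x - b) - indicator U x :: real\<bar> \<partial>lborel) =
        (\<integral>x. (indicator U (x - b) - indicator U x) + 2 * max (indicator U x - indicator U (x - b)) (0::real) \<partial>lborel)"
        by (rule Bochner_Integration.integral_cong) (auto simp: max_def)
      also have "\<dots> = 2 * (\<integral>x. max (indicator U x - indicator U (x - b)) 0 \<partial>lborel)"
        using iU iUk[of b] im[of b] eqU[of b] by (simp del: integral_indicator)
      finally show ?thesis .
    qed
    moreover have "(\<lambda>k. \<integral>x. max (indicator U x - indicator U (x - a k)) (0::real) \<partial>lborel) \<longlonglongrightarrow> (\<integral>x. 0 \<partial>(lborel :: 'a measure))"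
    proof (rule integral_dominated_convergence[where w="indicator U"])
      show "AE x in lborel. (\<lambda>k. max (indicator U x - indicator U (x - a k)) 0) \<longlonglongrightarrow> (0::real)"
      proof (rule AE_I2)
        fix x
        show "(\<lambda>k. max (indicator U x - indicator U (x - a k)) 0) \<longlonglongrightarrow> (0::real)"
        proof (cases "x \<in> U")
          case True
          have "(\<lambda>k. x - a k) \<longlonglongrightarrow> x" using tendsto_diff[OF tendsto_const a, of x] by simp
          then have "eventually (\<lambda>k. x - a k \<in> U) sequentially"
            using U True by (simp add: tendsto_def)
          then show ?thesis by (intro tendsto_eventually) (auto elim: eventually_mono)
        qed (auto intro!: tendsto_eventually)
      qed
    qed (auto simp: iU indicator_def)
    ultimately show ?thesis using tendsto_mult_right_zero[of _ _ "2::real"] by (simp add: mult.commute)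
  qed
  show ?case
  proof (intro allI impI)
    fix a :: "nat \<Rightarrow> 'a" assume a: "a \<longlonglongrightarrow> 0"
    have "(\<lambda>k. \<integral>x. \<bar>indicator A (x - a k) - indicator A x :: real\<bar> \<partial>lborel) \<longlonglongrightarrow> 0"
    proof (rule LIMSEQ_I)
      fix e :: real assume e: "e > 0"
      \<comment> \<open>One quarter of \<open>e\<close> is spent on the translates of
        \<open>U\<close> and twice one quarter on \<open>U - A\<close> and its translate.\<close>
      obtain U where U: "open U" "A \<subseteq> U" and UA: "emeasure lborel (U - A) < ennreal (e / 4)"
        using outer_regular_lborel[OF A, of "e / 4"] e by auto
      have [measurable]: "U \<in> sets borel" using U by simp
      have "emeasure lborel U = emeasure lborel A + emeasure lborel (U - A)"
        using U by (subst plus_emeasure) (auto intro!: arg_cong[where f="emeasure lborel"])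
      then have fU: "emeasure lborel U < \<infinity>" using fA UA by (auto simp: less_top[symmetric] top_unique)
      let ?D = "indicator (U - A) :: 'a \<Rightarrow> real"
      have fD: "emeasure lborel (U - A) < \<infinity>" using UA by (metis ennreal_less_top infinity_ennreal_def less_trans)
      have iD: "integrable lborel ?D" using fD by (intro integrable_real_indicator) auto
      have iDk: "integrable lborel (\<lambda>x. ?D (x - b))" for b
        using integrable_lborel_affine[OF iD, of 1 "- b"] by simp
      have iU: "integrable lborel (indicator U :: 'a \<Rightarrow> real)" using fU by (intro integrable_real_indicator) auto
      have iUk: "integrable lborel (\<lambda>x. indicator U (x - b) :: real)" for b
        using integrable_lborel_affine[OF iU, of 1 "- b"] by simp
      have iA: "integrable lborel (indicator A :: 'a \<Rightarrow> real)" using fA by (intro integrable_real_indicator) auto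
      have iAk: "integrable lborel (\<lambda>x. indicator A (x - b) :: real)" for b
        using integrable_lborel_affine[OF iA, of 1 "- b"] by simp
      have mD: "(\<integral>x. ?D x \<partial>lborel) \<le> e / 4"
        using enn2real_leI[OF _ less_imp_le[OF UA]] e by (simp add: measure_def)
      have mDk: "(\<integral>x. ?D (x - b) \<partial>lborel) = (\<integral>x. ?D x \<partial>lborel)" for b
        using integral_lborel_affine[of 1 ?D "- b"] by simp
      obtain N where N: "\<And>k. k \<ge> N \<Longrightarrow> \<bar>\<integral>x. \<bar>indicator U (x - a k) - indicator U x :: real\<bar> \<partial>lborel\<bar> < e / 4"
        using LIMSEQ_D[OF op[OF a U(1) fU], of "e / 4"] e by auto
      show "\<exists>N. \<forall>k\<ge>N. norm ((\<integral>x. \<bar>indicator A (x - a k) - indicator A x :: real\<bar> \<partial>lborel) - 0) < e"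
      proof (intro exI allI impI)
        fix k assume "k \<ge> N"
        have "(\<integral>x. \<bar>indicator A (x - a k) - indicator A x :: real\<bar> \<partial>lborel) \<le>
            (\<integral>x. \<bar>indicator U (x - a k) - indicator U x :: real\<bar> + (?D (x - a k) + ?D x) \<partial>lborel)"
          by (intro integral_mono Bochner_Integration.integrable_add Bochner_Integration.integrable_diff
              integrable_abs iD iDk iU iUk iA iAk) (use U(2) in \<open>auto simp: indicator_def\<close>)
        also have "\<dots> = (\<integral>x. \<bar>indicator U (x - a k) - indicator U x :: real\<bar> \<partial>lborel) + 2 * (\<integral>x. ?D x \<partial>lborel)"
          using iD iDk iU iUk mDk by (simp del: integral_indicator)
        also have "\<dots> < e" using N[OF \<open>k \<ge> N\<close>] mD e by linarith
        finally show "norm ((\<integral>x. \<bar>indicator A (x - a k) - indicator A x :: real\<bar> \<partial>lborel) - 0) < e" by simp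
      qed
    qed
    moreover have "\<bar>indicator A (x - a k) *\<^sub>R c - indicator A x *\<^sub>R c\<bar> = \<bar>c\<bar> * \<bar>indicator A (x - a k) - indicator A x :: real\<bar>" for x k
      by (simp add: abs_mult[symmetric] algebra_simps)
    ultimately show "(\<lambda>k. \<integral>x. \<bar>indicator A (x - a k) *\<^sub>R c - indicator A x *\<^sub>R c\<bar> \<partial>lborel) \<longlonglongrightarrow> 0"
      using tendsto_mult_right_zero[of _ _ "\<bar>c\<bar>"] by simp
  qed
next
  case (add f g)
  have "integrable lborel (\<lambda>x. \<bar>h (x - b) - h x\<bar>)" if "integrable lborel h" for h :: "'a \<Rightarrow> real" and b
    using integrable_lborel_affine[OF that, of 1 "- b"] that by (intro integrable_abs Bochner_Integration.integrable_diff) auto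
  note i = this[OF add(1)] this[OF add(2)] this[OF Bochner_Integration.integrable_add[OF add(1,2)]]
  show ?case
  proof (intro allI impI)
    fix a :: "nat \<Rightarrow> 'a" assume a: "a \<longlonglongrightarrow> 0"
    have "(\<lambda>k. (\<integral>x. \<bar>f (x - a k) - f x\<bar> \<partial>lborel) + (\<integral>x. \<bar>g (x - a k) - g x\<bar> \<partial>lborel)) \<longlonglongrightarrow> 0"
      using tendsto_add[OF add(3)[rule_format, OF a] add(4)[rule_format, OF a]] by simp
    then show "(\<lambda>k. \<integral>x. \<bar>f (x - a k) + g (x - a k) - (f x + g x)\<bar> \<partial>lborel) \<longlonglongrightarrow> 0"
    proof (rule tendsto_sandwich[OF _ _ tendsto_const, rotated 2])
      show "\<forall>\<^sub>F k in sequentially. (\<integral>x. \<bar>f (x - a k) + g (x - a k) - (f x + g x)\<bar> \<partial>lborel)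
        \<le> (\<integral>x. \<bar>f (x - a k) - f x\<bar> \<partial>lborel) + (\<integral>x. \<bar>g (x - a k) - g x\<bar> \<partial>lborel)"
      proof (intro always_eventually allI)
        fix k
        have "(\<integral>x. \<bar>f (x - a k) + g (x - a k) - (f x + g x)\<bar> \<partial>lborel)
          \<le> (\<integral>x. \<bar>f (x - a k) - f x\<bar> + \<bar>g (x - a k) - g x\<bar> \<partial>lborel)"
          by (intro integral_mono i Bochner_Integration.integrable_add) auto
        also have "\<dots> = (\<integral>x. \<bar>f (x - a k) - f x\<bar> \<partial>lborel) + (\<integral>x. \<bar>g (x - a k) - g x\<bar> \<partial>lborel)"
          by (intro Bochner_Integration.integral_add i)
        finally show "(\<integral>x. \<bar>f (x - a k) + g (x - a k) - (f x + g x)\<bar> \<partial>lborel)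
          \<le> (\<integral>x. \<bar>f (x - a k) - f x\<bar> \<partial>lborel) + (\<integral>x. \<bar>g (x - a k) - g x\<bar> \<partial>lborel)" .
      qed
    qed (auto intro!: always_eventually)
  qed
next
  case (lim f s)
  have ii: "integrable lborel (\<lambda>x. h (x - b))" "(\<integral>x. h (x - b) \<partial>lborel) = (\<integral>x. h x \<partial>lborel)" if "integrable lborel h" for h :: "'a \<Rightarrow> real" and b
    using integrable_lborel_affine[OF that, of 1 "- b"] integral_lborel_affine[of 1 h "- b"] by auto
  have [measurable]: "f \<in> borel_measurable borel" "\<And>i. s i \<in> borel_measurable borel"
    using borel_measurable_integrable[OF lim(4)] borel_measurable_integrable[OF lim(1)] by simp_all
  have s: "(\<lambda>i. \<integral>x. \<bar>s i x - f x\<bar> \<partial>lborel) \<longlonglongrightarrow> (\<integral>x. 0 \<partial>(lborel :: 'a measure))"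
  proof (rule integral_dominated_convergence)
    show "integrable lborel (\<lambda>x. 3 * norm (f x))" using lim by auto
    show "AE x in lborel. (\<lambda>i. \<bar>s i x - f x\<bar>) \<longlonglongrightarrow> 0"
      using lim(2) by (intro AE_I2 tendsto_rabs_zero) (simp add: LIM_zero)
    \<comment> \<open>The simple functions of the induction rule satisfy |s| \<le> 2|f|, whence the
      factor 3.\<close>
    show "AE x in lborel. norm \<bar>s i x - f x\<bar> \<le> 3 * norm (f x)" for i
    proof (rule AE_I2)
      fix x show "norm \<bar>s i x - f x\<bar> \<le> 3 * norm (f x)" using lim(3)[of x i] by simp
    qed
  qed auto
  show ?case
  proof (intro allI impI LIMSEQ_I)
    fix a :: "nat \<Rightarrow> 'a" and e :: real assume a: "a \<longlonglongrightarrow> 0" and e: "e > 0"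
    obtain i where i: "\<bar>\<integral>x. \<bar>s i x - f x\<bar> \<partial>lborel\<bar> < e / 4"
      using LIMSEQ_D[OF s, of "e / 4"] e by auto
    obtain N where N: "\<And>k. k \<ge> N \<Longrightarrow> \<bar>\<integral>x. \<bar>s i (x - a k) - s i x\<bar> \<partial>lborel\<bar> < e / 4"
      using LIMSEQ_D[OF lim(5)[rule_format, OF a], of "e / 4" i] e by auto
    show "\<exists>N. \<forall>k\<ge>N. norm ((\<integral>x. \<bar>f (x - a k) - f x\<bar> \<partial>lborel) - 0) < e"
    proof (intro exI allI impI)
      fix k assume "k \<ge> N"
      have d: "integrable lborel (\<lambda>x. \<bar>s i x - f x\<bar>)" using lim by auto
      note f = lim(4) ii(1)[OF lim(4), of "a k"] and si = lim(1)[of i] ii(1)[OF lim(1)[of i], of "a k"]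
      have "(\<integral>x. \<bar>f (x - a k) - f x\<bar> \<partial>lborel) \<le>
          (\<integral>x. \<bar>s i (x - a k) - s i x\<bar> + (\<bar>s i (x - a k) - f (x - a k)\<bar> + \<bar>s i x - f x\<bar>) \<partial>lborel)"
        by (intro integral_mono Bochner_Integration.integrable_add Bochner_Integration.integrable_diff
              integrable_abs f si) auto
      also have "\<dots> = (\<integral>x. \<bar>s i (x - a k) - s i x\<bar> \<partial>lborel) + 2 * (\<integral>x. \<bar>s i x - f x\<bar> \<partial>lborel)"
        using f si d ii[OF d, of "a k"] by simp
      also have "\<dots> < e" using N[OF \<open>k \<ge> N\<close>] i e by linarith
      finally show "norm ((\<integral>x. \<bar>f (x - a k) - f x\<bar> \<partial>lborel) - 0) < e" by simp
    qed
  qed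
qed

definition mol :: "nat \<Rightarrow> real ^ 'n::finite \<Rightarrow> real" where
  "mol k = (SOME \<rho>. mollifier (1 / real (Suc k)) \<rho>)"

lemma mol:
  shows test_function_mol: "test_function (mol k :: real ^ 'n::finite \<Rightarrow> real)"
    and mol_nonneg: "mol k (x :: real ^ 'n) \<ge> 0"
    and mol_support: "mol k (x :: real ^ 'n) \<noteq> 0 \<Longrightarrow> norm x \<le> 1 / real (Suc k)"
    and integrable_mol: "integrable lborel (mol k :: real ^ 'n \<Rightarrow> real)"
    and integral_mol: "(\<integral>x. mol k x \<partial>(lborel :: (real ^ 'n) measure)) = 1"
proof -
  have "mollifier (1 / real (Suc k)) (mol k :: real ^ 'n \<Rightarrow> real)"
    unfolding mol_def by (rule someI_ex[OF ex_mollifier]) simp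
  then show "test_function (mol k :: real ^ 'n::finite \<Rightarrow> real)" "mol k (x :: real ^ 'n) \<ge> 0"
    "mol k (x :: real ^ 'n) \<noteq> 0 \<Longrightarrow> norm x \<le> 1 / real (Suc k)"
    "integrable lborel (mol k :: real ^ 'n \<Rightarrow> real)"
    "(\<integral>x. mol k x \<partial>(lborel :: (real ^ 'n) measure)) = 1"
    by (auto simp: mollifier_def)
qed

lemma mol_continuous: "continuous_on UNIV (mol k)"
  using C1_grad_continuous[OF test_function_C1_grad[OF test_function_mol]] .

lemma mol_measurable[measurable]: "mol k \<in> borel_measurable borel"
  using mol_continuous by (rule borel_measurable_continuous_onI)

lemma nn_integral_mol: "(\<integral>\<^sup>+x. ennreal (mol k x) \<partial>(lborel :: (real ^ 'n::finite) measure)) = 1"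
  using integral_mol[where 'n='n] nn_integral_eq_integral[OF integrable_mol[where 'n='n]] by (simp add: mol_nonneg)

lemma conv_mol_reflect: "conv f (mol k) x = (\<integral>y. f (x - y) * mol k y \<partial>lborel)"
  unfolding conv_def using integral_lborel_reflect[of "\<lambda>y. f y * mol k (x - y)" x] by simp

lemma conv_mol_integrable:
  assumes "locally_integrable f"
  shows "integrable lborel (\<lambda>y. f y * mol k (x - y))" "integrable lborel (\<lambda>y. f (x - y) * mol k y)"
proof -
  show 1: "integrable lborel (\<lambda>y. f y * mol k (x - y))"
    using conv_integrable[OF assms mol_continuous mol_support] by simp
  show "integrable lborel (\<lambda>y. f (x - y) * mol k y)"
    using integrable_lborel_reflect[OF 1, of x] by simp
qed

lemma conv_measurable:
  assumes "locally_integrable f" shows "conv f (mol k) \<in> borel_measurable borel"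
  using conv_continuous[OF assms mol_continuous mol_support] by (rule borel_measurable_continuous_onI)

text \<open>The mollifier has integral 1, so the constant \<open>c\<close> can be moved under the
  integral. With \<open>c = f x\<close> this measures the mollification error, with
  \<open>c = 0\<close> the size of the convolution. In \<open>ennreal\<close> the right-hand side
  may be infinite.\<close>

lemma conv_mol_diff_bound:
  fixes f :: "real ^ 'n::finite \<Rightarrow> real"
  assumes "locally_integrable f"
  shows "ennreal \<bar>conv f (mol k) x - c\<bar> \<le> (\<integral>\<^sup>+y. ennreal (mol k y) * ennreal \<bar>f (x - y) - c\<bar> \<partial>lborel)"
proof -
  note i = conv_mol_integrable(2)[OF assms, of x k]
  have i2: "integrable lborel (\<lambda>y. (f (x - y) - c) * mol k y)"
    unfolding left_diff_distrib
    by (intro Bochner_Integration.integrable_diff i integrable_mult_right integrable_mol)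
  have "conv f (mol k) x - c = (\<integral>y. (f (x - y) - c) * mol k y \<partial>lborel)"
    unfolding left_diff_distrib
    by (subst Bochner_Integration.integral_diff[OF i integrable_mult_right[OF integrable_mol]])
      (simp_all add: conv_mol_reflect integral_mol)
  also have "ennreal \<bar>\<dots>\<bar> \<le> (\<integral>\<^sup>+y. ennreal \<bar>(f (x - y) - c) * mol k y\<bar> \<partial>lborel)"
    using integral_norm_bound_ennreal[OF i2] by simp
  also have "\<dots> = (\<integral>\<^sup>+y. ennreal (mol k y) * ennreal \<bar>f (x - y) - c\<bar> \<partial>lborel)"
    by (simp add: abs_mult mol_nonneg ennreal_mult' mult.commute)
  finally show ?thesis .
qed

lemma ennreal_tendsto_0I:
  assumes "\<And>e. e > 0 \<Longrightarrow> eventually (\<lambda>k. f k \<le> ennreal e) F"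
  shows "(f \<longlongrightarrow> 0) F"
proof (rule order_tendstoI)
  fix a :: ennreal assume a: "0 < a"
  obtain e where e: "e > 0" "ennreal e < a"
  proof (cases a)
    case (real r)
    then show ?thesis using a that[of "r / 2"] by (simp add: ennreal_lessI)
  qed (use that[of 1] in simp)
  show "eventually (\<lambda>k. f k < a) F"
    using assms[OF e(1)] e(2) by (auto elim: eventually_mono intro: le_less_trans)
qed simp

text \<open>By Fubini the error is at most the mean, with density \<open>mol k\<close>, of the L^1
  modulus of translation, which is continuous at 0 by
  \<open>L1_translation_continuous\<close>.\<close>

lemma mollify_L1:
  fixes f :: "real ^ 'n::finite \<Rightarrow> real"
  assumes f: "integrable lborel f"
  shows "(\<lambda>k. \<integral>\<^sup>+x. ennreal \<bar>conv f (mol k) x - f x\<bar> \<partial>lborel) \<longlonglongrightarrow> 0"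
proof -
  note li = locally_integrable_integrable[OF f]
  have [measurable]: "f \<in> borel_measurable borel" using f by auto
  define D where "D = (\<lambda>a. \<integral>x. \<bar>f (x - a) - f x\<bar> \<partial>lborel)"
  have D: "(\<integral>\<^sup>+x. ennreal \<bar>f (x - a) - f x\<bar> \<partial>lborel) = ennreal (D a)" for a
    unfolding D_def using integrable_lborel_affine[OF f, of 1 "- a"] f
    by (intro nn_integral_eq_integral) auto
  have bound: "(\<integral>\<^sup>+x. ennreal \<bar>conv f (mol k) x - f x\<bar> \<partial>lborel) \<le> ennreal e"
    if e: "e > 0" and De: "\<And>y. norm y \<le> 1 / real (Suc k) \<Longrightarrow> D y \<le> e" for k e
  proof -
    have "(\<integral>\<^sup>+x. ennreal \<bar>conv f (mol k) x - f x\<bar> \<partial>lborel)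
        \<le> (\<integral>\<^sup>+x. \<integral>\<^sup>+y. ennreal (mol k y) * ennreal \<bar>f (x - y) - f x\<bar> \<partial>lborel \<partial>lborel)"
      by (intro nn_integral_mono conv_mol_diff_bound li)
    also have "\<dots> = (\<integral>\<^sup>+y. \<integral>\<^sup>+x. ennreal (mol k y) * ennreal \<bar>f (x - y) - f x\<bar> \<partial>lborel \<partial>lborel)"
      by (rule lborel_pair.Fubini') measurable
    also have "\<dots> = (\<integral>\<^sup>+y. ennreal (mol k y) * ennreal (D y) \<partial>(lborel :: (real ^ 'n) measure))"
      by (subst nn_integral_cmult) (auto simp: D)
    also have "\<dots> \<le> (\<integral>\<^sup>+y. ennreal (mol k y) * ennreal e \<partial>(lborel :: (real ^ 'n) measure))"
    proof (rule nn_integral_mono)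
      fix y :: "real ^ 'n"
      show "ennreal (mol k y) * ennreal (D y) \<le> ennreal (mol k y) * ennreal e"
        using De[of y] mol_support[of k y] by (cases "mol k y = 0") (auto intro!: mult_left_mono ennreal_leI)
    qed
    also have "\<dots> = ennreal e" by (simp add: nn_integral_multc nn_integral_mol)
    finally show ?thesis .
  qed
  have "isCont D 0"
    unfolding continuous_at_sequentially
    using L1_translation_continuous[OF f] by (simp add: D_def o_def)
  then have D0: "(D \<longlongrightarrow> 0) (at 0)" by (simp add: isCont_def D_def)
  show ?thesis
  proof (rule ennreal_tendsto_0I)
    fix e :: real assume e: "e > 0"
    obtain d where d: "d > 0" "\<And>y. y \<noteq> 0 \<Longrightarrow> norm y < d \<Longrightarrow> D y < e"
      using LIM_D[OF D0 e] by (auto simp: D_def)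
    have "eventually (\<lambda>k. 1 / real (Suc k) < d) sequentially"
      using order_tendstoD(2)[OF LIMSEQ_inverse_real_of_nat d(1)] by (simp add: inverse_eq_divide)
    then show "eventually (\<lambda>k. (\<integral>\<^sup>+x. ennreal \<bar>conv f (mol k) x - f x\<bar> \<partial>lborel) \<le> ennreal e) sequentially"
    proof eventually_elim
      case (elim k)
      show ?case
      proof (rule bound[OF e])
        fix y :: "real ^ 'n" assume "norm y \<le> 1 / real (Suc k)"
        then show "D y \<le> e" using d(2)[of y] elim e by (cases "y = 0") (auto simp: D_def)
      qed
    qed
  qed
qed

text \<open>Jensen's inequality for the probability density \<open>mol k\<close>, obtained from
  Cauchy-Schwarz by splitting the density into two square roots.\<close>

lemma conv_mol_sq_bound:
  fixes f :: "real ^ 'n::finite \<Rightarrow> real"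
  assumes "locally_integrable f"
  shows "ennreal ((conv f (mol k) x)\<^sup>2) \<le> (\<integral>\<^sup>+y. ennreal (mol k y) * ennreal ((f (x - y))\<^sup>2) \<partial>lborel)"
proof -
  have [measurable]: "f \<in> borel_measurable borel" using assms by (rule locally_integrable_measurable)
  have "ennreal ((conv f (mol k) x)\<^sup>2) = (ennreal \<bar>conv f (mol k) x\<bar>)\<^sup>2"
    by (simp add: ennreal_power)
  also have "\<dots> \<le> (\<integral>\<^sup>+y. ennreal (mol k y) * ennreal \<bar>f (x - y)\<bar> \<partial>lborel)\<^sup>2"
    using conv_mol_diff_bound[OF assms, of k x 0] by (intro power_mono) auto
  also have "(\<integral>\<^sup>+y. ennreal (mol k y) * ennreal \<bar>f (x - y)\<bar> \<partial>lborel) =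
      (\<integral>\<^sup>+y. ennreal (sqrt (mol k y)) * ennreal (sqrt (mol k y) * \<bar>f (x - y)\<bar>) \<partial>lborel)"
    by (simp add: mol_nonneg ennreal_mult'[symmetric] mult.assoc[symmetric])
  also have "\<dots>\<^sup>2 \<le> (\<integral>\<^sup>+y. (ennreal (sqrt (mol k y)))\<^sup>2 \<partial>(lborel :: (real ^ 'n) measure)) * (\<integral>\<^sup>+y. (ennreal (sqrt (mol k y) * \<bar>f (x - y)\<bar>))\<^sup>2 \<partial>lborel)"
    by (rule Cauchy_Schwarz_nn_integral) measurable
  also have "\<dots> = (\<integral>\<^sup>+y. ennreal (mol k y) * ennreal ((f (x - y))\<^sup>2) \<partial>lborel)"
    by (simp add: ennreal_power mol_nonneg power_mult_distrib nn_integral_mol ennreal_mult')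
  finally show ?thesis .
qed

lemma mollify_L2_bound:
  fixes f :: "real ^ 'n::finite \<Rightarrow> real"
  assumes f: "locally_integrable f"
  shows "(\<integral>\<^sup>+x. ennreal ((conv f (mol k) x)\<^sup>2) \<partial>lborel) \<le> (\<integral>\<^sup>+x. ennreal ((f x)\<^sup>2) \<partial>lborel)"
proof -
  have [measurable]: "f \<in> borel_measurable borel" using assms by (rule locally_integrable_measurable)
  have "(\<integral>\<^sup>+x. ennreal ((conv f (mol k) x)\<^sup>2) \<partial>lborel)
      \<le> (\<integral>\<^sup>+x. \<integral>\<^sup>+y. ennreal (mol k y) * ennreal ((f (x - y))\<^sup>2) \<partial>lborel \<partial>lborel)"
    by (intro nn_integral_mono conv_mol_sq_bound f)
  also have "\<dots> = (\<integral>\<^sup>+y. \<integral>\<^sup>+x. ennreal (mol k y) * ennreal ((f (x - y))\<^sup>2) \<partial>lborel \<partial>lborel)"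
    by (rule lborel_pair.Fubini') measurable
  also have "\<dots> = (\<integral>\<^sup>+y. ennreal (mol k y) * (\<integral>\<^sup>+x. ennreal ((f x)\<^sup>2) \<partial>lborel) \<partial>(lborel :: (real ^ 'n) measure))"
  proof (rule nn_integral_cong)
    fix y :: "real ^ 'n"
    show "(\<integral>\<^sup>+x. ennreal (mol k y) * ennreal ((f (x - y))\<^sup>2) \<partial>lborel) = ennreal (mol k y) * (\<integral>\<^sup>+x. ennreal ((f x)\<^sup>2) \<partial>lborel)"
      using nn_integral_lborel_translate[of "\<lambda>x. ennreal ((f x)\<^sup>2)" "- y"] by (simp add: nn_integral_cmult)
  qed
  also have "\<dots> = (\<integral>\<^sup>+x. ennreal ((f x)\<^sup>2) \<partial>lborel)"
    by (simp add: nn_integral_multc nn_integral_mol)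
  finally show ?thesis .
qed

lemma locally_integrable_L2:
  fixes f :: "real ^ 'n::finite \<Rightarrow> 'b::{banach, second_countable_topology}"
  assumes f: "f \<in> borel_measurable borel" "integrable lborel (\<lambda>x. (norm (f x))\<^sup>2)"
  shows "locally_integrable f"
proof (rule locally_integrable_cong_bound[OF f(1)])
  show "locally_integrable (\<lambda>x. 1 + (norm (f x))\<^sup>2)"
    by (intro locally_integrable_add locally_integrable_integrable f locally_integrable_continuous) auto
  have "t \<le> 1 + t\<^sup>2" for t :: real
  proof -
    have "2 * t \<le> 1 + t\<^sup>2" "0 \<le> t\<^sup>2" using sum_squares_bound[of 1 t] by auto
    then show ?thesis by linarith
  qed
  then show "AE x in lborel. norm (f x) \<le> norm (1 + (norm (f x))\<^sup>2)"
    by (intro AE_I2) (metis abs_ge_self order_trans real_norm_def)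
qed

lemma conv_mol_norm_le:
  fixes Z :: "real ^ 'n::finite \<Rightarrow> 'b::{banach, second_countable_topology}"
  assumes [measurable]: "Z \<in> borel_measurable borel" and C: "AE x in lborel. norm (Z x) \<le> C"
  shows "integrable lborel (\<lambda>y. mol k (x - y) *\<^sub>R Z y)" "norm (\<integral>y. mol k (x - y) *\<^sub>R Z y \<partial>lborel) \<le> C"
proof -
  have i: "integrable lborel (\<lambda>y. C * mol k (x - y))"
    by (intro integrable_mult_right integrable_lborel_reflect integrable_mol)
  have b: "AE y in lborel. norm (mol k (x - y) *\<^sub>R Z y) \<le> C * mol k (x - y)"
    using C by eventually_elim (simp add: mol_nonneg mult.commute mult_right_mono)
  show 1: "integrable lborel (\<lambda>y. mol k (x - y) *\<^sub>R Z y)"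
    by (rule Bochner_Integration.integrable_bound[OF i])
      (measurable, use b in eventually_elim, auto intro: order_trans)
  have "norm (\<integral>y. mol k (x - y) *\<^sub>R Z y \<partial>lborel) \<le> (\<integral>y. norm (mol k (x - y) *\<^sub>R Z y) \<partial>lborel)"
    by (rule integral_norm_bound)
  also have "\<dots> \<le> (\<integral>y. C * mol k (x - y) \<partial>lborel)"
    by (rule integral_mono_AE[OF integrable_norm[OF 1] i b])
  also have "\<dots> = C" by (simp add: integral_lborel_reflect[of "mol k" x] integral_mol)
  finally show "norm (\<integral>y. mol k (x - y) *\<^sub>R Z y \<partial>lborel) \<le> C" .
qed

lemma conv_mol_abs_le:
  fixes f :: "real ^ 'n::finite \<Rightarrow> real"
  assumes "f \<in> borel_measurable borel" "AE x in lborel. \<bar>f x\<bar> \<le> C"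
  shows "\<bar>conv f (mol k) x\<bar> \<le> C"
  using conv_mol_norm_le(2)[of f C k x] assms by (simp add: conv_def mult.commute)

text \<open>The norm is estimated for the vector-valued integral: working component by component
  would lose a dimensional factor, and the constraint |Z| \<le> 1 has to survive exactly.\<close>

lemma conv_mol_AE_bound:
  fixes Z :: "real ^ 'n::finite \<Rightarrow> real ^ 'm::finite"
  assumes Z: "Z \<in> borel_measurable borel" and C: "AE x in lborel. norm (Z x) \<le> C"
  shows "norm (\<chi> i. conv (\<lambda>y. Z y $ i) (mol k) x) \<le> C"
proof -
  note c = conv_mol_norm_le[OF Z C, of k x]
  have "(\<chi> i. conv (\<lambda>y. Z y $ i) (mol k) x) = (\<integral>y. mol k (x - y) *\<^sub>R Z y \<partial>lborel)"
    using integrable_vec_nth(2)[OF c(1)] by (simp add: vec_eq_iff conv_def mult.commute)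
  then show ?thesis using c(2) by simp
qed

lemma conv_mol_diff:
  assumes "locally_integrable f" "locally_integrable g"
  shows "conv (\<lambda>x. f x - g x) (mol k) x = conv f (mol k) x - conv g (mol k) x"
  using conv_mol_integrable(1)[OF assms(1), of k x] conv_mol_integrable(1)[OF assms(2), of k x]
  by (simp add: conv_def left_diff_distrib)

text \<open>On a bounded integrable truncation \<open>g m\<close> the L^2 error is controlled by the
  L^1 error times a bound for the function; the remainder \<open>f - g m\<close> is small in L^2 and
  stays so under mollification.\<close>

lemma mollify_L2:
  fixes f :: "real ^ 'n::finite \<Rightarrow> real"
  assumes m[measurable]: "f \<in> borel_measurable borel" and f2: "integrable lborel (\<lambda>x. (f x)\<^sup>2)"
  shows "(\<lambda>k. \<integral>\<^sup>+x. ennreal ((conv f (mol k) x - f x)\<^sup>2) \<partial>lborel) \<longlonglongrightarrow> 0"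
proof (rule ennreal_tendsto_0I)
  fix e :: real assume e: "e > 0"
  have lf: "locally_integrable f" using f2 by (intro locally_integrable_L2 m) simp
  define g where "g = (\<lambda>m x. if \<bar>f x\<bar> \<le> real m \<and> norm x \<le> real m then f x else 0)"
  have [measurable]: "g m \<in> borel_measurable borel" for m
    unfolding g_def by measurable
  have gm: "\<bar>g m x\<bar> \<le> real m" for m x by (auto simp: g_def)
  have gi: "integrable lborel (g m)" for m
  proof (rule Bochner_Integration.integrable_bound)
    show "integrable lborel (\<lambda>x::real ^ 'n. real m * indicator (cball 0 (real m)) x)"
      using emeasure_lborel_cball_finite[of "0 :: real ^ 'n"] by (intro integrable_mult_right integrable_real_indicator) auto
    show "AE x in lborel. norm (g m x) \<le> norm (real m * indicator (cball 0 (real m)) x)"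
      by (auto simp: g_def indicator_def)
  qed simp
  have d2: "integrable lborel (\<lambda>x. (f x - g m x)\<^sup>2)" for m
    by (rule Bochner_Integration.integrable_bound[OF f2]) (auto simp: g_def)
  have "(\<lambda>m. \<integral>x. (f x - g m x)\<^sup>2 \<partial>lborel) \<longlonglongrightarrow> (\<integral>x. 0 \<partial>(lborel :: (real ^ 'n) measure))"
  proof (rule integral_dominated_convergence[OF _ _ f2])
    show "AE x in lborel. (\<lambda>m. (f x - g m x)\<^sup>2) \<longlonglongrightarrow> 0"
    proof (rule AE_I2, rule tendsto_eventually)
      fix x
      obtain N where N: "max \<bar>f x\<bar> (norm x) \<le> real N" using real_arch_simple by blast
      show "eventually (\<lambda>m. (f x - g m x)\<^sup>2 = 0) sequentially"
        using eventually_ge_at_top[of N] by eventually_elim (use N in \<open>auto simp: g_def\<close>)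
    qed
  qed (auto simp: g_def)
  then have "(\<lambda>m. \<integral>x. (f x - g m x)\<^sup>2 \<partial>lborel) \<longlonglongrightarrow> 0" by simp
  \<comment> \<open>The final sum is 3 e/12 + e/2 + 3 e/12 = e: the factors 3 come from squaring a
    sum of three terms, and 6m below is 3 times the bound 2m for the mollification error of
    \<open>g m\<close>.\<close>
  from LIMSEQ_D[OF this, of "e / 12"] e
  obtain m where "norm ((\<integral>x. (f x - g m x)\<^sup>2 \<partial>lborel) - 0) < e / 12" by auto
  then have "(\<integral>x. (f x - g m x)\<^sup>2 \<partial>lborel) \<le> e / 12" by simp
  then have I: "(\<integral>\<^sup>+x. ennreal ((f x - g m x)\<^sup>2) \<partial>lborel) \<le> ennreal (e / 12)"
    by (subst nn_integral_eq_integral[OF d2]) (auto intro: ennreal_leI)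
  have lg: "locally_integrable (g m)" using gi by (rule locally_integrable_integrable)
  have ld: "locally_integrable (\<lambda>x. f x - g m x)"
    using d2 by (intro locally_integrable_L2) auto
  have [measurable]: "conv f (mol k) \<in> borel_measurable borel" "conv (g m) (mol k) \<in> borel_measurable borel"
     "conv (\<lambda>x. f x - g m x) (mol k) \<in> borel_measurable borel" for k
    using conv_measurable lf lg ld by auto
  have "(\<lambda>k. ennreal (6 * real m) * (\<integral>\<^sup>+x. ennreal \<bar>conv (g m) (mol k) x - g m x\<bar> \<partial>lborel)) \<longlonglongrightarrow> ennreal (6 * real m) * 0"
    by (intro tendsto_mult_ennreal mollify_L1[OF gi] tendsto_const) auto
  then have "eventually (\<lambda>k. ennreal (6 * real m) * (\<integral>\<^sup>+x. ennreal \<bar>conv (g m) (mol k) x - g m x\<bar> \<partial>lborel) < ennreal (e / 2)) sequentially"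
    using e by (intro order_tendstoD) auto
  then show "eventually (\<lambda>k. (\<integral>\<^sup>+x. ennreal ((conv f (mol k) x - f x)\<^sup>2) \<partial>lborel) \<le> ennreal e) sequentially"
  proof eventually_elim
    case (elim k)
    have pt: "(conv f (mol k) x - f x)\<^sup>2 \<le> 3 * (conv (\<lambda>x. f x - g m x) (mol k) x)\<^sup>2
        + 6 * real m * \<bar>conv (g m) (mol k) x - g m x\<bar> + 3 * (f x - g m x)\<^sup>2" for x
    proof -
      define a b c where "a = conv (\<lambda>x. f x - g m x) (mol k) x" and "b = conv (g m) (mol k) x - g m x"
        and "c = f x - g m x"
      have eq: "conv f (mol k) x - f x = a + b - c"
        by (simp add: a_def b_def c_def conv_mol_diff[OF lf lg])
      have "\<bar>conv (g m) (mol k) x\<bar> \<le> real m"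
        by (rule conv_mol_abs_le) (auto simp: gm)
      then have "\<bar>b\<bar> \<le> 2 * real m" using gm[of m x] by (simp add: b_def)
      then have "b\<^sup>2 \<le> 2 * real m * \<bar>b\<bar>"
        using mult_right_mono[of "\<bar>b\<bar>" "2 * real m" "\<bar>b\<bar>"] by (simp add: power2_eq_square)
      moreover have "(a + b - c)\<^sup>2 \<le> 3 * a\<^sup>2 + 3 * b\<^sup>2 + 3 * c\<^sup>2"
        using sum_squares_ge_zero[of "a - b" "a + c"] zero_le_power2[of "b + c"]
        by (simp add: power2_eq_square algebra_simps)
      ultimately show ?thesis unfolding eq using a_def b_def c_def by simp
    qed
    have "(\<integral>\<^sup>+x. ennreal ((conv f (mol k) x - f x)\<^sup>2) \<partial>lborel)
      \<le> (\<integral>\<^sup>+x. 3 * ennreal ((conv (\<lambda>x. f x - g m x) (mol k) x)\<^sup>2)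
        + ennreal (6 * real m) * ennreal \<bar>conv (g m) (mol k) x - g m x\<bar> + 3 * ennreal ((f x - g m x)\<^sup>2) \<partial>lborel)"
    proof (rule nn_integral_mono)
      fix x
      show "ennreal ((conv f (mol k) x - f x)\<^sup>2) \<le> 3 * ennreal ((conv (\<lambda>x. f x - g m x) (mol k) x)\<^sup>2)
        + ennreal (6 * real m) * ennreal \<bar>conv (g m) (mol k) x - g m x\<bar> + 3 * ennreal ((f x - g m x)\<^sup>2)"
        using ennreal_leI[OF pt[of x]]
        by (simp add: ennreal_plus ennreal_mult ennreal_numeral[symmetric] del: ennreal_numeral)
    qed
    also have "\<dots> = 3 * (\<integral>\<^sup>+x. ennreal ((conv (\<lambda>x. f x - g m x) (mol k) x)\<^sup>2) \<partial>lborel)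
        + ennreal (6 * real m) * (\<integral>\<^sup>+x. ennreal \<bar>conv (g m) (mol k) x - g m x\<bar> \<partial>lborel)
        + 3 * (\<integral>\<^sup>+x. ennreal ((f x - g m x)\<^sup>2) \<partial>lborel)"
      by (simp add: nn_integral_add nn_integral_cmult)
    also have "\<dots> \<le> 3 * ennreal (e / 12) + ennreal (e / 2) + 3 * ennreal (e / 12)"
      by (intro add_mono mult_left_mono order_trans[OF mollify_L2_bound[OF ld] I] I less_imp_le[OF elim]) auto
    also have "\<dots> = ennreal e"
      using e by (simp add: ennreal_numeral[symmetric] ennreal_mult[symmetric] ennreal_plus[symmetric] del: ennreal_numeral ennreal_plus)
    finally show ?case .
  qed
qed

text \<open>Mollifications of \<open>G\<close> are integrals against test functions, hence 0;
  localised to a ball they converge to \<open>G\<close> in L^1.\<close>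

lemma fundamental_lemma:
  fixes G :: "real ^ 'n::finite \<Rightarrow> real"
  assumes G: "locally_integrable G" and t: "\<And>\<phi>. test_function \<phi> \<Longrightarrow> (\<integral>x. G x * \<phi> x \<partial>lborel) = 0"
  shows "AE x in lborel. G x = 0"
proof -
  have [measurable]: "G \<in> borel_measurable borel" using G by (rule locally_integrable_measurable)
  have "AE x in lborel. norm x \<le> real N \<longrightarrow> G x = 0" for N
  proof -
    \<comment> \<open>The margin 1 covers the supports of all mollifiers, whose radii are at most 1,
      so on the smaller ball the localisation is invisible to the convolution.\<close>
    define g where "g = (\<lambda>x. indicator (cball 0 (real N + 1)) x * G x)"
    have g: "integrable lborel g"
      using locally_integrable_cball[OF G, of 0 "real N + 1"] by (simp add: g_def set_integrable_def)
    have z: "conv g (mol k) x = 0" if x: "norm x \<le> real N" for k x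
    proof -
      have "conv g (mol k) x = (\<integral>y. G y * mol k (x - y) \<partial>lborel)"
        unfolding conv_def
      proof (rule Bochner_Integration.integral_cong)
        fix y
        show "g y *\<^sub>R mol k (x - y) = G y * mol k (x - y)"
        proof (cases "mol k (x - y) = 0")
          case False
          then have "norm (x - y) \<le> 1 / real (Suc k)" by (rule mol_support)
          also have "\<dots> \<le> 1" by simp
          finally have "norm y \<le> real N + 1"
            using norm_triangle_ineq2[of y x] x by (simp add: norm_minus_commute)
          then show ?thesis by (simp add: g_def)
        qed simp
      qed simp
      also have "\<dots> = 0" by (intro t partial_deriv_reflect(1) test_function_mol)
      finally show ?thesis .
    qed
    have "(\<integral>\<^sup>+x. ennreal \<bar>G x\<bar> * indicator {x. norm x \<le> real N} x \<partial>lborel) \<le> (\<integral>\<^sup>+x. ennreal \<bar>conv g (mol k) x - g x\<bar> \<partial>lborel)" for k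
    proof (rule nn_integral_mono)
      fix x
      show "ennreal \<bar>G x\<bar> * indicator {x. norm x \<le> real N} x \<le> ennreal \<bar>conv g (mol k) x - g x\<bar>"
        using z[of x k] by (cases "norm x \<le> real N") (simp_all add: g_def[THEN fun_cong, of x])
    qed
    then have "(\<integral>\<^sup>+x. ennreal \<bar>G x\<bar> * indicator {x. norm x \<le> real N} x \<partial>lborel) \<le> 0"
      by (intro LIMSEQ_le_const[OF mollify_L1[OF g]]) auto
    moreover have "(\<lambda>x. ennreal \<bar>G x\<bar> * indicator {x. norm x \<le> real N} x) \<in> borel_measurable lborel"
      by measurable
    ultimately have "AE x in lborel. ennreal \<bar>G x\<bar> * indicator {x. norm x \<le> real N} x = 0"
      by (subst nn_integral_0_iff_AE[symmetric]) auto
    then show ?thesis by eventually_elim (auto simp: indicator_def split: if_splits)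
  qed
  then have "AE x in lborel. \<forall>N::nat. norm x \<le> real N \<longrightarrow> G x = 0"
    by (intro AE_all_countable[THEN iffD2]) blast
  then show ?thesis by eventually_elim (use real_arch_simple in blast)
qed

subsection \<open>Poincare and Sobolev inequalities\<close>

lemma pred_mem_cball[measurable]:
  "f \<in> borel_measurable M \<Longrightarrow> Measurable.pred M (\<lambda>x. f x \<in> cball a r)"
  for a :: "'a::euclidean_space"
  unfolding mem_cball by measurable

text \<open>The Dirichlet integral when \<open>G\<close> is a gradient. Its values are in
  \<open>ennreal\<close>, so estimates and Fubini need no integrability side conditions.\<close>

definition energy :: "(real ^ 'n::finite \<Rightarrow> real ^ 'n) \<Rightarrow> ennreal" where
  "energy G = (\<integral>\<^sup>+x. ennreal ((norm (G x))\<^sup>2) \<partial>lborel)"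

lemma nn_integral_indicator_sq_bound:
  assumes [measurable]: "f \<in> borel_measurable M" "A \<in> sets M"
  shows "(\<integral>\<^sup>+x. ennreal \<bar>f x\<bar> * indicator A x \<partial>M)\<^sup>2 \<le>
    (\<integral>\<^sup>+x. ennreal ((f x)\<^sup>2) * indicator A x \<partial>M) * emeasure M A"
proof -
  have "(\<integral>\<^sup>+x. ennreal \<bar>f x\<bar> * indicator A x \<partial>M)\<^sup>2 = (\<integral>\<^sup>+x. (ennreal \<bar>f x\<bar> * indicator A x) * indicator A x \<partial>M)\<^sup>2"
    by (intro arg_cong[where f="\<lambda>x. x\<^sup>2"] nn_integral_cong) (simp split: split_indicator)
  also have "\<dots> \<le> (\<integral>\<^sup>+x. (ennreal \<bar>f x\<bar> * indicator A x)\<^sup>2 \<partial>M) * (\<integral>\<^sup>+x. (indicator A x)\<^sup>2 \<partial>M)"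
    by (rule Cauchy_Schwarz_nn_integral) measurable
  also have "(\<integral>\<^sup>+x. (ennreal \<bar>f x\<bar> * indicator A x)\<^sup>2 \<partial>M) = (\<integral>\<^sup>+x. ennreal ((f x)\<^sup>2) * indicator A x \<partial>M)"
    by (intro nn_integral_cong) (simp add: ennreal_power split: split_indicator)
  also have "(\<integral>\<^sup>+x. (indicator A x)\<^sup>2 \<partial>M) = (\<integral>\<^sup>+x. indicator A x \<partial>M)"
    by (intro nn_integral_cong) (simp split: split_indicator)
  also have "\<dots> = emeasure M A" by simp
  finally show ?thesis .
qed

text \<open>The fundamental theorem of calculus on the segment from \<open>x\<close> to
  \<open>x + v\<close>, then Cauchy-Schwarz on the unit interval.\<close>

lemma C1_grad_segment_sq:
  assumes w: "C1_grad w G"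
  shows "ennreal ((w (x + v) - w x)\<^sup>2) \<le>
    (\<integral>\<^sup>+t. ennreal ((norm v)\<^sup>2) * ennreal ((norm (G (x + t *\<^sub>R v)))\<^sup>2) * indicator {0..1} t \<partial>lborel)"
proof -
  define f where "f = (\<lambda>t. G (x + t *\<^sub>R v) \<bullet> v)"
  have cont: "isCont f t" for t
  proof -
    have "isCont (\<lambda>t. x + t *\<^sub>R v) t" by (intro continuous_intros)
    moreover have "isCont G (x + t *\<^sub>R v)"
      using C1_grad_continuous_grad[OF w, of UNIV] by (simp add: continuous_on_eq_continuous_at)
    ultimately have "isCont (\<lambda>t. G (x + t *\<^sub>R v)) t" by (rule isCont_o2)
    then show ?thesis unfolding f_def by (intro continuous_intros)
  qed
  have [measurable]: "f \<in> borel_measurable borel"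
    using cont by (intro borel_measurable_continuous_onI) (simp add: continuous_on_eq_continuous_at)
  have hb: "has_bochner_integral lborel (\<lambda>t. f t * indicator {0..1} t) (w (x + 1 *\<^sub>R v) - w (x + 0 *\<^sub>R v))"
    using C1_grad_direction[OF w] cont by (intro has_bochner_integral_FTC_Icc_real) (auto simp: f_def)
  have "ennreal ((w (x + v) - w x)\<^sup>2) = (ennreal \<bar>w (x + v) - w x\<bar>)\<^sup>2"
    by (simp add: ennreal_power)
  also have "\<dots> = (ennreal (norm (\<integral>t. f t * indicator {0..1} t \<partial>lborel)))\<^sup>2"
    using has_bochner_integral_integral_eq[OF hb] by simp
  also have "\<dots> \<le> (\<integral>\<^sup>+t. ennreal (norm (f t * indicator {0..1} t)) \<partial>lborel)\<^sup>2"
    using hb by (intro power_mono integral_norm_bound_ennreal) (auto simp: has_bochner_integral_iff)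
  also have "\<dots> = (\<integral>\<^sup>+t. ennreal \<bar>f t\<bar> * indicator {0..1} t \<partial>lborel)\<^sup>2"
    by (intro arg_cong[where f="\<lambda>x. x\<^sup>2"] nn_integral_cong) (simp split: split_indicator)
  also have "\<dots> \<le> (\<integral>\<^sup>+t. ennreal ((f t)\<^sup>2) * indicator {0..1} t \<partial>lborel) * emeasure lborel {0..1::real}"
    by (rule nn_integral_indicator_sq_bound) auto
  also have "\<dots> = (\<integral>\<^sup>+t. ennreal ((f t)\<^sup>2) * indicator {0..1} t \<partial>lborel)" by simp
  also have "\<dots> \<le> (\<integral>\<^sup>+t. ennreal ((norm v)\<^sup>2) * ennreal ((norm (G (x + t *\<^sub>R v)))\<^sup>2) * indicator {0..1} t \<partial>lborel)"
  proof (intro nn_integral_mono mult_right_mono)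
    fix t
    have "(f t)\<^sup>2 \<le> (norm v)\<^sup>2 * (norm (G (x + t *\<^sub>R v)))\<^sup>2"
      using power_mono[OF Cauchy_Schwarz_ineq2[of "G (x + t *\<^sub>R v)" v], of 2]
      by (simp add: f_def power_mult_distrib mult.commute)
    then show "ennreal ((f t)\<^sup>2) \<le> ennreal ((norm v)\<^sup>2) * ennreal ((norm (G (x + t *\<^sub>R v)))\<^sup>2)"
      by (simp add: ennreal_mult[symmetric] ennreal_leI)
  qed simp
  finally show ?thesis .
qed

text \<open>Integrating the segment estimate over \<open>x\<close> first, each point of the segment
  contributes the same energy by translation invariance.\<close>

lemma translation_L2_bound:
  fixes w :: "real ^ 'n::finite \<Rightarrow> real"
  assumes w: "C1_grad w G"
  shows "(\<integral>\<^sup>+x. ennreal ((w (x + v) - w x)\<^sup>2) \<partial>lborel) \<le> ennreal ((norm v)\<^sup>2) * energy G"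
proof -
  have [measurable]: "G \<in> borel_measurable borel" using C1_grad_measurable[OF w] by simp
  have "(\<integral>\<^sup>+x. ennreal ((w (x + v) - w x)\<^sup>2) \<partial>lborel) \<le>
    (\<integral>\<^sup>+x. \<integral>\<^sup>+t. ennreal ((norm v)\<^sup>2) * ennreal ((norm (G (x + t *\<^sub>R v)))\<^sup>2) * indicator {0..1} t \<partial>lborel \<partial>lborel)"
    by (intro nn_integral_mono C1_grad_segment_sq w)
  also have "\<dots> = (\<integral>\<^sup>+t. \<integral>\<^sup>+x. ennreal ((norm v)\<^sup>2) * ennreal ((norm (G (x + t *\<^sub>R v)))\<^sup>2) * indicator {0..1} t \<partial>lborel \<partial>lborel)"
    by (rule lborel_pair.Fubini') measurable
  also have "\<dots> = (\<integral>\<^sup>+t. (ennreal ((norm v)\<^sup>2) * energy G) * indicator {0..1::real} t \<partial>lborel)"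
  proof (rule nn_integral_cong)
    fix t :: real
    have "(\<integral>\<^sup>+x. ennreal ((norm (G (x + t *\<^sub>R v)))\<^sup>2) \<partial>lborel) = energy G"
      unfolding energy_def by (rule nn_integral_lborel_translate) measurable
    then show "(\<integral>\<^sup>+x. ennreal ((norm v)\<^sup>2) * ennreal ((norm (G (x + t *\<^sub>R v)))\<^sup>2) * indicator {0..1} t \<partial>lborel)
      = (ennreal ((norm v)\<^sup>2) * energy G) * indicator {0..1::real} t"
      by (simp add: nn_integral_multc nn_integral_cmult)
  qed
  also have "\<dots> = ennreal ((norm v)\<^sup>2) * energy G" by (simp add: nn_integral_cmult)
  finally show ?thesis .
qed

text \<open>The segment from \<open>x + r z\<close> to \<open>x + 2 r z\<close> has length at most
  \<open>r\<close>, giving r^2; the substitution z to (1 + t) r z has Jacobian at least r^n, giving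
  the denominator.\<close>

lemma dilation_L2_bound:
  fixes w :: "real ^ 'n::finite \<Rightarrow> real"
  assumes w: "C1_grad w G" and r: "r > 0"
  shows "(\<integral>\<^sup>+z. ennreal ((w (x + (2 * r) *\<^sub>R z) - w (x + r *\<^sub>R z))\<^sup>2) * indicator (cball 0 1) z \<partial>lborel) \<le>
    ennreal (r\<^sup>2 / r ^ CARD('n)) * energy G"
proof -
  have [measurable]: "G \<in> borel_measurable borel" using C1_grad_measurable[OF w] by simp
  have "(\<integral>\<^sup>+z. ennreal ((w (x + (2 * r) *\<^sub>R z) - w (x + r *\<^sub>R z))\<^sup>2) * indicator (cball 0 1) z \<partial>lborel) \<le>
    (\<integral>\<^sup>+z. \<integral>\<^sup>+t. ennreal (r\<^sup>2) * ennreal ((norm (G (x + ((1 + t) * r) *\<^sub>R z)))\<^sup>2) * indicator {0..1} t \<partial>lborel \<partial>lborel)"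
  proof (rule nn_integral_mono)
    fix z :: "real ^ 'n"
    show "ennreal ((w (x + (2 * r) *\<^sub>R z) - w (x + r *\<^sub>R z))\<^sup>2) * indicator (cball 0 1) z \<le>
      (\<integral>\<^sup>+t. ennreal (r\<^sup>2) * ennreal ((norm (G (x + ((1 + t) * r) *\<^sub>R z)))\<^sup>2) * indicator {0..1} t \<partial>lborel)"
    proof (cases "norm z \<le> 1")
      case True
      have "norm (r *\<^sub>R z) \<le> r" using True r by (simp add: mult_left_le)
      then have "(norm (r *\<^sub>R z))\<^sup>2 \<le> r\<^sup>2" by (rule power_mono) simp
      have e1: "x + r *\<^sub>R z + r *\<^sub>R z = x + (2 * r) *\<^sub>R z" by (simp only: mult_2 scaleR_add_left add.assoc)
      have e2: "x + r *\<^sub>R z + t *\<^sub>R (r *\<^sub>R z) = x + ((1 + t) * r) *\<^sub>R z" for t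
        by (simp add: algebra_simps)
      have "ennreal ((w (x + (2 * r) *\<^sub>R z) - w (x + r *\<^sub>R z))\<^sup>2) \<le>
        (\<integral>\<^sup>+t. ennreal ((norm (r *\<^sub>R z))\<^sup>2) * ennreal ((norm (G (x + ((1 + t) * r) *\<^sub>R z)))\<^sup>2) * indicator {0..1} t \<partial>lborel)"
        using C1_grad_segment_sq[OF w, of "x + r *\<^sub>R z" "r *\<^sub>R z"] by (simp only: e1 e2)
      also have "\<dots> \<le> (\<integral>\<^sup>+t. ennreal (r\<^sup>2) * ennreal ((norm (G (x + ((1 + t) * r) *\<^sub>R z)))\<^sup>2) * indicator {0..1} t \<partial>lborel)"
        using \<open>(norm (r *\<^sub>R z))\<^sup>2 \<le> r\<^sup>2\<close> by (intro nn_integral_mono mult_right_mono ennreal_leI) auto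
      finally show ?thesis using True by simp
    qed simp
  qed
  also have "\<dots> = (\<integral>\<^sup>+t. \<integral>\<^sup>+z. ennreal (r\<^sup>2) * ennreal ((norm (G (x + ((1 + t) * r) *\<^sub>R z)))\<^sup>2) * indicator {0..1} t \<partial>lborel \<partial>lborel)"
    by (rule lborel_pair.Fubini') measurable
  also have "\<dots> \<le> (\<integral>\<^sup>+t. (ennreal (r\<^sup>2 / r ^ CARD('n)) * energy G) * indicator {0..1::real} t \<partial>lborel)"
  proof (rule nn_integral_mono)
    fix t :: real
    let ?I = "\<integral>\<^sup>+z. ennreal ((norm (G (x + ((1 + t) * r) *\<^sub>R z)))\<^sup>2) \<partial>lborel"
    show "(\<integral>\<^sup>+z. ennreal (r\<^sup>2) * ennreal ((norm (G (x + ((1 + t) * r) *\<^sub>R z)))\<^sup>2) * indicator {0..1} t \<partial>lborel)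
      \<le> (ennreal (r\<^sup>2 / r ^ CARD('n)) * energy G) * indicator {0..1::real} t"
    proof (cases "t \<in> {0..1}")
      case True
      have c: "(1 + t) * r \<noteq> 0" "r \<le> (1 + t) * r" using True r by auto
      have "energy G = ennreal (\<bar>(1 + t) * r\<bar> ^ DIM(real ^ 'n)) * ?I"
        unfolding energy_def by (rule nn_integral_lborel_affine[OF _ c(1)]) measurable
      moreover have "ennreal (r ^ CARD('n)) \<le> ennreal (\<bar>(1 + t) * r\<bar> ^ DIM(real ^ 'n))"
        using c r by (intro ennreal_leI) (auto intro!: power_mono)
      ultimately have "ennreal (r ^ CARD('n)) * ?I \<le> energy G" by (simp add: mult_right_mono)
      then have "ennreal (1 / r ^ CARD('n)) * (ennreal (r ^ CARD('n)) * ?I) \<le> ennreal (1 / r ^ CARD('n)) * energy G"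
        by (rule mult_left_mono) simp
      then have I: "?I \<le> ennreal (1 / r ^ CARD('n)) * energy G"
        using r by (simp add: mult.assoc[symmetric] ennreal_mult[symmetric])
      have "ennreal (r\<^sup>2) * ?I \<le> ennreal (r\<^sup>2) * (ennreal (1 / r ^ CARD('n)) * energy G)"
        using I by (rule mult_left_mono) simp
      also have "\<dots> = ennreal (r\<^sup>2 / r ^ CARD('n)) * energy G"
        using r by (simp add: mult.assoc[symmetric] ennreal_mult[symmetric])
      finally show ?thesis using True by (simp add: nn_integral_cmult)
    qed simp
  qed
  also have "\<dots> = ennreal (r\<^sup>2 / r ^ CARD('n)) * energy G" by (simp add: nn_integral_cmult)
  finally show ?thesis .
qed

section \<open>Means over balls and the Poincare inequality\<close>

definition avg :: "(real ^ 'n::finite \<Rightarrow> real) \<Rightarrow> real" where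
  "avg u = (\<integral>z. indicator (cball 0 1) z * u z \<partial>lborel) / measure lborel (cball (0 :: real ^ 'n) 1)"

lemma measure_unit_cball_pos: "measure lborel (cball (0 :: real ^ 'n::finite) 1) > 0"
  using content_cball[of 1 "0 :: real ^ 'n"] by simp

lemma emeasure_unit_cball:
  "emeasure lborel (cball (0 :: real ^ 'n::finite) r) = ennreal (measure lborel (cball (0 :: real ^ 'n) r))"
  by (rule emeasure_eq_ennreal_measure) (use emeasure_lborel_cball_finite[of "0 :: real ^ 'n" r] in \<open>simp add: less_top\<close>)

lemma avg_integrable:
  fixes u :: "real ^ 'n::finite \<Rightarrow> real"
  assumes "continuous_on UNIV u" shows "integrable lborel (\<lambda>z. indicator (cball 0 1) z * u z)"
  using locally_integrable_cball[OF locally_integrable_continuous[OF assms], of 0 1]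
  by (simp add: set_integrable_def)

lemma avg_const: "avg (\<lambda>z::real ^ 'n::finite. a) = a"
  using measure_unit_cball_pos[where 'n='n] by (simp add: avg_def)

lemma avg_diff:
  assumes "continuous_on UNIV u1" "continuous_on UNIV u2"
  shows "avg (\<lambda>z. u1 z - u2 z) = avg u1 - avg u2"
  using avg_integrable[OF assms(1)] avg_integrable[OF assms(2)]
  by (simp add: avg_def right_diff_distrib diff_divide_distrib)

lemma avg_abs_le:
  fixes u :: "real ^ 'n::finite \<Rightarrow> real"
  assumes u: "continuous_on UNIV u"
  shows "ennreal \<bar>avg u\<bar> \<le> ennreal (1 / measure lborel (cball (0 :: real ^ 'n) 1)) *
    (\<integral>\<^sup>+z. ennreal \<bar>u z\<bar> * indicator (cball 0 1) z \<partial>lborel)"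
proof -
  note p = measure_unit_cball_pos[where 'n='n]
  have "ennreal \<bar>avg u\<bar> = ennreal (1 / measure lborel (cball (0 :: real ^ 'n) 1)) *
      ennreal (norm (\<integral>z. indicator (cball 0 1) z * u z \<partial>lborel))"
    using p by (simp add: avg_def ennreal_mult[symmetric] abs_divide)
  also have "\<dots> \<le> ennreal (1 / measure lborel (cball (0 :: real ^ 'n) 1)) *
      (\<integral>\<^sup>+z. norm (indicator (cball 0 1) z * u z) \<partial>lborel)"
    by (intro mult_left_mono integral_norm_bound_ennreal avg_integrable u) auto
  also have "(\<integral>\<^sup>+z. norm (indicator (cball 0 1) z * u z) \<partial>lborel) = (\<integral>\<^sup>+z. ennreal \<bar>u z\<bar> * indicator (cball 0 1) z \<partial>lborel)"
    by (intro nn_integral_cong) (simp split: split_indicator)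
  finally show ?thesis .
qed

lemma avg_sq_le:
  fixes u :: "real ^ 'n::finite \<Rightarrow> real"
  assumes u: "continuous_on UNIV u"
  shows "ennreal ((avg u)\<^sup>2) \<le> ennreal (1 / measure lborel (cball (0 :: real ^ 'n) 1)) *
    (\<integral>\<^sup>+z. ennreal ((u z)\<^sup>2) * indicator (cball 0 1) z \<partial>lborel)"
proof -
  define c where "c = measure lborel (cball (0 :: real ^ 'n) 1)"
  have c: "c > 0" unfolding c_def by (rule measure_unit_cball_pos)
  have [measurable]: "u \<in> borel_measurable borel" using u by (rule borel_measurable_continuous_onI)
  let ?I = "\<integral>\<^sup>+z. ennreal ((u z)\<^sup>2) * indicator (cball 0 1) z \<partial>lborel"
  have "ennreal ((avg u)\<^sup>2) = (ennreal \<bar>avg u\<bar>)\<^sup>2" by (simp add: ennreal_power)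
  also have "\<dots> \<le> (ennreal (1 / c) * (\<integral>\<^sup>+z. ennreal \<bar>u z\<bar> * indicator (cball 0 1) z \<partial>lborel))\<^sup>2"
    unfolding c_def by (intro power_mono avg_abs_le u) simp
  also have "\<dots> = (ennreal (1 / c))\<^sup>2 * (\<integral>\<^sup>+z. ennreal \<bar>u z\<bar> * indicator (cball 0 1) z \<partial>lborel)\<^sup>2"
    by (simp add: power_mult_distrib)
  also have "\<dots> \<le> (ennreal (1 / c))\<^sup>2 * (?I * emeasure lborel (cball (0 :: real ^ 'n) 1))"
    by (intro mult_left_mono nn_integral_indicator_sq_bound) auto
  also have "emeasure lborel (cball (0 :: real ^ 'n) 1) = ennreal c"
    unfolding c_def by (rule emeasure_unit_cball)
  also have "(ennreal (1 / c))\<^sup>2 * (?I * ennreal c) = (ennreal (1 / c) * ennreal c) * (ennreal (1 / c) * ?I)"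
    by (simp add: power2_eq_square ac_simps)
  also have "ennreal (1 / c) * ennreal c = 1" using c by (simp add: ennreal_mult[symmetric])
  finally show ?thesis by (simp add: c_def)
qed

text \<open>Mean over the ball of radius \<open>r\<close> about \<open>x\<close>, rescaled to the
  unit ball so that means for different radii or centres are integrals over one domain and can be
  subtracted under the integral.\<close>

definition ball_avg :: "real \<Rightarrow> (real ^ 'n::finite \<Rightarrow> real) \<Rightarrow> real ^ 'n \<Rightarrow> real" where
  "ball_avg r w x = avg (\<lambda>z. w (x + r *\<^sub>R z))"

lemma C1_grad_continuous_affine:
  assumes "C1_grad w G" shows "continuous_on UNIV (\<lambda>z. w (x + r *\<^sub>R z))"
  using C1_grad_continuous[OF C1_grad_affine[OF assms]] .

text \<open>The factor r^(2 - n) is what makes the bounds decay geometrically along doubling radii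
  when n \<ge> 3.\<close>

lemma ball_avg_step:
  fixes w :: "real ^ 'n::finite \<Rightarrow> real"
  assumes w: "C1_grad w G" and r: "r > 0"
  shows "ennreal ((ball_avg (2 * r) w x - ball_avg r w x)\<^sup>2) \<le>
    ennreal (1 / measure lborel (cball (0 :: real ^ 'n) 1)) * (ennreal (r\<^sup>2 / r ^ CARD('n)) * energy G)"
proof -
  have "ball_avg (2 * r) w x - ball_avg r w x = avg (\<lambda>z. w (x + (2 * r) *\<^sub>R z) - w (x + r *\<^sub>R z))"
    unfolding ball_avg_def
    by (rule avg_diff[OF C1_grad_continuous_affine[OF w] C1_grad_continuous_affine[OF w], symmetric])
  also have "ennreal (\<dots>\<^sup>2) \<le> ennreal (1 / measure lborel (cball (0 :: real ^ 'n) 1)) *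
    (\<integral>\<^sup>+z. ennreal ((w (x + (2 * r) *\<^sub>R z) - w (x + r *\<^sub>R z))\<^sup>2) * indicator (cball 0 1) z \<partial>lborel)"
    by (intro avg_sq_le continuous_intros C1_grad_continuous_affine[OF w])
  also have "\<dots> \<le> ennreal (1 / measure lborel (cball (0 :: real ^ 'n) 1)) * (ennreal (r\<^sup>2 / r ^ CARD('n)) * energy G)"
    by (intro mult_left_mono dilation_L2_bound w r) auto
  finally show ?thesis .
qed

lemma ball_avg_translate:
  fixes w :: "real ^ 'n::finite \<Rightarrow> real"
  assumes w: "C1_grad w G"
  shows "ennreal ((ball_avg 1 w x - ball_avg 1 w 0)\<^sup>2) \<le>
    ennreal (1 / measure lborel (cball (0 :: real ^ 'n) 1)) * (ennreal ((norm x)\<^sup>2) * energy G)"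
proof -
  have "ball_avg 1 w x - ball_avg 1 w 0 = avg (\<lambda>z. w (x + 1 *\<^sub>R z) - w (0 + 1 *\<^sub>R z))"
    unfolding ball_avg_def
    by (rule avg_diff[OF C1_grad_continuous_affine[OF w] C1_grad_continuous_affine[OF w], symmetric])
  also have "ennreal (\<dots>\<^sup>2) \<le> ennreal (1 / measure lborel (cball (0 :: real ^ 'n) 1)) *
    (\<integral>\<^sup>+z. ennreal ((w (x + 1 *\<^sub>R z) - w (0 + 1 *\<^sub>R z))\<^sup>2) * indicator (cball 0 1) z \<partial>lborel)"
    by (intro avg_sq_le continuous_intros C1_grad_continuous_affine[OF w])
  also have "\<dots> \<le> ennreal (1 / measure lborel (cball (0 :: real ^ 'n) 1)) *
    (\<integral>\<^sup>+z. ennreal ((w (z + x) - w z)\<^sup>2) \<partial>lborel)"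
    by (intro mult_left_mono nn_integral_mono) (auto simp: add.commute split: split_indicator)
  also have "\<dots> \<le> ennreal (1 / measure lborel (cball (0 :: real ^ 'n) 1)) * (ennreal ((norm x)\<^sup>2) * energy G)"
    by (intro mult_left_mono translation_L2_bound w) auto
  finally show ?thesis .
qed

lemma ball_avg_measurable:
  assumes "C1_grad w G" shows "ball_avg r w \<in> borel_measurable borel"
proof -
  have [measurable]: "w \<in> borel_measurable borel" using C1_grad_measurable[OF assms] by simp
  have "(\<lambda>x. \<integral>z. indicator (cball 0 1) z * w (x + r *\<^sub>R z) \<partial>lborel) \<in> borel_measurable lborel"
    by measurable
  then show ?thesis unfolding ball_avg_def avg_def
    by (intro borel_measurable_divide borel_measurable_const) simp
qed

lemma ball_avg_L2:
  fixes w :: "real ^ 'n::finite \<Rightarrow> real"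
  assumes w: "C1_grad w G" and r: "r \<ge> 0"
  shows "(\<integral>\<^sup>+x. ennreal ((ball_avg r w x - w x)\<^sup>2) \<partial>lborel) \<le> ennreal (r\<^sup>2) * energy G"
proof -
  define c where "c = measure lborel (cball (0 :: real ^ 'n) 1)"
  have c: "c > 0" unfolding c_def by (rule measure_unit_cball_pos)
  have [measurable]: "w \<in> borel_measurable borel" using C1_grad_measurable[OF w] by simp
  have "(\<integral>\<^sup>+x. ennreal ((ball_avg r w x - w x)\<^sup>2) \<partial>lborel) \<le>
    (\<integral>\<^sup>+x. ennreal (1 / c) * (\<integral>\<^sup>+z. ennreal ((w (x + r *\<^sub>R z) - w x)\<^sup>2) * indicator (cball 0 1) z \<partial>lborel) \<partial>lborel)"
  proof (rule nn_integral_mono)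
    fix x
    have "ball_avg r w x - w x = avg (\<lambda>z. w (x + r *\<^sub>R z) - w x)"
      unfolding ball_avg_def
      by (subst avg_diff) (auto intro!: C1_grad_continuous_affine w simp: avg_const)
    also have "ennreal (\<dots>\<^sup>2) \<le> ennreal (1 / c) * (\<integral>\<^sup>+z. ennreal ((w (x + r *\<^sub>R z) - w x)\<^sup>2) * indicator (cball 0 1) z \<partial>lborel)"
      unfolding c_def by (intro avg_sq_le continuous_intros C1_grad_continuous_affine[OF w])
    finally show "ennreal ((ball_avg r w x - w x)\<^sup>2) \<le> ennreal (1 / c) * (\<integral>\<^sup>+z. ennreal ((w (x + r *\<^sub>R z) - w x)\<^sup>2) * indicator (cball 0 1) z \<partial>lborel)" .
  qed
  also have "\<dots> = ennreal (1 / c) * (\<integral>\<^sup>+x. \<integral>\<^sup>+z. ennreal ((w (x + r *\<^sub>R z) - w x)\<^sup>2) * indicator (cball 0 1) z \<partial>lborel \<partial>lborel)"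
    by (rule nn_integral_cmult) measurable
  also have "(\<integral>\<^sup>+x. \<integral>\<^sup>+z. ennreal ((w (x + r *\<^sub>R z) - w x)\<^sup>2) * indicator (cball 0 1) z \<partial>lborel \<partial>lborel) =
    (\<integral>\<^sup>+z. \<integral>\<^sup>+x. ennreal ((w (x + r *\<^sub>R z) - w x)\<^sup>2) * indicator (cball 0 1) z \<partial>lborel \<partial>lborel)"
    by (rule lborel_pair.Fubini') measurable
  also have "\<dots> \<le> (\<integral>\<^sup>+z. (ennreal (r\<^sup>2) * energy G) * indicator (cball (0 :: real ^ 'n) 1) z \<partial>lborel)"
  proof (rule nn_integral_mono)
    fix z :: "real ^ 'n"
    show "(\<integral>\<^sup>+x. ennreal ((w (x + r *\<^sub>R z) - w x)\<^sup>2) * indicator (cball 0 1) z \<partial>lborel)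
      \<le> (ennreal (r\<^sup>2) * energy G) * indicator (cball (0 :: real ^ 'n) 1) z"
    proof (cases "norm z \<le> 1")
      case True
      have "norm (r *\<^sub>R z) \<le> r" using True r by (simp add: mult_left_le)
      then have "(norm (r *\<^sub>R z))\<^sup>2 \<le> r\<^sup>2" by (rule power_mono) simp
      then have "(\<integral>\<^sup>+x. ennreal ((w (x + r *\<^sub>R z) - w x)\<^sup>2) \<partial>lborel) \<le> ennreal (r\<^sup>2) * energy G"
        by (intro order_trans[OF translation_L2_bound[OF w]] mult_right_mono ennreal_leI) auto
      then show ?thesis using True by simp
    qed simp
  qed
  also have "\<dots> = (ennreal (r\<^sup>2) * energy G) * ennreal c"
    by (simp add: nn_integral_cmult emeasure_unit_cball c_def)
  finally have "(\<integral>\<^sup>+x. ennreal ((ball_avg r w x - w x)\<^sup>2) \<partial>lborel) \<le> ennreal (1 / c) * ((ennreal (r\<^sup>2) * energy G) * ennreal c)"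
    by (simp add: mult_left_mono)
  also have "\<dots> = (ennreal (1 / c) * ennreal c) * (ennreal (r\<^sup>2) * energy G)" by (simp add: ac_simps)
  also have "ennreal (1 / c) * ennreal c = 1" using c by (simp add: ennreal_mult[symmetric])
  finally show ?thesis by simp
qed

text \<open>Two comparisons: \<open>w x\<close> with the mean about \<open>x\<close>, controlled in
  L^2 of the whole space, and this mean with the one about 0, controlled pointwise by the distance
  |x| \<le> R.\<close>

lemma poincare:
  "\<exists>C \<ge> 0. \<forall>(w :: real ^ 'n::finite \<Rightarrow> real) G. C1_grad w G \<longrightarrow>
    (\<integral>\<^sup>+x. ennreal ((w x - ball_avg 1 w 0)\<^sup>2) * indicator (cball 0 R) x \<partial>lborel) \<le> ennreal C * energy G"
proof -
  define c where "c = measure lborel (cball (0 :: real ^ 'n) 1)"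
  have c: "c > 0" unfolding c_def by (rule measure_unit_cball_pos)
  define m where "m = measure lborel (cball (0 :: real ^ 'n) R)"
  have m: "m \<ge> 0" by (simp add: m_def)
  show ?thesis
  \<comment> \<open>Squaring the sum of the two differences costs a factor 2 each; the second one is
    a constant integrated over the ball of measure \<open>m\<close>.\<close>
  proof (intro exI[of _ "2 + 2 * R\<^sup>2 / c * m"] conjI allI impI)
    show "0 \<le> 2 + 2 * R\<^sup>2 / c * m" using c m by simp
    fix w :: "real ^ 'n \<Rightarrow> real" and G assume w: "C1_grad w G"
    have [measurable]: "w \<in> borel_measurable borel" "ball_avg 1 w \<in> borel_measurable borel"
      using C1_grad_measurable[OF w] ball_avg_measurable[OF w] by auto
    have "(\<integral>\<^sup>+x. ennreal ((w x - ball_avg 1 w 0)\<^sup>2) * indicator (cball 0 R) x \<partial>lborel) \<le>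
      (\<integral>\<^sup>+x. 2 * ennreal ((ball_avg 1 w x - w x)\<^sup>2) + (ennreal (2 * R\<^sup>2 / c) * energy G) * indicator (cball 0 R) x \<partial>lborel)"
    proof (rule nn_integral_mono)
      fix x
      show "ennreal ((w x - ball_avg 1 w 0)\<^sup>2) * indicator (cball 0 R) x \<le>
        2 * ennreal ((ball_avg 1 w x - w x)\<^sup>2) + (ennreal (2 * R\<^sup>2 / c) * energy G) * indicator (cball 0 R) x"
      proof (cases "norm x \<le> R")
        case True
        let ?a = "ball_avg 1 w x - w x" and ?b = "ball_avg 1 w x - ball_avg 1 w 0"
        have "(w x - ball_avg 1 w 0)\<^sup>2 \<le> 2 * ?a\<^sup>2 + 2 * ?b\<^sup>2"
          using zero_le_power2[of "?a + ?b"] by (simp add: power2_eq_square algebra_simps)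
        then have "ennreal ((w x - ball_avg 1 w 0)\<^sup>2) \<le> 2 * ennreal (?a\<^sup>2) + 2 * ennreal (?b\<^sup>2)"
          using ennreal_leI by (fastforce simp: ennreal_plus ennreal_mult')
        also have "2 * ennreal (?b\<^sup>2) \<le> 2 * (ennreal (1 / c) * (ennreal (R\<^sup>2) * energy G))"
          using ball_avg_translate[OF w, of x] True
          by (intro mult_left_mono order_trans[OF ball_avg_translate[OF w]]) (auto simp: c_def intro!: mult_left_mono mult_right_mono ennreal_leI power_mono)
        also have "\<dots> = ennreal (2 * R\<^sup>2 / c) * energy G"
          using c by (simp add: mult.assoc[symmetric] ennreal_mult'[symmetric] ennreal_numeral[symmetric] del: ennreal_numeral)
        finally show ?thesis using True by (simp add: add_left_mono)
      qed simp
    qed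
    also have "\<dots> = 2 * (\<integral>\<^sup>+x. ennreal ((ball_avg 1 w x - w x)\<^sup>2) \<partial>lborel) + (ennreal (2 * R\<^sup>2 / c) * energy G) * ennreal m"
      by (simp add: nn_integral_add nn_integral_cmult emeasure_unit_cball m_def)
    also have "\<dots> \<le> 2 * (ennreal (1\<^sup>2) * energy G) + (ennreal (2 * R\<^sup>2 / c) * energy G) * ennreal m"
      by (intro add_right_mono mult_left_mono ball_avg_L2 w) auto
    also have "\<dots> = ennreal (2 + 2 * R\<^sup>2 / c * m) * energy G"
    proof -
      have "ennreal (2 + 2 * R\<^sup>2 / c * m) = 2 + ennreal (2 * R\<^sup>2 / c) * ennreal m"
        using c m by (subst ennreal_plus) (auto simp: ennreal_mult[symmetric])
      then show ?thesis by (simp add: distrib_left distrib_right ac_simps)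
    qed
    finally show "(\<integral>\<^sup>+x. ennreal ((w x - ball_avg 1 w 0)\<^sup>2) * indicator (cball 0 R) x \<partial>lborel) \<le> ennreal (2 + 2 * R\<^sup>2 / c * m) * energy G" .
  qed
qed

text \<open>The form of decay at infinity under which constants are excluded but which, unlike membership
  in a Lebesgue space, is inherited by truncations and mollifications with no bookkeeping of norms.\<close>

definition vanishing :: "(real ^ 'n::finite \<Rightarrow> real) \<Rightarrow> bool" where
  "vanishing w \<longleftrightarrow> w \<in> borel_measurable borel \<and> (\<forall>\<tau>>0. (\<integral>\<^sup>+x. ennreal (\<bar>w x\<bar> - \<tau>) \<partial>lborel) < \<infinity>)"

section \<open>Decay of means and the weak-type Sobolev inequality\<close>

text \<open>Below the threshold e/2 the function contributes at most e/2 to a mean, and the excess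
  above it has a fixed finite integral \<open>J\<close>, which is divided by the growing
  volume.\<close>

lemma ball_avg_vanishing:
  fixes w :: "real ^ 'n::finite \<Rightarrow> real"
  assumes w: "C1_grad w G" and van: "vanishing w" and r: "r > 0"
  shows "(\<lambda>k. ball_avg (2 ^ k * r) w x) \<longlonglongrightarrow> 0"
proof (rule LIMSEQ_I)
  fix e :: real assume e: "e > 0"
  define c where "c = measure lborel (cball (0 :: real ^ 'n) 1)"
  have c: "c > 0" unfolding c_def by (rule measure_unit_cball_pos)
  have [measurable]: "w \<in> borel_measurable borel" using C1_grad_measurable[OF w] by simp
  define J where "J = enn2real (\<integral>\<^sup>+x. ennreal (\<bar>w x\<bar> - e / 2) \<partial>lborel)"
  have J: "(\<integral>\<^sup>+x. ennreal (\<bar>w x\<bar> - e / 2) \<partial>lborel) = ennreal J" "J \<ge> 0"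
    using van e by (auto simp: vanishing_def J_def)
  have bound: "\<bar>ball_avg R w x\<bar> \<le> e / 2 + J / (c * R ^ CARD('n))" if R: "R > 0" for R
  proof -
    let ?I = "\<integral>\<^sup>+z. ennreal (\<bar>w (x + R *\<^sub>R z)\<bar> - e / 2) \<partial>lborel"
    have "ennreal J = ennreal (\<bar>R\<bar> ^ DIM(real ^ 'n)) * ?I"
      unfolding J(1)[symmetric] by (rule nn_integral_lborel_affine) (use R in auto)
    then have "ennreal (1 / R ^ CARD('n)) * ennreal J = (ennreal (1 / R ^ CARD('n)) * ennreal (R ^ CARD('n))) * ?I"
      using R by (simp add: mult.assoc)
    then have I: "?I = ennreal (J / R ^ CARD('n))"
      using R J(2) by (simp add: ennreal_mult[symmetric])
    have "ennreal \<bar>ball_avg R w x\<bar> \<le> ennreal (1 / c) * (\<integral>\<^sup>+z. ennreal \<bar>w (x + R *\<^sub>R z)\<bar> * indicator (cball 0 1) z \<partial>lborel)"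
      unfolding ball_avg_def c_def by (intro avg_abs_le C1_grad_continuous_affine[OF w])
    also have "\<dots> \<le> ennreal (1 / c) * (\<integral>\<^sup>+z. ennreal (e / 2) * indicator (cball 0 1) z + ennreal (\<bar>w (x + R *\<^sub>R z)\<bar> - e / 2) \<partial>lborel)"
    proof (intro mult_left_mono nn_integral_mono)
      fix z :: "real ^ 'n"
      have "ennreal \<bar>w (x + R *\<^sub>R z)\<bar> \<le> ennreal (e / 2 + max 0 (\<bar>w (x + R *\<^sub>R z)\<bar> - e / 2))"
        by (intro ennreal_leI) (auto simp: max_def)
      also have "\<dots> = ennreal (e / 2) + ennreal (\<bar>w (x + R *\<^sub>R z)\<bar> - e / 2)"
        using e by (subst ennreal_plus) (auto simp: max_def ennreal_neg)
      finally show "ennreal \<bar>w (x + R *\<^sub>R z)\<bar> * indicator (cball 0 1) z \<le>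
          ennreal (e / 2) * indicator (cball 0 1) z + ennreal (\<bar>w (x + R *\<^sub>R z)\<bar> - e / 2)"
        by (simp split: split_indicator)
    qed simp
    also have "\<dots> = ennreal (1 / c) * (ennreal (e / 2) * ennreal c + ennreal (J / R ^ CARD('n)))"
      by (simp add: nn_integral_add nn_integral_cmult emeasure_unit_cball c_def I)
    also have "\<dots> = ennreal (e / 2 + J / (c * R ^ CARD('n)))"
      using c e R J(2) by (simp add: distrib_left ennreal_mult[symmetric] ennreal_plus[symmetric] del: ennreal_plus)
    finally show ?thesis
      using e c R J(2) by (subst (asm) ennreal_le_iff) auto
  qed
  have "(\<lambda>k. J / (c * r ^ CARD('n)) * (1 / 2 ^ CARD('n)) ^ k) \<longlonglongrightarrow> 0"
    by (intro tendsto_mult_right_zero LIMSEQ_realpow_zero) (auto simp: divide_less_eq)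
  from LIMSEQ_D[OF this, of "e / 2"] e
  obtain N where N: "\<And>k. k \<ge> N \<Longrightarrow> norm (J / (c * r ^ CARD('n)) * (1 / 2 ^ CARD('n)) ^ k - 0) < e / 2" by auto
  show "\<exists>N. \<forall>k\<ge>N. norm (ball_avg (2 ^ k * r) w x - 0) < e"
  proof (intro exI allI impI)
    fix k assume "k \<ge> N"
    have "J / (c * (2 ^ k * r) ^ CARD('n)) = J / (c * r ^ CARD('n)) * (1 / 2 ^ CARD('n)) ^ k"
      by (simp add: power_mult_distrib power_divide power_mult[symmetric] mult.commute)
    then have "J / (c * (2 ^ k * r) ^ CARD('n)) < e / 2"
      using N[OF \<open>k \<ge> N\<close>] abs_ge_self le_less_trans by (metis diff_zero real_norm_def)
    then show "norm (ball_avg (2 ^ k * r) w x - 0) < e"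
      using bound[OF mult_pos_pos[OF zero_less_power[OF zero_less_numeral] r], of "num.Bit0 num.One" k]
      unfolding real_norm_def diff_zero by linarith
  qed
qed

lemma geometric_telescope:
  fixes a :: "nat \<Rightarrow> real"
  assumes a: "a \<longlonglongrightarrow> 0" and q: "0 < q" "q < 1" and M: "M \<ge> 0"
    and step: "\<And>k. \<bar>a (Suc k) - a k\<bar> \<le> M * q ^ k"
  shows "\<bar>a 0\<bar> \<le> M / (1 - q)"
proof -
  have "\<bar>a 0\<bar> \<le> \<bar>a N\<bar> + M / (1 - q)" for N
  proof -
    have "a 0 = a N - (\<Sum>k<N. a (Suc k) - a k)" by (simp add: sum_lessThan_telescope)
    then have "\<bar>a 0\<bar> \<le> \<bar>a N\<bar> + (\<Sum>k<N. \<bar>a (Suc k) - a k\<bar>)"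
      using sum_abs[of "\<lambda>k. a (Suc k) - a k" "{..<N}"] by linarith
    also have "(\<Sum>k<N. \<bar>a (Suc k) - a k\<bar>) \<le> (\<Sum>k<N. M * q ^ k)" by (intro sum_mono step)
    also have "\<dots> = M * (\<Sum>k<N. q ^ k)" by (simp add: sum_distrib_left)
    also have "\<dots> \<le> M * (1 / (1 - q))"
      using q M by (intro mult_left_mono) (auto simp: geometric_sum field_simps)
    finally show ?thesis by simp
  qed
  moreover have "(\<lambda>N. \<bar>a N\<bar> + M / (1 - q)) \<longlonglongrightarrow> 0 + M / (1 - q)"
    by (intro tendsto_add tendsto_rabs_zero a tendsto_const)
  ultimately show ?thesis using LIMSEQ_le_const by fastforce
qed

text \<open>Telescope the mean along the radii \<open>2 ^ k * r\<close> to its limit 0. For n \<ge>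
  3 the steps are bounded by a geometric series of ratio 1/sqrt 2, whose sum explains the
  constant.\<close>

lemma ball_avg_bound:
  fixes w :: "real ^ 'n::finite \<Rightarrow> real"
  assumes n: "CARD('n) \<ge> 3" and w: "C1_grad w G" and van: "vanishing w" and r: "r > 0"
    and D: "D \<ge> 0" "energy G \<le> ennreal (D\<^sup>2)"
  shows "\<bar>ball_avg r w x\<bar> \<le> (1 / sqrt (measure lborel (cball (0 :: real ^ 'n) 1))) / (1 - 1 / sqrt 2) * D * (r / sqrt (r ^ CARD('n)))"
proof -
  define c where "c = measure lborel (cball (0 :: real ^ 'n) 1)"
  have c: "c > 0" unfolding c_def by (rule measure_unit_cball_pos)
  define M where "M = 1 / sqrt c * D * (r / sqrt (r ^ CARD('n)))"
  have M: "M \<ge> 0" using c D r by (simp add: M_def)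
  have step0: "\<bar>ball_avg (2 * s) w x - ball_avg s w x\<bar> \<le> 1 / sqrt c * D * (s / sqrt (s ^ CARD('n)))" if s: "s > 0" for s
  proof -
    have "ennreal ((ball_avg (2 * s) w x - ball_avg s w x)\<^sup>2) \<le> ennreal (1 / c) * (ennreal (s\<^sup>2 / s ^ CARD('n)) * energy G)"
      unfolding c_def by (rule ball_avg_step[OF w s])
    also have "\<dots> \<le> ennreal (1 / c) * (ennreal (s\<^sup>2 / s ^ CARD('n)) * ennreal (D\<^sup>2))"
      by (intro mult_left_mono D) auto
    also have "\<dots> = ennreal (1 / c * (s\<^sup>2 / s ^ CARD('n) * D\<^sup>2))"
      using c s by (simp add: ennreal_mult[symmetric])
    also have "1 / c * (s\<^sup>2 / s ^ CARD('n) * D\<^sup>2) = (1 / sqrt c * D * (s / sqrt (s ^ CARD('n))))\<^sup>2"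
      using c s by (simp add: power_mult_distrib power_divide)
    finally have "(ball_avg (2 * s) w x - ball_avg s w x)\<^sup>2 \<le> (1 / sqrt c * D * (s / sqrt (s ^ CARD('n))))\<^sup>2"
      by (subst (asm) ennreal_le_iff) auto
    then show ?thesis
      using c D s abs_le_square_iff[THEN iffD2, of "ball_avg (2 * s) w x - ball_avg s w x" "1 / sqrt c * D * (s / sqrt (s ^ CARD('n)))"]
      by simp
  qed
  have "\<bar>ball_avg (2 ^ 0 * r) w x\<bar> \<le> M / (1 - 1 / sqrt 2)"
  proof (rule geometric_telescope[OF ball_avg_vanishing[OF w van r] _ _ M])
    show "\<bar>ball_avg (2 ^ Suc k * r) w x - ball_avg (2 ^ k * r) w x\<bar> \<le> M * (1 / sqrt 2) ^ k" for k
    proof -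
      have e: "2 ^ Suc k * r = 2 * (2 ^ k * r)" by simp
      have "2 ^ k / sqrt ((2 ^ k) ^ CARD('n)) \<le> (1 / sqrt 2) ^ k"
      proof (rule power2_le_imp_le)
        have "(2::real) ^ (k * 3) \<le> 2 ^ (k * CARD('n))" using n by (intro power_increasing) auto
        then have "((2::real) ^ k)\<^sup>2 * 2 ^ k \<le> 2 ^ (k * CARD('n))"
          by (simp add: power_mult[symmetric] power_add[symmetric] numeral_3_eq_3 numeral_2_eq_2)
        then show "(2 ^ k / sqrt ((2 ^ k) ^ CARD('n)))\<^sup>2 \<le> ((1 / sqrt 2) ^ k)\<^sup>2"
          by (simp add: power_divide power_mult[symmetric] power_mult[of "sqrt 2" 2 k, simplified mult.commute[of 2 k]] field_simps)
      qed simp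
      then have "1 / sqrt c * D * (r / sqrt (r ^ CARD('n))) * (2 ^ k / sqrt ((2 ^ k) ^ CARD('n))) \<le> M * (1 / sqrt 2) ^ k"
        unfolding M_def using M M_def by (intro mult_left_mono) auto
      moreover have "1 / sqrt c * D * ((2 ^ k * r) / sqrt ((2 ^ k * r) ^ CARD('n))) =
        1 / sqrt c * D * (r / sqrt (r ^ CARD('n))) * (2 ^ k / sqrt ((2 ^ k) ^ CARD('n)))"
        by (simp add: power_mult_distrib real_sqrt_mult mult_ac)
      ultimately show ?thesis using step0[of "2 ^ k * r"] r unfolding e by simp
    qed
  qed (auto simp: divide_less_eq)
  then show ?thesis by (simp add: M_def c_def mult_ac)
qed

text \<open>At a suitable radius all ball means are at most t/2, so on {|w| \<ge> t} the function
  deviates from its mean by at least t/2; Chebyshev's inequality with \<open>ball_avg_L2\<close>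
  bounds the measure of this set.\<close>

lemma weak_sobolev_pos:
  fixes w :: "real ^ 'n::finite \<Rightarrow> real"
  assumes n: "CARD('n) \<ge> 3"
  defines "K \<equiv> (1 / sqrt (measure lborel (cball (0 :: real ^ 'n) 1))) / (1 - 1 / sqrt 2)"
    and "p \<equiv> 2 * real CARD('n) / (real CARD('n) - 2)"
  assumes w: "C1_grad w G" and van: "vanishing w"
    and D: "D > 0" "energy G \<le> ennreal (D\<^sup>2)" and t: "t > 0"
  shows "emeasure lborel {x. t \<le> \<bar>w x\<bar>} \<le> ennreal (4 * (2 * K) powr (4 / (real CARD('n) - 2)) * (D / t) powr p)"
proof -
  let ?n = "real CARD('n)"
  have n2: "?n - 2 > 0" using n by simp
  have K: "K > 0" unfolding K_def using measure_unit_cball_pos[where 'n='n] by (auto simp: divide_less_eq)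
  have [measurable]: "w \<in> borel_measurable borel" "ball_avg r w \<in> borel_measurable borel" for r
    using C1_grad_measurable[OF w] ball_avg_measurable[OF w] by auto
  \<comment> \<open>\<open>r\<close> solves K D r^(1 - n/2) = t/2, that is, it makes the bound of
    \<open>ball_avg_bound\<close> equal to t/2.\<close>
  define q where "q = 2 * K * D / t"
  have q: "q > 0" using K D t by (simp add: q_def)
  define r where "r = q powr (2 / (?n - 2))"
  have r: "r > 0" using q by (simp add: r_def)
  have "sqrt (r ^ CARD('n)) = r powr (?n / 2)"
    using r by (simp add: powr_realpow[symmetric] powr_half_sqrt[symmetric] powr_powr)
  then have "r / sqrt (r ^ CARD('n)) = r powr (1 - ?n / 2)"
    using r by (simp add: powr_diff)
  also have "\<dots> = q powr (2 / (?n - 2) * (1 - ?n / 2))" by (simp add: r_def powr_powr)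
  also have "2 / (?n - 2) * (1 - ?n / 2) = -1" using n2 by (simp add: field_simps)
  also have "q powr -1 = inverse q" using q by (simp add: powr_minus)
  also have "\<dots> = t / (2 * K * D)" by (simp add: q_def)
  finally have rr: "K * D * (r / sqrt (r ^ CARD('n))) = t / 2" using K D by simp
  have avg: "\<bar>ball_avg r w x\<bar> \<le> t / 2" for x
    using ball_avg_bound[OF n w van r less_imp_le[OF D(1)] D(2), of x] unfolding K_def[symmetric] rr .
  have "ennreal ((t / 2)\<^sup>2) * emeasure lborel {x. t \<le> \<bar>w x\<bar>} = (\<integral>\<^sup>+x. ennreal ((t / 2)\<^sup>2) * indicator {x. t \<le> \<bar>w x\<bar>} x \<partial>lborel)"
    by (simp add: nn_integral_cmult)
  also have "\<dots> \<le> (\<integral>\<^sup>+x. ennreal ((ball_avg r w x - w x)\<^sup>2) \<partial>lborel)"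
  proof (rule nn_integral_mono)
    fix x
    have "(t / 2)\<^sup>2 \<le> (ball_avg r w x - w x)\<^sup>2" if "t \<le> \<bar>w x\<bar>"
    proof -
      have "t / 2 \<le> \<bar>ball_avg r w x - w x\<bar>" using avg[of x] that by linarith
      then show ?thesis using t power_mono[of "t / 2" "\<bar>ball_avg r w x - w x\<bar>" 2] by simp
    qed
    then show "ennreal ((t / 2)\<^sup>2) * indicator {x. t \<le> \<bar>w x\<bar>} x \<le> ennreal ((ball_avg r w x - w x)\<^sup>2)"
      by (auto simp: ennreal_leI split: split_indicator)
  qed
  also have "\<dots> \<le> ennreal (r\<^sup>2) * energy G" using r by (intro ball_avg_L2 w) simp
  also have "\<dots> \<le> ennreal (r\<^sup>2) * ennreal (D\<^sup>2)" by (intro mult_left_mono D) simp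
  finally have "ennreal (1 / (t / 2)\<^sup>2) * (ennreal ((t / 2)\<^sup>2) * emeasure lborel {x. t \<le> \<bar>w x\<bar>}) \<le>
      ennreal (1 / (t / 2)\<^sup>2) * (ennreal (r\<^sup>2) * ennreal (D\<^sup>2))"
    by (rule mult_left_mono) simp
  then have "emeasure lborel {x. t \<le> \<bar>w x\<bar>} \<le> ennreal (1 / (t / 2)\<^sup>2 * (r\<^sup>2 * D\<^sup>2))"
    using t by (simp add: mult.assoc[symmetric] ennreal_mult[symmetric])
  also have "1 / (t / 2)\<^sup>2 * (r\<^sup>2 * D\<^sup>2) = 4 * r\<^sup>2 * (D / t)\<^sup>2" by (simp add: power_divide)
  also have "r\<^sup>2 = (2 * K) powr (4 / (?n - 2)) * (D / t) powr (4 / (?n - 2))"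
  proof -
    have "r\<^sup>2 = r powr 2" using r by (simp add: powr_numeral)
    also have "\<dots> = q powr (4 / (?n - 2))" by (simp add: r_def powr_powr)
    also have "q = (2 * K) * (D / t)" by (simp add: q_def)
    also have "((2 * K) * (D / t)) powr (4 / (?n - 2)) = (2 * K) powr (4 / (?n - 2)) * (D / t) powr (4 / (?n - 2))"
      by (rule powr_mult)
    finally show ?thesis .
  qed
  also have "4 * ((2 * K) powr (4 / (?n - 2)) * (D / t) powr (4 / (?n - 2))) * (D / t)\<^sup>2 =
    4 * (2 * K) powr (4 / (?n - 2)) * ((D / t) powr (4 / (?n - 2)) * (D / t) powr 2)"
    using D t by (simp add: powr_numeral)
  also have "(D / t) powr (4 / (?n - 2)) * (D / t) powr 2 = (D / t) powr p"
  proof -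
    have "4 / (?n - 2) + 2 = p" unfolding p_def using n2 by (simp add: field_simps)
    then show ?thesis by (simp add: powr_add[symmetric])
  qed
  finally show ?thesis .
qed

text \<open>The value D = 0, for which no such radius exists, is reached as a limit from above; it
  is needed when a truncation has no energy.\<close>

lemma weak_sobolev:
  assumes n: "CARD('n::finite) \<ge> 3"
  defines "p \<equiv> 2 * real CARD('n) / (real CARD('n) - 2)"
  shows "\<exists>C\<ge>0. \<forall>(w :: real ^ 'n \<Rightarrow> real) G D t. C1_grad w G \<longrightarrow> vanishing w \<longrightarrow> D \<ge> 0 \<longrightarrow>
    energy G \<le> ennreal (D\<^sup>2) \<longrightarrow> t > 0 \<longrightarrow>
    emeasure lborel {x. t \<le> \<bar>w x\<bar>} \<le> ennreal (C * (D / t) powr p)"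
proof -
  have p: "p > 0" using n by (simp add: p_def)
  define C where "C = 4 * (2 * ((1 / sqrt (measure lborel (cball (0 :: real ^ 'n) 1))) / (1 - 1 / sqrt 2))) powr (4 / (real CARD('n) - 2))"
  show ?thesis
  proof (intro exI[of _ C] conjI allI impI)
    show "C \<ge> 0" by (simp add: C_def)
    fix w :: "real ^ 'n \<Rightarrow> real" and G D and t :: real
    assume w: "C1_grad w G" "vanishing w" and D: "D \<ge> 0" "energy G \<le> ennreal (D\<^sup>2)" and t: "t > 0"
    define d where "d = (\<lambda>k. D + 1 / real (Suc k))"
    have dD: "d \<longlonglongrightarrow> D + 0" unfolding d_def
      by (intro tendsto_add tendsto_const) (use LIMSEQ_inverse_real_of_nat in \<open>simp add: inverse_eq_divide\<close>)
    have "emeasure lborel {x. t \<le> \<bar>w x\<bar>} \<le> ennreal (C * (d k / t) powr p)" for k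
    proof -
      have "D\<^sup>2 \<le> (d k)\<^sup>2" using D by (intro power_mono) (auto simp: d_def)
      then have "energy G \<le> ennreal ((d k)\<^sup>2)" using D(2) by (meson ennreal_leI order_trans)
      moreover have "d k > 0" using D(1) by (simp add: d_def add_nonneg_pos)
      ultimately show ?thesis
        unfolding C_def p_def using weak_sobolev_pos[OF n w _ _ t, of "d k"] by blast
    qed
    moreover have "(\<lambda>k. ennreal (C * (d k / t) powr p)) \<longlonglongrightarrow> ennreal (C * ((D + 0) / t) powr p)"
      using p t D(1) by (intro tendsto_ennrealI tendsto_mult tendsto_const tendsto_powr' tendsto_divide dD)
        (auto simp: d_def intro!: always_eventually divide_nonneg_pos add_nonneg_nonneg)
    ultimately show "emeasure lborel {x. t \<le> \<bar>w x\<bar>} \<le> ennreal (C * (D / t) powr p)"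
      using LIMSEQ_le_const by fastforce
  qed
qed

subsection \<open>Cutoff profiles\<close>

text \<open>An exponent of at least 2 removes the kink of the positive part at 0.\<close>

lemma pos_part_power_deriv:
  "((\<lambda>y::real. max 0 y ^ Suc (Suc m)) has_real_derivative (real (Suc (Suc m)) * max 0 y ^ Suc m)) (at y)"
proof -
  consider "y > 0" | "y < 0" | "y = 0" by linarith
  then show ?thesis
  proof cases
    case 1
    have "((\<lambda>y::real. y ^ Suc (Suc m)) has_real_derivative (real (Suc (Suc m)) * max 0 y ^ Suc m)) (at y)"
      using 1 DERIV_pow[of "Suc (Suc m)" y] by (simp add: max_def)
    moreover have "eventually (\<lambda>y. max 0 y ^ Suc (Suc m) = y ^ Suc (Suc m)) (nhds y)"
      using 1 by (intro eventually_nhds[THEN iffD2] exI[of _ "{0<..}"]) auto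
    ultimately show ?thesis by (subst DERIV_cong_ev[OF refl _ refl])
  next
    case 2
    have "((\<lambda>y::real. 0) has_real_derivative (real (Suc (Suc m)) * max 0 y ^ Suc m)) (at y)"
      using 2 by simp
    moreover have "eventually (\<lambda>y::real. max 0 y ^ Suc (Suc m) = 0) (nhds y)"
      using 2 by (intro eventually_nhds[THEN iffD2] exI[of _ "{..<0}"]) auto
    ultimately show ?thesis by (subst DERIV_cong_ev[OF refl _ refl])
  next
    case 3
    have "((\<lambda>h::real. max 0 h ^ Suc (Suc m) / h) \<longlongrightarrow> 0) (at 0)"
    proof (rule Lim_null_comparison)
      show "eventually (\<lambda>h::real. norm (max 0 h ^ Suc (Suc m) / h) \<le> \<bar>h\<bar> ^ Suc m) (at 0)"
      proof (rule always_eventually, rule allI)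
        fix h :: real
        show "norm (max 0 h ^ Suc (Suc m) / h) \<le> \<bar>h\<bar> ^ Suc m"
        proof (cases "h > 0")
          case False
          then have "max 0 h = 0" by simp
          show ?thesis unfolding \<open>max 0 h = 0\<close> by simp
        qed (simp add: max_def)
      qed
      have "((\<lambda>h::real. \<bar>h\<bar> ^ Suc m) \<longlongrightarrow> \<bar>0\<bar> ^ Suc m) (at 0)" by (intro tendsto_intros)
      then show "((\<lambda>h::real. \<bar>h\<bar> ^ Suc m) \<longlongrightarrow> 0) (at 0)" by simp
    qed
    then show ?thesis using 3 by (simp add: DERIV_def)
  qed
qed

text \<open>Descends from 1 for y \<le> 0 to 0 for y \<ge> 1. The cubes make it twice continuously
  differentiable, as the Hessian of the logarithmic cutoff requires.\<close>

definition cut :: "real \<Rightarrow> real" where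
  "cut y = max 0 (1 - max 0 y ^ 3) ^ 3"

definition cut' :: "real \<Rightarrow> real" where
  "cut' y = - 9 * (max 0 y ^ 2 * max 0 (1 - max 0 y ^ 3) ^ 2)"

lemma cut_deriv: "(cut has_real_derivative cut' y) (at y)"
proof -
  have a: "((\<lambda>y::real. max 0 y ^ 3) has_real_derivative (3 * max 0 y ^ 2)) (at y)" for y
    using pos_part_power_deriv[of 1 y] by (simp add: numeral_3_eq_3 numeral_2_eq_2)
  have b: "((\<lambda>y. 1 - max 0 y ^ 3) has_real_derivative (0 - 3 * max 0 y ^ 2)) (at y)"
    by (intro derivative_intros a)
  have "((\<lambda>y. max 0 (1 - max 0 y ^ 3) ^ 3) has_real_derivative
      (3 * max 0 (1 - max 0 y ^ 3) ^ 2 * (0 - 3 * max 0 y ^ 2))) (at y)"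
    using DERIV_chain2[OF a b] .
  then show ?thesis
    unfolding cut_def[abs_def] cut'_def by (rule DERIV_cong) simp
qed

lemma cut'_continuous: "continuous_on UNIV cut'"
  unfolding cut'_def by (intro continuous_intros)

lemma cut_le_0: "y \<le> 0 \<Longrightarrow> cut y = 1" by (simp add: cut_def max_def)

lemma cut_aux: assumes "y \<ge> 1" shows "max 0 (1 - max 0 y ^ 3) = (0::real)"
proof -
  have "1 \<le> max 0 y" using assms by simp
  then have "1 \<le> max 0 y ^ 3" by (rule one_le_power)
  then show ?thesis by linarith
qed

lemma cut_ge_1: "y \<ge> 1 \<Longrightarrow> cut y = 0" by (simp only: cut_def cut_aux) simp

lemma cut_bounds: "0 \<le> cut y" "cut y \<le> 1"
  by (auto simp: cut_def max_def intro!: power_le_one)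

lemma cut'_eq_0: "y \<le> 0 \<or> y \<ge> 1 \<Longrightarrow> cut' y = 0"
  by (elim disjE) (simp add: cut'_def max_def, simp only: cut'_def cut_aux, simp)

lemma cut'_bound: "\<bar>cut' y\<bar> \<le> 9"
proof (cases "y \<le> 0 \<or> y \<ge> 1")
  case False
  then have "max 0 y ^ 2 * max 0 (1 - max 0 y ^ 3) ^ 2 \<le> 1 * 1"
    by (intro mult_mono) (auto simp: max_def intro!: power_le_one)
  then show ?thesis by (simp add: cut'_def abs_mult)
qed (simp add: cut'_eq_0)

text \<open>Even, $C^1$, zero for $|s| \le 1$ and one for $|s| \ge 2$: applied at dyadic levels it upgrades the
  weak Sobolev inequality to the strong one.\<close>

definition trunc :: "real \<Rightarrow> real" where
  "trunc s = cut ((4 - s\<^sup>2) / 3)"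

definition trunc' :: "real \<Rightarrow> real" where
  "trunc' s = cut' ((4 - s\<^sup>2) / 3) * (- 2 * s / 3)"

lemma trunc_deriv: "(trunc has_real_derivative trunc' s) (at s)"
proof -
  have "((\<lambda>s. (4 - s\<^sup>2) / 3) has_real_derivative (- 2 * s / 3)) (at s)"
    by (auto intro!: derivative_eq_intros)
  from DERIV_chain2[OF cut_deriv this] show ?thesis
    unfolding trunc_def[abs_def] trunc'_def .
qed

lemma trunc'_continuous: "continuous_on UNIV trunc'"
  unfolding trunc'_def
  by (intro continuous_intros continuous_on_compose2[OF cut'_continuous]) auto

lemma trunc_small: "\<bar>s\<bar> \<le> 1 \<Longrightarrow> trunc s = 0"
  using abs_square_le_1[of s] by (auto simp: trunc_def intro!: cut_ge_1)

lemma trunc_large: "\<bar>s\<bar> \<ge> 2 \<Longrightarrow> trunc s = 1"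
  using abs_le_square_iff[of 2 s] by (auto simp: trunc_def intro!: cut_le_0)

lemma trunc_abs_le: "\<bar>trunc s\<bar> \<le> \<bar>s\<bar>"
proof (cases "\<bar>s\<bar> \<le> 1")
  case False
  then show ?thesis using cut_bounds[of "(4 - s\<^sup>2) / 3"] by (simp add: trunc_def)
qed (simp add: trunc_small)

lemma trunc'_bound: "\<bar>trunc' s\<bar> \<le> 12 * indicator {s. 1 < \<bar>s\<bar> \<and> \<bar>s\<bar> < 2} s"
proof (cases "1 < \<bar>s\<bar> \<and> \<bar>s\<bar> < 2")
  case True
  \<comment> \<open>The constant 12 is the bound 9 for \<open>cut'\<close> times the bound 4/3 for
    |2s/3| on the shell |s| < 2.\<close>
  have "\<bar>cut' ((4 - s\<^sup>2) / 3)\<bar> * \<bar>- 2 * s / 3\<bar> \<le> 9 * (4 / 3)"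
    using True by (intro mult_mono cut'_bound) (auto simp: abs_mult)
  then show ?thesis using True by (simp add: trunc'_def abs_mult)
next
  case False
  then have "(4 - s\<^sup>2) / 3 \<le> 0 \<or> (4 - s\<^sup>2) / 3 \<ge> 1"
    using abs_le_square_iff[of 2 s] abs_square_le_1[of s] by auto
  then show ?thesis using False cut'_eq_0 by (simp add: trunc'_def)
qed

section \<open>Truncation at dyadic levels and the strong Sobolev inequality\<close>

text \<open>The truncated function is still at least \<open>b\<close> where |w| \<ge> 2b, but its
  energy comes only from the slab where |w| is between b and 2b. The slabs for dyadic levels are
  disjoint, so these energies can be added. The factor 144 is 12 squared.\<close>

lemma truncation:
  fixes w :: "real ^ 'n::finite \<Rightarrow> real"
  assumes w: "C1_grad w G" and van: "vanishing w" and b: "b > 0"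
  shows "C1_grad (\<lambda>x. b * trunc (w x / b)) (\<lambda>x. trunc' (w x / b) *\<^sub>R G x)"
    and "vanishing (\<lambda>x. b * trunc (w x / b))"
    and "energy (\<lambda>x. trunc' (w x / b) *\<^sub>R G x) \<le>
      144 * (\<integral>\<^sup>+x. ennreal ((norm (G x))\<^sup>2) * indicator {x. b < \<bar>w x\<bar> \<and> \<bar>w x\<bar> < 2 * b} x \<partial>lborel)"
    and "{x. 2 * b \<le> \<bar>w x\<bar>} \<subseteq> {x. b \<le> \<bar>b * trunc (w x / b)\<bar>}"
proof -
  have [measurable]: "w \<in> borel_measurable borel" "G \<in> borel_measurable borel"
    using C1_grad_measurable[OF w] by auto
  have "((\<lambda>y. b * trunc (y / b)) has_real_derivative trunc' (y / b)) (at y)" for y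
  proof -
    have "((\<lambda>y. y / b) has_real_derivative (1 / b)) (at y)"
      using DERIV_cdivide[OF DERIV_ident, of b y] by simp
    from DERIV_cmult[OF DERIV_chain2[OF trunc_deriv this], of b] show ?thesis using b by simp
  qed
  moreover have "continuous_on UNIV (\<lambda>y. trunc' (y / b))"
    by (intro continuous_on_compose2[OF trunc'_continuous] continuous_intros) (use b in auto)
  ultimately show c: "C1_grad (\<lambda>x. b * trunc (w x / b)) (\<lambda>x. trunc' (w x / b) *\<^sub>R G x)"
    by (rule C1_grad_compose[OF w])
  show "vanishing (\<lambda>x. b * trunc (w x / b))"
    unfolding vanishing_def
  proof (intro conjI allI impI)
    show "(\<lambda>x. b * trunc (w x / b)) \<in> borel_measurable borel" using C1_grad_measurable[OF c] by simp
    fix \<tau> :: real assume "\<tau> > 0"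
    have "\<bar>b * trunc (w x / b)\<bar> \<le> \<bar>w x\<bar>" for x
      using mult_left_mono[OF trunc_abs_le[of "w x / b"], of b] b by (simp add: abs_mult)
    then have "(\<integral>\<^sup>+x. ennreal (\<bar>b * trunc (w x / b)\<bar> - \<tau>) \<partial>lborel) \<le> (\<integral>\<^sup>+x. ennreal (\<bar>w x\<bar> - \<tau>) \<partial>lborel)"
      by (intro nn_integral_mono ennreal_leI) simp
    also have "\<dots> < \<infinity>" using van \<open>\<tau> > 0\<close> by (auto simp: vanishing_def)
    finally show "(\<integral>\<^sup>+x. ennreal (\<bar>b * trunc (w x / b)\<bar> - \<tau>) \<partial>lborel) < \<infinity>" .
  qed
  have "energy (\<lambda>x. trunc' (w x / b) *\<^sub>R G x) \<le>
      (\<integral>\<^sup>+x. 144 * (ennreal ((norm (G x))\<^sup>2) * indicator {x. b < \<bar>w x\<bar> \<and> \<bar>w x\<bar> < 2 * b} x) \<partial>lborel)"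
    unfolding energy_def
  proof (rule nn_integral_mono)
    fix x
    have "(norm (trunc' (w x / b) *\<^sub>R G x))\<^sup>2 \<le> 144 * (norm (G x))\<^sup>2 * indicator {x. b < \<bar>w x\<bar> \<and> \<bar>w x\<bar> < 2 * b} x"
    proof -
      have "\<bar>trunc' (w x / b)\<bar> \<le> 12 * indicator {x. b < \<bar>w x\<bar> \<and> \<bar>w x\<bar> < 2 * b} x"
        using trunc'_bound[of "w x / b"] b by (simp add: indicator_def abs_divide field_simps)
      then have "\<bar>trunc' (w x / b)\<bar>\<^sup>2 \<le> (12 * indicator {x. b < \<bar>w x\<bar> \<and> \<bar>w x\<bar> < 2 * b} x)\<^sup>2"
        by (rule power_mono) simp
      also have "\<dots> = 144 * indicator {x. b < \<bar>w x\<bar> \<and> \<bar>w x\<bar> < 2 * b} x" by (simp split: split_indicator)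
      finally have "\<bar>trunc' (w x / b)\<bar>\<^sup>2 * (norm (G x))\<^sup>2 \<le>
          144 * indicator {x. b < \<bar>w x\<bar> \<and> \<bar>w x\<bar> < 2 * b} x * (norm (G x))\<^sup>2"
        by (rule mult_right_mono) simp
      then show ?thesis by (simp add: power_mult_distrib mult_ac)
    qed
    from ennreal_leI[OF this]
    show "ennreal ((norm (trunc' (w x / b) *\<^sub>R G x))\<^sup>2) \<le>
      144 * (ennreal ((norm (G x))\<^sup>2) * indicator {x. b < \<bar>w x\<bar> \<and> \<bar>w x\<bar> < 2 * b} x)"
      by (cases "b < \<bar>w x\<bar> \<and> \<bar>w x\<bar> < 2 * b") (simp_all add: ennreal_mult')
  qed
  then show "energy (\<lambda>x. trunc' (w x / b) *\<^sub>R G x) \<le>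
      144 * (\<integral>\<^sup>+x. ennreal ((norm (G x))\<^sup>2) * indicator {x. b < \<bar>w x\<bar> \<and> \<bar>w x\<bar> < 2 * b} x \<partial>lborel)"
    by (simp add: nn_integral_cmult)
  show "{x. 2 * b \<le> \<bar>w x\<bar>} \<subseteq> {x. b \<le> \<bar>b * trunc (w x / b)\<bar>}"
  proof clarify
    fix x assume "2 * b \<le> \<bar>w x\<bar>"
    then have "trunc (w x / b) = 1" using b by (intro trunc_large) (simp add: abs_divide field_simps)
    then show "b \<le> \<bar>b * trunc (w x / b)\<bar>" using b by simp
  qed
qed

text \<open>Truncation method of Maz'ya: the weak inequality is applied to each dyadic truncation,
  and the resulting bounds are summed over the levels against the total energy.\<close>

lemma sobolev:
  assumes n: "CARD('n::finite) \<ge> 3"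
  defines "p \<equiv> 2 * real CARD('n) / (real CARD('n) - 2)"
  shows "\<exists>C\<ge>0. \<forall>(w :: real ^ 'n \<Rightarrow> real) G D. C1_grad w G \<longrightarrow> vanishing w \<longrightarrow> D \<ge> 0 \<longrightarrow>
    energy G \<le> ennreal (D\<^sup>2) \<longrightarrow> (\<integral>\<^sup>+x. ennreal (\<bar>w x\<bar> powr p) \<partial>lborel) \<le> ennreal (C * D powr p)"
proof -
  have p2: "p > 2" unfolding p_def using n by (simp add: field_simps)
  obtain C where C: "C \<ge> 0" and weak: "\<And>(w :: real ^ 'n \<Rightarrow> real) G D t. C1_grad w G \<Longrightarrow> vanishing w \<Longrightarrow> D \<ge> 0 \<Longrightarrow>
    energy G \<le> ennreal (D\<^sup>2) \<Longrightarrow> t > 0 \<Longrightarrow> emeasure lborel {x. t \<le> \<bar>w x\<bar>} \<le> ennreal (C * (D / t) powr p)"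
    using weak_sobolev[OF n] unfolding p_def by metis
  show ?thesis
  \<comment> \<open>4 arises because |w| is at most 4 times its dyadic level, 12 because truncation
    multiplies gradients by at most 12.\<close>
  proof (intro exI[of _ "C * 4 powr p * 12 powr p"] conjI allI impI)
    show "0 \<le> C * 4 powr p * 12 powr p" using C by simp
    fix w :: "real ^ 'n \<Rightarrow> real" and G D
    assume w: "C1_grad w G" "vanishing w" and D: "D \<ge> 0" "energy G \<le> ennreal (D\<^sup>2)"
    have [measurable]: "w \<in> borel_measurable borel" "G \<in> borel_measurable borel"
      using C1_grad_measurable[OF w(1)] by auto
    \<comment> \<open>All integer powers of 2 are needed; \<open>int_decode\<close> enumerates them
      by naturals so that countable sums can be used.\<close>
    define b :: "nat \<Rightarrow> real" where "b = (\<lambda>i. 2 powr real_of_int (int_decode i))"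
    have b: "b i > 0" for i by (simp add: b_def)
    define A where "A = (\<lambda>i. {x. b i < \<bar>w x\<bar> \<and> \<bar>w x\<bar> < 2 * b i})"
    have [measurable]: "A i \<in> sets borel" for i unfolding A_def by measurable
    define e where "e = (\<lambda>i. \<integral>\<^sup>+x. ennreal ((norm (G x))\<^sup>2) * indicator (A i) x \<partial>lborel)"
    have disj: "disjoint_family A"
    proof (unfold disjoint_family_on_def, intro ballI impI)
      fix i j :: nat assume "i \<noteq> j"
      have "A i \<inter> A j = {}" if ij: "int_decode i < int_decode j" for i j
      proof -
        have "2 * b i = 2 powr (real_of_int (int_decode i) + 1)" by (simp add: b_def powr_add)
        also have "\<dots> \<le> b j" unfolding b_def using ij by (intro powr_mono) auto
        finally show ?thesis by (auto simp: A_def)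
      qed
      moreover have "int_decode i \<noteq> int_decode j" using \<open>i \<noteq> j\<close> by (simp add: int_decode_eq)
      ultimately show "A i \<inter> A j = {}" by (metis Int_commute linorder_neqE)
    qed
    have esum: "(\<Sum>i. e i) \<le> energy G"
    proof -
      have "(\<Sum>i. e i) = (\<integral>\<^sup>+x. (\<Sum>i. ennreal ((norm (G x))\<^sup>2) * indicator (A i) x) \<partial>lborel)"
        unfolding e_def by (rule nn_integral_suminf[symmetric]) measurable
      also have "\<dots> = (\<integral>\<^sup>+x. ennreal ((norm (G x))\<^sup>2) * indicator (\<Union>i. A i) x \<partial>lborel)"
        by (intro nn_integral_cong) (simp add: suminf_indicator[OF disj])
      also have "\<dots> \<le> energy G"
        unfolding energy_def by (intro nn_integral_mono) (simp split: split_indicator)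
      finally show ?thesis .
    qed
    have eE: "e i \<le> ennreal (D\<^sup>2)" for i
    proof -
      have "e i \<le> energy G"
        unfolding energy_def e_def by (intro nn_integral_mono) (simp split: split_indicator)
      then show ?thesis using D(2) by (rule order_trans)
    qed
    define d where "d = (\<lambda>i. enn2real (e i))"
    have d: "e i = ennreal (d i)" "d i \<ge> 0" "d i \<le> D\<^sup>2" for i
    proof -
      have "e i < \<infinity>" using eE[of i] by (simp add: le_less_trans)
      then show "e i = ennreal (d i)" by (simp add: d_def)
      show "d i \<ge> 0" by (simp add: d_def)
      show "d i \<le> D\<^sup>2" unfolding d_def using eE[of i] by (intro enn2real_leI) auto
    qed
    have level: "ennreal ((4 * b i) powr p) * emeasure lborel {x. 2 * b i \<le> \<bar>w x\<bar>} \<le>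
        ennreal (C * 4 powr p * 12 powr p * D powr (p - 2)) * e i" for i
    proof -
      note T = truncation[OF w b[of i]]
      have "energy (\<lambda>x. trunc' (w x / b i) *\<^sub>R G x) \<le> 144 * e i"
        using T(3) by (simp add: e_def A_def)
      also have "\<dots> = ennreal ((12 * sqrt (d i))\<^sup>2)"
        using d(2)[of i] by (simp add: d(1) power_mult_distrib ennreal_mult')
      finally have en: "energy (\<lambda>x. trunc' (w x / b i) *\<^sub>R G x) \<le> ennreal ((12 * sqrt (d i))\<^sup>2)" .
      have "f \<in> borel_measurable borel \<Longrightarrow> {x. b i \<le> \<bar>f x\<bar>} \<in> sets borel" for f :: "real ^ 'n \<Rightarrow> real"
        by measurable
      from this[OF C1_grad_measurable(1)[OF T(1)]]
      have "emeasure lborel {x. 2 * b i \<le> \<bar>w x\<bar>} \<le> emeasure lborel {x. b i \<le> \<bar>b i * trunc (w x / b i)\<bar>}"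
        by (intro emeasure_mono T(4)) simp
      also have "\<dots> \<le> ennreal (C * ((12 * sqrt (d i)) / b i) powr p)"
        by (rule weak[OF T(1,2) _ en b]) (simp add: d(2))
      finally have "ennreal ((4 * b i) powr p) * emeasure lborel {x. 2 * b i \<le> \<bar>w x\<bar>} \<le>
          ennreal ((4 * b i) powr p) * ennreal (C * ((12 * sqrt (d i)) / b i) powr p)"
        by (rule mult_left_mono) simp
      also have "\<dots> = ennreal (C * 4 powr p * 12 powr p * (sqrt (d i)) powr p)"
        using b[of i] C d(2)[of i]
        by (simp add: ennreal_mult[symmetric] powr_mult powr_divide mult_ac)
      also have "\<dots> \<le> ennreal (C * 4 powr p * 12 powr p * (D powr (p - 2) * d i))"
      proof (intro ennreal_leI mult_left_mono)
        \<comment> \<open>The power p/2 of the slab energy must become linear for the sum over slabs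
          to be controlled; as p > 2, the surplus power is bounded by the total energy.\<close>
        show "(sqrt (d i)) powr p \<le> D powr (p - 2) * d i"
        proof (cases "d i = 0")
          case False
          then have di: "d i > 0" using d(2)[of i] by simp
          have "(sqrt (d i)) powr p = (sqrt (d i)) powr (p - 2) * (sqrt (d i)) powr 2"
            by (simp add: powr_add[symmetric])
          also have "(sqrt (d i)) powr 2 = d i" using di by (simp add: powr_numeral)
          also have "(sqrt (d i)) powr (p - 2) \<le> D powr (p - 2)"
            using p2 d(3)[of i] D(1) by (intro powr_mono2) (auto intro: real_le_lsqrt d(2))
          finally show ?thesis using di by simp
        qed simp
      qed (use C in auto)
      also have "\<dots> = ennreal (C * 4 powr p * 12 powr p * D powr (p - 2)) * e i"
        using C d(2)[of i] by (simp add: d(1) ennreal_mult[symmetric] mult.assoc)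
      finally show ?thesis .
    qed
    have "(\<integral>\<^sup>+x. ennreal (\<bar>w x\<bar> powr p) \<partial>lborel) \<le>
      (\<integral>\<^sup>+x. (\<Sum>i. ennreal ((4 * b i) powr p) * indicator {x. 2 * b i \<le> \<bar>w x\<bar>} x) \<partial>lborel)"
    proof (rule nn_integral_mono)
      fix x
      show "ennreal (\<bar>w x\<bar> powr p) \<le> (\<Sum>i. ennreal ((4 * b i) powr p) * indicator {x. 2 * b i \<le> \<bar>w x\<bar>} x)"
      proof (cases "w x = 0")
        case False
        \<comment> \<open>One below the integer part of the logarithm, so that 2 ^ j satisfies both
          2 * 2 ^ j \<le> |w x| and |w x| \<le> 4 * 2 ^ j.\<close>
        define j where "j = \<lfloor>log 2 \<bar>w x\<bar>\<rfloor> - 1"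
        have bj: "b (int_encode j) = 2 powr real_of_int j" by (simp add: b_def)
        have "2 * b (int_encode j) = 2 powr (real_of_int j + 1)" unfolding bj by (simp add: powr_add)
        also have "\<dots> \<le> 2 powr (log 2 \<bar>w x\<bar>)" unfolding j_def by (intro powr_mono) auto
        also have "\<dots> = \<bar>w x\<bar>" using False by simp
        finally have lo: "2 * b (int_encode j) \<le> \<bar>w x\<bar>" .
        have "\<bar>w x\<bar> = 2 powr (log 2 \<bar>w x\<bar>)" using False by simp
        also have "\<dots> \<le> 2 powr (real_of_int j + 2)" unfolding j_def by (intro powr_mono) (auto, linarith)
        also have "\<dots> = 4 * b (int_encode j)" unfolding bj by (simp add: powr_add)
        finally have hi: "\<bar>w x\<bar> \<le> 4 * b (int_encode j)" .
        have "ennreal (\<bar>w x\<bar> powr p) \<le> ennreal ((4 * b (int_encode j)) powr p) * indicator {x. 2 * b (int_encode j) \<le> \<bar>w x\<bar>} x"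
          using lo hi p2 by (auto intro!: ennreal_leI powr_mono2)
        also have "F (int_encode j) \<le> (\<Sum>i. F i)" for F :: "nat \<Rightarrow> ennreal"
          using sum_le_suminf[of F "{int_encode j}"] by simp
        finally show ?thesis .
      qed simp
    qed
    also have "\<dots> = (\<Sum>i. \<integral>\<^sup>+x. ennreal ((4 * b i) powr p) * indicator {x. 2 * b i \<le> \<bar>w x\<bar>} x \<partial>lborel)"
      by (rule nn_integral_suminf) measurable
    also have "\<dots> = (\<Sum>i. ennreal ((4 * b i) powr p) * emeasure lborel {x. 2 * b i \<le> \<bar>w x\<bar>})"
      by (simp add: nn_integral_cmult)
    also have "\<dots> \<le> (\<Sum>i. ennreal (C * 4 powr p * 12 powr p * D powr (p - 2)) * e i)"
      by (intro suminf_le level) auto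
    also have "\<dots> = ennreal (C * 4 powr p * 12 powr p * D powr (p - 2)) * (\<Sum>i. e i)"
      by (rule ennreal_suminf_cmult)
    also have "\<dots> \<le> ennreal (C * 4 powr p * 12 powr p * D powr (p - 2)) * ennreal (D\<^sup>2)"
      by (intro mult_left_mono order_trans[OF esum D(2)]) auto
    also have "\<dots> = ennreal (C * 4 powr p * 12 powr p * D powr p)"
    proof -
      have "D powr (p - 2) * D\<^sup>2 = D powr p"
      proof (cases "D = 0")
        case False
        then have "D\<^sup>2 = D powr 2" using D(1) by (simp add: powr_numeral)
        then show ?thesis by (simp add: powr_add[symmetric])
      qed simp
      then show ?thesis using C by (simp add: ennreal_mult[symmetric] mult.assoc)
    qed
    finally show "(\<integral>\<^sup>+x. ennreal (\<bar>w x\<bar> powr p) \<partial>lborel) \<le> ennreal (C * 4 powr p * 12 powr p * D powr p)" .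
  qed
qed

subsection \<open>The space $D^1_0$\<close>

definition L2field :: "(real ^ 'n::finite \<Rightarrow> real ^ 'n) \<Rightarrow> bool" where
  "L2field F \<longleftrightarrow> F \<in> borel_measurable borel \<and> integrable lborel (\<lambda>x. (norm (F x))\<^sup>2)"

lemma norm_powr_2: "norm x powr 2 = (norm x)\<^sup>2"
  by (cases "x = 0") (simp_all add: powr_numeral)

lemma Lp_2_iff: "F \<in> Lp 2 \<longleftrightarrow> L2field F"
  by (simp add: Lp_def L2field_def norm_powr_2)

lemma L2field_energy:
  assumes "F \<in> borel_measurable borel"
  shows "L2field F \<longleftrightarrow> energy F < \<infinity>"
  using assms by (auto simp: L2field_def energy_def integrable_iff_bounded)

lemma energy_eq_integral: "L2field F \<Longrightarrow> energy F = ennreal (\<integral>x. (norm (F x))\<^sup>2 \<partial>lborel)"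
  by (auto simp: L2field_def energy_def intro!: nn_integral_eq_integral)

lemma L2field_add:
  fixes F G :: "real ^ 'n::finite \<Rightarrow> real ^ 'n"
  assumes "L2field F" "L2field G" shows "L2field (\<lambda>x. F x + G x)"
proof -
  have m[measurable]: "F \<in> borel_measurable borel" "G \<in> borel_measurable borel"
    using assms by (auto simp: L2field_def)
  have le: "(norm (a + b))\<^sup>2 \<le> 2 * (norm a)\<^sup>2 + 2 * (norm b)\<^sup>2" for a b :: "real ^ 'n"
    using zero_le_power2[of "norm (a - b)"] by (simp add: power2_norm_eq_inner inner_simps inner_commute)
  have i: "integrable lborel (\<lambda>x. 2 * (norm (F x))\<^sup>2 + 2 * (norm (G x))\<^sup>2)"
    using assms by (auto simp: L2field_def)
  have "integrable lborel (\<lambda>x. (norm (F x + G x))\<^sup>2)"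
    by (rule Bochner_Integration.integrable_bound[OF i]) (measurable, intro AE_I2, use le in simp)
  then show ?thesis by (simp add: L2field_def)
qed

lemma L2field_scaleR:
  assumes "L2field F" shows "L2field (\<lambda>x. c *\<^sub>R F x)"
  using assms by (auto simp: L2field_def power_mult_distrib)

lemma L2field_diff:
  assumes "L2field F" "L2field G" shows "L2field (\<lambda>x. F x - G x)"
  using L2field_add[OF assms(1) L2field_scaleR[OF assms(2), of "-1"]] by simp

lemma L2field_inner_integrable:
  assumes "L2field F" "L2field G" shows "integrable lborel (\<lambda>x. F x \<bullet> G x)"
proof (rule Bochner_Integration.integrable_bound)
  show "integrable lborel (\<lambda>x. (norm (F x))\<^sup>2 + (norm (G x))\<^sup>2)" using assms by (auto simp: L2field_def)
  have [measurable]: "F \<in> borel_measurable borel" "G \<in> borel_measurable borel"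
    using assms by (auto simp: L2field_def)
  show "(\<lambda>x. F x \<bullet> G x) \<in> borel_measurable lborel" by measurable
  show "AE x in lborel. norm (F x \<bullet> G x) \<le> norm ((norm (F x))\<^sup>2 + (norm (G x))\<^sup>2)"
  proof (rule AE_I2)
    fix x
    have "\<bar>F x \<bullet> G x\<bar> \<le> norm (F x) * norm (G x)" by (rule Cauchy_Schwarz_ineq2)
    also have "\<dots> \<le> (norm (F x))\<^sup>2 + (norm (G x))\<^sup>2"
      using sum_squares_bound[of "norm (F x)" "norm (G x)"]
        mult_nonneg_nonneg[OF norm_ge_zero[of "F x"] norm_ge_zero[of "G x"]] by linarith
    finally show "norm (F x \<bullet> G x) \<le> norm ((norm (F x))\<^sup>2 + (norm (G x))\<^sup>2)" by simp
  qed
qed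

lemma L2field_locally_integrable: "L2field F \<Longrightarrow> locally_integrable F"
  by (auto simp: L2field_def intro: locally_integrable_L2)

section \<open>Weak gradients and the inner product on D^1_0\<close>

lemma has_weak_gradient_unique:
  fixes f :: "real ^ 'n::finite \<Rightarrow> real"
  assumes F: "has_weak_gradient f F" and G: "has_weak_gradient f G"
  shows "AE x in lborel. F x = G x"
proof -
  have "AE x in lborel. F x $ i - G x $ i = 0" for i
  proof (rule fundamental_lemma)
    have li: "locally_integrable (\<lambda>x. F x $ i)" "locally_integrable (\<lambda>x. G x $ i)"
      using F G by (auto simp: has_weak_gradient_def intro: locally_integrable_nth)
    show "locally_integrable (\<lambda>x. F x $ i - G x $ i)"
      using locally_integrable_add[OF li(1) locally_integrable_scaleR[OF li(2), of "-1"]] by simp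
    fix \<phi> :: "real ^ 'n \<Rightarrow> real" assume \<phi>: "test_function \<phi>"
    obtain R where R: "\<And>x. \<phi> x \<noteq> 0 \<Longrightarrow> norm x \<le> R" using test_functionE[OF \<phi>] by metis
    note c = C1_grad_continuous[OF test_function_C1_grad[OF \<phi>]]
    have "integrable lborel (\<lambda>x. F x $ i * \<phi> x)" "integrable lborel (\<lambda>x. G x $ i * \<phi> x)"
      using integrable_locally_integrable_continuous[OF li(1) c R] integrable_locally_integrable_continuous[OF li(2) c R] by simp_all
    moreover have "(\<integral>x. F x $ i * \<phi> x \<partial>lborel) = (\<integral>x. G x $ i * \<phi> x \<partial>lborel)"
    proof -
      have "(\<integral>x. f x * partial_deriv i \<phi> x \<partial>lborel) = - (\<integral>x. F x $ i * \<phi> x \<partial>lborel)"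
        "(\<integral>x. f x * partial_deriv i \<phi> x \<partial>lborel) = - (\<integral>x. G x $ i * \<phi> x \<partial>lborel)"
        using F G \<phi> by (auto simp: has_weak_gradient_def)
      then show ?thesis by linarith
    qed
    ultimately show "(\<integral>x. (F x $ i - G x $ i) * \<phi> x \<partial>lborel) = 0"
      by (simp add: left_diff_distrib)
  qed
  then have "AE x in lborel. \<forall>i. F x $ i - G x $ i = 0"
    using AE_finite_allI[where M=lborel and S=UNIV and Q="\<lambda>i x. F x $ i - G x $ i = 0"] by simp
  then show ?thesis by eventually_elim (simp add: vec_eq_iff)
qed

lemma has_weak_gradient_add:
  fixes f g :: "real ^ 'n::finite \<Rightarrow> real"
  assumes F: "has_weak_gradient f F" and G: "has_weak_gradient g G"
  shows "has_weak_gradient (\<lambda>x. f x + g x) (\<lambda>x. F x + G x)"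
  unfolding has_weak_gradient_def
proof (intro conjI allI impI)
  show "locally_integrable (\<lambda>x. f x + g x)" "locally_integrable (\<lambda>x. F x + G x)"
    using F G by (auto simp: has_weak_gradient_def intro: locally_integrable_add)
  fix \<phi> :: "real ^ 'n \<Rightarrow> real" and i assume \<phi>: "test_function \<phi>"
  have int: "integrable lborel (\<lambda>x. h x * \<psi> x)" if h: "locally_integrable h" and psi: "test_function \<psi>" for h \<psi> :: "real ^ 'n \<Rightarrow> real"
  proof -
    obtain R where R: "\<And>x. \<psi> x \<noteq> 0 \<Longrightarrow> norm x \<le> R" using test_functionE[OF psi] by metis
    show ?thesis
      using integrable_locally_integrable_continuous[OF h C1_grad_continuous[OF test_function_C1_grad[OF psi]] R] by simp
  qed
  have "locally_integrable f" "locally_integrable g" "locally_integrable (\<lambda>x. F x $ i)" "locally_integrable (\<lambda>x. G x $ i)"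
    using F G by (auto simp: has_weak_gradient_def intro: locally_integrable_nth)
  note li = this[THEN int]
  note dphi = test_function_partial_deriv[OF \<phi>, of i]
  have "(\<integral>x. (f x + g x) * partial_deriv i \<phi> x \<partial>lborel) = (\<integral>x. f x * partial_deriv i \<phi> x \<partial>lborel) + (\<integral>x. g x * partial_deriv i \<phi> x \<partial>lborel)"
    using li(1,2)[OF dphi] by (simp add: distrib_right)
  also have "\<dots> = - (\<integral>x. F x $ i * \<phi> x \<partial>lborel) + - (\<integral>x. G x $ i * \<phi> x \<partial>lborel)"
    using F G \<phi> by (simp add: has_weak_gradient_def)
  also have "\<dots> = - (\<integral>x. (F x + G x) $ i * \<phi> x \<partial>lborel)"
    using li(3,4)[OF \<phi>] by (simp add: distrib_right)
  finally show "(\<integral>x. (f x + g x) * partial_deriv i \<phi> x \<partial>lborel) = - (\<integral>x. (F x + G x) $ i * \<phi> x \<partial>lborel)" .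
qed

lemma has_weak_gradient_cmult:
  assumes F: "has_weak_gradient f F"
  shows "has_weak_gradient (\<lambda>x. c * f x) (\<lambda>x. c *\<^sub>R F x)"
  using F locally_integrable_scaleR[of f c] locally_integrable_scaleR[of F c]
  by (auto simp: has_weak_gradient_def mult.assoc)

lemma has_weak_gradient_C1:
  fixes w :: "real ^ 'n::finite \<Rightarrow> real"
  assumes w: "C1_grad w G" shows "has_weak_gradient w G"
  unfolding has_weak_gradient_def
proof (intro conjI allI impI)
  show "locally_integrable w" "locally_integrable G"
    using C1_grad_continuous[OF w] C1_grad_continuous_grad[OF w] by (auto intro: locally_integrable_continuous)
  fix \<phi> :: "real ^ 'n \<Rightarrow> real" and i assume \<phi>: "test_function \<phi>"
  obtain R where R: "\<And>x. \<phi> x \<noteq> 0 \<Longrightarrow> norm x \<le> R" using test_functionE[OF \<phi>] by metis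
  note c = test_function_C1_grad[OF \<phi>]
  have RG: "norm x \<le> R" if "gradient \<phi> x \<noteq> 0" for x
    using C1_grad_support[OF c R, of x] that by force
  have i1: "integrable lborel (\<lambda>x. w x *\<^sub>R gradient \<phi> x)"
    by (intro integrable_locally_integrable_continuous[OF _ C1_grad_continuous_grad[OF c] RG] locally_integrable_continuous C1_grad_continuous[OF w])
  have i2: "integrable lborel (\<lambda>x. \<phi> x *\<^sub>R G x)"
    by (rule continuous_compact_support_integrable[where R=R])
      (use R in \<open>auto intro!: continuous_intros C1_grad_continuous_grad[OF w] C1_grad_continuous[OF c]\<close>)
  have "(\<integral>x. w x *\<^sub>R gradient \<phi> x \<partial>lborel) $ i = (- (\<integral>x. \<phi> x *\<^sub>R G x \<partial>lborel)) $ i"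
    by (simp add: C1_grad_integration_by_parts[OF w c R])
  then show "(\<integral>x. w x * partial_deriv i \<phi> x \<partial>lborel) = - (\<integral>x. G x $ i * \<phi> x \<partial>lborel)"
    using integrable_vec_nth(2)[OF i1, of i] integrable_vec_nth(2)[OF i2, of i]
    by (simp add: gradient_def mult.commute)
qed

lemma D10I:
  fixes f :: "real ^ 'n::finite \<Rightarrow> real"
  assumes F: "has_weak_gradient f F" "L2field F"
    and p: "CARD('n) \<ge> 3 \<Longrightarrow> (\<integral>\<^sup>+x. ennreal (\<bar>f x\<bar> powr (2 * real CARD('n) / (real CARD('n) - 2))) \<partial>lborel) < \<infinity>"
  shows "f \<in> D10"
proof -
  have [measurable]: "f \<in> borel_measurable borel"
    using F(1) by (auto simp: has_weak_gradient_def intro: locally_integrable_measurable)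
  have "f \<in> D1" using F Lp_2_iff unfolding D1_def by (auto simp: has_weak_gradient_def)
  moreover have "f \<in> Lp (2 * real CARD('n) / (real CARD('n) - 2))" if "CARD('n) \<ge> 3"
    using p[OF that] by (simp add: Lp_def integrable_iff_bounded)
  ultimately show ?thesis by (simp add: D10_def)
qed

text \<open>\<open>weak_gradient\<close> is chosen among all weak gradients, whereas
  \<open>D1\<close> only asserts that some weak gradient is square integrable; uniqueness almost
  everywhere carries the integrability over.\<close>

lemma D10D:
  fixes f :: "real ^ 'n::finite \<Rightarrow> real"
  assumes "f \<in> D10"
  shows "has_weak_gradient f (weak_gradient f)" "L2field (weak_gradient f)" "locally_integrable f"
    "CARD('n) \<ge> 3 \<Longrightarrow> (\<integral>\<^sup>+x. ennreal (\<bar>f x\<bar> powr (2 * real CARD('n) / (real CARD('n) - 2))) \<partial>lborel) < \<infinity>"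
proof -
  have "f \<in> D1" using assms by (auto simp: D10_def split: if_splits)
  then obtain F where F: "L2field F" "has_weak_gradient f F" and li: "locally_integrable f"
    unfolding D1_def using Lp_2_iff by blast
  show h: "has_weak_gradient f (weak_gradient f)"
    unfolding weak_gradient_def using someI[of "has_weak_gradient f", OF F(2)] .
  have "AE x in lborel. weak_gradient f x = F x" by (rule has_weak_gradient_unique[OF h F(2)])
  moreover have m[measurable]: "weak_gradient f \<in> borel_measurable borel" "F \<in> borel_measurable borel"
    using h F(2) by (auto simp: has_weak_gradient_def intro: locally_integrable_measurable)
  ultimately have "integrable lborel (\<lambda>x. (norm (weak_gradient f x))\<^sup>2) \<longleftrightarrow> integrable lborel (\<lambda>x. (norm (F x))\<^sup>2)"
    by (intro integrable_cong_AE) auto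
  then show "L2field (weak_gradient f)" using F(1) m by (simp add: L2field_def)
  show "locally_integrable f" by (rule li)
  show "(\<integral>\<^sup>+x. ennreal (\<bar>f x\<bar> powr (2 * real CARD('n) / (real CARD('n) - 2))) \<partial>lborel) < \<infinity>" if "CARD('n) \<ge> 3"
    using assms that by (auto simp: D10_def Lp_def integrable_iff_bounded)
qed

lemma powr_add_le:
  fixes a b p :: real
  assumes "a \<ge> 0" "b \<ge> 0" "p \<ge> 0"
  shows "(a + b) powr p \<le> 2 powr p * (a powr p + b powr p)"
proof -
  have "(a + b) powr p \<le> (2 * max a b) powr p" using assms by (intro powr_mono2) auto
  also have "\<dots> = 2 powr p * max a b powr p" using assms by (simp add: powr_mult)
  also have "\<dots> \<le> 2 powr p * (a powr p + b powr p)" by (intro mult_left_mono) (auto simp: max_def)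
  finally show ?thesis .
qed

lemma D10_add:
  fixes f g :: "real ^ 'n::finite \<Rightarrow> real"
  assumes f: "f \<in> D10" and g: "g \<in> D10" shows "(\<lambda>x. f x + g x) \<in> D10"
proof (rule D10I[OF has_weak_gradient_add[OF D10D(1)[OF f] D10D(1)[OF g]] L2field_add[OF D10D(2)[OF f] D10D(2)[OF g]]])
  assume n: "CARD('n) \<ge> 3"
  let ?p = "2 * real CARD('n) / (real CARD('n) - 2)"
  have p: "?p \<ge> 0" using n by simp
  have [measurable]: "f \<in> borel_measurable borel" "g \<in> borel_measurable borel"
    using D10D(3) f g locally_integrable_measurable by auto
  have "(\<integral>\<^sup>+x. ennreal (\<bar>f x + g x\<bar> powr ?p) \<partial>lborel) \<le>
     (\<integral>\<^sup>+x. ennreal (2 powr ?p) * (ennreal (\<bar>f x\<bar> powr ?p) + ennreal (\<bar>g x\<bar> powr ?p)) \<partial>lborel)"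
  proof (rule nn_integral_mono)
    fix x
    have "\<bar>f x + g x\<bar> powr ?p \<le> (\<bar>f x\<bar> + \<bar>g x\<bar>) powr ?p" by (intro powr_mono2 p) auto
    also have "\<dots> \<le> 2 powr ?p * (\<bar>f x\<bar> powr ?p + \<bar>g x\<bar> powr ?p)" by (intro powr_add_le p) auto
    finally show "ennreal (\<bar>f x + g x\<bar> powr ?p) \<le> ennreal (2 powr ?p) * (ennreal (\<bar>f x\<bar> powr ?p) + ennreal (\<bar>g x\<bar> powr ?p))"
      by (simp add: ennreal_mult[symmetric] ennreal_plus[symmetric] ennreal_leI del: ennreal_plus)
  qed
  also have "\<dots> < \<infinity>"
    using D10D(4)[OF f n] D10D(4)[OF g n] by (simp add: nn_integral_cmult nn_integral_add ennreal_mult_less_top)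
  finally show "(\<integral>\<^sup>+x. ennreal (\<bar>f x + g x\<bar> powr ?p) \<partial>lborel) < \<infinity>" .
qed

lemma D10_cmult:
  fixes f :: "real ^ 'n::finite \<Rightarrow> real"
  assumes f: "f \<in> D10" shows "(\<lambda>x. c * f x) \<in> D10"
proof (rule D10I[OF has_weak_gradient_cmult[OF D10D(1)[OF f]] L2field_scaleR[OF D10D(2)[OF f]]])
  assume n: "CARD('n) \<ge> 3"
  have [measurable]: "f \<in> borel_measurable borel" using D10D(3) f locally_integrable_measurable by auto
  show "(\<integral>\<^sup>+x. ennreal (\<bar>c * f x\<bar> powr (2 * real CARD('n) / (real CARD('n) - 2))) \<partial>lborel) < \<infinity>"
    using D10D(4)[OF f n] by (simp add: abs_mult powr_mult ennreal_mult nn_integral_cmult ennreal_mult_less_top)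
qed

lemma D10_diff: "f \<in> D10 \<Longrightarrow> g \<in> D10 \<Longrightarrow> (\<lambda>x. f x - g x) \<in> D10"
  using D10_add[of f "\<lambda>x. (-1) * g x"] D10_cmult[of g "-1"] by simp

text \<open>Lets every later computation use whichever weak gradient is at hand instead of the
  chosen one.\<close>

lemma D10_inner_eq:
  fixes f g :: "real ^ 'n::finite \<Rightarrow> real"
  assumes f: "f \<in> D10" and g: "g \<in> D10" and F: "has_weak_gradient f F" and G: "has_weak_gradient g G"
  shows "D10_inner f g = (\<integral>x. F x \<bullet> G x \<partial>lborel)"
proof -
  have [measurable]: "weak_gradient f \<in> borel_measurable borel" "weak_gradient g \<in> borel_measurable borel"
      "F \<in> borel_measurable borel" "G \<in> borel_measurable borel"
    using D10D(1)[OF f] D10D(1)[OF g] F G by (auto simp: has_weak_gradient_def intro: locally_integrable_measurable)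
  show ?thesis unfolding D10_inner_def
  proof (rule integral_cong_AE)
    show "AE x in lborel. weak_gradient f x \<bullet> weak_gradient g x = F x \<bullet> G x"
      using has_weak_gradient_unique[OF D10D(1)[OF f] F] has_weak_gradient_unique[OF D10D(1)[OF g] G]
      by eventually_elim simp
  qed measurable
qed

lemma D10_inner_commute: "D10_inner f g = D10_inner g f"
  by (simp add: D10_inner_def inner_commute)

lemma D10_inner_add:
  fixes f g h :: "real ^ 'n::finite \<Rightarrow> real"
  assumes f: "f \<in> D10" and g: "g \<in> D10" and h: "h \<in> D10"
  shows "D10_inner (\<lambda>x. f x + g x) h = D10_inner f h + D10_inner g h"
  using D10_inner_eq[OF D10_add[OF f g] h has_weak_gradient_add[OF D10D(1)[OF f] D10D(1)[OF g]] D10D(1)[OF h]]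
    L2field_inner_integrable[OF D10D(2)[OF f] D10D(2)[OF h]] L2field_inner_integrable[OF D10D(2)[OF g] D10D(2)[OF h]]
  by (simp add: D10_inner_def inner_add_left)

lemma D10_inner_cmult:
  fixes f h :: "real ^ 'n::finite \<Rightarrow> real"
  assumes f: "f \<in> D10" and h: "h \<in> D10"
  shows "D10_inner (\<lambda>x. c * f x) h = c * D10_inner f h"
  using D10_inner_eq[OF D10_cmult[OF f] h has_weak_gradient_cmult[OF D10D(1)[OF f]] D10D(1)[OF h], of c]
  by (simp add: D10_inner_def)

lemma D10_inner_diff:
  fixes f g h :: "real ^ 'n::finite \<Rightarrow> real"
  assumes f: "f \<in> D10" and g: "g \<in> D10" and h: "h \<in> D10"
  shows "D10_inner (\<lambda>x. f x - g x) h = D10_inner f h - D10_inner g h"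
  using D10_inner_add[OF f D10_cmult[OF g, of "-1"] h] D10_inner_cmult[OF g h, of "-1"] by simp

lemma D10_inner_self: "D10_inner f f = (\<integral>x. (norm (weak_gradient f x))\<^sup>2 \<partial>lborel)"
  by (simp add: D10_inner_def power2_norm_eq_inner)

lemma D10_inner_self_nonneg: "D10_inner f f \<ge> 0"
  by (simp add: D10_inner_self)

lemma D10_norm_nonneg: "D10_norm f \<ge> 0"
  by (simp add: D10_norm_def D10_inner_self_nonneg)

lemma D10_norm_sq: "(D10_norm f)\<^sup>2 = D10_inner f f"
  by (simp add: D10_norm_def D10_inner_self_nonneg)

lemma D10_norm_energy:
  assumes "f \<in> D10" "has_weak_gradient f F"
  shows "energy F = ennreal ((D10_norm f)\<^sup>2)"
proof -
  have [measurable]: "weak_gradient f \<in> borel_measurable borel" "F \<in> borel_measurable borel"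
    using D10D(1)[OF assms(1)] assms(2) by (auto simp: has_weak_gradient_def intro: locally_integrable_measurable)
  have "energy F = energy (weak_gradient f)"
    unfolding energy_def
  proof (rule nn_integral_cong_AE)
    show "AE x in lborel. ennreal ((norm (F x))\<^sup>2) = ennreal ((norm (weak_gradient f x))\<^sup>2)"
      using has_weak_gradient_unique[OF assms(2) D10D(1)[OF assms(1)]] by eventually_elim simp
  qed
  also have "\<dots> = ennreal ((D10_norm f)\<^sup>2)"
    unfolding D10_norm_sq D10_inner_self by (rule energy_eq_integral[OF D10D(2)[OF assms(1)]])
  finally show ?thesis .
qed

lemma D10_norm_sq_add:
  assumes f: "f \<in> D10" and g: "g \<in> D10"
  shows "(D10_norm (\<lambda>x. f x + c * g x))\<^sup>2 = (D10_norm f)\<^sup>2 + 2 * c * D10_inner f g + c\<^sup>2 * (D10_norm g)\<^sup>2"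
proof -
  note cg = D10_cmult[OF g, of c] and fcg = D10_add[OF f D10_cmult[OF g, of c]]
  show ?thesis
    unfolding D10_norm_sq
    using D10_inner_add[OF f cg fcg] D10_inner_cmult[OF g fcg, of c]
      D10_inner_add[OF f cg f] D10_inner_cmult[OF g f, of c]
      D10_inner_add[OF f cg g] D10_inner_cmult[OF g g, of c]
    by (simp add: D10_inner_commute[of f "\<lambda>x. f x + c * g x"] D10_inner_commute[of g "\<lambda>x. f x + c * g x"]
        D10_inner_commute[of g f] power2_eq_square algebra_simps)
qed

text \<open>The discriminant argument. On representatives the form is only semidefinite, so the case
  \<open>D10_norm g = 0\<close> is treated on its own.\<close>

lemma D10_cauchy_schwarz:
  assumes f: "f \<in> D10" and g: "g \<in> D10"
  shows "\<bar>D10_inner f g\<bar> \<le> D10_norm f * D10_norm g"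
proof -
  define a b c where "a = (D10_norm f)\<^sup>2" and "b = D10_inner f g" and "c = (D10_norm g)\<^sup>2"
  have q: "a + 2 * t * b + t\<^sup>2 * c \<ge> 0" for t
    using D10_norm_sq_add[OF f g, of t] zero_le_power2[of "D10_norm (\<lambda>x. f x + t * g x)"] by (simp add: a_def b_def c_def)
  have "b\<^sup>2 \<le> a * c"
  proof (cases "c = 0")
    case True
    have "b = 0"
    proof (rule ccontr)
      assume "b \<noteq> 0"
      \<comment> \<open>With c = 0 the quadratic is affine in \<open>t\<close>; this choice of
        \<open>t\<close> makes its value -1.\<close>
      then have "a + 2 * (- (a + 1) / (2 * b)) * b \<ge> 0" using q[of "- (a + 1) / (2 * b)"] True by simp
      then show False using \<open>b \<noteq> 0\<close> by (simp add: field_simps)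
    qed
    then show ?thesis using True by simp
  next
    case False
    then have c: "c > 0" by (simp add: c_def)
    have "a + 2 * (- b / c) * b + (- b / c)\<^sup>2 * c \<ge> 0" by (rule q)
    also have "a + 2 * (- b / c) * b + (- b / c)\<^sup>2 * c = a - b\<^sup>2 / c"
      using c by (simp add: power2_eq_square field_simps)
    finally show ?thesis using c by (simp add: field_simps)
  qed
  then have "\<bar>b\<bar>\<^sup>2 \<le> (D10_norm f * D10_norm g)\<^sup>2" by (simp add: a_def c_def power_mult_distrib)
  then show ?thesis unfolding b_def by (rule power2_le_imp_le) (simp add: D10_norm_nonneg)
qed

lemma D10_norm_triangle:
  assumes f: "f \<in> D10" and g: "g \<in> D10"
  shows "D10_norm (\<lambda>x. f x + g x) \<le> D10_norm f + D10_norm g"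
proof (rule power2_le_imp_le)
  show "(D10_norm (\<lambda>x. f x + g x))\<^sup>2 \<le> (D10_norm f + D10_norm g)\<^sup>2"
    using D10_norm_sq_add[OF f g, of 1] D10_cauchy_schwarz[OF f g] by (simp add: power2_sum)
qed (simp add: D10_norm_nonneg)

lemma D10_norm_cmult:
  assumes "f \<in> D10" shows "D10_norm (\<lambda>x. c * f x) = \<bar>c\<bar> * D10_norm f"
  using D10_inner_cmult[OF assms D10_cmult[OF assms], of c c] D10_inner_cmult[OF assms assms, of c]
  by (simp add: D10_norm_def D10_inner_commute[of f "\<lambda>x. c * f x"] real_sqrt_mult)

lemma D10_norm_minus_commute:
  assumes "f \<in> D10" "g \<in> D10" shows "D10_norm (\<lambda>x. f x - g x) = D10_norm (\<lambda>x. g x - f x)"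
  using D10_norm_cmult[OF D10_diff[OF assms], of "-1"] by simp

lemma D10_norm_triangle_diff:
  assumes "f \<in> D10" "g \<in> D10" "h \<in> D10"
  shows "D10_norm (\<lambda>x. f x - h x) \<le> D10_norm (\<lambda>x. f x - g x) + D10_norm (\<lambda>x. g x - h x)"
  using D10_norm_triangle[OF D10_diff[OF assms(1,2)] D10_diff[OF assms(2,3)]] by simp

text \<open>Representatives for which the pointwise estimates above are available. Test functions
  belong to this set, and mollification approximates every element of \<open>D10\<close> from
  it.\<close>

definition D10_C1 :: "(real ^ 'n::finite \<Rightarrow> real) set" where
  "D10_C1 = {w. \<exists>G. C1_grad w G \<and> energy G < \<infinity> \<and> (CARD('n) \<ge> 3 \<longrightarrow> vanishing w)}"

text \<open>For n \<ge> 3 membership in the Lebesgue space is the point, and it is the Sobolev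
  inequality that supplies it.\<close>

lemma D10_C1_energy:
  fixes w :: "real ^ 'n::finite \<Rightarrow> real"
  assumes w: "C1_grad w G" and e: "energy G < \<infinity>" and van: "CARD('n) \<ge> 3 \<Longrightarrow> vanishing w"
  shows "w \<in> D10" "w \<in> D10_C1" "energy G = ennreal ((D10_norm w)\<^sup>2)"
proof -
  have wg: "has_weak_gradient w G" using w by (rule has_weak_gradient_C1)
  show D: "w \<in> D10"
  proof (rule D10I[OF wg])
    show "L2field G" using L2field_energy[OF C1_grad_measurable(2)[OF w]] e by simp
    assume n: "CARD('n) \<ge> 3"
    obtain C where C: "\<And>(w :: real ^ 'n \<Rightarrow> real) G D. C1_grad w G \<Longrightarrow> vanishing w \<Longrightarrow> D \<ge> 0 \<Longrightarrow>
      energy G \<le> ennreal (D\<^sup>2) \<Longrightarrow> (\<integral>\<^sup>+x. ennreal (\<bar>w x\<bar> powr (2 * real CARD('n) / (real CARD('n) - 2))) \<partial>lborel)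
        \<le> ennreal (C * D powr (2 * real CARD('n) / (real CARD('n) - 2)))"
      using sobolev[OF n] by metis
    have "energy G \<le> ennreal ((sqrt (enn2real (energy G)))\<^sup>2)" using e by simp
    from C[OF w van[OF n] _ this] show "(\<integral>\<^sup>+x. ennreal (\<bar>w x\<bar> powr (2 * real CARD('n) / (real CARD('n) - 2))) \<partial>lborel) < \<infinity>"
      by (auto intro: le_less_trans)
  qed
  show "w \<in> D10_C1" using assms by (auto simp: D10_C1_def)
  show "energy G = ennreal ((D10_norm w)\<^sup>2)" using D wg by (rule D10_norm_energy)
qed

lemma vanishing_diff:
  assumes f: "vanishing f" and g: "vanishing g" shows "vanishing (\<lambda>x. f x - g x)"
  unfolding vanishing_def
proof (intro conjI allI impI)
  have [measurable]: "f \<in> borel_measurable borel" "g \<in> borel_measurable borel"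
    using f g by (auto simp: vanishing_def)
  show "(\<lambda>x. f x - g x) \<in> borel_measurable borel" by measurable
  fix \<tau> :: real assume t: "\<tau> > 0"
  have "(\<integral>\<^sup>+x. ennreal (\<bar>f x - g x\<bar> - \<tau>) \<partial>lborel) \<le> (\<integral>\<^sup>+x. ennreal (\<bar>f x\<bar> - \<tau> / 2) + ennreal (\<bar>g x\<bar> - \<tau> / 2) \<partial>lborel)"
  proof (rule nn_integral_mono)
    fix x
    have "ennreal (\<bar>f x - g x\<bar> - \<tau>) \<le> ennreal (max 0 (\<bar>f x\<bar> - \<tau> / 2) + max 0 (\<bar>g x\<bar> - \<tau> / 2))"
      by (intro ennreal_leI) (simp add: max_def, linarith)
    also have "\<dots> = ennreal (\<bar>f x\<bar> - \<tau> / 2) + ennreal (\<bar>g x\<bar> - \<tau> / 2)"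
      by (subst ennreal_plus) (auto simp: max_def ennreal_neg)
    finally show "ennreal (\<bar>f x - g x\<bar> - \<tau>) \<le> ennreal (\<bar>f x\<bar> - \<tau> / 2) + ennreal (\<bar>g x\<bar> - \<tau> / 2)" .
  qed
  also have "\<dots> = (\<integral>\<^sup>+x. ennreal (\<bar>f x\<bar> - \<tau> / 2) \<partial>lborel) + (\<integral>\<^sup>+x. ennreal (\<bar>g x\<bar> - \<tau> / 2) \<partial>lborel)"
    by (rule nn_integral_add) measurable
  also have "\<dots> < \<infinity>" using f g t by (simp add: vanishing_def)
  finally show "(\<integral>\<^sup>+x. ennreal (\<bar>f x - g x\<bar> - \<tau>) \<partial>lborel) < \<infinity>" .
qed

lemma vanishing_compact_support:
  fixes f :: "real ^ 'n::finite \<Rightarrow> real"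
  assumes f: "continuous_on UNIV f" and R: "\<And>x. f x \<noteq> 0 \<Longrightarrow> norm x \<le> R"
  shows "vanishing f"
  unfolding vanishing_def
proof (intro conjI allI impI)
  show "f \<in> borel_measurable borel" using f by (rule borel_measurable_continuous_onI)
  fix \<tau> :: real assume t: "\<tau> > 0"
  have "integrable lborel f" using continuous_compact_support_integrable[OF f R] .
  then have "(\<integral>\<^sup>+x. ennreal \<bar>f x\<bar> \<partial>lborel) < \<infinity>" by (simp add: integrable_iff_bounded)
  moreover have "(\<integral>\<^sup>+x. ennreal (\<bar>f x\<bar> - \<tau>) \<partial>lborel) \<le> (\<integral>\<^sup>+x. ennreal \<bar>f x\<bar> \<partial>lborel)"
    using t by (intro nn_integral_mono ennreal_leI) simp
  ultimately show "(\<integral>\<^sup>+x. ennreal (\<bar>f x\<bar> - \<tau>) \<partial>lborel) < \<infinity>" by (rule le_less_trans[rotated])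
qed

lemma compact_support_D10:
  fixes f :: "real ^ 'n::finite \<Rightarrow> real"
  assumes f: "C1_grad f F" and R: "\<And>x. f x \<noteq> 0 \<Longrightarrow> norm x \<le> R"
  shows "f \<in> D10" "f \<in> D10_C1" "energy F = ennreal ((D10_norm f)\<^sup>2)"
proof -
  have RF: "norm x \<le> R" if "F x \<noteq> 0" for x
    using C1_grad_support[OF f R, of x] that by force
  have "integrable lborel (\<lambda>x. (norm (F x))\<^sup>2)"
    using RF by (intro continuous_compact_support_integrable[where R=R] continuous_intros C1_grad_continuous_grad[OF f]) auto
  then have e: "energy F < \<infinity>" by (simp add: energy_def integrable_iff_bounded)
  show "f \<in> D10" "f \<in> D10_C1" "energy F = ennreal ((D10_norm f)\<^sup>2)"
    using D10_C1_energy[OF f e vanishing_compact_support[OF C1_grad_continuous[OF f] R]] by auto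
qed

lemma test_function_D10:
  assumes "test_function f" shows "f \<in> D10" "f \<in> D10_C1"
  using test_functionE[OF assms] compact_support_D10[OF test_function_C1_grad[OF assms]] by metis+

lemma D10_C1_diff:
  fixes f g :: "real ^ 'n::finite \<Rightarrow> real"
  assumes f: "C1_grad f F" "energy F < \<infinity>" "CARD('n) \<ge> 3 \<Longrightarrow> vanishing f"
    and g: "C1_grad g G" "energy G < \<infinity>" "CARD('n) \<ge> 3 \<Longrightarrow> vanishing g"
  shows "C1_grad (\<lambda>x. f x - g x) (\<lambda>x. F x - G x)"
    "CARD('n) \<ge> 3 \<Longrightarrow> vanishing (\<lambda>x. f x - g x)"
    "energy (\<lambda>x. F x - G x) = ennreal ((D10_norm (\<lambda>x. f x - g x))\<^sup>2)"
proof -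
  show c: "C1_grad (\<lambda>x. f x - g x) (\<lambda>x. F x - G x)" using f g by (intro C1_grad_diff)
  show "CARD('n) \<ge> 3 \<Longrightarrow> vanishing (\<lambda>x. f x - g x)" using f g by (intro vanishing_diff)
  show "energy (\<lambda>x. F x - G x) = ennreal ((D10_norm (\<lambda>x. f x - g x))\<^sup>2)"
    using D10_norm_energy[OF D10_diff[OF D10_C1_energy(1)[OF f] D10_C1_energy(1)[OF g]] has_weak_gradient_C1[OF c]] .
qed

text \<open>Where |f| exceeds the threshold, |f| \<le> \<tau>^(1 - p) |f|^p because p > 1.\<close>

lemma vanishing_Lp:
  fixes f :: "real ^ 'n::finite \<Rightarrow> real"
  assumes m: "f \<in> borel_measurable borel" and p: "p > 1" and f: "(\<integral>\<^sup>+x. ennreal (\<bar>f x\<bar> powr p) \<partial>lborel) < \<infinity>"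
  shows "vanishing f"
  unfolding vanishing_def
proof (intro conjI allI impI m)
  fix \<tau> :: real assume t: "\<tau> > 0"
  note [measurable] = m
  have "(\<integral>\<^sup>+x. ennreal (\<bar>f x\<bar> - \<tau>) \<partial>lborel) \<le> (\<integral>\<^sup>+x. ennreal (\<tau> powr (1 - p)) * ennreal (\<bar>f x\<bar> powr p) \<partial>lborel)"
  proof (rule nn_integral_mono)
    fix x
    show "ennreal (\<bar>f x\<bar> - \<tau>) \<le> ennreal (\<tau> powr (1 - p)) * ennreal (\<bar>f x\<bar> powr p)"
    proof (cases "\<bar>f x\<bar> \<le> \<tau>")
      case False
      then have "\<bar>f x\<bar> = \<bar>f x\<bar> powr (1 - p) * \<bar>f x\<bar> powr p" using t by (simp add: powr_add[symmetric])
      also have "\<dots> \<le> \<tau> powr (1 - p) * \<bar>f x\<bar> powr p"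
        using False t p by (intro mult_right_mono powr_mono2') auto
      finally show ?thesis using t by (simp add: ennreal_mult[symmetric] ennreal_leI)
    qed (simp add: ennreal_neg)
  qed
  also have "\<dots> < \<infinity>" using f by (simp add: nn_integral_cmult ennreal_mult_less_top)
  finally show "(\<integral>\<^sup>+x. ennreal (\<bar>f x\<bar> - \<tau>) \<partial>lborel) < \<infinity>" .
qed

text \<open>The excess of an average over the threshold is at most the average of the excesses;
  integrating, Fubini returns the excess integral of \<open>f\<close>.\<close>

lemma vanishing_conv:
  fixes f :: "real ^ 'n::finite \<Rightarrow> real"
  assumes f: "vanishing f" "locally_integrable f" shows "vanishing (conv f (mol k))"
  unfolding vanishing_def
proof (intro conjI allI impI conv_measurable f)
  fix \<tau> :: real assume t: "\<tau> > 0"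
  have [measurable]: "f \<in> borel_measurable borel" using f by (auto simp: vanishing_def)
  have "(\<integral>\<^sup>+x. ennreal (\<bar>conv f (mol k) x\<bar> - \<tau>) \<partial>lborel) \<le>
    (\<integral>\<^sup>+x. \<integral>\<^sup>+y. ennreal (mol k y) * ennreal (\<bar>f (x - y)\<bar> - \<tau>) \<partial>lborel \<partial>lborel)"
  proof (rule nn_integral_mono)
    fix x
    have "ennreal \<bar>conv f (mol k) x\<bar> \<le> (\<integral>\<^sup>+y. ennreal (mol k y) * ennreal \<bar>f (x - y)\<bar> \<partial>lborel)"
      using conv_mol_diff_bound[OF f(2), of k x 0] by simp
    also have "\<dots> \<le> (\<integral>\<^sup>+y. ennreal (mol k y) * ennreal \<tau> + ennreal (mol k y) * ennreal (\<bar>f (x - y)\<bar> - \<tau>) \<partial>lborel)"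
    proof (rule nn_integral_mono)
      fix y
      have "ennreal \<bar>f (x - y)\<bar> \<le> ennreal (\<tau> + max 0 (\<bar>f (x - y)\<bar> - \<tau>))" by (intro ennreal_leI) (simp add: max_def)
      also have "\<dots> = ennreal \<tau> + ennreal (\<bar>f (x - y)\<bar> - \<tau>)"
        using t by (subst ennreal_plus) (auto simp: max_def ennreal_neg)
      finally show "ennreal (mol k y) * ennreal \<bar>f (x - y)\<bar> \<le> ennreal (mol k y) * ennreal \<tau> + ennreal (mol k y) * ennreal (\<bar>f (x - y)\<bar> - \<tau>)"
        by (simp add: distrib_left[symmetric] mult_left_mono)
    qed
    also have "\<dots> = ennreal \<tau> + (\<integral>\<^sup>+y. ennreal (mol k y) * ennreal (\<bar>f (x - y)\<bar> - \<tau>) \<partial>lborel)"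
      by (simp add: nn_integral_add nn_integral_multc nn_integral_mol)
    finally have "ennreal \<bar>conv f (mol k) x\<bar> - ennreal \<tau> \<le> (\<integral>\<^sup>+y. ennreal (mol k y) * ennreal (\<bar>f (x - y)\<bar> - \<tau>) \<partial>lborel)"
      by (simp add: ennreal_minus_le_iff)
    then show "ennreal (\<bar>conv f (mol k) x\<bar> - \<tau>) \<le> (\<integral>\<^sup>+y. ennreal (mol k y) * ennreal (\<bar>f (x - y)\<bar> - \<tau>) \<partial>lborel)"
      using t by (simp add: ennreal_minus)
  qed
  also have "\<dots> = (\<integral>\<^sup>+y. \<integral>\<^sup>+x. ennreal (mol k y) * ennreal (\<bar>f (x - y)\<bar> - \<tau>) \<partial>lborel \<partial>lborel)"
    by (rule lborel_pair.Fubini') measurable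
  also have "\<dots> = (\<integral>\<^sup>+y. ennreal (mol k y) * (\<integral>\<^sup>+x. ennreal (\<bar>f x\<bar> - \<tau>) \<partial>lborel) \<partial>(lborel :: (real ^ 'n) measure))"
  proof (rule nn_integral_cong)
    fix y :: "real ^ 'n"
    show "(\<integral>\<^sup>+x. ennreal (mol k y) * ennreal (\<bar>f (x - y)\<bar> - \<tau>) \<partial>lborel) = ennreal (mol k y) * (\<integral>\<^sup>+x. ennreal (\<bar>f x\<bar> - \<tau>) \<partial>lborel)"
      using nn_integral_lborel_translate[of "\<lambda>x. ennreal (\<bar>f x\<bar> - \<tau>)" "- y"] by (simp add: nn_integral_cmult)
  qed
  also have "\<dots> = (\<integral>\<^sup>+x. ennreal (\<bar>f x\<bar> - \<tau>) \<partial>lborel)" by (simp add: nn_integral_multc nn_integral_mol)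
  also have "\<dots> < \<infinity>" using f t by (auto simp: vanishing_def)
  finally show "(\<integral>\<^sup>+x. ennreal (\<bar>conv f (mol k) x\<bar> - \<tau>) \<partial>lborel) < \<infinity>" .
qed

lemma energy_components:
  fixes F :: "real ^ 'n::finite \<Rightarrow> real ^ 'n"
  assumes [measurable]: "\<And>i. (\<lambda>x. F x $ i) \<in> borel_measurable borel"
  shows "energy F = (\<Sum>i\<in>UNIV. \<integral>\<^sup>+x. ennreal ((F x $ i)\<^sup>2) \<partial>lborel)"
proof -
  have "energy F = (\<integral>\<^sup>+x. (\<Sum>i\<in>UNIV. ennreal ((F x $ i)\<^sup>2)) \<partial>lborel)"
    unfolding energy_def power2_norm_eq_inner inner_vec_def
    by (simp add: power2_eq_square)
  also have "\<dots> = (\<Sum>i\<in>UNIV. \<integral>\<^sup>+x. ennreal ((F x $ i)\<^sup>2) \<partial>lborel)"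
    by (rule nn_integral_sum) measurable
  finally show ?thesis .
qed

text \<open>The gradient of the mollified function is the mollified weak gradient, so convergence in
  energy is \<open>mollify_L2\<close> in each component.\<close>

lemma mollify_D10:
  fixes f :: "real ^ 'n::finite \<Rightarrow> real"
  assumes f: "f \<in> D10"
  shows "conv f (mol k) \<in> D10" "conv f (mol k) \<in> D10_C1"
    "(\<lambda>k. D10_norm (\<lambda>x. conv f (mol k) x - f x)) \<longlonglongrightarrow> 0"
proof -
  define F where "F = weak_gradient f"
  have F: "has_weak_gradient f F" "L2field F" unfolding F_def using D10D[OF f] by auto
  have li: "locally_integrable F" using F(1) by (simp add: has_weak_gradient_def)
  note lii = locally_integrable_nth[OF li]
  have m[measurable]: "(\<lambda>x. F x $ i) \<in> borel_measurable borel" for i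
    using locally_integrable_measurable[OF lii] .
  have cm[measurable]: "conv (\<lambda>x. F x $ i) (mol k) \<in> borel_measurable borel" for i k
    by (rule conv_measurable[OF lii])
  define Fk where "Fk = (\<lambda>k x. \<chi> i. conv (\<lambda>y. F y $ i) (mol k) x)"
  have c: "C1_grad (conv f (mol k)) (Fk k)" for k
    unfolding Fk_def by (rule C1_grad_conv_weak_gradient[OF F(1) test_function_mol])
  have "energy (Fk k) = (\<Sum>i\<in>UNIV. \<integral>\<^sup>+x. ennreal ((conv (\<lambda>y. F y $ i) (mol k) x)\<^sup>2) \<partial>lborel)" for k
    by (subst energy_components) (auto simp: Fk_def)
  also have "\<dots> k \<le> (\<Sum>i\<in>UNIV. \<integral>\<^sup>+x. ennreal ((F x $ i)\<^sup>2) \<partial>lborel)" for k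
    by (intro sum_mono mollify_L2_bound lii)
  also have "(\<Sum>i\<in>UNIV. \<integral>\<^sup>+x. ennreal ((F x $ i)\<^sup>2) \<partial>lborel) = energy F" by (simp add: energy_components)
  finally have le: "energy (Fk k) \<le> energy F" for k .
  have e: "energy (Fk k) < \<infinity>" for k
    by (rule le_less_trans[OF le]) (simp add: energy_eq_integral[OF F(2)])
  have van: "vanishing (conv f (mol k))" if n: "CARD('n) \<ge> 3" for k
  proof (rule vanishing_conv[OF vanishing_Lp D10D(3)[OF f]])
    show "(\<integral>\<^sup>+x. ennreal (\<bar>f x\<bar> powr (2 * real CARD('n) / (real CARD('n) - 2))) \<partial>lborel) < \<infinity>" by (rule D10D(4)[OF f n])
    show "1 < 2 * real CARD('n) / (real CARD('n) - 2)" using n by (simp add: field_simps)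
    show "f \<in> borel_measurable borel" using D10D(3)[OF f] by (rule locally_integrable_measurable)
  qed
  note S = D10_C1_energy[OF c e van]
  show "conv f (mol k) \<in> D10" "conv f (mol k) \<in> D10_C1" using S by auto
  have fi2: "integrable lborel (\<lambda>x. (F x $ i)\<^sup>2)" for i
  proof (rule Bochner_Integration.integrable_bound)
    show "integrable lborel (\<lambda>x. (norm (F x))\<^sup>2)" using F(2) by (simp add: L2field_def)
    show "AE x in lborel. norm ((F x $ i)\<^sup>2) \<le> norm ((norm (F x))\<^sup>2)"
    proof (rule AE_I2)
      fix x show "norm ((F x $ i)\<^sup>2) \<le> norm ((norm (F x))\<^sup>2)"
        using power_mono[OF component_le_norm_cart[of "F x" i], of 2] by simp
    qed
  qed simp
  have en: "energy (\<lambda>x. Fk k x - F x) = ennreal ((D10_norm (\<lambda>x. conv f (mol k) x - f x))\<^sup>2)" for k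
  proof (rule D10_norm_energy[OF D10_diff[OF S(1) f]])
    show "has_weak_gradient (\<lambda>x. conv f (mol k) x - f x) (\<lambda>x. Fk k x - F x)"
      using has_weak_gradient_add[OF has_weak_gradient_C1[OF c[of k]] has_weak_gradient_cmult[OF F(1), of "-1"]] by simp
  qed
  have "energy (\<lambda>x. Fk k x - F x) = (\<Sum>i\<in>UNIV. \<integral>\<^sup>+x. ennreal ((conv (\<lambda>y. F y $ i) (mol k) x - F x $ i)\<^sup>2) \<partial>lborel)" for k
    by (subst energy_components) (auto simp: Fk_def)
  moreover have "(\<lambda>k. \<Sum>i\<in>UNIV. \<integral>\<^sup>+x. ennreal ((conv (\<lambda>y. F y $ i) (mol k) x - F x $ i)\<^sup>2) \<partial>lborel) \<longlonglongrightarrow> (\<Sum>i\<in>(UNIV :: 'n set). 0)"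
    by (intro tendsto_sum mollify_L2 m fi2)
  ultimately have "(\<lambda>k. ennreal ((D10_norm (\<lambda>x. conv f (mol k) x - f x))\<^sup>2)) \<longlonglongrightarrow> ennreal 0"
    by (simp add: en)
  then have "(\<lambda>k. (D10_norm (\<lambda>x. conv f (mol k) x - f x))\<^sup>2) \<longlonglongrightarrow> 0"
    by (subst (asm) tendsto_ennreal_iff) auto
  then have "(\<lambda>k. sqrt ((D10_norm (\<lambda>x. conv f (mol k) x - f x))\<^sup>2)) \<longlonglongrightarrow> sqrt 0" by (rule tendsto_real_sqrt)
  then show "(\<lambda>k. D10_norm (\<lambda>x. conv f (mol k) x - f x)) \<longlonglongrightarrow> 0" by (simp add: D10_norm_nonneg)
qed

subsection \<open>Completeness and Riesz representation\<close>

text \<open>The squared increments weighted by 4^k still have a summable integral. Hence almost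
  everywhere their sum is finite, the increments are at most a constant times 2^(-k), and the
  sequence converges.\<close>

lemma AE_convergent_fast:
  fixes X :: "nat \<Rightarrow> 'a \<Rightarrow> 'b::{banach, second_countable_topology}"
  assumes [measurable]: "\<And>k. X k \<in> borel_measurable M" and K: "K \<ge> 0"
    and X: "\<And>k. (\<integral>\<^sup>+x. ennreal ((norm (X (Suc k) x - X k x))\<^sup>2) \<partial>M) \<le> ennreal (K * (1 / 16) ^ k)"
  shows "AE x in M. convergent (\<lambda>k. X k x)"
proof -
  define S where "S = (\<lambda>x. \<Sum>k. ennreal (4 ^ k) * ennreal ((norm (X (Suc k) x - X k x))\<^sup>2))"
  have [measurable]: "S \<in> borel_measurable M" unfolding S_def by measurable
  have "(\<integral>\<^sup>+x. S x \<partial>M) = (\<Sum>k. \<integral>\<^sup>+x. ennreal (4 ^ k) * ennreal ((norm (X (Suc k) x - X k x))\<^sup>2) \<partial>M)"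
    unfolding S_def by (rule nn_integral_suminf) measurable
  also have "\<dots> \<le> (\<Sum>k. ennreal (K * (1 / 4) ^ k))"
  proof (rule suminf_le)
    fix k
    have "(\<integral>\<^sup>+x. ennreal (4 ^ k) * ennreal ((norm (X (Suc k) x - X k x))\<^sup>2) \<partial>M) \<le> ennreal (4 ^ k) * ennreal (K * (1 / 16) ^ k)"
      using X[of k] by (simp add: nn_integral_cmult mult_left_mono)
    also have "\<dots> = ennreal (K * (1 / 4) ^ k)"
    proof -
      have "(4::real) ^ k * (1 / 16) ^ k = (1 / 4) ^ k" by (simp add: power_mult_distrib[symmetric])
      then show ?thesis using K by (simp add: ennreal_mult[symmetric] mult.left_commute)
    qed
    finally show "(\<integral>\<^sup>+x. ennreal (4 ^ k) * ennreal ((norm (X (Suc k) x - X k x))\<^sup>2) \<partial>M) \<le> ennreal (K * (1 / 4) ^ k)" .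
  qed auto
  also have "\<dots> = ennreal (\<Sum>k. K * (1 / 4) ^ k)"
    using K by (intro suminf_ennreal2) (auto intro!: summable_mult)
  finally have "(\<integral>\<^sup>+x. S x \<partial>M) \<noteq> \<infinity>" by (auto simp: top_unique)
  then have "AE x in M. S x \<noteq> \<infinity>" by (intro nn_integral_PInf_AE) auto
  then show ?thesis
  proof eventually_elim
    case (elim x)
    then obtain B where B: "B \<ge> 0" "S x = ennreal B" by (cases "S x") auto
    have bd: "norm (X (Suc k) x - X k x) \<le> sqrt B * (1 / 2) ^ k" for k
    proof -
      have "ennreal (4 ^ k * (norm (X (Suc k) x - X k x))\<^sup>2) = (\<Sum>i\<in>{k}. ennreal (4 ^ i) * ennreal ((norm (X (Suc i) x - X i x))\<^sup>2))"
        by (simp add: ennreal_mult)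
      also have "\<dots> \<le> S x" unfolding S_def by (rule sum_le_suminf) auto
      finally have "4 ^ k * (norm (X (Suc k) x - X k x))\<^sup>2 \<le> B" using B by simp
      then have "(2 ^ k * norm (X (Suc k) x - X k x))\<^sup>2 \<le> B"
        by (simp add: power_mult_distrib power_mult[symmetric] mult.commute[of k 2] power_mult)
      then have "2 ^ k * norm (X (Suc k) x - X k x) \<le> sqrt B" by (rule real_le_rsqrt)
      then show ?thesis by (simp add: power_one_over field_simps)
    qed
    have "summable (\<lambda>k. sqrt B * (1 / 2) ^ k)" by (intro summable_mult) auto
    then have "summable (\<lambda>k. norm (X (Suc k) x - X k x))"
      by (rule summable_comparison_test'[where N=0]) (use bd in auto)
    then have "summable (\<lambda>k. X (Suc k) x - X k x)" by (rule summable_norm_cancel)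
    from summable_LIMSEQ[OF this]
    have "(\<lambda>n. X n x - X 0 x) \<longlonglongrightarrow> (\<Sum>k. X (Suc k) x - X k x)" by (simp add: sum_lessThan_telescope[of "\<lambda>k. X k x"])
    from tendsto_add[OF this tendsto_const[of "X 0 x"]] show ?case by (auto intro: convergentI)
  qed
qed

lemma nn_fatou:
  fixes f :: "nat \<Rightarrow> 'a \<Rightarrow> ennreal"
  assumes [measurable]: "\<And>l. f l \<in> borel_measurable M"
    and lim: "AE x in M. (\<lambda>l. f l x) \<longlonglongrightarrow> g x" and B: "\<And>l. l \<ge> N \<Longrightarrow> (\<integral>\<^sup>+x. f l x \<partial>M) \<le> B"
  shows "(\<integral>\<^sup>+x. g x \<partial>M) \<le> B"
proof -
  have "(\<integral>\<^sup>+x. g x \<partial>M) = (\<integral>\<^sup>+x. liminf (\<lambda>l. f l x) \<partial>M)"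
    using lim by (intro nn_integral_cong_AE) (auto elim!: eventually_mono simp: lim_imp_Liminf)
  also have "\<dots> \<le> liminf (\<lambda>l. \<integral>\<^sup>+x. f l x \<partial>M)" by (rule nn_integral_liminf) simp
  also have "\<dots> \<le> limsup (\<lambda>l. \<integral>\<^sup>+x. f l x \<partial>M)" by (rule Liminf_le_Limsup) simp
  also have "\<dots> \<le> B"
    by (intro Limsup_bounded) (auto simp: eventually_sequentially intro!: exI[of _ N] B)
  finally show ?thesis .
qed

lemma ennreal_squeeze_0:
  fixes a b :: "nat \<Rightarrow> ennreal"
  assumes "b \<longlonglongrightarrow> 0" "\<And>k. a k \<le> b k" shows "a \<longlonglongrightarrow> 0"
  by (rule tendsto_sandwich[OF always_eventually always_eventually tendsto_const assms(1)])
    (simp_all add: assms(2))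

lemma ennreal_power2_le: assumes "a\<^sup>2 \<le> ennreal (s\<^sup>2)" "s \<ge> 0" shows "a \<le> ennreal s"
proof (cases a)
  case (real r)
  then have "r\<^sup>2 \<le> s\<^sup>2" using assms by (simp add: ennreal_power)
  then have "r \<le> s" using assms(2) by (rule power2_le_imp_le)
  then show ?thesis using real by (simp add: ennreal_leI)
next
  case top
  then have "a\<^sup>2 = top" by (simp add: power2_eq_square ennreal_top_mult)
  then show ?thesis using assms(1) by (simp add: top_unique)
qed

lemma ball_L1_le_L2:
  fixes h :: "real ^ 'n::finite \<Rightarrow> real"
  assumes [measurable]: "h \<in> borel_measurable borel" and s: "s \<ge> 0"
    and h: "(\<integral>\<^sup>+x. ennreal ((h x)\<^sup>2) * indicator (cball 0 R) x \<partial>lborel) \<le> ennreal (s\<^sup>2)"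
  shows "(\<integral>\<^sup>+x. ennreal \<bar>h x\<bar> * indicator (cball 0 R) x \<partial>lborel) \<le> ennreal (s * sqrt (measure lborel (cball (0 :: real ^ 'n) R)))"
proof (rule ennreal_power2_le)
  have "(\<integral>\<^sup>+x. ennreal \<bar>h x\<bar> * indicator (cball 0 R) x \<partial>lborel)\<^sup>2 \<le>
      (\<integral>\<^sup>+x. ennreal ((h x)\<^sup>2) * indicator (cball 0 R) x \<partial>lborel) * emeasure lborel (cball (0 :: real ^ 'n) R)"
    by (rule nn_integral_indicator_sq_bound) auto
  also have "\<dots> \<le> ennreal (s\<^sup>2) * emeasure lborel (cball (0 :: real ^ 'n) R)"
    using h by (rule mult_right_mono) simp
  also have "\<dots> = ennreal ((s * sqrt (measure lborel (cball (0 :: real ^ 'n) R)))\<^sup>2)"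
    by (simp add: emeasure_unit_cball ennreal_mult[symmetric] power_mult_distrib)
  finally show "(\<integral>\<^sup>+x. ennreal \<bar>h x\<bar> * indicator (cball 0 R) x \<partial>lborel)\<^sup>2 \<le>
      ennreal ((s * sqrt (measure lborel (cball (0 :: real ^ 'n) R)))\<^sup>2)" .
qed (use s in simp)

lemma tendsto_ball_integral:
  fixes h :: "nat \<Rightarrow> real ^ 'n::finite \<Rightarrow> real" and f \<psi> :: "real ^ 'n \<Rightarrow> real"
  assumes h: "\<And>k. locally_integrable (h k)" and f: "locally_integrable f"
    and psi: "continuous_on UNIV \<psi>" and R: "\<And>x. \<psi> x \<noteq> 0 \<Longrightarrow> norm x \<le> R"
    and lim: "(\<lambda>k. \<integral>\<^sup>+x. ennreal \<bar>h k x - f x\<bar> * indicator (cball 0 R) x \<partial>lborel) \<longlonglongrightarrow> 0"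
  shows "(\<lambda>k. \<integral>x. h k x * \<psi> x \<partial>lborel) \<longlonglongrightarrow> (\<integral>x. f x * \<psi> x \<partial>lborel)"
proof (rule tendsto_L1_int)
  show "integrable lborel (\<lambda>x. h k x * \<psi> x)" for k
    using integrable_locally_integrable_continuous[OF h psi R] by simp
  show "integrable lborel (\<lambda>x. f x * \<psi> x)"
    using integrable_locally_integrable_continuous[OF f psi R] by simp
  obtain C where C: "C > 0" "\<And>x. norm (\<psi> x) \<le> C" using continuous_compact_support_bounded[OF psi R] by metis
  have [measurable]: "h k \<in> borel_measurable borel" "f \<in> borel_measurable borel" for k
    using h f locally_integrable_measurable by auto
  have le: "(\<integral>\<^sup>+x. ennreal (norm (h k x * \<psi> x - f x * \<psi> x)) \<partial>lborel) \<le>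
      ennreal C * (\<integral>\<^sup>+x. ennreal \<bar>h k x - f x\<bar> * indicator (cball 0 R) x \<partial>lborel)" for k
  proof -
    have "(\<integral>\<^sup>+x. ennreal (norm (h k x * \<psi> x - f x * \<psi> x)) \<partial>lborel) \<le>
      (\<integral>\<^sup>+x. ennreal C * (ennreal \<bar>h k x - f x\<bar> * indicator (cball 0 R) x) \<partial>lborel)"
    proof (rule nn_integral_mono)
      fix x
      show "ennreal (norm (h k x * \<psi> x - f x * \<psi> x)) \<le> ennreal C * (ennreal \<bar>h k x - f x\<bar> * indicator (cball 0 R) x)"
      proof (cases "\<psi> x = 0")
        case False
        have "norm (h k x * \<psi> x - f x * \<psi> x) = \<bar>h k x - f x\<bar> * \<bar>\<psi> x\<bar>"
          by (simp add: abs_mult[symmetric] left_diff_distrib)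
        also have "\<dots> \<le> C * \<bar>h k x - f x\<bar>" using mult_left_mono[OF C(2)[of x], of "\<bar>h k x - f x\<bar>"] by (simp add: mult.commute)
        finally show ?thesis using R[OF False] C(1) by (simp add: ennreal_mult[symmetric] ennreal_leI)
      qed simp
    qed
    also have "\<dots> = ennreal C * (\<integral>\<^sup>+x. ennreal \<bar>h k x - f x\<bar> * indicator (cball 0 R) x \<partial>lborel)"
      by (rule nn_integral_cmult) measurable
    finally show ?thesis .
  qed
  have "(\<lambda>k. ennreal C * (\<integral>\<^sup>+x. ennreal \<bar>h k x - f x\<bar> * indicator (cball 0 R) x \<partial>lborel)) \<longlonglongrightarrow> ennreal C * 0"
    by (intro tendsto_mult_ennreal lim tendsto_const) auto
  then have "(\<lambda>k. ennreal C * (\<integral>\<^sup>+x. ennreal \<bar>h k x - f x\<bar> * indicator (cball 0 R) x \<partial>lborel)) \<longlonglongrightarrow> 0" by simp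
  from ennreal_squeeze_0[OF this le]
  show "(\<lambda>k. \<integral>\<^sup>+x. ennreal (norm (h k x * \<psi> x - f x * \<psi> x)) \<partial>lborel) \<longlonglongrightarrow> 0" .
qed

text \<open>For \<open>CARD('n) \<le> 2\<close> the gradients determine the limit only up to constants, which \<open>c\<close> removes.\<close>

lemma D10_C1_complete:
  fixes w :: "nat \<Rightarrow> real ^ 'n::finite \<Rightarrow> real"
  assumes w: "\<And>k. w k \<in> D10_C1"
    and cauchy: "\<And>e. e > 0 \<Longrightarrow> \<exists>N. \<forall>k\<ge>N. \<forall>l\<ge>N. D10_norm (\<lambda>x. w k x - w l x) < e"
  shows "\<exists>f (r :: nat \<Rightarrow> nat) c. f \<in> D10 \<and> strict_mono r \<and> (CARD('n) \<ge> 3 \<longrightarrow> c = (\<lambda>_. 0)) \<and>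
    (\<lambda>k. D10_norm (\<lambda>x. w k x - f x)) \<longlonglongrightarrow> 0 \<and>
    (\<forall>R. (\<lambda>k. \<integral>\<^sup>+x. ennreal \<bar>w (r k) x - c k - f x\<bar> * indicator (cball 0 R) x \<partial>lborel) \<longlonglongrightarrow> 0)"
proof -
  have "\<forall>k. \<exists>G. C1_grad (w k) G \<and> energy G < \<infinity> \<and> (CARD('n) \<ge> 3 \<longrightarrow> vanishing (w k))"
    using w by (auto simp: D10_C1_def)
  then obtain G where G: "\<And>k. C1_grad (w k) (G k)" "\<And>k. energy (G k) < \<infinity>" "\<And>k. CARD('n) \<ge> 3 \<Longrightarrow> vanishing (w k)"
    by metis
  have wD: "w k \<in> D10" for k using D10_C1_energy(1)[OF G] .
  obtain N where N: "\<And>j k l. k \<ge> N j \<Longrightarrow> l \<ge> N j \<Longrightarrow> D10_norm (\<lambda>x. w k x - w l x) < (1 / 4) ^ j"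
  proof -
    have "\<forall>j. \<exists>N. \<forall>k\<ge>N. \<forall>l\<ge>N. D10_norm (\<lambda>x. w k x - w l x) < (1 / 4) ^ j"
      by (intro allI cauchy) simp
    from choice[OF this] show ?thesis using that by blast
  qed
  \<comment> \<open>The sum makes \<open>r\<close> dominate every earlier \<open>N\<close>, the
    summand \<open>j\<close> makes it strictly increasing.\<close>
  define r where "r = (\<lambda>j. j + (\<Sum>i\<le>j. N i))"
  have rmono: "strict_mono r" unfolding strict_mono_Suc_iff by (simp add: r_def)
  have rN: "r k \<ge> N j" if "k \<ge> j" for j k
  proof -
    have "N j \<le> (\<Sum>i\<le>k. N i)" using that by (intro member_le_sum) auto
    then show ?thesis by (simp add: r_def)
  qed
  define u where "u = (\<lambda>k. w (r k))"
  define g where "g = (\<lambda>k. G (r k))"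
  have uD: "u k \<in> D10" for k by (simp add: u_def wD)
  have ug: "C1_grad (u k) (g k)" "energy (g k) < \<infinity>" "CARD('n) \<ge> 3 \<Longrightarrow> vanishing (u k)" for k
    unfolding u_def g_def by (fact G)+
  have dif: "C1_grad (\<lambda>x. u k x - u l x) (\<lambda>x. g k x - g l x)"
    "CARD('n) \<ge> 3 \<Longrightarrow> vanishing (\<lambda>x. u k x - u l x)"
    "energy (\<lambda>x. g k x - g l x) = ennreal ((D10_norm (\<lambda>x. u k x - u l x))\<^sup>2)" for k l
    using D10_C1_diff[OF ug(1,2)[of k] _ ug(1,2)[of l]] ug(3) by blast+
  have un: "D10_norm (\<lambda>x. u k x - u l x) < (1 / 4) ^ j" if "k \<ge> j" "l \<ge> j" for j k l
    unfolding u_def by (intro N rN that)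
  have ge: "energy (\<lambda>x. g k x - g l x) \<le> ennreal ((1 / 16) ^ j)" if "k \<ge> j" "l \<ge> j" for j k l
  proof -
    have "(D10_norm (\<lambda>x. u k x - u l x))\<^sup>2 \<le> ((1 / 4) ^ j)\<^sup>2"
      using un[OF that] by (intro power_mono) (auto simp: D10_norm_nonneg)
    also have "((1 / 4 :: real) ^ j)\<^sup>2 = (1 / 16) ^ j"
      by (simp add: power_mult[symmetric] mult.commute[of j 2]) (simp add: power_mult power_divide)
    finally show ?thesis unfolding dif(3) by (rule ennreal_leI)
  qed
  \<comment> \<open>Subtracting the mean over the unit ball is what the Poincare inequality
    requires; it turns small energies of differences into small L^2 norms on every ball.\<close>
  define b where "b = (\<lambda>k. ball_avg 1 (u k) 0)"
  have bdiff: "ball_avg 1 (\<lambda>x. u k x - u l x) 0 = b k - b l" for k l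
    unfolding b_def ball_avg_def
    by (rule avg_diff[OF C1_grad_continuous_affine[OF ug(1)] C1_grad_continuous_affine[OF ug(1)]])
  define v where "v = (\<lambda>k x. u k x - b k)"
  have vg: "C1_grad (v k) (g k)" for k
    using C1_grad_diff[OF ug(1)[of k] C1_grad_const[of "b k"]] by (simp add: v_def)
  have [measurable]: "v k \<in> borel_measurable borel" "u k \<in> borel_measurable borel" "g k \<in> borel_measurable borel" for k
    using C1_grad_measurable[OF vg[of k]] C1_grad_measurable[OF ug(1)[of k]] by auto
  have vball: "\<exists>C\<ge>0. \<forall>j k l. k \<ge> j \<longrightarrow> l \<ge> j \<longrightarrow>
    (\<integral>\<^sup>+x. ennreal ((v k x - v l x)\<^sup>2) * indicator (cball 0 R) x \<partial>lborel) \<le> ennreal (C * (1 / 16) ^ j)" for R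
  proof -
    obtain C where C: "C \<ge> 0" "\<And>(w :: real ^ 'n \<Rightarrow> real) G. C1_grad w G \<Longrightarrow>
      (\<integral>\<^sup>+x. ennreal ((w x - ball_avg 1 w 0)\<^sup>2) * indicator (cball 0 R) x \<partial>lborel) \<le> ennreal C * energy G"
      using poincare[where 'n='n and R=R] by blast
    show ?thesis
    proof (intro exI[of _ C] conjI allI impI C(1))
      fix j k l :: nat assume jk: "j \<le> k" "j \<le> l"
      have "(\<integral>\<^sup>+x. ennreal ((v k x - v l x)\<^sup>2) * indicator (cball 0 R) x \<partial>lborel) =
         (\<integral>\<^sup>+x. ennreal ((u k x - u l x - ball_avg 1 (\<lambda>x. u k x - u l x) 0)\<^sup>2) * indicator (cball 0 R) x \<partial>lborel)"
        unfolding bdiff by (simp add: v_def algebra_simps)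
      also have "\<dots> \<le> ennreal C * energy (\<lambda>x. g k x - g l x)" by (rule C(2)[OF dif(1)])
      also have "\<dots> \<le> ennreal C * ennreal ((1 / 16) ^ j)" by (intro mult_left_mono ge jk) simp
      finally show "(\<integral>\<^sup>+x. ennreal ((v k x - v l x)\<^sup>2) * indicator (cball 0 R) x \<partial>lborel) \<le> ennreal (C * (1 / 16) ^ j)"
        using C(1) by (simp add: ennreal_mult)
    qed
  qed
  define F where "F = (\<lambda>x. lim (\<lambda>k. g k x))"
  define f0 where "f0 = (\<lambda>x. lim (\<lambda>k. v k x))"
  have [measurable]: "F \<in> borel_measurable borel" unfolding F_def by (rule borel_measurable_lim_metric) measurable
  have [measurable]: "f0 \<in> borel_measurable borel" unfolding f0_def by (rule borel_measurable_lim_metric) measurable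
  have "AE x in lborel. convergent (\<lambda>k. g k x)"
    by (rule AE_convergent_fast[where K=1]) (use ge[of _ "Suc _" _] in \<open>auto simp: energy_def\<close>)
  then have Flim: "AE x in lborel. (\<lambda>k. g k x) \<longlonglongrightarrow> F x"
    unfolding F_def by eventually_elim (simp add: convergent_LIMSEQ_iff)
  have "AE x in lborel. convergent (\<lambda>k. indicator (cball 0 (real m)) x * v k x)" for m
  proof -
    obtain C where C: "C \<ge> 0" "\<And>j k l. k \<ge> j \<Longrightarrow> l \<ge> j \<Longrightarrow>
      (\<integral>\<^sup>+x. ennreal ((v k x - v l x)\<^sup>2) * indicator (cball 0 (real m)) x \<partial>lborel) \<le> ennreal (C * (1 / 16) ^ j)"
      using vball[of "real m"] by blast
    show ?thesis
    proof (rule AE_convergent_fast[OF _ C(1)])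
      fix k
      have "(\<integral>\<^sup>+x. ennreal ((norm (indicator (cball 0 (real m)) x * v (Suc k) x - indicator (cball 0 (real m)) x * v k x))\<^sup>2) \<partial>lborel)
        = (\<integral>\<^sup>+x. ennreal ((v (Suc k) x - v k x)\<^sup>2) * indicator (cball 0 (real m)) x \<partial>lborel)"
        by (intro nn_integral_cong) (simp split: split_indicator)
      also have "\<dots> \<le> ennreal (C * (1 / 16) ^ k)" by (rule C(2)) auto
      finally show "(\<integral>\<^sup>+x. ennreal ((norm (indicator (cball 0 (real m)) x * v (Suc k) x - indicator (cball 0 (real m)) x * v k x))\<^sup>2) \<partial>lborel) \<le> ennreal (C * (1 / 16) ^ k)" .
    qed measurable
  qed
  then have "AE x in lborel. \<forall>m::nat. convergent (\<lambda>k. indicator (cball 0 (real m)) x * v k x)"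
    by (intro AE_all_countable[THEN iffD2]) blast
  then have f0lim: "AE x in lborel. (\<lambda>k. v k x) \<longlonglongrightarrow> f0 x"
  proof eventually_elim
    case (elim x)
    obtain m where "norm x \<le> real m" using real_arch_simple by blast
    then have "convergent (\<lambda>k. v k x)" using elim[rule_format, of m] by simp
    then show ?case by (simp add: f0_def convergent_LIMSEQ_iff)
  qed
  have gF: "energy (\<lambda>x. g k x - F x) \<le> ennreal ((1 / 16) ^ k)" for k
    unfolding energy_def
  proof (rule nn_fatou[where f="\<lambda>l x. ennreal ((norm (g k x - g l x))\<^sup>2)" and N=k])
    show "AE x in lborel. (\<lambda>l. ennreal ((norm (g k x - g l x))\<^sup>2)) \<longlonglongrightarrow> ennreal ((norm (g k x - F x))\<^sup>2)"
      using Flim by eventually_elim (intro tendsto_ennrealI tendsto_power tendsto_norm tendsto_diff tendsto_const)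
    show "\<And>l. k \<le> l \<Longrightarrow> (\<integral>\<^sup>+x. ennreal ((norm (g k x - g l x))\<^sup>2) \<partial>lborel) \<le> ennreal ((1 / 16) ^ k)"
      using ge[of k k] by (simp add: energy_def)
  qed measurable
  have vf: "(\<lambda>k. \<integral>\<^sup>+x. ennreal \<bar>v k x - f0 x\<bar> * indicator (cball 0 R) x \<partial>lborel) \<longlonglongrightarrow> 0" for R
  proof -
    obtain C where C: "C \<ge> 0" "\<And>j k l. k \<ge> j \<Longrightarrow> l \<ge> j \<Longrightarrow>
      (\<integral>\<^sup>+x. ennreal ((v k x - v l x)\<^sup>2) * indicator (cball 0 R) x \<partial>lborel) \<le> ennreal (C * (1 / 16) ^ j)"
      using vball[of R] by blast
    define s where "s = (\<lambda>k. sqrt C * (1 / 4) ^ k)"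
    have s: "s k \<ge> 0" "(s k)\<^sup>2 = C * (1 / 16) ^ k" for k
    proof -
      have "((1 / 4 :: real) ^ k)\<^sup>2 = (1 / 16) ^ k"
        by (simp add: power_mult[symmetric] mult.commute[of k 2]) (simp add: power_mult power_divide)
      then show "s k \<ge> 0" "(s k)\<^sup>2 = C * (1 / 16) ^ k" using C(1) by (auto simp: s_def power_mult_distrib)
    qed
    have le: "(\<integral>\<^sup>+x. ennreal \<bar>v k x - f0 x\<bar> * indicator (cball 0 R) x \<partial>lborel) \<le> ennreal (s k * sqrt (measure lborel (cball (0 :: real ^ 'n) R)))" for k
    proof (rule ball_L1_le_L2[OF _ s(1)])
      show "(\<integral>\<^sup>+x. ennreal ((v k x - f0 x)\<^sup>2) * indicator (cball 0 R) x \<partial>lborel) \<le> ennreal ((s k)\<^sup>2)"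
      proof (rule nn_fatou[where f="\<lambda>l x. ennreal ((v k x - v l x)\<^sup>2) * indicator (cball 0 R) x" and N=k])
        show "AE x in lborel. (\<lambda>l. ennreal ((v k x - v l x)\<^sup>2) * indicator (cball 0 R) x) \<longlonglongrightarrow> ennreal ((v k x - f0 x)\<^sup>2) * indicator (cball 0 R) x"
          using f0lim
        proof eventually_elim
          case (elim x)
          then have "(\<lambda>l. ennreal ((v k x - v l x)\<^sup>2)) \<longlonglongrightarrow> ennreal ((v k x - f0 x)\<^sup>2)"
            by (intro tendsto_ennrealI tendsto_power tendsto_diff tendsto_const)
          then show ?case by (cases "x \<in> cball 0 R") simp_all
        qed
        show "\<And>l. k \<le> l \<Longrightarrow> (\<integral>\<^sup>+x. ennreal ((v k x - v l x)\<^sup>2) * indicator (cball 0 R) x \<partial>lborel) \<le> ennreal ((s k)\<^sup>2)"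
          using C(2)[of k k] by (simp add: s(2))
      qed measurable
    qed measurable
    have "(\<lambda>k. ennreal (s k * sqrt (measure lborel (cball (0 :: real ^ 'n) R)))) \<longlonglongrightarrow> ennreal (sqrt C * 0 * sqrt (measure lborel (cball (0 :: real ^ 'n) R)))"
      unfolding s_def by (intro tendsto_ennrealI tendsto_mult tendsto_const LIMSEQ_power_zero) simp
    then show ?thesis by (intro ennreal_squeeze_0[OF _ le]) simp
  qed
  have f0li: "locally_integrable f0"
  proof (rule locally_integrable_from_cball)
    fix R
    obtain k where k: "(\<integral>\<^sup>+x. ennreal \<bar>v k x - f0 x\<bar> * indicator (cball 0 R) x \<partial>lborel) < 1"
      using order_tendstoD(2)[OF vf, of 1 R] by (auto simp: eventually_sequentially)
    have "set_integrable lborel (cball 0 R) (v k)"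
      by (intro locally_integrable_cball locally_integrable_continuous C1_grad_continuous[OF vg])
    then have "(\<integral>\<^sup>+x. ennreal \<bar>v k x\<bar> * indicator (cball 0 R) x \<partial>lborel) < \<infinity>"
      by (simp add: set_integrable_def integrable_iff_bounded abs_mult ennreal_mult ennreal_indicator mult.commute)
    then have "(\<integral>\<^sup>+x. ennreal \<bar>v k x\<bar> * indicator (cball 0 R) x \<partial>lborel) + (\<integral>\<^sup>+x. ennreal \<bar>v k x - f0 x\<bar> * indicator (cball 0 R) x \<partial>lborel) < \<infinity>"
      using k by (auto simp: less_top intro: less_trans)
    then have "(\<integral>\<^sup>+x. ennreal \<bar>v k x\<bar> * indicator (cball 0 R) x + ennreal \<bar>v k x - f0 x\<bar> * indicator (cball 0 R) x \<partial>lborel) < \<infinity>"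
      by (subst nn_integral_add) auto
    moreover have "(\<integral>\<^sup>+x. ennreal (norm (indicator (cball 0 R) x *\<^sub>R f0 x)) \<partial>lborel) \<le>
      (\<integral>\<^sup>+x. ennreal \<bar>v k x\<bar> * indicator (cball 0 R) x + ennreal \<bar>v k x - f0 x\<bar> * indicator (cball 0 R) x \<partial>lborel)"
    proof (rule nn_integral_mono)
      fix x
      have "ennreal \<bar>f0 x\<bar> \<le> ennreal (\<bar>v k x\<bar> + \<bar>v k x - f0 x\<bar>)" by (intro ennreal_leI) linarith
      then show "ennreal (norm (indicator (cball 0 R) x *\<^sub>R f0 x)) \<le> ennreal \<bar>v k x\<bar> * indicator (cball 0 R) x + ennreal \<bar>v k x - f0 x\<bar> * indicator (cball 0 R) x"
        by (simp split: split_indicator)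
    qed
    ultimately have "(\<integral>\<^sup>+x. ennreal (norm (indicator (cball 0 R) x *\<^sub>R f0 x)) \<partial>lborel) < \<infinity>" by (rule le_less_trans[rotated])
    then show "set_integrable lborel (cball 0 R) f0" by (simp add: set_integrable_def integrable_iff_bounded)
  qed simp
  have L2g: "L2field (g k)" for k using ug(2) by (subst L2field_energy) auto
  have "L2field (\<lambda>x. g 0 x - F x)" using gF[of 0] by (subst L2field_energy) (auto intro: le_less_trans)
  then have L2F: "L2field F" using L2field_diff[OF L2g[of 0], of "\<lambda>x. g 0 x - F x"] by simp
  have gFi: "(\<lambda>k. \<integral>\<^sup>+x. ennreal \<bar>g k x $ i - F x $ i\<bar> * indicator (cball 0 R) x \<partial>lborel) \<longlonglongrightarrow> 0" for i R
  proof -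
    have [measurable]: "(\<lambda>x. g k x $ i) \<in> borel_measurable borel" "(\<lambda>x. F x $ i) \<in> borel_measurable borel" for k
      using locally_integrable_measurable[OF locally_integrable_nth[OF L2field_locally_integrable[OF L2g]]]
        locally_integrable_measurable[OF locally_integrable_nth[OF L2field_locally_integrable[OF L2F]]] by auto
    have le: "(\<integral>\<^sup>+x. ennreal \<bar>g k x $ i - F x $ i\<bar> * indicator (cball 0 R) x \<partial>lborel) \<le> ennreal ((1 / 4) ^ k * sqrt (measure lborel (cball (0 :: real ^ 'n) R)))" for k
    proof (rule ball_L1_le_L2)
      have "(\<integral>\<^sup>+x. ennreal ((g k x $ i - F x $ i)\<^sup>2) * indicator (cball 0 R) x \<partial>lborel) \<le> energy (\<lambda>x. g k x - F x)"
        unfolding energy_def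
      proof (rule nn_integral_mono)
        fix x
        have "(g k x $ i - F x $ i)\<^sup>2 \<le> (norm (g k x - F x))\<^sup>2"
          using power_mono[OF component_le_norm_cart[of "g k x - F x" i], of 2] by simp
        then show "ennreal ((g k x $ i - F x $ i)\<^sup>2) * indicator (cball 0 R) x \<le> ennreal ((norm (g k x - F x))\<^sup>2)"
          by (simp add: ennreal_leI split: split_indicator)
      qed
      also have "\<dots> \<le> ennreal ((1 / 16) ^ k)" by (rule gF)
      also have "(1 / 16 :: real) ^ k = ((1 / 4) ^ k)\<^sup>2"
        by (simp add: power_mult[symmetric] mult.commute[of k 2]) (simp add: power_mult power_divide)
      finally show "(\<integral>\<^sup>+x. ennreal ((g k x $ i - F x $ i)\<^sup>2) * indicator (cball 0 R) x \<partial>lborel) \<le> ennreal (((1 / 4) ^ k)\<^sup>2)" .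
    qed auto
    have "(\<lambda>k. ennreal ((1 / 4) ^ k * sqrt (measure lborel (cball (0 :: real ^ 'n) R)))) \<longlonglongrightarrow> ennreal (0 * sqrt (measure lborel (cball (0 :: real ^ 'n) R)))"
      by (intro tendsto_ennrealI tendsto_mult tendsto_const LIMSEQ_power_zero) simp
    then show ?thesis by (intro ennreal_squeeze_0[OF _ le]) simp
  qed
  have f0F: "has_weak_gradient f0 F"
    unfolding has_weak_gradient_def
  proof (intro conjI allI impI f0li L2field_locally_integrable L2F)
    fix \<phi> :: "real ^ 'n \<Rightarrow> real" and i assume \<phi>: "test_function \<phi>"
    obtain R where R: "\<And>x. \<phi> x \<noteq> 0 \<Longrightarrow> norm x \<le> R" using test_functionE[OF \<phi>] by metis
    note c = test_function_C1_grad[OF \<phi>] and cp = test_function_C1_grad[OF test_function_partial_deriv[OF \<phi>]]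
    have RP: "norm x \<le> R" if "partial_deriv i \<phi> x \<noteq> 0" for x
      using C1_grad_support[OF c R, of x] C1_grad_partial[OF c, of i x] that by force
    have "(\<lambda>k. \<integral>x. v k x * partial_deriv i \<phi> x \<partial>lborel) \<longlonglongrightarrow> (\<integral>x. f0 x * partial_deriv i \<phi> x \<partial>lborel)"
      by (rule tendsto_ball_integral[OF locally_integrable_continuous[OF C1_grad_continuous[OF vg]] f0li C1_grad_continuous[OF cp] RP vf])
    then have l1: "(\<lambda>k. - (\<integral>x. g k x $ i * \<phi> x \<partial>lborel)) \<longlonglongrightarrow> (\<integral>x. f0 x * partial_deriv i \<phi> x \<partial>lborel)"
      using has_weak_gradient_C1[OF vg] \<phi> by (simp add: has_weak_gradient_def)
    have l2: "(\<lambda>k. \<integral>x. g k x $ i * \<phi> x \<partial>lborel) \<longlonglongrightarrow> (\<integral>x. F x $ i * \<phi> x \<partial>lborel)"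
      by (rule tendsto_ball_integral[OF locally_integrable_nth[OF L2field_locally_integrable[OF L2g]]
          locally_integrable_nth[OF L2field_locally_integrable[OF L2F]] C1_grad_continuous[OF c] R gFi])
    show "(\<integral>x. f0 x * partial_deriv i \<phi> x \<partial>lborel) = - (\<integral>x. F x $ i * \<phi> x \<partial>lborel)"
      by (rule LIMSEQ_unique[OF l1 tendsto_minus[OF l2]])
  qed
  \<comment> \<open>For n \<ge> 3 the means of the differences are bounded by the energies through
    \<open>ball_avg_bound\<close>, so no constant has to be removed.\<close>
  have bconv: "convergent b" if n: "CARD('n) \<ge> 3"
  proof (rule Cauchy_convergent, rule CauchyI)
    fix e :: real assume e: "e > 0"
    define K where "K = (1 / sqrt (measure lborel (cball (0 :: real ^ 'n) 1))) / (1 - 1 / sqrt 2)"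
    have "(\<lambda>j. K * (1 / 4) ^ j) \<longlonglongrightarrow> 0" by (intro tendsto_mult_right_zero LIMSEQ_power_zero) simp
    from LIMSEQ_D[OF this e] obtain j where "norm (K * (1 / 4) ^ j - 0) < e" by blast
    then have j: "K * (1 / 4) ^ j < e" by simp
    have "norm (b k - b l) < e" if "k \<ge> j" "l \<ge> j" for k l
    proof -
      have "energy (\<lambda>x. g k x - g l x) \<le> ennreal (((1 / 4) ^ j)\<^sup>2)"
        using ge[OF that] by (simp add: power_mult[symmetric] mult.commute[of j 2]) (simp add: power_mult power_divide)
      from ball_avg_bound[OF n dif(1) dif(2)[OF n] zero_less_one _ this, of 0]
      show ?thesis using j by (simp add: bdiff K_def)
    qed
    then show "\<exists>M. \<forall>m\<ge>M. \<forall>n\<ge>M. norm (b m - b n) < e" by blast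
  qed
  \<comment> \<open>For n \<ge> 3 the limit of the means is added back to \<open>f0\<close>; for n
    \<le> 2 the means may diverge and stay in \<open>c\<close>.\<close>
  define \<beta> where "\<beta> = (if CARD('n) \<ge> 3 then lim b else 0)"
  define c where "c = (if CARD('n) \<ge> 3 then (\<lambda>_. 0) else b)"
  define f where "f = (\<lambda>x. f0 x + \<beta>)"
  have delta: "(\<lambda>k. b k - c k - \<beta>) \<longlonglongrightarrow> 0"
    using bconv by (auto simp: c_def \<beta>_def convergent_LIMSEQ_iff LIM_zero_iff)
  have fF: "has_weak_gradient f F"
    using has_weak_gradient_add[OF f0F has_weak_gradient_C1[OF C1_grad_const[of \<beta>]]] by (simp add: f_def)
  have fD: "f \<in> D10"
  proof (rule D10I[OF fF L2F])
    assume n: "CARD('n) \<ge> 3"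
    let ?p = "2 * real CARD('n) / (real CARD('n) - 2)"
    have p: "?p > 0" using n by simp
    obtain C where C: "\<And>(w :: real ^ 'n \<Rightarrow> real) G D. C1_grad w G \<Longrightarrow> vanishing w \<Longrightarrow> D \<ge> 0 \<Longrightarrow>
      energy G \<le> ennreal (D\<^sup>2) \<Longrightarrow> (\<integral>\<^sup>+x. ennreal (\<bar>w x\<bar> powr ?p) \<partial>lborel) \<le> ennreal (C * D powr ?p)"
      using sobolev[OF n] by metis
    \<comment> \<open>The members of the subsequence differ from \<open>u 0\<close> by less than
      (1/4)^0 = 1, which bounds all norms and lets Fatou's lemma pass the Sobolev bound to the
      limit.\<close>
    define D where "D = D10_norm (u 0) + 1"
    have "(\<integral>\<^sup>+x. ennreal (\<bar>f x\<bar> powr ?p) \<partial>lborel) \<le> ennreal (C * D powr ?p)"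
    proof (rule nn_fatou[where f="\<lambda>l x. ennreal (\<bar>u l x\<bar> powr ?p)" and N=0])
      have "(\<lambda>k. b k) \<longlonglongrightarrow> \<beta>" using bconv[OF n] n by (simp add: \<beta>_def convergent_LIMSEQ_iff)
      then show "AE x in lborel. (\<lambda>l. ennreal (\<bar>u l x\<bar> powr ?p)) \<longlonglongrightarrow> ennreal (\<bar>f x\<bar> powr ?p)"
        using f0lim
      proof (elim eventually_mono)
        fix x assume "b \<longlonglongrightarrow> \<beta>" "(\<lambda>k. v k x) \<longlonglongrightarrow> f0 x"
        from tendsto_add[OF this(2) this(1)] have "(\<lambda>k. u k x) \<longlonglongrightarrow> f x" by (simp add: v_def f_def)
        then show "(\<lambda>l. ennreal (\<bar>u l x\<bar> powr ?p)) \<longlonglongrightarrow> ennreal (\<bar>f x\<bar> powr ?p)"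
          using p by (intro tendsto_ennrealI tendsto_powr' tendsto_rabs tendsto_const) auto
      qed
      fix l
      have "D10_norm (u l) \<le> D10_norm (\<lambda>x. u l x - u 0 x) + D10_norm (u 0)"
        using D10_norm_triangle[OF D10_diff[OF uD uD] uD, of l 0 0] by simp
      also have "\<dots> \<le> D" using un[of 0 l 0] by (simp add: D_def)
      finally have "(D10_norm (u l))\<^sup>2 \<le> D\<^sup>2" by (intro power_mono) (auto simp: D10_norm_nonneg)
      then have "energy (g l) \<le> ennreal (D\<^sup>2)" using D10_C1_energy(3)[OF ug] by (simp add: ennreal_leI)
      then show "(\<integral>\<^sup>+x. ennreal (\<bar>u l x\<bar> powr ?p) \<partial>lborel) \<le> ennreal (C * D powr ?p)"
        by (intro C[OF ug(1) ug(3)[OF n]]) (auto simp: D_def D10_norm_nonneg)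
    qed measurable
    then show "(\<integral>\<^sup>+x. ennreal (\<bar>f x\<bar> powr ?p) \<partial>lborel) < \<infinity>" by (auto intro: le_less_trans)
  qed
  have uf: "D10_norm (\<lambda>x. u k x - f x) \<le> (1 / 4) ^ k" for k
  proof (rule power2_le_imp_le)
    have "has_weak_gradient (\<lambda>x. u k x - f x) (\<lambda>x. g k x - F x)"
      using has_weak_gradient_add[OF has_weak_gradient_C1[OF ug(1)[of k]] has_weak_gradient_cmult[OF fF, of "-1"]] by simp
    from D10_norm_energy[OF D10_diff[OF uD fD] this] gF[of k]
    have "(D10_norm (\<lambda>x. u k x - f x))\<^sup>2 \<le> (1 / 16) ^ k" by simp
    then show "(D10_norm (\<lambda>x. u k x - f x))\<^sup>2 \<le> ((1 / 4) ^ k)\<^sup>2"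
      by (simp add: power_mult[symmetric] mult.commute[of k 2]) (simp add: power_mult power_divide)
  qed simp
  have "(\<lambda>k. D10_norm (\<lambda>x. w k x - f x)) \<longlonglongrightarrow> 0"
  proof (rule LIMSEQ_I)
    fix e :: real assume e: "e > 0"
    obtain M where M: "\<And>k l. k \<ge> M \<Longrightarrow> l \<ge> M \<Longrightarrow> D10_norm (\<lambda>x. w k x - w l x) < e / 2"
      using cauchy[of "e / 2"] e by auto
    have "(\<lambda>k. (1 / 4 :: real) ^ k) \<longlonglongrightarrow> 0" by (intro LIMSEQ_power_zero) simp
    from LIMSEQ_D[OF this, of "e / 2"] e obtain j where j: "\<And>k. k \<ge> j \<Longrightarrow> (1 / 4 :: real) ^ k < e / 2" by auto
    \<comment> \<open>Large enough both for the subsequence to be close to \<open>f\<close> and for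
      \<open>r i\<close> to lie in the Cauchy range of the whole sequence.\<close>
    define i where "i = max j M"
    have ri: "r i \<ge> M" using strict_mono_imp_increasing[OF rmono, of i] by (simp add: i_def)
    have "norm (D10_norm (\<lambda>x. w k x - f x) - 0) < e" if "k \<ge> M" for k
    proof -
      have "D10_norm (\<lambda>x. w k x - f x) \<le> D10_norm (\<lambda>x. w k x - u i x) + D10_norm (\<lambda>x. u i x - f x)"
        by (rule D10_norm_triangle_diff[OF wD uD fD])
      also have "\<dots> < e / 2 + e / 2"
        using M[OF that ri] uf[of i] j[of i] by (simp add: u_def i_def)
      finally show ?thesis by (simp add: D10_norm_nonneg)
    qed
    then show "\<exists>no. \<forall>k\<ge>no. norm (D10_norm (\<lambda>x. w k x - f x) - 0) < e" by blast
  qed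
  moreover have "(\<lambda>k. \<integral>\<^sup>+x. ennreal \<bar>w (r k) x - c k - f x\<bar> * indicator (cball 0 R) x \<partial>lborel) \<longlonglongrightarrow> 0" for R
  proof -
    let ?m = "measure lborel (cball (0 :: real ^ 'n) R)"
    have "(\<lambda>k. (\<integral>\<^sup>+x. ennreal \<bar>v k x - f0 x\<bar> * indicator (cball 0 R) x \<partial>lborel) + ennreal (\<bar>b k - c k - \<beta>\<bar> * ?m)) \<longlonglongrightarrow> 0 + ennreal (0 * ?m)"
      by (intro tendsto_add vf tendsto_ennrealI tendsto_mult tendsto_const tendsto_rabs_zero delta)
    then have lim: "(\<lambda>k. (\<integral>\<^sup>+x. ennreal \<bar>v k x - f0 x\<bar> * indicator (cball 0 R) x \<partial>lborel) + ennreal (\<bar>b k - c k - \<beta>\<bar> * ?m)) \<longlonglongrightarrow> 0" by simp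
    have le: "(\<integral>\<^sup>+x. ennreal \<bar>w (r k) x - c k - f x\<bar> * indicator (cball 0 R) x \<partial>lborel) \<le>
      (\<integral>\<^sup>+x. ennreal \<bar>v k x - f0 x\<bar> * indicator (cball 0 R) x \<partial>lborel) + ennreal (\<bar>b k - c k - \<beta>\<bar> * ?m)" for k
    proof -
      have "(\<integral>\<^sup>+x. ennreal \<bar>w (r k) x - c k - f x\<bar> * indicator (cball 0 R) x \<partial>lborel) \<le>
        (\<integral>\<^sup>+x. ennreal \<bar>v k x - f0 x\<bar> * indicator (cball 0 R) x + ennreal \<bar>b k - c k - \<beta>\<bar> * indicator (cball 0 R) x \<partial>lborel)"
      proof (rule nn_integral_mono)
        fix x
        have "w (r k) x - c k - f x = (v k x - f0 x) + (b k - c k - \<beta>)" by (simp add: v_def u_def f_def)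
        then have "ennreal \<bar>w (r k) x - c k - f x\<bar> \<le> ennreal (\<bar>v k x - f0 x\<bar> + \<bar>b k - c k - \<beta>\<bar>)"
          by (simp add: ennreal_leI del: ennreal_plus)
        then show "ennreal \<bar>w (r k) x - c k - f x\<bar> * indicator (cball 0 R) x \<le> ennreal \<bar>v k x - f0 x\<bar> * indicator (cball 0 R) x + ennreal \<bar>b k - c k - \<beta>\<bar> * indicator (cball 0 R) x"
          by (simp split: split_indicator)
      qed
      also have "\<dots> = (\<integral>\<^sup>+x. ennreal \<bar>v k x - f0 x\<bar> * indicator (cball 0 R) x \<partial>lborel) + ennreal (\<bar>b k - c k - \<beta>\<bar> * ?m)"
        by (simp add: nn_integral_add nn_integral_cmult emeasure_unit_cball ennreal_mult)
      finally show ?thesis .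
    qed
    show ?thesis by (rule ennreal_squeeze_0[OF lim le])
  qed
  ultimately show ?thesis
    using fD rmono by (intro exI[of _ f] exI[of _ r] exI[of _ c]) (simp add: c_def)
qed

text \<open>Each term is replaced by a mollification within 1/(k + 1); the new sequence is Cauchy in
  \<open>D10_C1\<close> and has the same limit.\<close>

lemma D10_complete:
  fixes f :: "nat \<Rightarrow> real ^ 'n::finite \<Rightarrow> real"
  assumes f: "\<And>k. f k \<in> D10"
    and cauchy: "\<And>e. e > 0 \<Longrightarrow> \<exists>N. \<forall>k\<ge>N. \<forall>l\<ge>N. D10_norm (\<lambda>x. f k x - f l x) < e"
  shows "\<exists>g\<in>D10. (\<lambda>k. D10_norm (\<lambda>x. f k x - g x)) \<longlonglongrightarrow> 0"
proof -
  have "\<forall>k. \<exists>j. D10_norm (\<lambda>x. conv (f k) (mol j) x - f k x) < 1 / real (Suc k)"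
  proof
    fix k
    show "\<exists>j. D10_norm (\<lambda>x. conv (f k) (mol j) x - f k x) < 1 / real (Suc k)"
      using order_tendstoD(2)[OF mollify_D10(3)[OF f[of k]], of "1 / real (Suc k)"]
      by (auto simp: eventually_sequentially)
  qed
  then obtain j where j: "\<And>k. D10_norm (\<lambda>x. conv (f k) (mol (j k)) x - f k x) < 1 / real (Suc k)" by metis
  define w where "w = (\<lambda>k. conv (f k) (mol (j k)))"
  have wD: "w k \<in> D10" "w k \<in> D10_C1" for k unfolding w_def using mollify_D10[OF f] by auto
  have wf: "D10_norm (\<lambda>x. w k x - f k x) < 1 / real (Suc k)" for k using j by (simp add: w_def)
  have small: "\<exists>N. \<forall>k\<ge>N. 1 / real (Suc k) < e" if "e > 0" for e
    using order_tendstoD(2)[OF LIMSEQ_inverse_real_of_nat that] by (simp add: eventually_sequentially inverse_eq_divide)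
  have cw: "\<exists>N. \<forall>k\<ge>N. \<forall>l\<ge>N. D10_norm (\<lambda>x. w k x - w l x) < e" if e: "e > 0" for e
  proof -
    obtain N where N: "\<And>k l. k \<ge> N \<Longrightarrow> l \<ge> N \<Longrightarrow> D10_norm (\<lambda>x. f k x - f l x) < e / 3"
      using cauchy[of "e / 3"] e by auto
    obtain M where M: "\<And>k. k \<ge> M \<Longrightarrow> 1 / real (Suc k) < e / 3" using small[of "e / 3"] e by auto
    have "D10_norm (\<lambda>x. w k x - w l x) < e" if "k \<ge> max N M" "l \<ge> max N M" for k l
    proof -
      have "D10_norm (\<lambda>x. w k x - w l x) \<le> D10_norm (\<lambda>x. w k x - f k x) + D10_norm (\<lambda>x. f k x - w l x)"
        by (rule D10_norm_triangle_diff[OF wD(1) f wD(1)])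
      also have "D10_norm (\<lambda>x. f k x - w l x) \<le> D10_norm (\<lambda>x. f k x - f l x) + D10_norm (\<lambda>x. f l x - w l x)"
        by (rule D10_norm_triangle_diff[OF f f wD(1)])
      also have "D10_norm (\<lambda>x. f l x - w l x) = D10_norm (\<lambda>x. w l x - f l x)"
        by (rule D10_norm_minus_commute[OF f wD(1)])
      finally show ?thesis
        using wf[of k] wf[of l] N[of k l] M[of k] M[of l] that by simp
    qed
    then show ?thesis by blast
  qed
  obtain g where g: "g \<in> D10" "(\<lambda>k. D10_norm (\<lambda>x. w k x - g x)) \<longlonglongrightarrow> 0"
    using D10_C1_complete[OF wD(2) cw] by blast
  have "(\<lambda>k. 1 / real (Suc k) + D10_norm (\<lambda>x. w k x - g x)) \<longlonglongrightarrow> 0 + 0"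
    using LIMSEQ_inverse_real_of_nat by (intro tendsto_add g) (simp add: inverse_eq_divide)
  then have lim: "(\<lambda>k. 1 / real (Suc k) + D10_norm (\<lambda>x. w k x - g x)) \<longlonglongrightarrow> 0" by simp
  have le: "D10_norm (\<lambda>x. f k x - g x) \<le> 1 / real (Suc k) + D10_norm (\<lambda>x. w k x - g x)" for k
    using D10_norm_triangle_diff[OF f wD(1) g(1), of k k] wf[of k] D10_norm_minus_commute[OF f wD(1), of k k] by simp
  have "(\<lambda>k. D10_norm (\<lambda>x. f k x - g x)) \<longlonglongrightarrow> 0"
    by (rule tendsto_sandwich[OF always_eventually always_eventually tendsto_const lim]) (intro allI le D10_norm_nonneg)+
  then show ?thesis using g(1) by blast
qed

section \<open>Bounded functionals, quadratic minimisation and the Riesz theorem\<close>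

lemma Dm1D:
  fixes u :: "(real ^ 'n::finite \<Rightarrow> real) \<Rightarrow> real"
  assumes "u \<in> Dm1"
  shows "f \<in> D10 \<Longrightarrow> g \<in> D10 \<Longrightarrow> u (\<lambda>x. f x + g x) = u f + u g"
    "f \<in> D10 \<Longrightarrow> u (\<lambda>x. c * f x) = c * u f" "f \<notin> D10 \<Longrightarrow> u f = 0"
    "f \<in> D10 \<Longrightarrow> g \<in> D10 \<Longrightarrow> u (\<lambda>x. f x - g x) = u f - u g"
    "\<exists>C\<ge>0. \<forall>f\<in>D10. \<bar>u f\<bar> \<le> C * D10_norm f"
proof -
  show a: "f \<in> D10 \<Longrightarrow> g \<in> D10 \<Longrightarrow> u (\<lambda>x. f x + g x) = u f + u g" for f g
    using assms unfolding Dm1_def by blast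
  show b: "f \<in> D10 \<Longrightarrow> u (\<lambda>x. c * f x) = c * u f" for f c
    using assms unfolding Dm1_def by blast
  show "f \<notin> D10 \<Longrightarrow> u f = 0" using assms unfolding Dm1_def by blast
  show "f \<in> D10 \<Longrightarrow> g \<in> D10 \<Longrightarrow> u (\<lambda>x. f x - g x) = u f - u g"
    using a[of f "\<lambda>x. (-1) * g x"] b[of g "-1"] D10_cmult[of g "-1"] by simp
  obtain C where C: "\<forall>f\<in>D10. \<bar>u f\<bar> \<le> C * D10_norm f" using assms unfolding Dm1_def by blast
  show "\<exists>C\<ge>0. \<forall>f\<in>D10. \<bar>u f\<bar> \<le> C * D10_norm f"
  proof (intro exI[of _ "\<bar>C\<bar>"] conjI ballI)
    fix f :: "real ^ 'n \<Rightarrow> real" assume "f \<in> D10"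
    then have "\<bar>u f\<bar> \<le> C * D10_norm f" using C by blast
    also have "\<dots> \<le> \<bar>C\<bar> * D10_norm f" by (intro mult_right_mono) (auto simp: D10_norm_nonneg)
    finally show "\<bar>u f\<bar> \<le> \<bar>C\<bar> * D10_norm f" .
  qed simp
qed

lemma Dm1_continuous:
  assumes u: "u \<in> Dm1" and f: "\<And>k. f k \<in> D10" and g: "g \<in> D10"
    and lim: "(\<lambda>k. D10_norm (\<lambda>x. f k x - g x)) \<longlonglongrightarrow> 0"
  shows "(\<lambda>k. u (f k)) \<longlonglongrightarrow> u g"
proof -
  obtain C where C: "\<forall>f\<in>D10. \<bar>u f\<bar> \<le> C * D10_norm f" using Dm1D(5)[OF u] by blast
  have "(\<lambda>k. u (f k) - u g) \<longlonglongrightarrow> 0"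
  proof (rule Lim_null_comparison)
    show "eventually (\<lambda>k. norm (u (f k) - u g) \<le> C * D10_norm (\<lambda>x. f k x - g x)) sequentially"
      using C D10_diff[OF f g] by (auto intro!: always_eventually simp: Dm1D(4)[OF u f g, symmetric])
    show "(\<lambda>k. C * D10_norm (\<lambda>x. f k x - g x)) \<longlonglongrightarrow> 0" by (intro tendsto_mult_right_zero lim)
  qed
  then show ?thesis by (simp add: LIM_zero_iff)
qed

lemma Dm1_diff:
  fixes u v :: "(real ^ 'n::finite \<Rightarrow> real) \<Rightarrow> real"
  assumes u: "u \<in> Dm1" and v: "v \<in> Dm1"
  shows "(\<lambda>f. a * u f + b * v f) \<in> Dm1"
  unfolding Dm1_def
proof (intro CollectI conjI ballI allI impI)
  obtain C where C: "\<forall>f\<in>D10. \<bar>u f\<bar> \<le> C * D10_norm f" using Dm1D(5)[OF u] by blast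
  obtain E where E: "\<forall>f\<in>D10. \<bar>v f\<bar> \<le> E * D10_norm f" using Dm1D(5)[OF v] by blast
  show "\<exists>C. \<forall>f\<in>D10. \<bar>a * u f + b * v f\<bar> \<le> C * D10_norm f"
  proof (intro exI[of _ "\<bar>a\<bar> * C + \<bar>b\<bar> * E"] ballI)
    fix f :: "real ^ 'n \<Rightarrow> real" assume f: "f \<in> D10"
    have "\<bar>a * u f + b * v f\<bar> \<le> \<bar>a\<bar> * \<bar>u f\<bar> + \<bar>b\<bar> * \<bar>v f\<bar>"
      by (metis abs_mult abs_triangle_ineq)
    also have "\<dots> \<le> \<bar>a\<bar> * (C * D10_norm f) + \<bar>b\<bar> * (E * D10_norm f)"
      using C E f by (intro add_mono mult_left_mono) auto
    finally show "\<bar>a * u f + b * v f\<bar> \<le> (\<bar>a\<bar> * C + \<bar>b\<bar> * E) * D10_norm f" by (simp add: algebra_simps)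
  qed
qed (use Dm1D[OF u] Dm1D[OF v] in \<open>simp_all add: algebra_simps\<close>)

lemma neg_laplacian_Dm1:
  fixes f :: "real ^ 'n::finite \<Rightarrow> real"
  assumes f: "f \<in> D10" shows "neg_laplacian f \<in> Dm1"
  unfolding Dm1_def
proof (intro CollectI conjI ballI allI impI)
  show "\<exists>C. \<forall>g\<in>D10. \<bar>neg_laplacian f g\<bar> \<le> C * D10_norm g"
    using D10_cauchy_schwarz[OF f] by (intro exI[of _ "D10_norm f"]) (auto simp: neg_laplacian_def)
  fix g h :: "real ^ 'n \<Rightarrow> real" assume g: "g \<in> D10" and h: "h \<in> D10"
  show "neg_laplacian f (\<lambda>x. g x + h x) = neg_laplacian f g + neg_laplacian f h"
    using D10_inner_add[OF g h f] D10_add[OF g h] g h by (simp add: neg_laplacian_def D10_inner_commute)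
next
  fix g :: "real ^ 'n \<Rightarrow> real" and c assume g: "g \<in> D10"
  show "neg_laplacian f (\<lambda>x. c * g x) = c * neg_laplacian f g"
    using D10_inner_cmult[OF g f] D10_cmult[OF g] g by (simp add: neg_laplacian_def D10_inner_commute)
qed (simp add: neg_laplacian_def)

text \<open>Up to a constant the squared distance of \<open>f\<close> from the Riesz representative
  of \<open>l\<close>. In this form it can be minimised before the representative is known, which
  serves both the Riesz theorem and the projection onto divergences.\<close>

definition quad :: "((real ^ 'n::finite \<Rightarrow> real) \<Rightarrow> real) \<Rightarrow> (real ^ 'n \<Rightarrow> real) \<Rightarrow> real" where
  "quad l f = (D10_norm f)\<^sup>2 - 2 * l f"

lemma quad_bounded_below:
  assumes "l \<in> Dm1" shows "\<exists>m. \<forall>f\<in>D10. m \<le> quad l f"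
proof -
  obtain C where C: "\<forall>f\<in>D10. \<bar>l f\<bar> \<le> C * D10_norm f" using Dm1D(5)[OF assms] by blast
  have "- C\<^sup>2 \<le> quad l f" if "f \<in> D10" for f
  proof -
    have "2 * l f \<le> 2 * (C * D10_norm f)" using C that by fastforce
    moreover have "2 * C * D10_norm f \<le> C\<^sup>2 + (D10_norm f)\<^sup>2" by (rule sum_squares_bound)
    ultimately show ?thesis by (simp add: quad_def)
  qed
  then show ?thesis by blast
qed

text \<open>The linear part cancels against the midpoint, so this is the parallelogram law; it makes
  minimising sequences over any midpoint-convex set Cauchy.\<close>

lemma quad_parallelogram:
  assumes l: "l \<in> Dm1" and f: "f \<in> D10" and g: "g \<in> D10"
  shows "(D10_norm (\<lambda>x. f x - g x))\<^sup>2 = 2 * quad l f + 2 * quad l g - 4 * quad l (\<lambda>x. (1 / 2) * (f x + g x))"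
proof -
  have 1: "(D10_norm (\<lambda>x. f x - g x))\<^sup>2 = (D10_norm f)\<^sup>2 - 2 * D10_inner f g + (D10_norm g)\<^sup>2"
    using D10_norm_sq_add[OF f g, of "-1"] by simp
  have "(D10_norm (\<lambda>x. (1 / 2) * (f x + g x)))\<^sup>2 = (1 / 4) * (D10_norm (\<lambda>x. f x + g x))\<^sup>2"
    unfolding D10_norm_cmult[OF D10_add[OF f g]] by (simp add: power_mult_distrib power_divide)
  also have "(D10_norm (\<lambda>x. f x + g x))\<^sup>2 = (D10_norm f)\<^sup>2 + 2 * D10_inner f g + (D10_norm g)\<^sup>2"
    using D10_norm_sq_add[OF f g, of 1] by simp
  finally show ?thesis
    unfolding quad_def 1 using Dm1D(2)[OF l D10_add[OF f g], of "1 / 2"] Dm1D(1)[OF l f g]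
    by (simp add: field_simps)
qed

lemma D10_norm_continuous:
  assumes f: "\<And>k. f k \<in> D10" and g: "g \<in> D10"
    and lim: "(\<lambda>k. D10_norm (\<lambda>x. f k x - g x)) \<longlonglongrightarrow> 0"
  shows "(\<lambda>k. D10_norm (f k)) \<longlonglongrightarrow> D10_norm g"
proof -
  have "(\<lambda>k. D10_norm (f k) - D10_norm g) \<longlonglongrightarrow> 0"
  proof (rule Lim_null_comparison[OF always_eventually lim], rule allI)
    fix k
    have "D10_norm (f k) \<le> D10_norm (\<lambda>x. f k x - g x) + D10_norm g"
      using D10_norm_triangle[OF D10_diff[OF f g] g, of k] by simp
    moreover have "D10_norm g \<le> D10_norm (\<lambda>x. g x - f k x) + D10_norm (f k)"
      using D10_norm_triangle[OF D10_diff[OF g f] f, of k k] by simp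
    ultimately show "norm (D10_norm (f k) - D10_norm g) \<le> D10_norm (\<lambda>x. f k x - g x)"
      using D10_norm_minus_commute[OF f g, of k] by simp
  qed
  then show ?thesis by (simp add: LIM_zero_iff)
qed

lemma quad_continuous:
  assumes l: "l \<in> Dm1" and f: "\<And>k. f k \<in> D10" and g: "g \<in> D10"
    and lim: "(\<lambda>k. D10_norm (\<lambda>x. f k x - g x)) \<longlonglongrightarrow> 0"
  shows "(\<lambda>k. quad l (f k)) \<longlonglongrightarrow> quad l g"
  unfolding quad_def
  by (intro tendsto_diff tendsto_power tendsto_mult tendsto_const D10_norm_continuous[OF f g lim] Dm1_continuous[OF l f g lim])

text \<open>Only 0 < t \<le> 1 is tested, so the first variation applies at a minimum over a convex
  set, with \<open>d\<close> pointing into the set, and not only over the whole space.\<close>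

lemma quad_variation:
  assumes l: "l \<in> Dm1" and f: "f \<in> D10" and d: "d \<in> D10"
    and min: "\<And>t. 0 < t \<Longrightarrow> t \<le> 1 \<Longrightarrow> quad l f \<le> quad l (\<lambda>x. f x + t * d x)"
  shows "l d \<le> D10_inner f d"
proof (rule ccontr)
  assume "\<not> l d \<le> D10_inner f d"
  then have a: "l d - D10_inner f d > 0" by simp
  define a where "a = l d - D10_inner f d"
  \<comment> \<open>The 1 keeps the denominator of \<open>t\<close> positive when \<open>d\<close>
    has norm 0 and yields the strict inequality below.\<close>
  define b where "b = (D10_norm d)\<^sup>2 + 1"
  have b: "b > 0" by (simp add: b_def add_nonneg_pos)
  define t where "t = min 1 (a / b)"
  have t: "0 < t" "t \<le> 1" "t * b \<le> a" using a b by (auto simp: t_def a_def min_def field_simps)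
  have "quad l (\<lambda>x. f x + t * d x) = quad l f - 2 * t * a + t\<^sup>2 * (D10_norm d)\<^sup>2"
    unfolding quad_def D10_norm_sq_add[OF f d]
    using Dm1D(1)[OF l f D10_cmult[OF d], of t] Dm1D(2)[OF l d, of t] by (simp add: a_def algebra_simps)
  with min[OF t(1,2)] have "2 * t * a \<le> t\<^sup>2 * (D10_norm d)\<^sup>2" by simp
  also have "\<dots> < t\<^sup>2 * b" using t(1) by (simp add: b_def)
  also have "\<dots> = t * (t * b)" by (simp add: power2_eq_square)
  also have "\<dots> \<le> t * a" using t by (intro mult_left_mono) auto
  finally have "t * a < 0" by (simp add: mult.commute)
  then show False using t(1) a by (simp add: a_def mult_less_0_iff)
qed

text \<open>Dirichlet's principle: minimise \<open>quad l\<close> over all of \<open>D10\<close>,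
  using completeness. The one-sided variational inequality for \<open>d\<close> and for its negative
  gives equality.\<close>

lemma riesz:
  fixes l :: "(real ^ 'n::finite \<Rightarrow> real) \<Rightarrow> real"
  assumes l: "l \<in> Dm1" shows "\<exists>f\<in>D10. neg_laplacian f = l"
proof -
  have D10_0: "(\<lambda>_. 0) \<in> (D10 :: (real ^ 'n \<Rightarrow> real) set)"
    using compact_support_D10(1)[OF C1_grad_const[of 0]] by simp
  obtain m0 where m0: "\<And>f. f \<in> D10 \<Longrightarrow> m0 \<le> quad l f" using quad_bounded_below[OF l] by blast
  define m where "m = Inf (quad l ` D10)"
  have bdd: "bdd_below (quad l ` D10)" using m0 by (auto simp: bdd_below_def)
  have m: "m \<le> quad l f" if "f \<in> D10" for f unfolding m_def using that bdd by (intro cInf_lower) auto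
  have "\<exists>f\<in>D10. quad l f < m + 1 / real (Suc k)" for k
  proof -
    have "quad l ` D10 \<noteq> {}" using D10_0 by blast
    from cInf_lessD[OF this, of "m + 1 / real (Suc k)"] show ?thesis by (auto simp: m_def)
  qed
  then obtain f where f: "\<And>k. f k \<in> D10" "\<And>k. quad l (f k) < m + 1 / real (Suc k)" by metis
  have cf: "\<exists>N. \<forall>k\<ge>N. \<forall>i\<ge>N. D10_norm (\<lambda>x. f k x - f i x) < e" if e: "e > 0" for e
  proof -
    \<comment> \<open>In the parallelogram law the two excesses enter with factor 2 each, so 4 times
      the tolerance has to stay below e^2.\<close>
    obtain N where N: "1 / real (Suc N) < e\<^sup>2 / 4" using nat_approx_posE[of "e\<^sup>2 / 4"] e by auto
    have "D10_norm (\<lambda>x. f k x - f i x) < e" if "k \<ge> N" "i \<ge> N" for k i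
    proof -
      have "(D10_norm (\<lambda>x. f k x - f i x))\<^sup>2 = 2 * quad l (f k) + 2 * quad l (f i) - 4 * quad l (\<lambda>x. (1 / 2) * (f k x + f i x))"
        by (rule quad_parallelogram[OF l f(1) f(1)])
      also have "\<dots> \<le> 2 * (m + 1 / real (Suc k)) + 2 * (m + 1 / real (Suc i)) - 4 * m"
      proof -
        define q where "q = quad l (\<lambda>x. (1 / 2) * (f k x + f i x))"
        have "m \<le> q" unfolding q_def by (intro m D10_cmult D10_add f)
        moreover have "2 * x + 2 * y - 4 * z \<le> 2 * (m + p) + 2 * (m + s) - 4 * m"
          if "x < m + p" "y < m + s" "m \<le> z" for x y z p s :: real
          using that by (intro diff_mono add_mono mult_left_mono) auto
        ultimately show ?thesis using f(2)[of k] f(2)[of i] unfolding q_def[symmetric] by blast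
      qed
      also have "\<dots> = 2 / real (Suc k) + 2 / real (Suc i)" by simp
      also have "\<dots> \<le> 2 / real (Suc N) + 2 / real (Suc N)" using that by (intro add_mono divide_left_mono) auto
      also have "\<dots> < e\<^sup>2" using N by simp
      finally show ?thesis using e by (simp add: power2_less_imp_less)
    qed
    then show ?thesis by blast
  qed
  obtain g where g: "g \<in> D10" "(\<lambda>k. D10_norm (\<lambda>x. f k x - g x)) \<longlonglongrightarrow> 0"
    using D10_complete[OF f(1) cf] by blast
  have "quad l g \<le> m"
  proof (rule LIMSEQ_le[OF quad_continuous[OF l f(1) g]])
    show "(\<lambda>k. m + 1 / real (Suc k)) \<longlonglongrightarrow> m"
      using tendsto_add[OF tendsto_const[of m] LIMSEQ_inverse_real_of_nat] by (simp add: inverse_eq_divide)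
    show "\<exists>N. \<forall>n\<ge>N. quad l (f n) \<le> m + 1 / real (Suc n)" using f(2) less_imp_le by blast
  qed
  then have gmin: "quad l g \<le> quad l h" if "h \<in> D10" for h using m[OF that] by simp
  have le: "l d \<le> D10_inner g d" if "d \<in> D10" for d
    by (rule quad_variation[OF l g(1) that]) (intro gmin D10_add g(1) D10_cmult that)
  have "l d = D10_inner g d" if d: "d \<in> D10" for d
    using le[OF d] le[OF D10_cmult[OF d, of "-1"]] Dm1D(2)[OF l d, of "-1"] D10_inner_cmult[OF d g(1), of "-1"]
    by (simp add: D10_inner_commute)
  then have "neg_laplacian g = l"
    using Dm1D(3)[OF l] by (auto simp: neg_laplacian_def fun_eq_iff)
  then show ?thesis using g(1) by blast
qed

lemma neg_laplacian_inv:
  assumes "l \<in> Dm1"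
  shows "inv_into D10 neg_laplacian l \<in> D10" "neg_laplacian (inv_into D10 neg_laplacian l) = l"
proof -
  have "l \<in> neg_laplacian ` D10" using riesz[OF assms] by blast
  then show "inv_into D10 neg_laplacian l \<in> D10" "neg_laplacian (inv_into D10 neg_laplacian l) = l"
    by (rule inv_into_into, rule f_inv_into_f)
qed

subsection \<open>Total variation\<close>

definition unit_fields :: "(real ^ 'n::finite \<Rightarrow> real ^ 'n) set" where
  "unit_fields = {\<phi>. test_field \<phi> \<and> (AE x in lborel. norm (\<phi> x) \<le> 1)}"

lemma TV_upper: "\<phi> \<in> unit_fields \<Longrightarrow> ereal (u (divergence \<phi>)) \<le> TV u"
  unfolding TV_def unit_fields_def by (rule SUP_upper)

lemma TV_least: "(\<And>\<phi>. \<phi> \<in> unit_fields \<Longrightarrow> ereal (u (divergence \<phi>)) \<le> c) \<Longrightarrow> TV u \<le> c"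
  unfolding TV_def unit_fields_def by (rule SUP_least)

lemma test_field_C1_grad:
  "test_field \<phi> \<Longrightarrow> C1_grad (\<lambda>x. \<phi> x $ i) (gradient (\<lambda>x. \<phi> x $ i))"
  by (simp add: test_field_def test_function_C1_grad)

lemma test_field_combination:
  fixes \<phi> \<psi> :: "real ^ 'n::finite \<Rightarrow> real ^ 'n"
  assumes "test_field \<phi>" "test_field \<psi>"
  shows "test_field (\<lambda>x. a *\<^sub>R \<phi> x + b *\<^sub>R \<psi> x)"
    "divergence (\<lambda>x. a *\<^sub>R \<phi> x + b *\<^sub>R \<psi> x) = (\<lambda>x. a * divergence \<phi> x + b * divergence \<psi> x)"
proof -
  show "test_field (\<lambda>x. a *\<^sub>R \<phi> x + b *\<^sub>R \<psi> x)"
    using assms by (auto simp: test_field_def intro!: test_function_add test_function_cmult)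
  have "C1_grad (\<lambda>x. (a *\<^sub>R \<phi> x + b *\<^sub>R \<psi> x) $ i)
      (\<lambda>x. a *\<^sub>R gradient (\<lambda>x. \<phi> x $ i) x + b *\<^sub>R gradient (\<lambda>x. \<psi> x $ i) x)" for i
    using C1_grad_add[OF C1_grad_cmult[OF test_field_C1_grad[OF assms(1)]] C1_grad_cmult[OF test_field_C1_grad[OF assms(2)]]]
    by simp
  from C1_grad_partial[OF this]
  show "divergence (\<lambda>x. a *\<^sub>R \<phi> x + b *\<^sub>R \<psi> x) = (\<lambda>x. a * divergence \<phi> x + b * divergence \<psi> x)"
    by (auto simp: divergence_def gradient_def sum.distrib sum_distrib_left)
qed

lemma test_function_sum:
  assumes "finite I" "\<And>i. i \<in> I \<Longrightarrow> test_function (f i)"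
  shows "test_function (\<lambda>x. \<Sum>i\<in>I. f i x)"
  using assms
proof (induction I)
  case empty
  have "test_function (\<lambda>x. 0 * mol 0 x :: real)" by (rule test_function_cmult[OF test_function_mol])
  then show ?case by simp
qed (auto intro: test_function_add)

lemma test_function_divergence:
  assumes "test_field \<phi>" shows "test_function (divergence \<phi>)"
  unfolding divergence_def using assms
  by (intro test_function_sum test_function_partial_deriv) (auto simp: test_field_def)

text \<open>Absolute convexity: besides convex combinations it covers negation, as the case a = -1,
  b = 0.\<close>

lemma unit_fields_convex:
  assumes p: "\<phi> \<in> unit_fields" and q: "\<psi> \<in> unit_fields" and t: "\<bar>a\<bar> + \<bar>b\<bar> \<le> 1"
  shows "(\<lambda>x. a *\<^sub>R \<phi> x + b *\<^sub>R \<psi> x) \<in> unit_fields"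
proof -
  have "AE x in lborel. norm (\<phi> x) \<le> 1" "AE x in lborel. norm (\<psi> x) \<le> 1" using p q by (auto simp: unit_fields_def)
  then have "AE x in lborel. norm (a *\<^sub>R \<phi> x + b *\<^sub>R \<psi> x) \<le> 1"
  proof eventually_elim
    case (elim x)
    have "norm (a *\<^sub>R \<phi> x + b *\<^sub>R \<psi> x) \<le> \<bar>a\<bar> * norm (\<phi> x) + \<bar>b\<bar> * norm (\<psi> x)"
      using norm_triangle_ineq[of "a *\<^sub>R \<phi> x" "b *\<^sub>R \<psi> x"] by simp
    also have "\<dots> \<le> \<bar>a\<bar> * 1 + \<bar>b\<bar> * 1" using elim by (intro add_mono mult_left_mono) auto
    finally show ?case using t by simp
  qed
  then show ?thesis using p q test_field_combination(1) by (auto simp: unit_fields_def)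
qed

lemma unit_fields_zero: "(\<lambda>x. 0 :: real ^ 'n) \<in> (unit_fields :: (real ^ 'n::finite \<Rightarrow> real ^ 'n) set)"
proof -
  have "test_function (\<lambda>x. 0 * mol 0 x :: real)" by (rule test_function_cmult[OF test_function_mol])
  then show ?thesis by (simp add: unit_fields_def test_field_def)
qed

lemma divergence_zero: "divergence (\<lambda>x. 0 :: real ^ 'n::finite) = (\<lambda>x. 0)"
  by (rule ext) (simp add: divergence_def C1_grad_partial[OF C1_grad_const])

lemma TV_nonneg:
  fixes u :: "(real ^ 'n::finite \<Rightarrow> real) \<Rightarrow> real"
  assumes "u \<in> Dm1" shows "0 \<le> TV u"
proof -
  have "(\<lambda>x. 0) \<in> (D10 :: (real ^ 'n \<Rightarrow> real) set)"
    using compact_support_D10(1)[OF C1_grad_const[of 0]] by simp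
  then have "u (\<lambda>x. 0) = 0" using Dm1D(2)[OF assms, of "\<lambda>_. 0" 0] by simp
  then show ?thesis using TV_upper[OF unit_fields_zero, of u] by (simp add: divergence_zero zero_ereal_def)
qed

lemma TV_add: "TV (\<lambda>f. u f + v f) \<le> TV u + TV v"
proof (rule TV_least)
  fix \<phi> :: "real ^ 'a \<Rightarrow> real ^ 'a" assume "\<phi> \<in> unit_fields"
  from add_mono[OF TV_upper[OF this, of u] TV_upper[OF this, of v]]
  show "ereal (u (divergence \<phi>) + v (divergence \<phi>)) \<le> TV u + TV v" by simp
qed

lemma has_weak_divergence_C1:
  fixes Z :: "real ^ 'n::finite \<Rightarrow> real ^ 'n"
  assumes Z: "\<And>i. C1_grad (\<lambda>x. Z x $ i) (G i)"
  shows "has_weak_divergence Z (\<lambda>x. \<Sum>i\<in>UNIV. G i x $ i)"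
  unfolding has_weak_divergence_def
proof (intro conjI allI impI)
  have "continuous_on UNIV Z"
    using continuous_on_vec_lambda[of UNIV "\<lambda>i x. Z x $ i", OF C1_grad_continuous[OF Z]] by simp
  then show "locally_integrable Z" by (rule locally_integrable_continuous)
  have "continuous_on UNIV (\<lambda>x. G i x $ i)" for i
    using C1_grad_continuous_grad[OF Z[of i]] by (intro continuous_intros)
  then show "locally_integrable (\<lambda>x. \<Sum>i\<in>UNIV. G i x $ i)"
    by (intro locally_integrable_continuous continuous_on_sum)
  fix \<phi> :: "real ^ 'n \<Rightarrow> real" assume \<phi>: "test_function \<phi>"
  obtain R where R: "\<And>x. \<phi> x \<noteq> 0 \<Longrightarrow> norm x \<le> R" using test_functionE[OF \<phi>] by metis
  note c = test_function_C1_grad[OF \<phi>]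
  have RG: "norm x \<le> R" if "gradient \<phi> x \<noteq> 0" for x
    using C1_grad_support[OF c R, of x] that by force
  have i1: "integrable lborel (\<lambda>x. Z x $ i *\<^sub>R gradient \<phi> x)" for i
    by (intro integrable_locally_integrable_continuous[OF _ C1_grad_continuous_grad[OF c] RG] locally_integrable_continuous C1_grad_continuous[OF Z])
  have i2: "integrable lborel (\<lambda>x. \<phi> x *\<^sub>R G i x)" for i
    by (rule continuous_compact_support_integrable[where R=R])
      (use R in \<open>auto intro!: continuous_intros C1_grad_continuous_grad[OF Z] C1_grad_continuous[OF c]\<close>)
  have eq: "(\<integral>x. Z x $ i * gradient \<phi> x $ i \<partial>lborel) = - (\<integral>x. \<phi> x * G i x $ i \<partial>lborel)" for i
    using arg_cong[OF C1_grad_integration_by_parts[OF Z[of i] c R], of "\<lambda>v. v $ i"]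
      integrable_vec_nth(2)[OF i1, of i i] integrable_vec_nth(2)[OF i2, of i i] by simp
  have j1: "integrable lborel (\<lambda>x. Z x $ i * gradient \<phi> x $ i)" for i
    using integrable_vec_nth(1)[OF i1, of i i] by simp
  have j2: "integrable lborel (\<lambda>x. G i x $ i * \<phi> x)" for i
    using integrable_vec_nth(1)[OF i2, of i i] by (simp add: mult.commute)
  have "(\<integral>x. (\<Sum>i\<in>UNIV. G i x $ i) * \<phi> x \<partial>lborel) = (\<Sum>i\<in>UNIV. \<integral>x. G i x $ i * \<phi> x \<partial>lborel)"
    unfolding sum_distrib_right by (rule Bochner_Integration.integral_sum) (rule j2)
  also have "\<dots> = - (\<Sum>i\<in>UNIV. \<integral>x. Z x $ i * gradient \<phi> x $ i \<partial>lborel)"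
    unfolding eq by (simp add: sum_negf mult.commute)
  also have "(\<Sum>i\<in>UNIV. \<integral>x. Z x $ i * gradient \<phi> x $ i \<partial>lborel) = (\<integral>x. Z x \<bullet> gradient \<phi> x \<partial>lborel)"
    unfolding inner_vec_def inner_real_def by (rule Bochner_Integration.integral_sum[symmetric]) (rule j1)
  finally show "(\<integral>x. (\<Sum>i\<in>UNIV. G i x $ i) * \<phi> x \<partial>lborel) = - (\<integral>x. Z x \<bullet> gradient \<phi> x \<partial>lborel)" .
qed

lemma has_weak_divergence_test_field:
  assumes "test_field \<phi>" shows "has_weak_divergence \<phi> (divergence \<phi>)"
proof -
  have "divergence \<phi> = (\<lambda>x. \<Sum>i\<in>UNIV. gradient (\<lambda>x. \<phi> x $ i) x $ i)"
    by (auto simp: divergence_def gradient_def)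
  then show ?thesis using has_weak_divergence_C1[OF test_field_C1_grad[OF assms]] by simp
qed

subsection \<open>Calibrating fields by minimisation\<close>

text \<open>Allows a change of representative: for n \<le> 2 the norm does not see constants, and it
  is by a constant that a limit in D^1_0 can differ from the divergence of the limit field.\<close>

lemma D10_add_const:
  fixes f :: "real ^ 'n::finite \<Rightarrow> real"
  assumes f: "f \<in> D10" and c: "CARD('n) \<ge> 3 \<Longrightarrow> c = 0" and g: "g \<in> D10"
  shows "(\<lambda>x. f x + c) \<in> D10" "D10_norm (\<lambda>x. g x - (f x + c)) = D10_norm (\<lambda>x. g x - f x)"
proof -
  have wg: "has_weak_gradient (\<lambda>x. f x + c) (weak_gradient f)"
    using has_weak_gradient_add[OF D10D(1)[OF f] has_weak_gradient_C1[OF C1_grad_const[of c]]] by simp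
  show fc: "(\<lambda>x. f x + c) \<in> D10"
    by (rule D10I[OF wg D10D(2)[OF f]]) (use c D10D(4)[OF f] in simp)
  have h1: "has_weak_gradient (\<lambda>x. g x - (f x + c)) (\<lambda>x. weak_gradient g x - weak_gradient f x)"
    using has_weak_gradient_add[OF D10D(1)[OF g] has_weak_gradient_cmult[OF wg, of "-1"]] by (simp add: algebra_simps)
  have h2: "has_weak_gradient (\<lambda>x. g x - f x) (\<lambda>x. weak_gradient g x - weak_gradient f x)"
    using has_weak_gradient_add[OF D10D(1)[OF g] has_weak_gradient_cmult[OF D10D(1)[OF f], of "-1"]] by simp
  have "ennreal ((D10_norm (\<lambda>x. g x - (f x + c)))\<^sup>2) = ennreal ((D10_norm (\<lambda>x. g x - f x))\<^sup>2)"
    using D10_norm_energy[OF D10_diff[OF g fc] h1] D10_norm_energy[OF D10_diff[OF g f] h2] by simp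
  then have "(D10_norm (\<lambda>x. g x - (f x + c)))\<^sup>2 = (D10_norm (\<lambda>x. g x - f x))\<^sup>2" by simp
  then show "D10_norm (\<lambda>x. g x - (f x + c)) = D10_norm (\<lambda>x. g x - f x)"
    by (simp add: power2_eq_iff_nonneg D10_norm_nonneg)
qed

lemma subsequence_from_Cauchy:
  fixes P :: "nat \<Rightarrow> nat \<Rightarrow> nat \<Rightarrow> bool"
  assumes "\<And>j. \<exists>N. \<forall>k\<ge>N. \<forall>l\<ge>N. P j k l"
  obtains r :: "nat \<Rightarrow> nat" where "strict_mono r" "\<And>j k l. j \<le> k \<Longrightarrow> j \<le> l \<Longrightarrow> P j (r k) (r l)"
proof -
  obtain N where N: "\<And>j k l. k \<ge> N j \<Longrightarrow> l \<ge> N j \<Longrightarrow> P j k l" using assms by metis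
  define r where "r = (\<lambda>j. j + (\<Sum>i\<le>j. N i))"
  have "strict_mono r" unfolding strict_mono_Suc_iff by (simp add: r_def)
  moreover have "r k \<ge> N j" if "k \<ge> j" for j k
  proof -
    have "N j \<le> (\<Sum>i\<le>k. N i)" using that by (intro member_le_sum) auto
    then show ?thesis by (simp add: r_def)
  qed
  ultimately show ?thesis using that N by blast
qed

lemma test_field_measurable:
  assumes "test_field \<phi>" shows "\<phi> \<in> borel_measurable borel"
proof -
  have "continuous_on UNIV \<phi>"
    using continuous_on_vec_lambda[of UNIV "\<lambda>i x. \<phi> x $ i", OF C1_grad_continuous[OF test_field_C1_grad[OF assms]]] by simp
  then show ?thesis by (rule borel_measurable_continuous_onI)
qed

text \<open>The functional controls only the divergences, not the fields, whence the additional weighted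
  $L^2$ norm: both are quadratic, so by the parallelogram law near-minimisers are Cauchy.\<close>

lemma minimising_fields:
  fixes l :: "(real ^ 'n::finite \<Rightarrow> real) \<Rightarrow> real"
  assumes l: "l \<in> Dm1"
  shows "\<exists>(\<psi> :: nat \<Rightarrow> real ^ 'n \<Rightarrow> real ^ 'n) m. (\<forall>k. \<psi> k \<in> unit_fields) \<and>
    (\<forall>\<phi>\<in>unit_fields. m \<le> quad l (divergence \<phi>)) \<and> (\<lambda>k. quad l (divergence (\<psi> k))) \<longlonglongrightarrow> m \<and>
    (\<forall>e>0. \<exists>N. \<forall>k\<ge>N. \<forall>i\<ge>N. D10_norm (\<lambda>x. divergence (\<psi> k) x - divergence (\<psi> i) x) < e) \<and>
    (AE x in lborel. convergent (\<lambda>k. \<psi> k x))"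
proof -
  define K where "K = (unit_fields :: (real ^ 'n \<Rightarrow> real ^ 'n) set)"
  define J where "J = (\<lambda>\<phi> :: real ^ 'n \<Rightarrow> real ^ 'n. quad l (divergence \<phi>))"
  define half where "half = (\<lambda>(\<phi> :: real ^ 'n \<Rightarrow> real ^ 'n) \<psi> x. (1 / 2) *\<^sub>R \<phi> x + (1 / 2) *\<^sub>R \<psi> x)"
  have tf: "test_field \<phi>" if "\<phi> \<in> K" for \<phi> using that by (simp add: K_def unit_fields_def)
  have divD: "divergence \<phi> \<in> D10" if "\<phi> \<in> K" for \<phi>
    using test_function_D10(1)[OF test_function_divergence[OF tf[OF that]]] .
  have halfK: "half \<phi> \<psi> \<in> K" if "\<phi> \<in> K" "\<psi> \<in> K" for \<phi> \<psi>
    using that unfolding K_def half_def by (intro unit_fields_convex) auto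
  have par: "(D10_norm (\<lambda>x. divergence \<phi> x - divergence \<psi> x))\<^sup>2 = 2 * J \<phi> + 2 * J \<psi> - 4 * J (half \<phi> \<psi>)"
    if "\<phi> \<in> K" "\<psi> \<in> K" for \<phi> \<psi>
  proof -
    have "divergence (half \<phi> \<psi>) = (\<lambda>x. (1 / 2) * (divergence \<phi> x + divergence \<psi> x))"
      unfolding half_def test_field_combination(2)[OF tf[OF that(1)] tf[OF that(2)]] by (simp add: field_simps)
    then show ?thesis unfolding J_def using quad_parallelogram[OF l divD[OF that(1)] divD[OF that(2)]] by simp
  qed
  have Kne: "(\<lambda>x. 0) \<in> K" unfolding K_def by (rule unit_fields_zero)
  obtain m0 where m0: "\<And>f. f \<in> D10 \<Longrightarrow> m0 \<le> quad l f" using quad_bounded_below[OF l] by blast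
  have bddJ: "bdd_below (J ` K)" using m0[OF divD] by (auto simp: bdd_below_def J_def)
  define m where "m = Inf (J ` K)"
  have mJ: "m \<le> J \<phi>" if "\<phi> \<in> K" for \<phi> unfolding m_def using that bddJ by (intro cInf_lower) auto
  \<comment> \<open>Nested, midpoint-convex classes of near-minimisers of \<open>J\<close>. Inside
    each class a second functional is nearly minimised, so that the gain for the fields does not
    spoil the minimisation of \<open>J\<close>.\<close>
  define C where "C = (\<lambda>j::nat. {\<phi>\<in>K. J \<phi> \<le> m + 1 / real (Suc j)})"
  have Cne: "C j \<noteq> {}" for j
  proof -
    have "J ` K \<noteq> {}" using Kne by blast
    from cInf_lessD[OF this, of "m + 1 / real (Suc j)"] show ?thesis by (force simp: m_def C_def)
  qed
  have CK: "\<phi> \<in> K" if "\<phi> \<in> C j" for \<phi> j using that by (simp add: C_def)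
  have Canti: "C k \<subseteq> C j" if "j \<le> k" for j k
  proof -
    have "1 / real (Suc k) \<le> 1 / real (Suc j)" using that by (intro divide_left_mono) auto
    then show ?thesis by (auto simp: C_def)
  qed
  have halfC: "half \<phi> \<psi> \<in> C j" if "\<phi> \<in> C j" "\<psi> \<in> C j" for \<phi> \<psi> j
  proof -
    have "0 \<le> 2 * J \<phi> + 2 * J \<psi> - 4 * J (half \<phi> \<psi>)"
      unfolding par[OF CK[OF that(1)] CK[OF that(2)], symmetric] by simp
    moreover have "J \<phi> \<le> m + 1 / real (Suc j)" "J \<psi> \<le> m + 1 / real (Suc j)" using that by (auto simp: C_def)
    ultimately have "J (half \<phi> \<psi>) \<le> m + 1 / real (Suc j)" by argo
    then show ?thesis using halfK[OF CK[OF that(1)] CK[OF that(2)]] by (simp add: C_def)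
  qed
  \<comment> \<open>A positive integrable weight: bounded fields acquire finite norm under the
    measure \<mu>, while positivity keeps the null sets those of Lebesgue measure.\<close>
  obtain q :: "real ^ 'n \<Rightarrow> ennreal" where q[measurable]: "q \<in> borel_measurable lborel"
    and qi: "(\<integral>\<^sup>+x. q x \<partial>lborel) \<noteq> \<infinity>" and qp: "\<And>x. q x > 0"
    using sigma_finite_measure.Ex_finite_integrable_function[OF sigma_finite_lborel] by (auto simp: Bex_def)
  define \<mu> where "\<mu> = density lborel q"
  have sets_mu[measurable_cong]: "sets \<mu> = sets borel" by (simp add: \<mu>_def)
  interpret \<mu>: finite_measure \<mu>
    by standard (use qi in \<open>simp add: \<mu>_def emeasure_density\<close>)
  have AEmu: "(AE x in \<mu>. P x) \<longleftrightarrow> (AE x in lborel. P x)" for P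
    unfolding \<mu>_def by (subst AE_density[OF q]) (simp add: qp)
  have meas: "\<phi> \<in> borel_measurable \<mu>" if "\<phi> \<in> K" for \<phi>
    using test_field_measurable[OF tf[OF that]] measurable_cong_sets[OF sets_mu refl] by blast
  have Kbound: "AE x in \<mu>. norm (\<phi> x) \<le> 1" if "\<phi> \<in> K" for \<phi>
    unfolding AEmu using that by (simp add: K_def unit_fields_def)
  have int: "integrable \<mu> (\<lambda>x. (norm (\<phi> x))\<^sup>2)" if "\<phi> \<in> K" for \<phi>
  proof (rule \<mu>.integrable_const_bound[where B=1])
    show "AE x in \<mu>. norm ((norm (\<phi> x))\<^sup>2) \<le> 1"
      using Kbound[OF that] by eventually_elim (simp add: power_le_one)
    show "(\<lambda>x. (norm (\<phi> x))\<^sup>2) \<in> borel_measurable \<mu>" using meas[OF that] by measurable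
  qed
  define N2 where "N2 = (\<lambda>\<phi> :: real ^ 'n \<Rightarrow> real ^ 'n. \<integral>x. (norm (\<phi> x))\<^sup>2 \<partial>\<mu>)"
  have N2_nonneg: "N2 \<phi> \<ge> 0" for \<phi> by (simp add: N2_def)
  have N2_le: "N2 \<phi> \<le> measure \<mu> (space \<mu>)" if "\<phi> \<in> K" for \<phi>
  proof -
    have "N2 \<phi> \<le> (\<integral>x. 1 \<partial>\<mu>)" unfolding N2_def
    proof (rule integral_mono_AE[OF int[OF that]])
      show "AE x in \<mu>. (norm (\<phi> x))\<^sup>2 \<le> 1" using Kbound[OF that] by eventually_elim (simp add: power_le_one)
    qed simp
    then show ?thesis by simp
  qed
  have N2par: "integrable \<mu> (\<lambda>x. (norm (\<phi> x - \<psi> x))\<^sup>2)"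
    "(\<integral>x. (norm (\<phi> x - \<psi> x))\<^sup>2 \<partial>\<mu>) = 2 * N2 \<phi> + 2 * N2 \<psi> - 4 * N2 (half \<phi> \<psi>)"
    if "\<phi> \<in> K" "\<psi> \<in> K" for \<phi> \<psi>
  proof -
    have eq: "(norm (a - b))\<^sup>2 = 2 * (norm a)\<^sup>2 + 2 * (norm b)\<^sup>2 - 4 * (norm ((1 / 2) *\<^sub>R a + (1 / 2) *\<^sub>R b))\<^sup>2" for a b :: "real ^ 'n"
      by (simp add: power2_norm_eq_inner inner_simps inner_commute[of b a] field_simps)
    note i = int[OF that(1)] int[OF that(2)] int[OF halfK[OF that], unfolded half_def]
    show "integrable \<mu> (\<lambda>x. (norm (\<phi> x - \<psi> x))\<^sup>2)" unfolding eq using i by simp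
    show "(\<integral>x. (norm (\<phi> x - \<psi> x))\<^sup>2 \<partial>\<mu>) = 2 * N2 \<phi> + 2 * N2 \<psi> - 4 * N2 (half \<phi> \<psi>)"
      unfolding eq N2_def half_def using i by simp
  qed
  \<comment> \<open>The classes shrink, so these infima increase; bounded by the total mass they
    converge. A midpoint of two later fields lies again in the earlier class and has norm at least
    the earlier infimum, which drives the Cauchy estimate.\<close>
  define d where "d = (\<lambda>j. Inf (N2 ` C j))"
  have bddN: "bdd_below (N2 ` A)" for A using N2_nonneg by (auto simp: bdd_below_def)
  have dN: "d j \<le> N2 \<phi>" if "\<phi> \<in> C j" for \<phi> j unfolding d_def using that bddN by (intro cInf_lower) auto
  have "\<exists>\<phi>\<in>C j. N2 \<phi> < d j + 1 / real (Suc j)" for j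
  proof -
    have "N2 ` C j \<noteq> {}" using Cne by blast
    from cInf_lessD[OF this, of "d j + 1 / real (Suc j)"] show ?thesis by (auto simp: d_def)
  qed
  then obtain \<phi> where \<phi>: "\<And>j. \<phi> j \<in> C j" "\<And>j. N2 (\<phi> j) < d j + 1 / real (Suc j)" by metis
  have dinc: "incseq d"
  proof (rule incseq_SucI)
    fix j show "d j \<le> d (Suc j)"
      unfolding d_def using Cne Canti[of j "Suc j"] bddN by (intro cInf_superset_mono) auto
  qed
  have "d j \<le> measure \<mu> (space \<mu>)" for j using dN[OF \<phi>(1)] N2_le[OF CK[OF \<phi>(1)]] by (rule order_trans)
  then obtain dl where dl: "d \<longlonglongrightarrow> dl" "\<forall>i. d i \<le> dl" using incseq_convergent[OF dinc] by blast
  have phiK: "\<phi> j \<in> K" for j using CK[OF \<phi>(1)] .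
  have small: "\<exists>N. 1 / real (Suc N) < e \<and> dl - d N < e" if "e > 0" for e
  proof -
    have "eventually (\<lambda>N. 1 / real (Suc N) < e) sequentially"
      using order_tendstoD(2)[OF LIMSEQ_inverse_real_of_nat that] by (simp add: inverse_eq_divide)
    moreover have "eventually (\<lambda>N. dl - e < d N) sequentially" using dl(1) that by (intro order_tendstoD) auto
    ultimately have "eventually (\<lambda>N. 1 / real (Suc N) < e \<and> dl - d N < e) sequentially"
      by eventually_elim auto
    then show ?thesis by (auto simp: eventually_sequentially)
  qed
  have inv_le: "1 / real (Suc k) \<le> 1 / real (Suc N)" if "N \<le> k" for k N
    using that by (intro divide_left_mono) auto
  have cauchyN: "\<exists>N. \<forall>k\<ge>N. \<forall>i\<ge>N. (\<integral>x. (norm (\<phi> k x - \<phi> i x))\<^sup>2 \<partial>\<mu>) \<le> (1 / 16) ^ j" for j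
  proof -
    \<comment> \<open>8 e is the required (1/16)^j: the parallelogram law gives at most 4 e + 4 (dl
      - d N), and dl - d N < e. The rate is that of \<open>AE_convergent_fast\<close>.\<close>
    define e :: real where "e = (1 / 16) ^ j / 8"
    have "e > 0" by (simp add: e_def)
    from small[OF this] obtain N where N: "1 / real (Suc N) < e" "dl - d N < e" by blast
    have "(\<integral>x. (norm (\<phi> k x - \<phi> i x))\<^sup>2 \<partial>\<mu>) \<le> (1 / 16) ^ j" if ki: "k \<ge> N" "i \<ge> N" for k i
    proof -
      have "d N \<le> N2 (half (\<phi> k) (\<phi> i))"
        using halfC[OF subsetD[OF Canti[OF ki(1)] \<phi>(1)] subsetD[OF Canti[OF ki(2)] \<phi>(1)]] by (rule dN)
      moreover have "N2 (\<phi> k) \<le> dl + e" "N2 (\<phi> i) \<le> dl + e"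
        using \<phi>(2)[of k] \<phi>(2)[of i] dl(2)[rule_format, of k] dl(2)[rule_format, of i] inv_le[OF ki(1)] inv_le[OF ki(2)] N(1) by linarith+
      ultimately have "2 * N2 (\<phi> k) + 2 * N2 (\<phi> i) - 4 * N2 (half (\<phi> k) (\<phi> i)) \<le> 8 * e"
        using N(2) by argo
      then show ?thesis unfolding N2par(2)[OF phiK phiK] by (simp add: e_def)
    qed
    then show ?thesis by blast
  qed
  obtain r :: "nat \<Rightarrow> nat" where r: "strict_mono r"
    "\<And>j k i. j \<le> k \<Longrightarrow> j \<le> i \<Longrightarrow> (\<integral>x. (norm (\<phi> (r k) x - \<phi> (r i) x))\<^sup>2 \<partial>\<mu>) \<le> (1 / 16) ^ j"
    using subsequence_from_Cauchy[of "\<lambda>j k i. (\<integral>x. (norm (\<phi> k x - \<phi> i x))\<^sup>2 \<partial>\<mu>) \<le> (1 / 16) ^ j"] cauchyN by blast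
  define \<psi> where "\<psi> = (\<lambda>k. \<phi> (r k))"
  have psiK: "\<psi> k \<in> K" for k by (simp add: \<psi>_def phiK)
  have "AE x in \<mu>. convergent (\<lambda>k. \<psi> k x)"
  proof (rule AE_convergent_fast[where K=1])
    show "\<psi> k \<in> borel_measurable \<mu>" for k by (rule meas[OF psiK])
    show "(\<integral>\<^sup>+x. ennreal ((norm (\<psi> (Suc k) x - \<psi> k x))\<^sup>2) \<partial>\<mu>) \<le> ennreal (1 * (1 / 16) ^ k)" for k
      using r(2)[of k "Suc k" k] by (subst nn_integral_eq_integral[OF N2par(1)[OF psiK psiK]]) (auto simp: \<psi>_def ennreal_leI)
  qed simp
  then have conv: "AE x in lborel. convergent (\<lambda>k. \<psi> k x)" by (simp add: AEmu)
  have Jpsi: "J (\<psi> k) \<le> m + 1 / real (Suc k)" for k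
  proof -
    have "J (\<psi> k) \<le> m + 1 / real (Suc (r k))" using \<phi>(1)[of "r k"] by (simp add: C_def \<psi>_def)
    then show ?thesis using inv_le[OF strict_mono_imp_increasing[OF r(1)], of k] by linarith
  qed
  have Jlim: "(\<lambda>k. J (\<psi> k)) \<longlonglongrightarrow> m"
  proof (rule tendsto_sandwich[OF always_eventually always_eventually tendsto_const])
    show "(\<lambda>k. m + 1 / real (Suc k)) \<longlonglongrightarrow> m"
      using tendsto_add[OF tendsto_const[of m] LIMSEQ_inverse_real_of_nat] by (simp add: inverse_eq_divide)
  qed (use mJ[OF psiK] Jpsi in blast)+
  have cauchyD: "\<exists>N. \<forall>k\<ge>N. \<forall>i\<ge>N. D10_norm (\<lambda>x. divergence (\<psi> k) x - divergence (\<psi> i) x) < e" if e: "e > 0" for e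
  proof -
    obtain N where N: "1 / real (Suc N) < e\<^sup>2 / 4" using nat_approx_posE[of "e\<^sup>2 / 4"] e by auto
    have "D10_norm (\<lambda>x. divergence (\<psi> k) x - divergence (\<psi> i) x) < e" if ki: "k \<ge> N" "i \<ge> N" for k i
    proof -
      define p where "p = 1 / real (Suc N)"
      have "J (\<psi> k) \<le> m + p" "J (\<psi> i) \<le> m + p" unfolding p_def
        using Jpsi[of k] Jpsi[of i] inv_le[OF ki(1)] inv_le[OF ki(2)] by linarith+
      moreover have "m \<le> J (half (\<psi> k) (\<psi> i))" by (intro mJ halfK psiK)
      ultimately have "2 * J (\<psi> k) + 2 * J (\<psi> i) - 4 * J (half (\<psi> k) (\<psi> i)) < e\<^sup>2"
        using N unfolding p_def[symmetric] by argo
      then have "(D10_norm (\<lambda>x. divergence (\<psi> k) x - divergence (\<psi> i) x))\<^sup>2 < e\<^sup>2"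
        unfolding par[OF psiK psiK] .
      then show ?thesis using e by (simp add: power2_less_imp_less)
    qed
    then show ?thesis by blast
  qed
  show ?thesis
    using psiK mJ Jlim cauchyD conv unfolding K_def J_def
    by (intro exI[of _ \<psi>] exI[of _ m]) blast
qed

text \<open>The two modes of convergence have to be reconciled. Pointwise convergence of bounded
  fields gives the divergence of \<open>Z\<close> as a distribution, by dominated convergence;
  convergence in D^1_0 gives a function only up to constants. Testing shows that these constants
  converge, and their limit selects the representative.\<close>

lemma minimiser:
  fixes l :: "(real ^ 'n::finite \<Rightarrow> real) \<Rightarrow> real"
  assumes l: "l \<in> Dm1"
  shows "\<exists>(Z :: real ^ 'n \<Rightarrow> real ^ 'n) f \<psi>. Z \<in> borel_measurable borel \<and> (AE x in lborel. norm (Z x) \<le> 1) \<and>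
    has_weak_divergence Z f \<and> f \<in> D10 \<and> (\<forall>k::nat. \<psi> k \<in> unit_fields) \<and>
    (\<lambda>k. D10_norm (\<lambda>x. divergence (\<psi> k) x - f x)) \<longlonglongrightarrow> 0 \<and>
    (\<forall>\<phi>\<in>unit_fields. quad l f \<le> quad l (divergence \<phi>))"
proof -
  obtain \<psi> :: "nat \<Rightarrow> real ^ 'n \<Rightarrow> real ^ 'n" and m where psi: "\<And>k. \<psi> k \<in> unit_fields"
    and m: "\<And>\<phi>. \<phi> \<in> unit_fields \<Longrightarrow> m \<le> quad l (divergence \<phi>)" "(\<lambda>k. quad l (divergence (\<psi> k))) \<longlonglongrightarrow> m"
    and cauchy: "\<And>e. e > 0 \<Longrightarrow> \<exists>N. \<forall>k\<ge>N. \<forall>i\<ge>N. D10_norm (\<lambda>x. divergence (\<psi> k) x - divergence (\<psi> i) x) < e"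
    and conv: "AE x in lborel. convergent (\<lambda>k. \<psi> k x)"
    using minimising_fields[OF l] by blast
  have tf: "test_field (\<psi> k)" for k using psi by (simp add: unit_fields_def)
  have [measurable]: "\<psi> k \<in> borel_measurable borel" for k using tf by (rule test_field_measurable)
  note td = test_function_divergence[OF tf]
  note dD = test_function_D10[OF td]
  obtain f and r :: "nat \<Rightarrow> nat" and c where f: "f \<in> D10" and r: "strict_mono r"
    and c: "CARD('n) \<ge> 3 \<longrightarrow> c = (\<lambda>_. 0)" and flim: "(\<lambda>k. D10_norm (\<lambda>x. divergence (\<psi> k) x - f x)) \<longlonglongrightarrow> 0"
    and loc: "\<And>R. (\<lambda>k. \<integral>\<^sup>+x. ennreal \<bar>divergence (\<psi> (r k)) x - c k - f x\<bar> * indicator (cball 0 R) x \<partial>lborel) \<longlonglongrightarrow> 0"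
    using D10_C1_complete[OF dD(2) cauchy] by blast
  define Z where "Z = (\<lambda>x. lim (\<lambda>k. \<psi> k x))"
  have [measurable]: "Z \<in> borel_measurable borel" unfolding Z_def by (rule borel_measurable_lim_metric) measurable
  have Zlim: "AE x in lborel. (\<lambda>k. \<psi> k x) \<longlonglongrightarrow> Z x"
    unfolding Z_def using conv by eventually_elim (simp add: convergent_LIMSEQ_iff)
  have "AE x in lborel. \<forall>k. norm (\<psi> k x) \<le> 1"
    using psi by (intro AE_all_countable[THEN iffD2] allI) (simp add: unit_fields_def)
  then have psi1: "AE x in lborel. norm (\<psi> k x) \<le> 1" for k by eventually_elim blast
  have Z1: "AE x in lborel. norm (Z x) \<le> 1"
    using Zlim \<open>AE x in lborel. \<forall>k. norm (\<psi> k x) \<le> 1\<close>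
    by eventually_elim (rule LIMSEQ_le_const2[OF tendsto_norm], assumption, blast)
  have Zli: "locally_integrable Z" by (rule locally_integrable_bounded[OF _ Z1]) simp
  have fli: "locally_integrable f" by (rule D10D(3)[OF f])
  have divlim: "(\<lambda>k. \<integral>x. divergence (\<psi> (r k)) x * \<phi> x \<partial>lborel) \<longlonglongrightarrow> - (\<integral>x. Z x \<bullet> gradient \<phi> x \<partial>lborel)"
    if \<phi>: "test_function \<phi>" for \<phi>
  proof -
    obtain R where R: "\<And>x. \<phi> x \<noteq> 0 \<Longrightarrow> norm x \<le> R" using test_functionE[OF \<phi>] by metis
    note cg = test_function_C1_grad[OF \<phi>]
    have RG: "norm x \<le> R" if "gradient \<phi> x \<noteq> 0" for x
      using C1_grad_support[OF cg R, of x] that by force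
    have [measurable]: "gradient \<phi> \<in> borel_measurable borel" using C1_grad_measurable[OF cg] by simp
    have gi: "integrable lborel (\<lambda>x. norm (gradient \<phi> x))"
      by (intro integrable_norm continuous_compact_support_integrable[OF C1_grad_continuous_grad[OF cg] RG])
    have "(\<lambda>k. \<integral>x. \<psi> (r k) x \<bullet> gradient \<phi> x \<partial>lborel) \<longlonglongrightarrow> (\<integral>x. Z x \<bullet> gradient \<phi> x \<partial>lborel)"
    proof (rule integral_dominated_convergence[OF _ _ gi])
      show "AE x in lborel. (\<lambda>k. \<psi> (r k) x \<bullet> gradient \<phi> x) \<longlonglongrightarrow> Z x \<bullet> gradient \<phi> x"
        using Zlim
      proof eventually_elim
        case (elim x)
        from LIMSEQ_subseq_LIMSEQ[OF this r] show ?case by (intro tendsto_intros) (simp add: o_def)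
      qed
      show "AE x in lborel. norm (\<psi> (r k) x \<bullet> gradient \<phi> x) \<le> norm (gradient \<phi> x)" for k
        using psi1[of "r k"]
      proof eventually_elim
        case (elim x)
        have "\<bar>\<psi> (r k) x \<bullet> gradient \<phi> x\<bar> \<le> norm (\<psi> (r k) x) * norm (gradient \<phi> x)" by (rule Cauchy_Schwarz_ineq2)
        also have "\<dots> \<le> 1 * norm (gradient \<phi> x)" by (intro mult_right_mono elim) simp
        finally show ?case by simp
      qed
    qed measurable
    then have "(\<lambda>k. - (\<integral>x. \<psi> (r k) x \<bullet> gradient \<phi> x \<partial>lborel)) \<longlonglongrightarrow> - (\<integral>x. Z x \<bullet> gradient \<phi> x \<partial>lborel)"
      by (rule tendsto_minus)
    moreover have "(\<integral>x. divergence (\<psi> (r k)) x * \<phi> x \<partial>lborel) = - (\<integral>x. \<psi> (r k) x \<bullet> gradient \<phi> x \<partial>lborel)" for k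
      using has_weak_divergence_test_field[OF tf] \<phi> by (simp add: has_weak_divergence_def)
    ultimately show ?thesis by simp
  qed
  have dcont: "continuous_on UNIV (divergence (\<psi> k))" for k
    using C1_grad_continuous[OF test_function_C1_grad[OF td]] .
  have shift: "(\<lambda>k. (\<integral>x. divergence (\<psi> (r k)) x * \<phi> x \<partial>lborel) - c k * (\<integral>x. \<phi> x \<partial>lborel)) \<longlonglongrightarrow> (\<integral>x. f x * \<phi> x \<partial>lborel)"
    if \<phi>: "test_function \<phi>" for \<phi>
  proof -
    obtain R where R: "\<And>x. \<phi> x \<noteq> 0 \<Longrightarrow> norm x \<le> R" using test_functionE[OF \<phi>] by metis
    note cp = C1_grad_continuous[OF test_function_C1_grad[OF \<phi>]]
    have li: "locally_integrable (\<lambda>x. divergence (\<psi> (r k)) x - c k)" for k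
      by (intro locally_integrable_continuous continuous_intros dcont)
    have "(\<lambda>k. \<integral>x. (divergence (\<psi> (r k)) x - c k) * \<phi> x \<partial>lborel) \<longlonglongrightarrow> (\<integral>x. f x * \<phi> x \<partial>lborel)"
      by (rule tendsto_ball_integral[OF li fli cp R loc])
    moreover have "(\<integral>x. (divergence (\<psi> (r k)) x - c k) * \<phi> x \<partial>lborel) =
        (\<integral>x. divergence (\<psi> (r k)) x * \<phi> x \<partial>lborel) - c k * (\<integral>x. \<phi> x \<partial>lborel)" for k
    proof -
      have i1: "integrable lborel (\<lambda>x. divergence (\<psi> (r k)) x * \<phi> x)"
        using integrable_locally_integrable_continuous[OF locally_integrable_continuous[OF dcont] cp R] by simp
      have i2: "integrable lborel (\<lambda>x. c k * \<phi> x)"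
        by (intro integrable_mult_right continuous_compact_support_integrable[OF cp R])
      show ?thesis unfolding left_diff_distrib by (simp add: Bochner_Integration.integral_diff[OF i1 i2])
    qed
    ultimately show ?thesis by simp
  qed
  \<comment> \<open>\<open>mol 0\<close> has integral 1, so testing with it isolates
    \<open>c k\<close>: the limit of the tested divergences minus that of the shifted ones.\<close>
  define b where "b = - (\<integral>x. Z x \<bullet> gradient (mol 0) x \<partial>lborel) - (\<integral>x. f x * mol 0 x \<partial>lborel)"
  have clim: "c \<longlonglongrightarrow> b"
    using tendsto_diff[OF divlim[OF test_function_mol[of 0]] shift[OF test_function_mol[of 0]]]
    by (simp add: b_def integral_mol)
  have b0: "CARD('n) \<ge> 3 \<Longrightarrow> b = 0"
    using clim c by (simp add: LIMSEQ_const_iff)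
  define g where "g = (\<lambda>x. f x + b)"
  have gD1: "g \<in> D10" unfolding g_def by (rule D10_add_const(1)[OF f b0 f])
  have glim: "(\<lambda>k. D10_norm (\<lambda>x. divergence (\<psi> k) x - g x)) \<longlonglongrightarrow> 0"
    using flim D10_add_const(2)[OF f b0 dD(1)] by (simp add: g_def)
  have "has_weak_divergence Z g"
    unfolding has_weak_divergence_def
  proof (intro conjI allI impI Zli D10D(3)[OF gD1])
    fix \<phi> :: "real ^ 'n \<Rightarrow> real" assume \<phi>: "test_function \<phi>"
    obtain R where R: "\<And>x. \<phi> x \<noteq> 0 \<Longrightarrow> norm x \<le> R" using test_functionE[OF \<phi>] by metis
    note cp = C1_grad_continuous[OF test_function_C1_grad[OF \<phi>]]
    have i1: "integrable lborel (\<lambda>x. f x * \<phi> x)"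
      using integrable_locally_integrable_continuous[OF fli cp R] by simp
    have i2: "integrable lborel (\<lambda>x. b * \<phi> x)"
      by (intro integrable_mult_right continuous_compact_support_integrable[OF cp R])
    have "(\<lambda>k. (\<integral>x. divergence (\<psi> (r k)) x * \<phi> x \<partial>lborel) - c k * (\<integral>x. \<phi> x \<partial>lborel) + c k * (\<integral>x. \<phi> x \<partial>lborel)) \<longlonglongrightarrow>
        (\<integral>x. f x * \<phi> x \<partial>lborel) + b * (\<integral>x. \<phi> x \<partial>lborel)"
      by (intro tendsto_add shift \<phi> tendsto_mult clim tendsto_const)
    then have "(\<lambda>k. \<integral>x. divergence (\<psi> (r k)) x * \<phi> x \<partial>lborel) \<longlonglongrightarrow> (\<integral>x. f x * \<phi> x \<partial>lborel) + b * (\<integral>x. \<phi> x \<partial>lborel)"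
      by simp
    from LIMSEQ_unique[OF this divlim[OF \<phi>]]
    show "(\<integral>x. g x * \<phi> x \<partial>lborel) = - (\<integral>x. Z x \<bullet> gradient \<phi> x \<partial>lborel)"
      unfolding g_def distrib_right by (simp add: Bochner_Integration.integral_add[OF i1 i2])
  qed
  moreover have "quad l g = m"
    by (rule LIMSEQ_unique[OF quad_continuous[OF l dD(1) gD1 glim] m(2)])
  ultimately show ?thesis
    using Z1 gD1 psi glim m(1) by (intro exI[of _ Z] exI[of _ g] exI[of _ \<psi>]) auto
qed

text \<open>With V the Riesz representative of \<open>v\<close>, the minimiser \<open>f\<close> is
  the projection of -V onto the closure of the divergences. The subgradient inequality says that -V
  cannot be separated from this closure, so the residual f + V has norm 0.\<close>

lemma subdifferential_calibrated:
  fixes u v :: "(real ^ 'n::finite \<Rightarrow> real) \<Rightarrow> real"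
  assumes u: "u \<in> Dm1" and v: "v \<in> Dm1" and sub: "v \<in> subdifferential TV u"
  shows "\<exists>(Z :: real ^ 'n \<Rightarrow> real ^ 'n) f. Z \<in> borel_measurable borel \<and> (AE x in lborel. norm (Z x) \<le> 1) \<and>
    has_weak_divergence Z f \<and> f \<in> D10 \<and> v = laplacian f \<and> ereal (- u f) = TV u"
proof -
  have fin: "TV u < \<infinity>" and subg: "\<And>g. g \<in> Dm1 \<Longrightarrow> TV u + ereal (Dm1_inner v (\<lambda>f. g f - u f)) \<le> TV g"
    using sub by (auto simp: subdifferential_def)
  obtain \<tau> where tau: "TV u = ereal \<tau>" using fin TV_nonneg[OF u] by (cases "TV u") auto
  \<comment> \<open>Test the subgradient inequality at u + (-\<Delta>)h; subadditivity of
    \<open>TV\<close> removes \<open>u\<close>, because \<open>TV u\<close> is finite.\<close>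
  have vle: "ereal (v h) \<le> TV (neg_laplacian h)" if h: "h \<in> D10" for h
  proof -
    define g where "g = (\<lambda>f. u f + neg_laplacian h f)"
    have gD: "g \<in> Dm1" using Dm1_diff[OF u neg_laplacian_Dm1[OF h], of 1 1] by (simp add: g_def)
    have gu: "(\<lambda>f. g f - u f) = neg_laplacian h" by (simp add: g_def)
    \<comment> \<open>The inverse of the Laplacian may pick a representative other than
      \<open>h\<close>; the two differ by an element of norm 0, on which the bounded functional
      \<open>v\<close> vanishes.\<close>
    define h' where "h' = inv_into D10 neg_laplacian (neg_laplacian h)"
    have h': "h' \<in> D10" "neg_laplacian h' = neg_laplacian h"
      unfolding h'_def using neg_laplacian_inv[OF neg_laplacian_Dm1[OF h]] by auto
    have dd: "(\<lambda>x. h x - h' x) \<in> D10" using h h'(1) by (rule D10_diff)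
    have "D10_inner (\<lambda>x. h x - h' x) (\<lambda>x. h x - h' x) = neg_laplacian h (\<lambda>x. h x - h' x) - neg_laplacian h' (\<lambda>x. h x - h' x)"
      using D10_inner_diff[OF h h'(1) dd] dd by (simp add: neg_laplacian_def)
    also have "\<dots> = 0" by (simp add: h'(2))
    finally have "D10_norm (\<lambda>x. h x - h' x) = 0" by (simp add: D10_norm_def)
    moreover obtain C where "\<forall>f\<in>D10. \<bar>v f\<bar> \<le> C * D10_norm f" using Dm1D(5)[OF v] by blast
    ultimately have "v (\<lambda>x. h x - h' x) = 0" using dd by fastforce
    then have vh: "v h' = v h" using Dm1D(4)[OF v h h'(1)] by simp
    have "TV u + ereal (v h) \<le> TV g"
      using subg[OF gD] unfolding gu Dm1_inner_def h'_def[symmetric] vh .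
    also have "\<dots> \<le> TV u + TV (neg_laplacian h)" unfolding g_def by (rule TV_add)
    finally show ?thesis unfolding tau by (cases "TV (neg_laplacian h)") auto
  qed
  obtain V where V: "V \<in> D10" "neg_laplacian V = v" using riesz[OF v] by blast
  \<comment> \<open>With this sign \<open>quad l f\<close> is the squared norm of f + V minus that
    of V, so its minimisation projects -V.\<close>
  define l where "l = (\<lambda>f. - v f)"
  have l: "l \<in> Dm1" using Dm1_diff[OF v v, of "-1" 0] by (simp add: l_def)
  obtain Z :: "real ^ 'n \<Rightarrow> real ^ 'n" and f \<psi> where Z: "Z \<in> borel_measurable borel" "AE x in lborel. norm (Z x) \<le> 1"
    "has_weak_divergence Z f" and f: "f \<in> D10" and psi: "\<And>k::nat. \<psi> k \<in> unit_fields"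
    and lim: "(\<lambda>k. D10_norm (\<lambda>x. divergence (\<psi> k) x - f x)) \<longlonglongrightarrow> 0"
    and min: "\<And>\<phi>. \<phi> \<in> unit_fields \<Longrightarrow> quad l f \<le> quad l (divergence \<phi>)"
    using minimiser[OF l] by blast
  have tf: "test_field \<phi>" if "\<phi> \<in> unit_fields" for \<phi> :: "real ^ 'n \<Rightarrow> real ^ 'n" using that by (simp add: unit_fields_def)
  have divD: "divergence \<phi> \<in> D10" if "\<phi> \<in> unit_fields" for \<phi> :: "real ^ 'n \<Rightarrow> real ^ 'n"
    using test_function_D10(1)[OF test_function_divergence[OF tf[OF that]]] .
  have neg: "(\<lambda>x. - \<phi> x) \<in> unit_fields" "divergence (\<lambda>x. - \<phi> x) = (\<lambda>x. (-1) * divergence \<phi> x)"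
    if "\<phi> \<in> unit_fields" for \<phi> :: "real ^ 'n \<Rightarrow> real ^ 'n"
    using unit_fields_convex[OF that that, of "-1" 0] test_field_combination(2)[OF tf[OF that] tf[OF that], of "-1" 0] by auto
  have var: "l (\<lambda>x. divergence \<phi> x - f x) \<le> D10_inner f (\<lambda>x. divergence \<phi> x - f x)" if \<phi>: "\<phi> \<in> unit_fields" for \<phi>
  proof (rule quad_variation[OF l f D10_diff[OF divD[OF \<phi>] f]])
    fix t :: real assume t: "0 < t" "t \<le> 1"
    \<comment> \<open>\<open>f\<close> is only a limit of divergences, so minimality is tested along
      combinations of the approximating fields with \<phi>, and passes to the limit by continuity of
      \<open>quad\<close>.\<close>
    define \<theta> where "\<theta> = (\<lambda>k x. (1 - t) *\<^sub>R \<psi> k x + t *\<^sub>R \<phi> x)"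
    have th: "\<theta> k \<in> unit_fields" for k
      unfolding \<theta>_def by (rule unit_fields_convex[OF psi \<phi>]) (use t in simp)
    have dth: "divergence (\<theta> k) = (\<lambda>x. (1 - t) * divergence (\<psi> k) x + t * divergence \<phi> x)" for k
      unfolding \<theta>_def by (rule test_field_combination(2)[OF tf[OF psi] tf[OF \<phi>]])
    have fd: "(\<lambda>x. f x + t * (divergence \<phi> x - f x)) \<in> D10"
      by (intro D10_add f D10_cmult D10_diff divD \<phi>)
    have "(\<lambda>k. (1 - t) * D10_norm (\<lambda>x. divergence (\<psi> k) x - f x)) \<longlonglongrightarrow> 0"
      by (intro tendsto_mult_right_zero lim)
    moreover have "D10_norm (\<lambda>x. divergence (\<theta> k) x - (f x + t * (divergence \<phi> x - f x))) =
      (1 - t) * D10_norm (\<lambda>x. divergence (\<psi> k) x - f x)" for k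
    proof -
      have "(\<lambda>x. divergence (\<theta> k) x - (f x + t * (divergence \<phi> x - f x))) = (\<lambda>x. (1 - t) * (divergence (\<psi> k) x - f x))"
        unfolding dth by (auto simp: algebra_simps)
      then show ?thesis using D10_norm_cmult[OF D10_diff[OF divD[OF psi] f], of "1 - t" k] t by simp
    qed
    ultimately have "(\<lambda>k. D10_norm (\<lambda>x. divergence (\<theta> k) x - (f x + t * (divergence \<phi> x - f x)))) \<longlonglongrightarrow> 0" by simp
    from quad_continuous[OF l divD[OF th] fd this]
    show "quad l f \<le> quad l (\<lambda>x. f x + t * (divergence \<phi> x - f x))"
      by (rule LIMSEQ_le_const) (use min[OF th] in blast)
  qed
  \<comment> \<open>The residual of the projection. The variational inequality says that
    \<open>f\<close> minimises the pairing with \<open>h\<close> over the closure, so that TV of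
    (-\<Delta>)h is at most minus the pairing of \<open>h\<close> and \<open>f\<close>; comparison
    with \<open>vle\<close> at \<open>h\<close> itself makes the squared norm of \<open>h\<close>
    nonpositive.\<close>
  define h where "h = (\<lambda>x. f x + V x)"
  have h: "h \<in> D10" unfolding h_def using f V(1) by (rule D10_add)
  have vV: "v d = D10_inner V d" if "d \<in> D10" for d using V(2)[symmetric] that by (simp add: neg_laplacian_def)
  have hle: "D10_inner h f \<le> D10_inner h (divergence \<phi>)" if \<phi>: "\<phi> \<in> unit_fields" for \<phi>
  proof -
    note dd = D10_diff[OF divD[OF \<phi>] f]
    have "0 \<le> D10_inner h (\<lambda>x. divergence \<phi> x - f x)"
      using var[OF \<phi>] vV[OF dd] D10_inner_add[OF f V(1) dd] by (simp add: l_def h_def)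
    then show ?thesis using D10_inner_diff[OF divD[OF \<phi>] f h] by (simp add: D10_inner_commute[of h])
  qed
  have "TV (neg_laplacian h) \<le> ereal (- D10_inner h f)"
  proof (rule TV_least)
    fix \<phi> :: "real ^ 'n \<Rightarrow> real ^ 'n" assume \<phi>: "\<phi> \<in> unit_fields"
    have "D10_inner h f \<le> - D10_inner h (divergence \<phi>)"
      using hle[OF neg(1)[OF \<phi>]] D10_inner_cmult[OF divD[OF \<phi>] h, of "-1"]
      unfolding neg(2)[OF \<phi>] by (simp add: D10_inner_commute[of h])
    then show "ereal (neg_laplacian h (divergence \<phi>)) \<le> ereal (- D10_inner h f)"
      using divD[OF \<phi>] by (simp add: neg_laplacian_def)
  qed
  with vle[OF h] have "v h \<le> - D10_inner h f" by (metis ereal_less_eq(3) order_trans)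
  then have "D10_inner h h \<le> 0"
    using vV[OF h] D10_inner_add[OF f V(1) h] by (simp add: h_def[symmetric] D10_inner_commute[of h f])
  then have h0: "D10_norm h = 0" using D10_inner_self_nonneg[of h] by (simp add: D10_norm_def)
  have vf: "v = laplacian f"
  proof
    fix g
    show "v g = laplacian f g"
    proof (cases "g \<in> D10")
      case True
      have "D10_inner h g = 0" using D10_cauchy_schwarz[OF h True] h0 by simp
      then show ?thesis
        using D10_inner_add[OF f V(1) True] vV[OF True] True by (simp add: h_def laplacian_def neg_laplacian_def)
    qed (simp add: Dm1D(3)[OF v] laplacian_def neg_laplacian_def)
  qed
  \<comment> \<open>Negated fields are admissible, so each approximating divergence obeys the bound
    and continuity of \<open>u\<close> gives it for \<open>f\<close>.\<close>
  have "ereal (- u f) \<le> TV u"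
  proof -
    have lm: "(\<lambda>k. ereal (- u (divergence (\<psi> k)))) \<longlonglongrightarrow> ereal (- u f)"
      by (intro tendsto_ereal tendsto_minus Dm1_continuous[OF u divD[OF psi] f lim])
    have le: "ereal (- u (divergence (\<psi> k))) \<le> TV u" for k
      using TV_upper[OF neg(1)[OF psi], of u k] Dm1D(2)[OF u divD[OF psi], of "-1" k] unfolding neg(2)[OF psi] by simp
    show ?thesis by (rule LIMSEQ_le_const2[OF lm]) (intro exI allI impI le)
  qed
  \<comment> \<open>The subgradient inequality at the zero functional, where the total variation is
    at most 0.\<close>
  moreover have "TV u \<le> ereal (- u f)"
  proof -
    define z where "z = (\<lambda>f :: real ^ 'n \<Rightarrow> real. 0 :: real)"
    have z: "z \<in> Dm1" using Dm1_diff[OF u u, of 0 0] by (simp add: z_def)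
    have mu: "(\<lambda>f. z f - u f) \<in> Dm1" using Dm1_diff[OF z u, of 1 "-1"] by simp
    define w where "w = inv_into D10 neg_laplacian (\<lambda>f. z f - u f)"
    have w: "w \<in> D10" "neg_laplacian w = (\<lambda>f. z f - u f)"
      unfolding w_def using neg_laplacian_inv[OF mu] by auto
    have "v w = - D10_inner f w" unfolding vf laplacian_def neg_laplacian_def using w(1) by simp
    also have "\<dots> = u f"
      using fun_cong[OF w(2), of f] f by (simp add: neg_laplacian_def D10_inner_commute[of f w] z_def)
    finally have "TV u + ereal (u f) \<le> TV z"
      using subg[OF z] by (simp add: Dm1_inner_def w_def[symmetric])
    also have "\<dots> \<le> 0" by (rule TV_least) (simp add: z_def)
    finally show ?thesis unfolding tau by simp
  qed
  ultimately have "ereal (- u f) = TV u" by simp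
  then show ?thesis using Z f vf by blast
qed

subsection \<open>Logarithmic cutoffs\<close>

definition cut'' :: "real \<Rightarrow> real" where
  "cut'' y = - 9 * (2 * max 0 y * max 0 (1 - max 0 y ^ 3) ^ 2
     + max 0 y ^ 2 * (2 * max 0 (1 - max 0 y ^ 3) * (- 3 * max 0 y ^ 2)))"

lemma cut'_deriv: "(cut' has_real_derivative cut'' y) (at y)"
proof -
  have a: "((\<lambda>y::real. max 0 y ^ 3) has_real_derivative (3 * max 0 y ^ 2)) (at y)" for y
    using pos_part_power_deriv[of 1 y] by (simp add: numeral_3_eq_3 numeral_2_eq_2)
  have b: "((\<lambda>y. 1 - max 0 y ^ 3) has_real_derivative (0 - 3 * max 0 y ^ 2)) (at y)"
    by (intro derivative_intros a)
  have c: "((\<lambda>y::real. max 0 y ^ 2) has_real_derivative (2 * max 0 y)) (at y)" for y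
    using pos_part_power_deriv[of 0 y] by (simp add: numeral_2_eq_2)
  have "((\<lambda>y. max 0 (1 - max 0 y ^ 3) ^ 2) has_real_derivative
      (2 * max 0 (1 - max 0 y ^ 3) * (0 - 3 * max 0 y ^ 2))) (at y)"
    using DERIV_chain2[OF c b] .
  from DERIV_cmult[OF DERIV_mult[OF c this], of "-9"]
  show ?thesis unfolding cut'_def[abs_def] cut''_def by (rule DERIV_cong) (simp add: algebra_simps)
qed

lemma cut''_continuous: "continuous_on UNIV cut''"
  unfolding cut''_def by (intro continuous_intros)

lemma cut''_bound: "\<bar>cut'' y\<bar> \<le> 72"
proof (cases "y \<le> 0")
  case False
  define a b where "a = max 0 y" and "b = max 0 (1 - max 0 y ^ 3)"
  show ?thesis
  proof (cases "y \<ge> 1")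
    case True
    then have "b = 0" unfolding b_def by (rule cut_aux)
    then show ?thesis by (simp add: cut''_def b_def[symmetric])
  next
    case y: False
    have ab: "0 \<le> a" "a \<le> 1" "0 \<le> b" "b \<le> 1" using y False by (auto simp: a_def b_def)
    have "\<bar>2 * a * b ^ 2\<bar> \<le> 2" using ab by (simp add: abs_mult mult_le_one power_le_one)
    moreover have "\<bar>a ^ 2 * (2 * b * (- 3 * a ^ 2))\<bar> \<le> 6"
    proof -
      have "a ^ 2 * (b * a ^ 2) \<le> 1" using ab by (intro mult_le_one) (auto simp: power_le_one mult_le_one)
      then show ?thesis using ab by (simp add: abs_mult)
    qed
    \<comment> \<open>The factor 9 in front turns 2 + 6 into 72.\<close>
    ultimately have "\<bar>2 * a * b ^ 2 + a ^ 2 * (2 * b * (- 3 * a ^ 2))\<bar> \<le> 2 + 6"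
      by (intro order_trans[OF abs_triangle_ineq] add_mono)
    then show ?thesis unfolding cut''_def a_def[symmetric] b_def[symmetric, unfolded a_def[symmetric]]
      by (simp add: abs_mult)
  qed
qed (simp add: cut''_def max_def)

lemma one_plus_sq_pos: "1 + (y::real)\<^sup>2 > 0"
  by (simp add: add_pos_nonneg)

lemma log_deriv: "((\<lambda>y. d * ln (1 + y\<^sup>2) - 1) has_real_derivative (d * (2 * y / (1 + y\<^sup>2)))) (at y)"
proof -
  have "((\<lambda>y. 1 + y\<^sup>2) has_real_derivative (2 * y)) (at y)" by (auto intro!: derivative_eq_intros)
  from DERIV_chain2[OF DERIV_ln_divide[OF one_plus_sq_pos] this]
  have "((\<lambda>y. ln (1 + y\<^sup>2)) has_real_derivative (2 * y / (1 + y\<^sup>2))) (at y)" by simp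
  from DERIV_diff[OF DERIV_cmult[OF this, of d] DERIV_const[of 1]] show ?thesis by simp
qed

lemma quotient_deriv: "((\<lambda>y. 2 * y / (1 + y\<^sup>2)) has_real_derivative (2 * (1 - y\<^sup>2) / (1 + y\<^sup>2)\<^sup>2)) (at (y::real))"
proof -
  have n: "1 + y\<^sup>2 \<noteq> 0" using one_plus_sq_pos[of y] by linarith
  show ?thesis
    using n by (auto intro!: derivative_eq_intros simp: power2_eq_square algebra_simps)
qed

text \<open>Derivative of the cutoff profile in the variable y, which stands for |x|^2
  below.\<close>

definition slope :: "real \<Rightarrow> real \<Rightarrow> real" where
  "slope d y = cut' (d * ln (1 + y\<^sup>2) - 1) * (d * (2 * y / (1 + y\<^sup>2)))"

definition slope' :: "real \<Rightarrow> real \<Rightarrow> real" where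
  "slope' d y = cut'' (d * ln (1 + y\<^sup>2) - 1) * (d * (2 * y / (1 + y\<^sup>2)))\<^sup>2
     + cut' (d * ln (1 + y\<^sup>2) - 1) * (d * (2 * (1 - y\<^sup>2) / (1 + y\<^sup>2)\<^sup>2))"

lemma logcut_deriv: "((\<lambda>y. cut (d * ln (1 + y\<^sup>2) - 1)) has_real_derivative slope d y) (at y)"
  unfolding slope_def using DERIV_chain2[OF cut_deriv log_deriv] .

lemma slope_deriv: "(slope d has_real_derivative slope' d y) (at y)"
proof -
  from DERIV_mult[OF DERIV_chain2[OF cut'_deriv log_deriv[of d y]] DERIV_cmult[OF quotient_deriv[of y], of d]]
  show ?thesis unfolding slope_def[abs_def] slope'_def
    by (rule DERIV_cong) (simp add: power2_eq_square algebra_simps)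
qed

lemma slope_continuous: "continuous_on UNIV (slope d)"
  using DERIV_isCont[OF slope_deriv] by (simp add: continuous_at_imp_continuous_on)

lemma slope'_continuous: "continuous_on UNIV (slope' d)"
proof -
  have n: "1 + y\<^sup>2 \<noteq> 0" for y :: real using one_plus_sq_pos[of y] by linarith
  have q: "continuous_on UNIV (\<lambda>y. d * ln (1 + y\<^sup>2) - 1)"
    by (intro continuous_intros) (simp add: n)
  have "continuous_on UNIV (\<lambda>y. cut'' (d * ln (1 + y\<^sup>2) - 1))" "continuous_on UNIV (\<lambda>y. cut' (d * ln (1 + y\<^sup>2) - 1))"
    by (rule continuous_on_compose2[OF cut''_continuous q] continuous_on_compose2[OF cut'_continuous q], simp)+
  then show ?thesis unfolding slope'_def by (intro continuous_intros) (auto simp: n)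
qed

lemma slope_bound:
  assumes d: "d > 0" and y: "y \<ge> 0" shows "\<bar>slope d y\<bar> \<le> 18 * d * (y / (1 + y\<^sup>2))"
proof -
  have "\<bar>slope d y\<bar> = \<bar>cut' (d * ln (1 + y\<^sup>2) - 1)\<bar> * (d * (2 * y / (1 + y\<^sup>2)))"
    using d y one_plus_sq_pos[of y] by (simp add: slope_def abs_mult)
  also have "\<dots> \<le> 9 * (d * (2 * y / (1 + y\<^sup>2)))"
    using d y one_plus_sq_pos[of y] by (intro mult_right_mono cut'_bound) auto
  finally show ?thesis by simp
qed

text \<open>306 is 72 * 4 from the second derivative of \<open>cut\<close> plus 9 * 2 from the
  first. The condition d \<le> 1 reduces the quadratic term in \<open>d\<close> to a linear
  one.\<close>

lemma slope'_bound:
  assumes d: "d > 0" "d \<le> 1" and y: "y \<ge> 0" shows "y * \<bar>slope' d y\<bar> \<le> 306 * d * (y / (1 + y\<^sup>2))"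
proof -
  let ?s = "1 + y\<^sup>2"
  have s: "?s > 0" by (rule one_plus_sq_pos)
  have r: "(2 * y / ?s)\<^sup>2 \<le> 4 / ?s"
  proof -
    have "(2 * y / ?s)\<^sup>2 = 4 / ?s * (y\<^sup>2 / ?s)" by (simp add: power_divide power_mult_distrib power2_eq_square)
    also have "\<dots> \<le> 4 / ?s * 1" using s by (intro mult_left_mono) auto
    finally show ?thesis by simp
  qed
  have "\<bar>cut'' (d * ln ?s - 1) * (d * (2 * y / ?s))\<^sup>2\<bar> \<le> 72 * (d\<^sup>2 * (4 / ?s))"
    unfolding abs_mult power_mult_distrib
    using r by (intro mult_mono cut''_bound) (auto intro!: mult_left_mono)
  also have "\<dots> \<le> 72 * (d * (4 / ?s))"
    using d s by (intro mult_left_mono mult_right_mono) (auto simp: power2_eq_square mult_left_le_one_le)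
  finally have 1: "\<bar>cut'' (d * ln ?s - 1) * (d * (2 * y / ?s))\<^sup>2\<bar> \<le> 288 * d / ?s" by simp
  have "\<bar>2 * (1 - y\<^sup>2) / ?s\<^sup>2\<bar> \<le> 2 / ?s"
  proof -
    have "\<bar>1 - y\<^sup>2\<bar> \<le> ?s" by (simp add: abs_le_iff)
    then have "2 * \<bar>1 - y\<^sup>2\<bar> / ?s\<^sup>2 \<le> 2 * ?s / ?s\<^sup>2" by (intro divide_right_mono) auto
    also have "2 * ?s / ?s\<^sup>2 = 2 / ?s" unfolding power2_eq_square[of ?s] using s by (intro mult_divide_mult_cancel_right) simp
    also have "2 * \<bar>1 - y\<^sup>2\<bar> / ?s\<^sup>2 = \<bar>2 * (1 - y\<^sup>2) / ?s\<^sup>2\<bar>" by (simp only: abs_divide abs_mult) simp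
    finally show ?thesis .
  qed
  then have "\<bar>cut' (d * ln ?s - 1) * (d * (2 * (1 - y\<^sup>2) / ?s\<^sup>2))\<bar> \<le> 9 * (d * (2 / ?s))"
    unfolding abs_mult[of "cut' _"] abs_mult[of d] using d by (intro mult_mono cut'_bound) auto
  then have 2: "\<bar>cut' (d * ln ?s - 1) * (d * (2 * (1 - y\<^sup>2) / ?s\<^sup>2))\<bar> \<le> 18 * d / ?s" by simp
  have "\<bar>slope' d y\<bar> \<le> 288 * d / ?s + 18 * d / ?s"
    unfolding slope'_def by (rule order_trans[OF abs_triangle_ineq add_mono[OF 1 2]])
  then have "\<bar>slope' d y\<bar> \<le> 306 * d / ?s" by (simp add: add_divide_distrib[symmetric])
  from mult_left_mono[OF this y] show ?thesis by (simp add: mult_ac)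
qed

text \<open>Equal to 1 where 1 + |x|^4 is at most exp(1/d) and to 0 where it is at least exp(2/d).
  Writing it through |x|^2 keeps it differentiable at the origin, and the summand 1 makes the
  logarithm vanish there.\<close>

definition lcut :: "real \<Rightarrow> real ^ 'n::finite \<Rightarrow> real" where
  "lcut d x = cut (d * ln (1 + ((norm x)\<^sup>2)\<^sup>2) - 1)"

definition lcut_grad :: "real \<Rightarrow> real ^ 'n::finite \<Rightarrow> real ^ 'n" where
  "lcut_grad d x = slope d ((norm x)\<^sup>2) *\<^sub>R (2 *\<^sub>R x)"

lemma C1_grad_norm_sq: "C1_grad (\<lambda>x :: real ^ 'n::finite. (norm x)\<^sup>2) (\<lambda>x. 2 *\<^sub>R x)"
proof -
  have "((\<lambda>x. x \<bullet> x) has_derivative (\<lambda>v. x \<bullet> v + v \<bullet> x)) (at x)" for x :: "real ^ 'n"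
    by (intro has_derivative_inner has_derivative_ident)
  then show ?thesis
    by (auto simp: C1_grad_def power2_norm_eq_inner inner_commute intro!: continuous_intros)
qed

lemma C1_grad_lcut: "C1_grad (lcut d) (lcut_grad d)"
  unfolding lcut_def[abs_def] lcut_grad_def[abs_def]
  by (rule C1_grad_compose[OF C1_grad_norm_sq logcut_deriv slope_continuous])

lemma C1_grad_lcut_grad:
  "C1_grad (\<lambda>x :: real ^ 'n::finite. lcut_grad d x $ i)
    (\<lambda>x. (2 * slope d ((norm x)\<^sup>2)) *\<^sub>R axis i 1 + (2 * x $ i * slope' d ((norm x)\<^sup>2)) *\<^sub>R (2 *\<^sub>R x))"
proof -
  have "C1_grad (\<lambda>x :: real ^ 'n. 2 * (slope d ((norm x)\<^sup>2) * x $ i))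
     (\<lambda>x. 2 *\<^sub>R (slope d ((norm x)\<^sup>2) *\<^sub>R axis i 1 + x $ i *\<^sub>R slope' d ((norm x)\<^sup>2) *\<^sub>R (2 *\<^sub>R x)))"
    by (intro C1_grad_cmult C1_grad_mult C1_grad_nth C1_grad_compose[OF C1_grad_norm_sq slope_deriv slope'_continuous])
  then show ?thesis by (simp add: lcut_grad_def[abs_def] scaleR_add_right mult_ac)
qed

lemma lcut_bounds: "0 \<le> lcut d x" "lcut d x \<le> 1"
  by (simp_all add: lcut_def cut_bounds)

lemma lcut_support:
  assumes d: "d > 0" and x: "lcut d x \<noteq> 0" shows "norm x \<le> exp (2 / d)"
proof -
  have "d * ln (1 + ((norm x)\<^sup>2)\<^sup>2) - 1 < 1"
    using x cut_ge_1 unfolding lcut_def by (meson not_less)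
  then have "ln (1 + ((norm x)\<^sup>2)\<^sup>2) \<le> 2 / d" using d by (simp add: field_simps)
  then have "exp (ln (1 + ((norm x)\<^sup>2)\<^sup>2)) \<le> exp (2 / d)" by simp
  then have "1 + ((norm x)\<^sup>2)\<^sup>2 \<le> exp (2 / d)"
    by (simp only: exp_ln[OF one_plus_sq_pos])
  moreover have "norm x \<le> 1 + ((norm x)\<^sup>2)\<^sup>2"
  proof (cases "norm x \<le> 1")
    case False
    then have "norm x ^ 1 \<le> norm x ^ 4" by (intro power_increasing) auto
    then show ?thesis by (simp add: power_mult[symmetric])
  qed (simp add: add_increasing2)
  ultimately show ?thesis by linarith
qed

lemma lcut_grad_support:
  assumes d: "d > 0" and x: "lcut_grad d x \<noteq> 0" shows "norm x \<le> exp (2 / d)"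
  using C1_grad_support[OF C1_grad_lcut lcut_support[OF d], of d x] x by force

lemma lcut_tendsto_1:
  assumes d: "d \<longlonglongrightarrow> 0" shows "(\<lambda>k. lcut (d k) x) \<longlonglongrightarrow> 1"
proof (rule tendsto_eventually)
  have "(\<lambda>k. d k * ln (1 + ((norm x)\<^sup>2)\<^sup>2) - 1) \<longlonglongrightarrow> 0 * ln (1 + ((norm x)\<^sup>2)\<^sup>2) - 1"
    by (intro tendsto_intros d)
  then have "eventually (\<lambda>k. d k * ln (1 + ((norm x)\<^sup>2)\<^sup>2) - 1 < 0) sequentially"
    by (rule order_tendstoD) simp
  then show "eventually (\<lambda>k. lcut (d k) x = 1) sequentially"
    by eventually_elim (simp add: lcut_def cut_le_0)
qed

section \<open>The scaling weight and logarithmic integrals\<close>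

text \<open>The function 1/|x| capped at 1: the size of the cutoff's gradient apart from the factor
  \<open>d\<close>.\<close>

definition kap :: "real ^ 'n::finite \<Rightarrow> real" where
  "kap x = 1 / max 1 (norm x)"

lemma kap_measurable[measurable]: "kap \<in> borel_measurable borel"
  unfolding kap_def by measurable

lemma kap_bounds: "0 < kap x" "kap x \<le> 1" "x \<noteq> 0 \<Longrightarrow> kap x \<le> 1 / norm x"
  by (auto simp: kap_def divide_le_eq intro!: divide_left_mono mult_pos_pos)

lemma cube_le_kap: "norm x * ((norm x)\<^sup>2 / (1 + ((norm x)\<^sup>2)\<^sup>2)) \<le> kap x"
  and square_le_kap: "(norm x)\<^sup>2 / (1 + ((norm x)\<^sup>2)\<^sup>2) \<le> kap x"
proof -
  define r where "r = norm x"
  have r: "r \<ge> 0" by (simp add: r_def)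
  have p: "1 + (r\<^sup>2)\<^sup>2 > 0" by (rule one_plus_sq_pos)
  have "r * (r\<^sup>2 / (1 + (r\<^sup>2)\<^sup>2)) \<le> 1 / max 1 r \<and> r\<^sup>2 / (1 + (r\<^sup>2)\<^sup>2) \<le> 1 / max 1 r"
  proof (cases "r \<le> 1")
    case True
    have "r * r\<^sup>2 \<le> 1" "r\<^sup>2 \<le> 1" using True r by (auto intro!: mult_le_one power_le_one)
    moreover have "0 \<le> (r\<^sup>2)\<^sup>2" by simp
    ultimately have "r * r\<^sup>2 \<le> 1 + (r\<^sup>2)\<^sup>2" "r\<^sup>2 \<le> 1 + (r\<^sup>2)\<^sup>2" by linarith+
    then show ?thesis using True p by (simp add: divide_le_eq max_def)
  next
    case False
    have 1: "r * (r * r\<^sup>2) \<le> 1 + (r\<^sup>2)\<^sup>2" by (simp add: power2_eq_square mult.assoc)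
    have "r * r\<^sup>2 \<le> r * (r * r\<^sup>2)" using False r mult_right_mono[of 1 r "r * r\<^sup>2"] by simp
    with 1 have 2: "r * r\<^sup>2 \<le> 1 + (r\<^sup>2)\<^sup>2" by linarith
    show ?thesis using False p 1 2 by (simp add: max_def divide_le_eq le_divide_eq mult_ac)
  qed
  then show "norm x * ((norm x)\<^sup>2 / (1 + ((norm x)\<^sup>2)\<^sup>2)) \<le> kap x" "(norm x)\<^sup>2 / (1 + ((norm x)\<^sup>2)\<^sup>2) \<le> kap x"
    by (auto simp: kap_def r_def)
qed

lemma lcut_grad_bound:
  assumes d: "d > 0" shows "norm (lcut_grad d x) \<le> 36 * d * kap x"
proof -
  have "norm (lcut_grad d x) = \<bar>slope d ((norm x)\<^sup>2)\<bar> * (2 * norm x)" by (simp add: lcut_grad_def abs_mult)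
  also have "\<dots> \<le> 18 * d * ((norm x)\<^sup>2 / (1 + ((norm x)\<^sup>2)\<^sup>2)) * (2 * norm x)"
    by (intro mult_right_mono slope_bound d) auto
  also have "\<dots> = 36 * d * (norm x * ((norm x)\<^sup>2 / (1 + ((norm x)\<^sup>2)\<^sup>2)))" by simp
  also have "\<dots> \<le> 36 * d * kap x" using d by (intro mult_left_mono cube_le_kap) auto
  finally show ?thesis .
qed

text \<open>1260 is 36 + 4 * 306. The proof gives decay of order |x|^(-2); the weaker weight
  \<open>kap\<close> is stated so that gradient and Hessian can be integrated together on the
  line.\<close>

lemma lcut_hessian_bound:
  assumes d: "d > 0" "d \<le> 1"
  shows "norm ((2 * slope d ((norm x)\<^sup>2)) *\<^sub>R axis i 1 + (2 * x $ i * slope' d ((norm x)\<^sup>2)) *\<^sub>R (2 *\<^sub>R x)) \<le> 1260 * d * kap x"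
proof -
  let ?q = "(norm x)\<^sup>2 / (1 + ((norm x)\<^sup>2)\<^sup>2)"
  have "norm ((2 * slope d ((norm x)\<^sup>2)) *\<^sub>R axis i (1::real)) = 2 * \<bar>slope d ((norm x)\<^sup>2)\<bar>" by (simp add: norm_axis_1)
  also have "\<dots> \<le> 2 * (18 * d * ?q)" by (intro mult_left_mono slope_bound d) auto
  finally have 1: "norm ((2 * slope d ((norm x)\<^sup>2)) *\<^sub>R axis i (1::real)) \<le> 36 * d * ?q" by simp
  have "norm ((2 * x $ i * slope' d ((norm x)\<^sup>2)) *\<^sub>R (2 *\<^sub>R x)) = 4 * (\<bar>x $ i\<bar> * norm x * \<bar>slope' d ((norm x)\<^sup>2)\<bar>)"
    by (simp add: abs_mult)
  also have "\<dots> \<le> 4 * (norm x * norm x * \<bar>slope' d ((norm x)\<^sup>2)\<bar>)"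
    by (intro mult_left_mono mult_right_mono component_le_norm_cart) auto
  also have "\<dots> = 4 * ((norm x)\<^sup>2 * \<bar>slope' d ((norm x)\<^sup>2)\<bar>)" by (simp add: power2_eq_square)
  also have "\<dots> \<le> 4 * (306 * d * ?q)" by (intro mult_left_mono slope'_bound d) auto
  finally have 2: "norm ((2 * x $ i * slope' d ((norm x)\<^sup>2)) *\<^sub>R (2 *\<^sub>R x)) \<le> 1224 * d * ?q" by simp
  have "norm ((2 * slope d ((norm x)\<^sup>2)) *\<^sub>R axis i 1 + (2 * x $ i * slope' d ((norm x)\<^sup>2)) *\<^sub>R (2 *\<^sub>R x)) \<le> 36 * d * ?q + 1224 * d * ?q"
    by (rule order_trans[OF norm_triangle_ineq add_mono[OF 1 2]])
  also have "\<dots> = 1260 * d * ?q" by simp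
  also have "\<dots> \<le> 1260 * d * kap x" using d by (intro mult_left_mono square_le_kap) auto
  finally show ?thesis .
qed

lemma measure_cball_scale:
  assumes "r \<ge> 0"
  shows "measure lborel (cball (0 :: real ^ 'n::finite) r) = measure lborel (cball (0 :: real ^ 'n) 1) * r ^ CARD('n)"
  using content_cball[OF assms, of "0 :: real ^ 'n"] content_cball[of 1 "0 :: real ^ 'n"] by simp

text \<open>On the shell from 2^k to 2^(k + 1) the weight is at most 2^(-kn), while the enclosing
  ball has volume c 2^((k + 1)n). So every shell contributes the same c 2^n, and the total is linear
  in the number of shells, that is, in the logarithm of the radius.\<close>

lemma kap_shells:
  assumes q: "CARD('n::finite) \<le> q"
  shows "(\<integral>\<^sup>+x. ennreal (kap x ^ q) * indicator (cball (0 :: real ^ 'n) (2 ^ N)) x \<partial>lborel) \<le>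
    ennreal (measure lborel (cball (0 :: real ^ 'n) 1) * (1 + real N * 2 ^ CARD('n)))"
proof -
  let ?n = "CARD('n)"
  define c where "c = measure lborel (cball (0 :: real ^ 'n) 1)"
  have c: "c > 0" unfolding c_def by (rule measure_unit_cball_pos)
  have "(\<integral>\<^sup>+x. ennreal (kap x ^ q) * indicator (cball (0 :: real ^ 'n) (2 ^ N)) x \<partial>lborel) \<le>
    (\<integral>\<^sup>+x. indicator (cball (0 :: real ^ 'n) 1) x + (\<Sum>k<N. ennreal (1 / (2 ^ k) ^ ?n) * indicator (cball (0 :: real ^ 'n) (2 ^ Suc k)) x) \<partial>lborel)"
  proof (rule nn_integral_mono)
    fix x :: "real ^ 'n"
    show "ennreal (kap x ^ q) * indicator (cball (0 :: real ^ 'n) (2 ^ N)) x \<le>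
      indicator (cball (0 :: real ^ 'n) 1) x + (\<Sum>k<N. ennreal (1 / (2 ^ k) ^ ?n) * indicator (cball (0 :: real ^ 'n) (2 ^ Suc k)) x)"
    proof (cases "norm x \<le> 1 \<or> norm x > 2 ^ N")
      case True
      then show ?thesis
      proof
        assume "norm x \<le> 1"
        then have "ennreal (kap x ^ q) * indicator (cball (0 :: real ^ 'n) (2 ^ N)) x \<le> 1 * 1"
          by (intro mult_mono) (auto simp: kap_def max_def split: split_indicator)
        then show ?thesis using \<open>norm x \<le> 1\<close> by (simp add: add_increasing2)
      qed simp
    next
      case False
      \<comment> \<open>Minimality yields the lower bound 2^k \<le> |x|, with |x| > 1 covering k =
        0.\<close>
      define k where "k = (LEAST k. norm x \<le> 2 ^ Suc k)"
      have N0: "N > 0" using False by (cases N) auto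
      have ex: "norm x \<le> 2 ^ Suc (N - 1)" using False N0 by simp
      have k1: "norm x \<le> 2 ^ Suc k" unfolding k_def using ex by (rule LeastI)
      have kN: "k < N" unfolding k_def using Least_le[of "\<lambda>k. norm x \<le> 2 ^ Suc k", OF ex] N0 by linarith
      have k2: "2 ^ k \<le> norm x"
      proof (cases k)
        case (Suc j)
        then have "\<not> norm x \<le> 2 ^ Suc j" using not_less_Least[of j "\<lambda>k. norm x \<le> 2 ^ Suc k"] unfolding k_def by simp
        then show ?thesis using Suc by simp
      qed (use False in simp)
      have "kap x ^ q \<le> kap x ^ ?n"
        using kap_bounds[of x] q by (intro power_decreasing) auto
      also have "\<dots> \<le> (1 / 2 ^ k) ^ ?n"
        using k2 by (intro power_mono) (auto simp: kap_def intro!: divide_left_mono mult_pos_pos)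
      finally have le: "kap x ^ q \<le> 1 / (2 ^ k) ^ ?n" by (simp add: power_divide)
      have "ennreal (kap x ^ q) * indicator (cball (0 :: real ^ 'n) (2 ^ N)) x \<le> ennreal (1 / (2 ^ k) ^ ?n) * indicator (cball (0 :: real ^ 'n) (2 ^ Suc k)) x"
        using k1 le by (auto simp: ennreal_leI split: split_indicator)
      also have "\<dots> \<le> (\<Sum>k<N. ennreal (1 / (2 ^ k) ^ ?n) * indicator (cball (0 :: real ^ 'n) (2 ^ Suc k)) x)"
        using kN by (intro member_le_sum) auto
      finally show ?thesis by (simp add: add_increasing)
    qed
  qed
  also have "\<dots> = ennreal c + (\<Sum>k<N. ennreal (1 / (2 ^ k) ^ ?n) * emeasure lborel (cball (0 :: real ^ 'n) (2 ^ Suc k)))"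
  proof -
    have "(\<lambda>x :: real ^ 'n. \<Sum>k<N. ennreal (1 / (2 ^ k) ^ ?n) * indicator (cball 0 (2 ^ Suc k)) x) \<in> borel_measurable lborel"
      by measurable
    moreover have "(\<integral>\<^sup>+x. (\<Sum>k<N. ennreal (1 / (2 ^ k) ^ ?n) * indicator (cball (0 :: real ^ 'n) (2 ^ Suc k)) x) \<partial>lborel) =
        (\<Sum>k<N. ennreal (1 / (2 ^ k) ^ ?n) * emeasure lborel (cball (0 :: real ^ 'n) (2 ^ Suc k)))"
      by (subst nn_integral_sum) (auto simp: nn_integral_cmult_indicator simp del: power_Suc)
    moreover have "(\<integral>\<^sup>+x. indicator (cball (0 :: real ^ 'n) 1) x \<partial>lborel) = ennreal c"
      by (simp add: emeasure_unit_cball c_def)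
    ultimately show ?thesis by (subst nn_integral_add) (auto simp del: power_Suc)
  qed
  also have "\<dots> = ennreal c + (\<Sum>k<N. ennreal (c * 2 ^ ?n))"
  proof -
    have "ennreal (1 / (2 ^ k) ^ ?n) * emeasure lborel (cball (0 :: real ^ 'n) (2 ^ Suc k)) = ennreal (c * 2 ^ ?n)" for k
    proof -
      have "1 / (2 ^ k) ^ ?n * (c * (2 ^ Suc k) ^ ?n) = c * 2 ^ ?n" by (simp add: power_mult_distrib)
      moreover have "measure lborel (cball (0 :: real ^ 'n) (2 ^ Suc k)) = c * (2 ^ Suc k) ^ ?n"
        unfolding c_def by (rule measure_cball_scale) simp
      ultimately show ?thesis using c by (simp add: emeasure_unit_cball ennreal_mult[symmetric] del: power_Suc)
    qed
    then show ?thesis by simp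
  qed
  also have "\<dots> = ennreal (c * (1 + real N * 2 ^ ?n))"
    using c by (simp add: ennreal_of_nat_eq_real_of_nat ennreal_mult[symmetric] ennreal_plus[symmetric] algebra_simps del: ennreal_plus)
  finally show ?thesis by (simp add: c_def)
qed

lemma kap_integral_bound:
  assumes q: "CARD('n::finite) \<le> q"
  shows "\<exists>C\<ge>0. \<forall>d. 0 < d \<longrightarrow> d \<le> 1 \<longrightarrow>
    (\<integral>\<^sup>+x. ennreal (kap x ^ q) * indicator (cball (0 :: real ^ 'n) (exp (2 / d))) x \<partial>lborel) \<le> ennreal (C / d)"
proof -
  define c where "c = measure lborel (cball (0 :: real ^ 'n) 1)"
  have c: "c > 0" unfolding c_def by (rule measure_unit_cball_pos)
  show ?thesis
  proof (intro exI[of _ "c * (1 + 5 * 2 ^ CARD('n))"] conjI allI impI)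
    show "0 \<le> c * (1 + 5 * 2 ^ CARD('n))" using c by simp
    fix d :: real assume d: "0 < d" "d \<le> 1"
    \<comment> \<open>As e \<le> 4, exp(2/d) is at most 2^(4/d), so about 4/d shells suffice;
      rounding up costs 1 \<le> 1/d, whence the 5.\<close>
    define N where "N = nat \<lceil>4 / d\<rceil>"
    have N: "4 / d \<le> real N" "real N \<le> 5 / d"
    proof -
      show "4 / d \<le> real N" unfolding N_def by (rule real_nat_ceiling_ge)
      have "real N \<le> 4 / d + 1" unfolding N_def using d by (simp add: of_nat_ceiling ceiling_correct)
      also have "1 \<le> 1 / d" using d by simp
      finally show "real N \<le> 5 / d" by (simp add: add_divide_distrib[symmetric])
    qed
    have "exp (2 / d) = exp 1 powr (2 / d)" by (simp add: powr_def)
    also have "\<dots> \<le> 4 powr (2 / d)" using exp_le d by (intro powr_mono2) auto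
    also have "(4::real) = 2 powr 2" by simp
    also have "(2 powr 2) powr (2 / d) = 2 powr (4 / d)" by (simp only: powr_powr) simp
    also have "\<dots> \<le> 2 powr (real N)" using N by (intro powr_mono) auto
    also have "\<dots> = 2 ^ N" by (simp add: powr_realpow)
    finally have e: "exp (2 / d) \<le> 2 ^ N" .
    have "(\<integral>\<^sup>+x. ennreal (kap x ^ q) * indicator (cball (0 :: real ^ 'n) (exp (2 / d))) x \<partial>lborel) \<le>
      (\<integral>\<^sup>+x. ennreal (kap x ^ q) * indicator (cball (0 :: real ^ 'n) (2 ^ N)) x \<partial>lborel)"
      using e by (intro nn_integral_mono mult_left_mono) (auto split: split_indicator)
    also have "\<dots> \<le> ennreal (c * (1 + real N * 2 ^ CARD('n)))" unfolding c_def by (rule kap_shells[OF q])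
    also have "\<dots> \<le> ennreal (c * (1 + 5 * 2 ^ CARD('n)) / d)"
    proof (rule ennreal_leI)
      have "real N * 2 ^ CARD('n) \<le> 5 / d * 2 ^ CARD('n)" using N(2) by (rule mult_right_mono) simp
      moreover have "1 \<le> 1 / d" using d by simp
      ultimately have "1 + real N * 2 ^ CARD('n) \<le> 1 / d + 5 / d * 2 ^ CARD('n)" by linarith
      also have "\<dots> = (1 + 5 * 2 ^ CARD('n)) / d" by (simp add: add_divide_distrib)
      finally have "c * (1 + real N * 2 ^ CARD('n)) \<le> c * ((1 + 5 * 2 ^ CARD('n)) / d)"
        using c by (intro mult_left_mono) auto
      then show "c * (1 + real N * 2 ^ CARD('n)) \<le> c * (1 + 5 * 2 ^ CARD('n)) / d" by simp
    qed
    finally show "(\<integral>\<^sup>+x. ennreal (kap x ^ q) * indicator (cball (0 :: real ^ 'n) (exp (2 / d))) x \<partial>lborel) \<le> ennreal (c * (1 + 5 * 2 ^ CARD('n)) / d)" .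
  qed
qed

text \<open>The gradient contributes d^q and the shells cost 1/d; q \<ge> 2 leaves a factor
  \<open>d\<close>. Below it is applied with q = n if n \<ge> 3 and q = 2 otherwise.\<close>

lemma lcut_grad_integral:
  assumes q: "CARD('n::finite) \<le> q" "2 \<le> q"
  shows "\<exists>C\<ge>0. \<forall>d. 0 < d \<longrightarrow> d \<le> 1 \<longrightarrow>
    (\<integral>\<^sup>+x. ennreal (norm (lcut_grad d (x :: real ^ 'n)) ^ q) \<partial>lborel) \<le> ennreal (C * d)"
proof -
  obtain C where C: "C \<ge> 0" "\<And>d. 0 < d \<Longrightarrow> d \<le> 1 \<Longrightarrow>
    (\<integral>\<^sup>+x. ennreal (kap x ^ q) * indicator (cball (0 :: real ^ 'n) (exp (2 / d))) x \<partial>lborel) \<le> ennreal (C / d)"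
    using kap_integral_bound[OF q(1)] by blast
  show ?thesis
  proof (intro exI[of _ "36 ^ q * C"] conjI allI impI)
    show "0 \<le> 36 ^ q * C" using C by simp
    fix d :: real assume d: "0 < d" "d \<le> 1"
    have "(\<integral>\<^sup>+x. ennreal (norm (lcut_grad d (x :: real ^ 'n)) ^ q) \<partial>lborel) \<le>
      (\<integral>\<^sup>+x. ennreal ((36 * d) ^ q) * (ennreal (kap x ^ q) * indicator (cball (0 :: real ^ 'n) (exp (2 / d))) x) \<partial>lborel)"
    proof (rule nn_integral_mono)
      fix x :: "real ^ 'n"
      show "ennreal (norm (lcut_grad d x) ^ q) \<le> ennreal ((36 * d) ^ q) * (ennreal (kap x ^ q) * indicator (cball (0 :: real ^ 'n) (exp (2 / d))) x)"
      proof (cases "lcut_grad d x = 0")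
        case True
        then show ?thesis using q by (simp add: power_0_left)
      next
        case False
        have "norm (lcut_grad d x) ^ q \<le> (36 * d * kap x) ^ q" by (intro power_mono lcut_grad_bound d) simp
        then show ?thesis using lcut_grad_support[OF d(1) False] d kap_bounds(1)[of x]
          by (simp add: power_mult_distrib ennreal_mult[symmetric] ennreal_leI)
      qed
    qed
    also have "\<dots> = ennreal ((36 * d) ^ q) * (\<integral>\<^sup>+x. ennreal (kap x ^ q) * indicator (cball (0 :: real ^ 'n) (exp (2 / d))) x \<partial>lborel)"
      by (rule nn_integral_cmult) measurable
    also have "\<dots> \<le> ennreal ((36 * d) ^ q) * ennreal (C / d)" by (intro mult_left_mono C d) simp
    also have "\<dots> = ennreal ((36 * d) ^ q * (C / d))" using d C(1) by (simp add: ennreal_mult[symmetric])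
    also have "\<dots> \<le> ennreal (36 ^ q * C * d)"
    proof (rule ennreal_leI)
      have "d ^ q \<le> d ^ 2" using d q by (intro power_decreasing) auto
      then have "(36 * d) ^ q * (C / d) \<le> 36 ^ q * d ^ 2 * (C / d)"
        using d C(1) by (intro mult_right_mono) (auto simp: power_mult_distrib)
      also have "\<dots> = 36 ^ q * C * d" using d by (simp add: power2_eq_square)
      finally show "(36 * d) ^ q * (C / d) \<le> 36 ^ q * C * d" .
    qed
    finally show "(\<integral>\<^sup>+x. ennreal (norm (lcut_grad d (x :: real ^ 'n)) ^ q) \<partial>lborel) \<le> ennreal (36 ^ q * C * d)" .
  qed
qed

subsection \<open>Approximation of bounded fields by test fields\<close>

lemma integrable_inner_gradient:
  fixes Z :: "real ^ 'n::finite \<Rightarrow> real ^ 'n"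
  assumes Z: "locally_integrable Z" and \<phi>: "test_function \<phi>"
  shows "integrable lborel (\<lambda>x. Z x \<bullet> gradient \<phi> x)"
proof -
  obtain R where R: "\<And>x. \<phi> x \<noteq> 0 \<Longrightarrow> norm x \<le> R" using test_functionE[OF \<phi>] by metis
  note c = test_function_C1_grad[OF \<phi>]
  have RG: "norm x \<le> R" if "gradient \<phi> x \<noteq> 0" for x
    using C1_grad_support[OF c R, of x] that by force
  have "integrable lborel (\<lambda>x. Z x $ i *\<^sub>R gradient \<phi> x)" for i
    by (rule integrable_locally_integrable_continuous[OF locally_integrable_nth[OF Z] C1_grad_continuous_grad[OF c] RG])
  from integrable_vec_nth(1)[OF this] have "integrable lborel (\<lambda>x. Z x $ i * gradient \<phi> x $ i)" for i by simp
  then show ?thesis unfolding inner_vec_def inner_real_def by (intro Bochner_Integration.integrable_sum)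
qed

lemma has_weak_divergence_diff:
  fixes Z W :: "real ^ 'n::finite \<Rightarrow> real ^ 'n"
  assumes Z: "has_weak_divergence Z f" and W: "has_weak_divergence W g"
  shows "has_weak_divergence (\<lambda>x. Z x - W x) (\<lambda>x. f x - g x)"
  unfolding has_weak_divergence_def
proof (intro conjI allI impI)
  have li: "locally_integrable Z" "locally_integrable W" "locally_integrable f" "locally_integrable g"
    using Z W by (auto simp: has_weak_divergence_def)
  show "locally_integrable (\<lambda>x. Z x - W x)" "locally_integrable (\<lambda>x. f x - g x)"
    using locally_integrable_add[OF li(1) locally_integrable_scaleR[OF li(2), of "-1"]]
      locally_integrable_add[OF li(3) locally_integrable_scaleR[OF li(4), of "-1"]] by simp_all
  fix \<phi> :: "real ^ 'n \<Rightarrow> real" assume \<phi>: "test_function \<phi>"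
  obtain R where R: "\<And>x. \<phi> x \<noteq> 0 \<Longrightarrow> norm x \<le> R" using test_functionE[OF \<phi>] by metis
  note cp = C1_grad_continuous[OF test_function_C1_grad[OF \<phi>]]
  have i: "integrable lborel (\<lambda>x. f x * \<phi> x)" "integrable lborel (\<lambda>x. g x * \<phi> x)"
    using integrable_locally_integrable_continuous[OF li(3) cp R] integrable_locally_integrable_continuous[OF li(4) cp R] by simp_all
  have "(\<integral>x. (f x - g x) * \<phi> x \<partial>lborel) = (\<integral>x. f x * \<phi> x \<partial>lborel) - (\<integral>x. g x * \<phi> x \<partial>lborel)"
    using i by (simp add: left_diff_distrib)
  also have "\<dots> = - (\<integral>x. Z x \<bullet> gradient \<phi> x \<partial>lborel) - - (\<integral>x. W x \<bullet> gradient \<phi> x \<partial>lborel)"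
    using Z W \<phi> by (simp add: has_weak_divergence_def)
  also have "\<dots> = - (\<integral>x. (Z x - W x) \<bullet> gradient \<phi> x \<partial>lborel)"
    using integrable_inner_gradient[OF li(1) \<phi>] integrable_inner_gradient[OF li(2) \<phi>] by (simp add: inner_diff_left)
  finally show "(\<integral>x. (f x - g x) * \<phi> x \<partial>lborel) = - (\<integral>x. (Z x - W x) \<bullet> gradient \<phi> x \<partial>lborel)" .
qed

lemma integrable_pair_bounded:
  fixes f :: "'a::euclidean_space \<Rightarrow> 'b::euclidean_space \<Rightarrow> real"
  assumes f: "case_prod f \<in> borel_measurable (lborel \<Otimes>\<^sub>M lborel)"
    and A: "A \<in> sets borel" "emeasure lborel A < \<infinity>" and B: "B \<in> sets borel" "emeasure lborel B < \<infinity>"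
    and b: "\<And>x y. \<bar>f x y\<bar> \<le> C * (indicator A x * indicator B y)"
  shows "integrable (lborel \<Otimes>\<^sub>M lborel) (case_prod f)"
proof (rule Bochner_Integration.integrable_bound[OF _ f])
  have "emeasure (lborel \<Otimes>\<^sub>M lborel) (A \<times> B) = emeasure lborel A * emeasure lborel B"
    using A B by (intro lborel.emeasure_pair_measure_Times) auto
  then have "integrable (lborel \<Otimes>\<^sub>M lborel) (indicator (A \<times> B) :: 'a \<times> 'b \<Rightarrow> real)"
    using A B by (intro integrable_real_indicator) (auto simp: ennreal_mult_less_top)
  then show "integrable (lborel \<Otimes>\<^sub>M lborel) (\<lambda>z. C * indicator (A \<times> B) z)" by (rule integrable_mult_right)
  show "AE z in lborel \<Otimes>\<^sub>M lborel. norm (case_prod f z) \<le> norm (C * indicator (A \<times> B) z)"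
  proof (rule AE_I2, clarify)
    fix x y
    have "\<bar>f x y\<bar> \<le> C * indicator (A \<times> B) (x, y)" using b[of x y] by (simp add: indicator_times)
    also have "\<dots> \<le> \<bar>C * indicator (A \<times> B) (x, y)\<bar>" by (rule abs_ge_self)
    finally show "norm (f x y) \<le> norm (C * indicator (A \<times> B) (x, y))" by simp
  qed
qed

text \<open>The divergence of \<open>x\<close> times $s^{-n-1} h(x/s)$ is minus the $s$-derivative of $s^{-n} h(x/s)$, so
  the divergence of this superposition of dilates telescopes.\<close>

definition radial :: "real \<Rightarrow> (real ^ 'n::finite \<Rightarrow> real) \<Rightarrow> real ^ 'n \<Rightarrow> real ^ 'n" where
  "radial T h x = (\<integral>s. indicator {1..T} s * (h ((1 / s) *\<^sub>R x) / s ^ Suc CARD('n)) \<partial>lborel) *\<^sub>R x"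

lemma radial_measurable:
  assumes [measurable]: "h \<in> borel_measurable borel"
  shows "radial T h \<in> borel_measurable borel"
proof -
  have "(\<lambda>x. (\<integral>s. indicator {1..T} s * (h ((1 / s) *\<^sub>R x) / s ^ Suc CARD('n)) \<partial>lborel) *\<^sub>R x) \<in> borel_measurable lborel"
    by measurable
  then show ?thesis unfolding radial_def[abs_def] by simp
qed

text \<open>The weak form of the telescoping: after Fubini and the substitution x = s y the powers
  of \<open>s\<close> cancel, and the inner integral is that of the derivative of s to \<phi>(s y)
  from 1 to T. The hypothesis \<open>bnd\<close> supplies local integrability of the field.\<close>

lemma radial_divergence:
  fixes h :: "real ^ 'n::finite \<Rightarrow> real"
  assumes h: "continuous_on UNIV h" and R: "\<And>x. h x \<noteq> 0 \<Longrightarrow> norm x \<le> R" and T: "T \<ge> 1"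
    and bnd: "\<And>x. norm (radial T h x) \<le> B"
  shows "has_weak_divergence (radial T h) (\<lambda>x. h x - (1 / T ^ CARD('n)) * h ((1 / T) *\<^sub>R x))"
  unfolding has_weak_divergence_def
proof (intro conjI allI impI)
  let ?n = "CARD('n)"
  have [measurable]: "h \<in> borel_measurable borel" using h by (rule borel_measurable_continuous_onI)
  have hT: "continuous_on UNIV (\<lambda>x. h ((1 / T) *\<^sub>R x))"
    by (rule continuous_on_compose2[OF h]) (auto intro!: continuous_intros)
  show "locally_integrable (radial T h)"
    by (rule locally_integrable_bounded[where C=B]) (auto intro: radial_measurable bnd)
  show "locally_integrable (\<lambda>x. h x - (1 / T ^ ?n) * h ((1 / T) *\<^sub>R x))"
    by (intro locally_integrable_continuous continuous_intros h hT)
  fix \<phi> :: "real ^ 'n \<Rightarrow> real" assume \<phi>: "test_function \<phi>"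
  obtain r where r: "\<And>x. \<phi> x \<noteq> 0 \<Longrightarrow> norm x \<le> r" using test_functionE[OF \<phi>] by metis
  note c = test_function_C1_grad[OF \<phi>]
  have rG: "norm x \<le> r" if "gradient \<phi> x \<noteq> 0" for x
    using C1_grad_support[OF c r, of x] that by force
  have [measurable]: "\<phi> \<in> borel_measurable borel" "gradient \<phi> \<in> borel_measurable borel"
    using C1_grad_measurable[OF c] by auto
  obtain L where L: "L > 0" "\<And>x. norm (gradient \<phi> x) \<le> L"
    using continuous_compact_support_bounded[OF C1_grad_continuous_grad[OF c] rG] by metis
  obtain K where K: "K > 0" "\<And>x. norm (h x) \<le> K" using continuous_compact_support_bounded[OF h R] by metis
  \<comment> \<open>\<open>Q\<close> is the integrand before and \<open>P\<close> the one after the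
    substitution x = s y; each is bounded on a product of sets of finite measure, which justifies
    the two exchanges of integrals.\<close>
  define Q where "Q = (\<lambda>(x :: real ^ 'n) s. indicator {1..T} s * (h ((1 / s) *\<^sub>R x) / s ^ Suc ?n) * (x \<bullet> gradient \<phi> x))"
  define P where "P = (\<lambda>(y :: real ^ 'n) s. indicator {1..T} s * (h y * (y \<bullet> gradient \<phi> (s *\<^sub>R y))))"
  have Qi: "integrable (lborel \<Otimes>\<^sub>M lborel) (case_prod Q)"
  proof (rule integrable_pair_bounded[where A="cball 0 r" and B="{1..T}" and C="K * (r * L)"])
    show "case_prod Q \<in> borel_measurable (lborel \<Otimes>\<^sub>M lborel)" unfolding Q_def by measurable
    fix x :: "real ^ 'n" and s :: real
    show "\<bar>Q x s\<bar> \<le> K * (r * L) * (indicator (cball 0 r) x * indicator {1..T} s)"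
    proof (cases "s \<in> {1..T} \<and> gradient \<phi> x \<noteq> 0")
      case True
      then have s: "1 \<le> s" and x: "norm x \<le> r" using rG by auto
      have "\<bar>h ((1 / s) *\<^sub>R x) / s ^ Suc ?n\<bar> \<le> K / 1"
        unfolding abs_divide using K(2)[of "(1 / s) *\<^sub>R x"] K(1) s one_le_power[OF s, of "Suc ?n"]
        by (intro frac_le) auto
      moreover have "\<bar>x \<bullet> gradient \<phi> x\<bar> \<le> r * L"
        using L x by (intro order_trans[OF Cauchy_Schwarz_ineq2] mult_mono) (auto intro: order_trans[OF norm_ge_zero])
      ultimately have "\<bar>h ((1 / s) *\<^sub>R x) / s ^ Suc ?n\<bar> * \<bar>x \<bullet> gradient \<phi> x\<bar> \<le> K * (r * L)"
        using K by (intro mult_mono) auto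
      then show ?thesis using True x by (simp add: Q_def abs_mult)
    next
      case False
      have "0 \<le> K * (r * L) * (indicator (cball 0 r) x * indicator {1..T} s)"
      proof (cases "norm x \<le> r")
        case True
        then have "r \<ge> 0" using norm_ge_zero order_trans by blast
        then show ?thesis using K L by simp
      qed simp
      then show ?thesis using False by (auto simp: Q_def)
    qed
  qed (use emeasure_lborel_cball_finite[of "0 :: real ^ 'n"] T in auto)
  have Pi: "integrable (lborel \<Otimes>\<^sub>M lborel) (case_prod P)"
  proof (rule integrable_pair_bounded[where A="cball 0 R" and B="{1..T}" and C="K * (R * L)"])
    show "case_prod P \<in> borel_measurable (lborel \<Otimes>\<^sub>M lborel)" unfolding P_def by measurable
    fix y :: "real ^ 'n" and s :: real
    show "\<bar>P y s\<bar> \<le> K * (R * L) * (indicator (cball 0 R) y * indicator {1..T} s)"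
    proof (cases "s \<in> {1..T} \<and> h y \<noteq> 0")
      case True
      then have y: "norm y \<le> R" using R by auto
      have "\<bar>y \<bullet> gradient \<phi> (s *\<^sub>R y)\<bar> \<le> R * L"
        using L y by (intro order_trans[OF Cauchy_Schwarz_ineq2] mult_mono) (auto intro: order_trans[OF norm_ge_zero])
      then have "\<bar>h y\<bar> * \<bar>y \<bullet> gradient \<phi> (s *\<^sub>R y)\<bar> \<le> K * (R * L)"
        using K(2)[of y] K(1) by (intro mult_mono) auto
      then show ?thesis using True y by (simp add: P_def abs_mult)
    next
      case False
      have "0 \<le> K * (R * L) * (indicator (cball 0 R) y * indicator {1..T} s)"
      proof (cases "norm y \<le> R")
        case True
        then have "R \<ge> 0" using norm_ge_zero order_trans by blast
        then show ?thesis using K L by simp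
      qed simp
      then show ?thesis using False by (auto simp: P_def)
    qed
  qed (use emeasure_lborel_cball_finite[of "0 :: real ^ 'n"] T in auto)
  have "(\<integral>x. radial T h x \<bullet> gradient \<phi> x \<partial>lborel) = (\<integral>x. \<integral>s. Q x s \<partial>lborel \<partial>lborel)"
    unfolding radial_def Q_def inner_scaleR_left integral_mult_left_zero ..
  also have "\<dots> = (\<integral>s. \<integral>x. Q x s \<partial>lborel \<partial>lborel)"
    by (rule lborel_pair.Fubini_integral[OF Qi, symmetric])
  also have "\<dots> = (\<integral>s. \<integral>y. P y s \<partial>lborel \<partial>lborel)"
  proof (rule Bochner_Integration.integral_cong[OF refl])
    fix s :: real
    show "(\<integral>x. Q x s \<partial>lborel) = (\<integral>y. P y s \<partial>lborel)"
    proof (cases "s \<in> {1..T}")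
      case True
      then have s: "s > 0" by auto
      have "(\<integral>x. Q x s \<partial>lborel) = (\<bar>s\<bar> ^ DIM(real ^ 'n)) *\<^sub>R (\<integral>y. Q (0 + s *\<^sub>R y) s \<partial>lborel)"
        by (rule integral_lborel_affine) (use s in simp)
      also have "\<dots> = (\<integral>y. s ^ ?n * Q (s *\<^sub>R y) s \<partial>lborel)" using s by simp
      also have "\<dots> = (\<integral>y. P y s \<partial>lborel)"
        using s True by (intro Bochner_Integration.integral_cong refl) (simp add: Q_def P_def)
      finally show ?thesis .
    qed (simp add: Q_def P_def)
  qed
  also have "\<dots> = (\<integral>y. \<integral>s. P y s \<partial>lborel \<partial>lborel)"
    by (rule lborel_pair.Fubini_integral[OF Pi])
  also have "\<dots> = (\<integral>y. h y * (\<phi> (T *\<^sub>R y) - \<phi> y) \<partial>lborel)"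
  proof (rule Bochner_Integration.integral_cong[OF refl])
    fix y
    have "(\<integral>s. (gradient \<phi> (0 + s *\<^sub>R y) \<bullet> y) * indicator {1..T} s \<partial>lborel) = \<phi> (0 + T *\<^sub>R y) - \<phi> (0 + 1 *\<^sub>R y)"
    proof (rule integral_FTC_Icc_real[OF T])
      show "\<And>s. 1 \<le> s \<Longrightarrow> s \<le> T \<Longrightarrow> ((\<lambda>s. \<phi> (0 + s *\<^sub>R y)) has_real_derivative gradient \<phi> (0 + s *\<^sub>R y) \<bullet> y) (at s)"
        by (rule C1_grad_direction[OF c])
      fix s :: real
      have "isCont (\<lambda>s. 0 + s *\<^sub>R y) s" by (intro continuous_intros)
      moreover have "isCont (gradient \<phi>) (0 + s *\<^sub>R y)"
        using C1_grad_continuous_grad[OF c, of UNIV] by (simp add: continuous_on_eq_continuous_at)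
      ultimately have "isCont (\<lambda>s. gradient \<phi> (0 + s *\<^sub>R y)) s" by (rule isCont_o2)
      then show "isCont (\<lambda>s. gradient \<phi> (0 + s *\<^sub>R y) \<bullet> y) s" by (intro continuous_intros)
    qed
    then have e: "(\<integral>s. indicator {1..T} s * (y \<bullet> gradient \<phi> (s *\<^sub>R y)) \<partial>lborel) = \<phi> (T *\<^sub>R y) - \<phi> y"
      by (simp add: inner_commute mult.commute)
    have "(\<integral>s. P y s \<partial>lborel) = (\<integral>s. h y * (indicator {1..T} s * (y \<bullet> gradient \<phi> (s *\<^sub>R y))) \<partial>lborel)"
      by (simp add: P_def mult.left_commute)
    then show "(\<integral>s. P y s \<partial>lborel) = h y * (\<phi> (T *\<^sub>R y) - \<phi> y)" by (simp add: e)
  qed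
  finally have main: "(\<integral>x. radial T h x \<bullet> gradient \<phi> x \<partial>lborel) = (\<integral>y. h y * (\<phi> (T *\<^sub>R y) - \<phi> y) \<partial>lborel)" .
  note cp = C1_grad_continuous[OF c]
  have cpT: "continuous_on UNIV (\<lambda>y. \<phi> (T *\<^sub>R y))"
    by (rule continuous_on_compose2[OF cp]) (auto intro!: continuous_intros)
  have i1: "integrable lborel (\<lambda>y. h y * \<phi> y)" and i2: "integrable lborel (\<lambda>y. h y * \<phi> (T *\<^sub>R y))"
    by (rule continuous_compact_support_integrable[where R=R]; use R h cp cpT in \<open>auto intro!: continuous_intros\<close>)+
  have i3: "integrable lborel (\<lambda>x. (1 / T ^ ?n * h ((1 / T) *\<^sub>R x)) * \<phi> x)"
    by (rule continuous_compact_support_integrable[where R=r]; use r hT cp T in \<open>auto intro!: continuous_intros\<close>)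
  have sc: "(\<integral>x. (1 / T ^ ?n * h ((1 / T) *\<^sub>R x)) * \<phi> x \<partial>lborel) = (\<integral>y. h y * \<phi> (T *\<^sub>R y) \<partial>lborel)"
    using T by (subst integral_lborel_affine[of T _ 0]) auto
  have "(\<integral>x. (h x - 1 / T ^ ?n * h ((1 / T) *\<^sub>R x)) * \<phi> x \<partial>lborel) = (\<integral>y. h y * \<phi> y \<partial>lborel) - (\<integral>y. h y * \<phi> (T *\<^sub>R y) \<partial>lborel)"
    unfolding left_diff_distrib Bochner_Integration.integral_diff[OF i1 i3] sc ..
  also have "\<dots> = - (\<integral>x. radial T h x \<bullet> gradient \<phi> x \<partial>lborel)"
    unfolding main right_diff_distrib Bochner_Integration.integral_diff[OF i2 i1] by simp
  finally show "(\<integral>x. (h x - 1 / T ^ ?n * h ((1 / T) *\<^sub>R x)) * \<phi> x \<partial>lborel) = - (\<integral>x. radial T h x \<bullet> gradient \<phi> x \<partial>lborel)" .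
qed

text \<open>Under the decay C/|x| the integrand is at most C/|x| times s^(-n), and for n \<ge> 2 the
  integral of s^(-2) from 1 to T is below 1 whatever T is. On the line this integral would be
  logarithmic.\<close>

lemma radial_bound:
  fixes h :: "real ^ 'n::finite \<Rightarrow> real"
  assumes n: "CARD('n) \<ge> 2" and [measurable]: "h \<in> borel_measurable borel" and T: "T \<ge> 1"
    and h: "\<And>x. x \<noteq> 0 \<Longrightarrow> \<bar>h x\<bar> \<le> C / norm x" and C: "C \<ge> 0"
  shows "norm (radial T h x) \<le> C"
proof (cases "x = 0")
  case False
  have hb: "has_bochner_integral lborel (\<lambda>s. (1 / s\<^sup>2) * indicator {1..T} s) (- (1 / T) - (- (1 / 1)))"
  proof (rule has_bochner_integral_FTC_Icc_real[OF T])
    fix s :: real assume s: "1 \<le> s" "s \<le> T"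
    show "((\<lambda>s. - (1 / s)) has_real_derivative 1 / s\<^sup>2) (at s)"
      using s by (auto intro!: derivative_eq_intros simp: power2_eq_square)
    show "isCont (\<lambda>s. 1 / s\<^sup>2) s" using s by (intro continuous_intros) auto
  qed
  then have i: "integrable lborel (\<lambda>s. (C / norm x) * ((1 / s\<^sup>2) * indicator {1..T} s))"
    by (intro integrable_mult_right) (simp add: has_bochner_integral_iff)
  have bd: "norm (indicator {1..T} s * (h ((1 / s) *\<^sub>R x) / s ^ Suc CARD('n))) \<le> (C / norm x) * ((1 / s\<^sup>2) * indicator {1..T} s)" for s
  proof (cases "s \<in> {1..T}")
    case True
    then have s: "s \<ge> 1" by simp
    have "\<bar>h ((1 / s) *\<^sub>R x)\<bar> \<le> C / norm ((1 / s) *\<^sub>R x)" using False s by (intro h) simp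
    also have "\<dots> = C / norm x * s" using s by simp
    finally have "\<bar>h ((1 / s) *\<^sub>R x)\<bar> / s ^ Suc CARD('n) \<le> C / norm x * s / s ^ Suc CARD('n)"
      using s by (intro divide_right_mono) auto
    also have "\<dots> = C / norm x * (1 / s ^ CARD('n))" using s by simp
    also have "\<dots> \<le> C / norm x * (1 / s\<^sup>2)"
      using C s n by (intro mult_left_mono divide_left_mono power_increasing) auto
    finally show ?thesis using True s by (simp add: abs_mult)
  qed simp
  have i2: "integrable lborel (\<lambda>s. indicator {1..T} s * (h ((1 / s) *\<^sub>R x) / s ^ Suc CARD('n)))"
  proof (rule Bochner_Integration.integrable_bound[OF i])
    show "AE s in lborel. norm (indicator {1..T} s * (h ((1 / s) *\<^sub>R x) / s ^ Suc CARD('n))) \<le> norm ((C / norm x) * ((1 / s\<^sup>2) * indicator {1..T} s))"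
      unfolding real_norm_def[of "(C / norm x) * _"] by (rule AE_I2, rule order_trans[OF bd abs_ge_self])
  qed measurable
  have "norm (\<integral>s. indicator {1..T} s * (h ((1 / s) *\<^sub>R x) / s ^ Suc CARD('n)) \<partial>lborel) \<le>
      (\<integral>s. norm (indicator {1..T} s * (h ((1 / s) *\<^sub>R x) / s ^ Suc CARD('n))) \<partial>lborel)"
    by (rule integral_norm_bound)
  also have "\<dots> \<le> (\<integral>s. (C / norm x) * ((1 / s\<^sup>2) * indicator {1..T} s) \<partial>lborel)"
    by (rule integral_mono[OF integrable_norm[OF i2] i bd])
  also have "\<dots> = (C / norm x) * (1 - 1 / T)"
    by (simp only: integral_mult_right_zero has_bochner_integral_integral_eq[OF hb]) simp
  also have "\<dots> \<le> C / norm x * 1" using C T by (intro mult_left_mono) auto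
  finally show ?thesis
    using False by (simp add: radial_def field_simps)
qed (use C in \<open>simp add: radial_def\<close>)

text \<open>Mollifying a compactly supported field bounded by M gives test fields with the same
  bound; divided by -M they are admissible in the definition of \<open>TV\<close>, and their
  divergences converge in D^1_0.\<close>

lemma TV_bound_compact_field:
  fixes g :: "(real ^ 'n::finite \<Rightarrow> real) \<Rightarrow> real"
  assumes g: "g \<in> Dm1" and tau: "TV g = ereal \<tau>"
    and Phi: "\<Phi> \<in> borel_measurable borel" "\<And>x. norm (\<Phi> x) \<le> M" "\<And>x. \<Phi> x \<noteq> 0 \<Longrightarrow> norm x \<le> R" and M: "M > 0"
    and d: "has_weak_divergence \<Phi> d" "d \<in> D10"
  shows "- g d \<le> M * \<tau>"
proof -
  define W where "W = (\<lambda>k x. \<chi> i. conv (\<lambda>y. \<Phi> y $ i) (mol k) x)"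
  have li: "locally_integrable (\<lambda>y. \<Phi> y $ i)" for i
    using d(1) by (auto simp: has_weak_divergence_def intro: locally_integrable_nth)
  have "test_function (conv (\<lambda>y. \<Phi> y $ i) (mol k))" for i k
    by (rule test_function_conv[OF li _ test_function_mol, where R'=R]) (use Phi(3) in force)
  then have tW: "test_field (W k)" for k by (simp add: test_field_def W_def)
  have divW: "divergence (W k) = conv d (mol k)" for k
    unfolding W_def by (rule divergence_conv[OF d(1) test_function_mol])
  have WM: "norm (W k x) \<le> M" for k x
    unfolding W_def using Phi by (intro conv_mol_AE_bound) auto
  \<comment> \<open>The zero summand brings the multiple into the form of
    \<open>test_field_combination\<close>.\<close>
  define \<psi> where "\<psi> = (\<lambda>k x. (- 1 / M) *\<^sub>R W k x + 0 *\<^sub>R W k x)"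
  have "\<psi> k \<in> unit_fields" for k
  proof -
    have "norm (\<psi> k x) \<le> 1" for x using WM[of k x] M by (simp add: \<psi>_def)
    then show ?thesis
      using test_field_combination(1)[OF tW tW, of "- 1 / M" k 0 k] by (simp add: unit_fields_def \<psi>_def)
  qed
  from TV_upper[OF this, of g] have le: "g (divergence (\<psi> k)) \<le> \<tau>" for k by (simp add: tau)
  have "divergence (\<psi> k) = (\<lambda>x. (- 1 / M) * conv d (mol k) x)" for k
    unfolding \<psi>_def test_field_combination(2)[OF tW tW] divW by simp
  then have "g (divergence (\<psi> k)) = (- 1 / M) * g (conv d (mol k))" for k
    using Dm1D(2)[OF g mollify_D10(1)[OF d(2)], of "- 1 / M"] by simp
  with le have le2: "- g (conv d (mol k)) \<le> M * \<tau>" for k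
    using M by (simp add: field_simps)
  have "(\<lambda>k. - g (conv d (mol k))) \<longlonglongrightarrow> - g d"
    by (intro tendsto_minus Dm1_continuous[OF g mollify_D10(1) d(2) mollify_D10(3)] d)
  then show ?thesis by (rule LIMSEQ_le_const2) (use le2 in blast)
qed

text \<open>The commutator term \<open>h\<close> is the inner product of \<open>Z\<close> with the gradient of the cutoff. In
  dimension one it is itself small in $D^1_0$. In higher dimension it is removed by subtracting a
  radial field of divergence \<open>h\<close>, up to a remote small remainder \<open>e\<close>; that field is small in the
  supremum norm precisely because the cutoff is logarithmic.\<close>

lemma cutoff_field:
  fixes Z :: "real ^ 'n::finite \<Rightarrow> real ^ 'n"
  assumes Z: "\<And>i. C1_grad (\<lambda>x. Z x $ i) (G i)" and Z1: "\<And>x. norm (Z x) \<le> 1"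
    and f: "\<And>x. f x = (\<Sum>i\<in>UNIV. G i x $ i)" and fM: "\<And>x. \<bar>f x\<bar> \<le> M"
  shows "\<exists>C\<ge>0. \<forall>d. 0 < d \<longrightarrow> d \<le> 1 \<longrightarrow> (\<exists>\<Phi> R e E. \<Phi> \<in> borel_measurable borel \<and>
    (\<forall>x. norm (\<Phi> x) \<le> 1 + 36 * d) \<and> (\<forall>x. \<Phi> x \<noteq> 0 \<longrightarrow> norm x \<le> R) \<and>
    has_weak_divergence \<Phi> (\<lambda>x. lcut d x * f x + e x) \<and> C1_grad e E \<and> (\<forall>x. e x \<noteq> 0 \<longrightarrow> norm x \<le> R) \<and>
    energy E \<le> ennreal (C * d))"
proof -
  have M0: "M \<ge> 0" using fM[of 0] abs_ge_zero order_trans by blast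
  define h where "h = (\<lambda>d x. \<Sum>i\<in>UNIV. lcut_grad d x $ i * Z x $ i)"
  \<comment> \<open>Row \<open>i\<close> of the Hessian of the cutoff, as in
    \<open>C1_grad_lcut_grad\<close>; it enters the gradient \<open>H\<close> of
    \<open>h\<close>.\<close>
  define L where "L = (\<lambda>d i (x :: real ^ 'n). (2 * slope d ((norm x)\<^sup>2)) *\<^sub>R axis i (1::real) + (2 * x $ i * slope' d ((norm x)\<^sup>2)) *\<^sub>R (2 *\<^sub>R x))"
  define H where "H = (\<lambda>d x. \<Sum>i\<in>UNIV. lcut_grad d x $ i *\<^sub>R G i x + Z x $ i *\<^sub>R L d i x)"
  have hH: "C1_grad (h d) (H d)" for d
    unfolding h_def H_def L_def by (intro C1_grad_sum C1_grad_mult C1_grad_lcut_grad Z) auto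
  have hin: "h d x = lcut_grad d x \<bullet> Z x" for d x by (simp add: h_def inner_vec_def)
  have hsupp: "norm x \<le> exp (2 / d)" if "d > 0" "h d x \<noteq> 0" for d x
    using lcut_grad_support[OF that(1), of x] that(2)
    by (cases "lcut_grad d x = 0") (auto simp: hin)
  have hbound: "\<bar>h d x\<bar> \<le> 36 * d * kap x" if "d > 0" for d x
  proof -
    have "\<bar>h d x\<bar> \<le> norm (lcut_grad d x) * norm (Z x)" unfolding hin by (rule Cauchy_Schwarz_ineq2)
    also have "\<dots> \<le> (36 * d * kap x) * 1"
      using that kap_bounds(1)[of x] by (intro mult_mono lcut_grad_bound Z1) auto
    finally show ?thesis by simp
  qed
  define \<Xi> where "\<Xi> = (\<lambda>d x. lcut d x *\<^sub>R Z x)"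
  have XiC: "C1_grad (\<lambda>x. \<Xi> d x $ i) (\<lambda>x. lcut d x *\<^sub>R G i x + Z x $ i *\<^sub>R lcut_grad d x)" for d i
    unfolding \<Xi>_def using C1_grad_mult[OF C1_grad_lcut Z] by simp
  have Xidiv: "has_weak_divergence (\<Xi> d) (\<lambda>x. lcut d x * f x + h d x)" for d
  proof -
    have "(\<lambda>x. \<Sum>i\<in>UNIV. (lcut d x *\<^sub>R G i x + Z x $ i *\<^sub>R lcut_grad d x) $ i) = (\<lambda>x. lcut d x * f x + h d x)"
      by (simp add: f h_def sum.distrib sum_distrib_left mult.commute)
    then show ?thesis using has_weak_divergence_C1[OF XiC, of d] by simp
  qed
  have Xim: "\<Xi> d \<in> borel_measurable borel" for d
    using Xidiv[of d] by (auto simp: has_weak_divergence_def intro: locally_integrable_measurable)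
  have Xi1: "norm (\<Xi> d x) \<le> 1" for d x
    using mult_le_one[OF lcut_bounds(2)[of d x] norm_ge_zero[of "Z x"] Z1] lcut_bounds(1)[of d x] by (simp add: \<Xi>_def)
  have Xisupp: "norm x \<le> exp (2 / d)" if "d > 0" "\<Xi> d x \<noteq> 0" for d x
    using lcut_support[OF that(1), of x] that(2) by (auto simp: \<Xi>_def)
  consider "CARD('n) = 1" | "CARD('n) \<ge> 2"
    using zero_less_card_finite[where 'a='n] by linarith
  then show ?thesis
  proof cases
    case 1
    then obtain i0 :: 'n where i0: "UNIV = {i0}" by (rule card_1_singletonE)
    \<comment> \<open>On the line the single partial derivative of \<open>Z\<close> is its
      divergence, so the bound on \<open>f\<close> controls the whole derivative.\<close>
    have nG: "norm (G i0 x) \<le> M" for x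
    proof -
      have "(norm (G i0 x))\<^sup>2 = \<bar>f x\<bar>\<^sup>2"
        unfolding power2_norm_eq_inner inner_vec_def f i0 by (simp add: power2_eq_square)
      then have "norm (G i0 x) = \<bar>f x\<bar>" by (rule power2_eq_imp_eq[OF _ norm_ge_zero abs_ge_zero])
      then show ?thesis using fM by simp
    qed
    obtain C0 where C0: "C0 \<ge> 0" "\<And>d. 0 < d \<Longrightarrow> d \<le> 1 \<Longrightarrow>
      (\<integral>\<^sup>+x. ennreal (kap x ^ 2) * indicator (cball (0 :: real ^ 'n) (exp (2 / d))) x \<partial>lborel) \<le> ennreal (C0 / d)"
      using kap_integral_bound[where 'n='n and q=2] 1 by auto
    \<comment> \<open>36 M comes from the gradient of the cutoff times the derivative of
      \<open>Z\<close>, 1260 from its Hessian. Squaring gives d^2, and the integral of the squared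
      weight costs 1/d.\<close>
    define A where "A = 36 * M + 1260"
    show ?thesis
    proof (intro exI[of _ "A\<^sup>2 * C0"] conjI allI impI)
      show "0 \<le> A\<^sup>2 * C0" using C0 by simp
      fix d :: real assume d: "0 < d" "d \<le> 1"
      have HA: "norm (H d x) \<le> A * d * kap x" for x
      proof -
        have "norm (H d x) \<le> \<bar>lcut_grad d x $ i0\<bar> * norm (G i0 x) + \<bar>Z x $ i0\<bar> * norm (L d i0 x)"
          unfolding H_def i0 by (simp add: order_trans[OF norm_triangle_ineq])
        also have "\<dots> \<le> (36 * d * kap x) * M + 1 * (1260 * d * kap x)"
        proof (intro add_mono mult_mono nG)
          show "\<bar>lcut_grad d x $ i0\<bar> \<le> 36 * d * kap x"
            using component_le_norm_cart[of "lcut_grad d x" i0] lcut_grad_bound[OF d(1), of x] by linarith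
          show "\<bar>Z x $ i0\<bar> \<le> 1" using component_le_norm_cart[of "Z x" i0] Z1[of x] by linarith
          show "norm (L d i0 x) \<le> 1260 * d * kap x" unfolding L_def by (rule lcut_hessian_bound[OF d])
        qed (use d kap_bounds(1)[of x] in auto)
        also have "\<dots> = A * d * kap x" by (simp add: A_def algebra_simps)
        finally show ?thesis .
      qed
      have "energy (H d) \<le> (\<integral>\<^sup>+x. ennreal ((A * d)\<^sup>2) * (ennreal (kap x ^ 2) * indicator (cball (0 :: real ^ 'n) (exp (2 / d))) x) \<partial>lborel)"
        unfolding energy_def
      proof (rule nn_integral_mono)
        fix x :: "real ^ 'n"
        show "ennreal ((norm (H d x))\<^sup>2) \<le> ennreal ((A * d)\<^sup>2) * (ennreal (kap x ^ 2) * indicator (cball (0 :: real ^ 'n) (exp (2 / d))) x)"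
        proof (cases "norm x \<le> exp (2 / d)")
          case True
          have "(norm (H d x))\<^sup>2 \<le> (A * d * kap x)\<^sup>2" by (intro power_mono HA) simp
          then show ?thesis using True by (simp add: power_mult_distrib ennreal_mult[symmetric] ennreal_leI)
        next
          case False
          then have "H d x = 0" using C1_grad_support[OF hH[of d] hsupp[OF d(1)], of x] by simp
          then show ?thesis by simp
        qed
      qed
      also have "\<dots> = ennreal ((A * d)\<^sup>2) * (\<integral>\<^sup>+x. ennreal (kap x ^ 2) * indicator (cball (0 :: real ^ 'n) (exp (2 / d))) x \<partial>lborel)"
        by (rule nn_integral_cmult) measurable
      also have "\<dots> \<le> ennreal ((A * d)\<^sup>2) * ennreal (C0 / d)" by (intro mult_left_mono C0 d) simp
      also have "\<dots> = ennreal (A\<^sup>2 * C0 * d)"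
      proof -
        have "(A * d)\<^sup>2 * (C0 / d) = A\<^sup>2 * C0 * d" using d by (simp add: power2_eq_square)
        then show ?thesis using d C0(1) by (simp flip: ennreal_mult)
      qed
      finally have en: "energy (H d) \<le> ennreal (A\<^sup>2 * C0 * d)" .
      show "\<exists>\<Phi> R e E. \<Phi> \<in> borel_measurable borel \<and>
        (\<forall>x. norm (\<Phi> x) \<le> 1 + 36 * d) \<and> (\<forall>x. \<Phi> x \<noteq> 0 \<longrightarrow> norm x \<le> R) \<and>
        has_weak_divergence \<Phi> (\<lambda>x. lcut d x * f x + e x) \<and> C1_grad e E \<and> (\<forall>x. e x \<noteq> 0 \<longrightarrow> norm x \<le> R) \<and>
        energy E \<le> ennreal (A\<^sup>2 * C0 * d)"
        using d Xim Xidiv hH en Xisupp[OF d(1)] hsupp[OF d(1)]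
        by (intro exI[of _ "\<Xi> d"] exI[of _ "exp (2 / d)"] exI[of _ "h d"] exI[of _ "H d"])
          (auto intro: order_trans[OF Xi1])
    qed
  next
    case 2
    show ?thesis
    proof (intro exI[of _ 1] conjI allI impI)
      fix d :: real assume d: "0 < d" "d \<le> 1"
      let ?n = "CARD('n)"
      define R where "R = exp (2 / d)"
      have R0: "R > 0" by (simp add: R_def)
      note hs = hsupp[OF d(1), folded R_def]
      have Hfin: "energy (H d) < \<infinity>" using compact_support_D10(3)[OF hH hs] by simp
      define J where "J = enn2real (energy (H d))"
      have J: "energy (H d) = ennreal J" "J \<ge> 0" using Hfin by (auto simp: J_def)
      \<comment> \<open>The remainder is the dilate of \<open>h\<close> by T, whose energy is J /
        T^(n + 2), hence at most J/T. The choice of T makes this at most \<open>d\<close>, and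
        \<open>radial_bound\<close> is insensitive to how large T is.\<close>
      define T where "T = 1 + J / d"
      have T: "T \<ge> 1" "J / T \<le> d"
      proof -
        show "T \<ge> 1" using J d by (simp add: T_def)
        then have "T > 0" by simp
        moreover have "J \<le> d * T" using d by (simp add: T_def algebra_simps)
        ultimately show "J / T \<le> d" by (simp add: divide_le_eq)
      qed
      have hm: "h d \<in> borel_measurable borel" using C1_grad_measurable[OF hH] by simp
      have rb: "norm (radial T (h d) x) \<le> 36 * d" for x
      proof (rule radial_bound[OF 2 hm T(1)])
        fix x :: "real ^ 'n" assume "x \<noteq> 0"
        have "\<bar>h d x\<bar> \<le> 36 * d * kap x" by (rule hbound[OF d(1)])
        also have "\<dots> \<le> 36 * d * (1 / norm x)" using d by (intro mult_left_mono kap_bounds(3) \<open>x \<noteq> 0\<close>) simp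
        finally show "\<bar>h d x\<bar> \<le> 36 * d / norm x" by simp
      qed (use d in simp)
      have rs: "norm x \<le> T * R" if "radial T (h d) x \<noteq> 0" for x
      proof (rule ccontr)
        assume "\<not> norm x \<le> T * R"
        have "indicator {1..T} s * (h d ((1 / s) *\<^sub>R x) / s ^ Suc ?n) = (0::real)" for s
        proof (cases "s \<in> {1..T}")
          case True
          then have "s * R \<le> T * R" "s > 0" using R0 by auto
          then have "\<not> norm ((1 / s) *\<^sub>R x) \<le> R" using \<open>\<not> norm x \<le> T * R\<close> by (simp add: divide_le_eq mult.commute)
          then have "h d ((1 / s) *\<^sub>R x) = 0" using hs by blast
          then show ?thesis by simp
        qed simp
        then have "radial T (h d) x = 0" unfolding radial_def by (simp only: integral_zero scaleR_zero_left)
        then show False using that by simp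
      qed
      define e where "e = (\<lambda>x. (1 / T ^ ?n) * h d ((1 / T) *\<^sub>R x))"
      define E where "E = (\<lambda>x. (1 / T ^ ?n) *\<^sub>R (1 / T) *\<^sub>R H d ((1 / T) *\<^sub>R x))"
      have eE: "C1_grad e E"
        unfolding e_def E_def using C1_grad_cmult[OF C1_grad_affine[OF hH, of d 0 "1 / T"], of "1 / T ^ ?n"] by simp
      have es: "norm x \<le> T * R" if "e x \<noteq> 0" for x
      proof -
        have "norm ((1 / T) *\<^sub>R x) \<le> R" using that by (intro hs) (auto simp: e_def)
        then show ?thesis using T by (simp add: divide_le_eq mult.commute)
      qed
      define \<Phi> where "\<Phi> = (\<lambda>x. \<Xi> d x - radial T (h d) x)"
      have "has_weak_divergence \<Phi> (\<lambda>x. lcut d x * f x + h d x - (h d x - 1 / T ^ ?n * h d ((1 / T) *\<^sub>R x)))"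
        unfolding \<Phi>_def
        by (intro has_weak_divergence_diff Xidiv radial_divergence[OF C1_grad_continuous[OF hH] hs T(1) rb])
      then have Phid: "has_weak_divergence \<Phi> (\<lambda>x. lcut d x * f x + e x)" by (simp add: e_def)
      have Phim: "\<Phi> \<in> borel_measurable borel"
        using Phid by (auto simp: has_weak_divergence_def intro: locally_integrable_measurable)
      have Phib: "norm (\<Phi> x) \<le> 1 + 36 * d" for x
        unfolding \<Phi>_def by (rule order_trans[OF norm_triangle_ineq4 add_mono[OF Xi1 rb]])
      have Phis: "norm x \<le> T * R" if "\<Phi> x \<noteq> 0" for x
      proof -
        have "\<Xi> d x \<noteq> 0 \<or> radial T (h d) x \<noteq> 0" using that by (auto simp: \<Phi>_def)
        moreover have "R \<le> T * R" using T R0 by simp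
        moreover have "norm x \<le> R" if "\<Xi> d x \<noteq> 0" using Xisupp[OF d(1) that] by (simp add: R_def)
        ultimately show ?thesis using rs[of x] by linarith
      qed
      have "energy E \<le> ennreal (1 * d)"
      proof -
        have [measurable]: "H d \<in> borel_measurable borel" using C1_grad_measurable[OF hH] by simp
        have "energy E = ennreal ((1 / T ^ ?n * (1 / T))\<^sup>2) * (\<integral>\<^sup>+x. ennreal ((norm (H d ((1 / T) *\<^sub>R x)))\<^sup>2) \<partial>lborel)"
          unfolding energy_def E_def
          by (subst nn_integral_cmult[symmetric]) (auto simp: power_mult_distrib power_divide ennreal_mult[symmetric])
        also have "(\<integral>\<^sup>+x. ennreal ((norm (H d ((1 / T) *\<^sub>R x)))\<^sup>2) \<partial>lborel) =
            ennreal (\<bar>T\<bar> ^ DIM(real ^ 'n)) * (\<integral>\<^sup>+x. ennreal ((norm (H d ((1 / T) *\<^sub>R (0 + T *\<^sub>R x))))\<^sup>2) \<partial>lborel)"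
          by (rule nn_integral_lborel_affine) (use T in auto)
        also have "\<dots> = ennreal (T ^ ?n) * ennreal J"
          using T J(1) by (simp add: energy_def)
        also have "ennreal ((1 / T ^ ?n * (1 / T))\<^sup>2) * (ennreal (T ^ ?n) * ennreal J) = ennreal (J / (T ^ ?n * T * T))"
          using T J(2) by (simp add: ennreal_mult[symmetric] power2_eq_square field_simps)
        also have "\<dots> \<le> ennreal (J / T)"
        proof (rule ennreal_leI)
          have "1 * T \<le> (T ^ ?n * T) * T" using T by (intro mult_right_mono) (auto intro!: mult_ge1_I one_le_power)
          then show "J / (T ^ ?n * T * T) \<le> J / T" using T J(2) by (intro divide_left_mono) auto
        qed
        also have "\<dots> \<le> ennreal (1 * d)" using T(2) by (simp add: ennreal_leI)
        finally show ?thesis .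
      qed
      then show "\<exists>\<Phi> R e E. \<Phi> \<in> borel_measurable borel \<and>
        (\<forall>x. norm (\<Phi> x) \<le> 1 + 36 * d) \<and> (\<forall>x. \<Phi> x \<noteq> 0 \<longrightarrow> norm x \<le> R) \<and>
        has_weak_divergence \<Phi> (\<lambda>x. lcut d x * f x + e x) \<and> C1_grad e E \<and> (\<forall>x. e x \<noteq> 0 \<longrightarrow> norm x \<le> R) \<and>
        energy E \<le> ennreal (1 * d)"
        using Phim Phib Phis Phid eE es by blast
    qed simp
  qed
qed

text \<open>Young's inequality for the conjugate exponents n/2 and n/(n - 2), with a weight. If the
  first term on the right is smaller than the left-hand side, then \<eta> b^(p - 2) \<le> a^2, which
  bounds b^2 by a power of \<open>a\<close>.\<close>

lemma weighted_young:
  fixes a b \<eta> :: real and n :: nat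
  assumes a: "a \<ge> 0" and b: "b \<ge> 0" and eta: "\<eta> > 0" and n: "n \<ge> 3"
  defines "p \<equiv> 2 * real n / (real n - 2)"
  shows "a\<^sup>2 * b\<^sup>2 \<le> \<eta> * b powr p + \<eta> powr (- (real n - 2) / 2) * a ^ n"
proof (cases "a\<^sup>2 * b\<^sup>2 \<le> \<eta> * b powr p")
  case True
  then show ?thesis using a by (simp add: add_increasing2)
next
  case False
  have n2: "real n - 2 > 0" using n by simp
  have pos: "a > 0" "b > 0"
  proof -
    have "a\<^sup>2 * b\<^sup>2 > 0" using False eta by (smt (verit) mult_nonneg_nonneg powr_ge_zero)
    then show "a > 0" "b > 0" using a b by (auto simp: less_eq_real_def)
  qed
  have p: "p - 2 = 4 / (real n - 2)" unfolding p_def using n2 by (simp add: field_simps)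
  have "\<eta> * b powr p = \<eta> * b powr (p - 2) * b\<^sup>2"
    using pos by (simp add: powr_diff powr_numeral)
  with False have "\<eta> * b powr (p - 2) * b\<^sup>2 \<le> a\<^sup>2 * b\<^sup>2" by simp
  then have "\<eta> * b powr (p - 2) \<le> a\<^sup>2" using pos by simp
  then have "b powr (p - 2) \<le> a\<^sup>2 / \<eta>" using eta by (simp add: field_simps)
  then have "(b powr (p - 2)) powr ((real n - 2) / 2) \<le> (a\<^sup>2 / \<eta>) powr ((real n - 2) / 2)"
    using n2 by (intro powr_mono2) auto
  also have "(b powr (p - 2)) powr ((real n - 2) / 2) = b\<^sup>2"
  proof -
    have "(p - 2) * ((real n - 2) / 2) = 2" unfolding p using n2 by (simp add: divide_simps)
    then show ?thesis using pos unfolding powr_powr by simp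
  qed
  also have "(a\<^sup>2 / \<eta>) powr ((real n - 2) / 2) = a ^ (n - 2) * \<eta> powr (- (real n - 2) / 2)"
  proof -
    have "(a\<^sup>2) powr ((real n - 2) / 2) = (a powr 2) powr ((real n - 2) / 2)" using pos by (simp add: powr_numeral)
    also have "\<dots> = a powr (real (n - 2))" using n by (simp add: powr_powr of_nat_diff diff_divide_distrib)
    also have "\<dots> = a ^ (n - 2)" using pos by (simp add: powr_realpow)
    finally have "(a\<^sup>2) powr ((real n - 2) / 2) = a ^ (n - 2)" .
    then show ?thesis using eta pos by (simp add: powr_divide powr_minus_divide minus_divide_left[symmetric] del: minus_diff_eq)
  qed
  finally have "a\<^sup>2 * b\<^sup>2 \<le> a\<^sup>2 * (a ^ (n - 2) * \<eta> powr (- (real n - 2) / 2))"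
    by (rule mult_left_mono) simp
  also have "\<dots> = \<eta> powr (- (real n - 2) / 2) * a ^ n"
  proof -
    have n': "2 + (n - 2) = n" using n by simp
    have "a ^ n = a\<^sup>2 * a ^ (n - 2)" using power_add[of a 2 "n - 2"] unfolding n' .
    then show ?thesis by (simp add: mult.commute mult.left_commute)
  qed
  finally show ?thesis using eta by (simp add: add_increasing)
qed

text \<open>The critical pairing: for n \<ge> 3, f lies in L^(2n/(n - 2)) and the gradient of the
  cutoff is small in L^n; for n \<le> 2 the gradient is small in L^2 and \<open>f\<close> is
  bounded.\<close>

lemma lcut_grad_product_small:
  fixes f :: "real ^ 'n::finite \<Rightarrow> real"
  assumes f: "f \<in> D10" and fM: "\<And>x. \<bar>f x\<bar> \<le> M"
  shows "(\<lambda>j. \<integral>\<^sup>+x. ennreal ((norm (lcut_grad (1 / real (Suc j)) x))\<^sup>2 * (f x)\<^sup>2) \<partial>(lborel :: (real ^ 'n) measure)) \<longlonglongrightarrow> 0"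
proof -
  define d where "d = (\<lambda>j. 1 / real (Suc j))"
  have d: "0 < d j" "d j \<le> 1" for j by (auto simp: d_def)
  have d0: "d \<longlonglongrightarrow> 0" unfolding d_def using LIMSEQ_inverse_real_of_nat by (simp add: inverse_eq_divide)
  have [measurable]: "f \<in> borel_measurable borel" using D10D(3)[OF f] by (rule locally_integrable_measurable)
  have [measurable]: "(lcut_grad t :: real ^ 'n \<Rightarrow> _) \<in> borel_measurable borel" for t by (rule C1_grad_measurable[OF C1_grad_lcut])
  show ?thesis
  proof (cases "CARD('n) \<ge> 3")
    case False
    then obtain C where C: "C \<ge> 0" "\<And>t. 0 < t \<Longrightarrow> t \<le> 1 \<Longrightarrow>
        (\<integral>\<^sup>+x. ennreal (norm (lcut_grad t (x :: real ^ 'n)) ^ 2) \<partial>(lborel :: (real ^ 'n) measure)) \<le> ennreal (C * t)"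
      using lcut_grad_integral[where 'n='n and q=2] by auto
    have le: "(\<integral>\<^sup>+x. ennreal ((norm (lcut_grad (d j) x))\<^sup>2 * (f x)\<^sup>2) \<partial>(lborel :: (real ^ 'n) measure)) \<le> ennreal (M\<^sup>2 * (C * d j))" for j
    proof -
      have "(\<integral>\<^sup>+x. ennreal ((norm (lcut_grad (d j) x))\<^sup>2 * (f x)\<^sup>2) \<partial>(lborel :: (real ^ 'n) measure)) \<le>
        (\<integral>\<^sup>+x. ennreal (M\<^sup>2) * ennreal (norm (lcut_grad (d j) x) ^ 2) \<partial>(lborel :: (real ^ 'n) measure))"
      proof (rule nn_integral_mono)
        fix x :: "real ^ 'n"
        have "(f x)\<^sup>2 \<le> M\<^sup>2" using power_mono[OF fM[of x], of 2] by simp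
        from mult_left_mono[OF this, of "(norm (lcut_grad (d j) x))\<^sup>2"]
        show "ennreal ((norm (lcut_grad (d j) x))\<^sup>2 * (f x)\<^sup>2) \<le> ennreal (M\<^sup>2) * ennreal (norm (lcut_grad (d j) x) ^ 2)"
          by (simp add: ennreal_mult[symmetric] ennreal_leI mult.commute)
      qed
      also have "\<dots> = ennreal (M\<^sup>2) * (\<integral>\<^sup>+x. ennreal (norm (lcut_grad (d j) (x :: real ^ 'n)) ^ 2) \<partial>(lborel :: (real ^ 'n) measure))"
        by (rule nn_integral_cmult) measurable
      also have "\<dots> \<le> ennreal (M\<^sup>2) * ennreal (C * d j)" by (intro mult_left_mono C d) simp
      also have "\<dots> = ennreal (M\<^sup>2 * (C * d j))" using C(1) d(1)[of j] by (simp add: ennreal_mult[symmetric] less_imp_le)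
      finally show ?thesis .
    qed
    have "(\<lambda>j. ennreal (M\<^sup>2 * (C * d j))) \<longlonglongrightarrow> ennreal (M\<^sup>2 * (C * 0))"
      by (intro tendsto_ennrealI tendsto_mult tendsto_const d0)
    then have "(\<lambda>j. ennreal (M\<^sup>2 * (C * d j))) \<longlonglongrightarrow> 0" by simp
    from ennreal_squeeze_0[OF this le] show ?thesis by (simp add: d_def)
  next
    case n: True
    let ?n = "CARD('n)"
    let ?p = "2 * real ?n / (real ?n - 2)"
    obtain C where C: "C \<ge> 0" "\<And>t. 0 < t \<Longrightarrow> t \<le> 1 \<Longrightarrow>
        (\<integral>\<^sup>+x. ennreal (norm (lcut_grad t (x :: real ^ 'n)) ^ ?n) \<partial>(lborel :: (real ^ 'n) measure)) \<le> ennreal (C * t)"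
      using lcut_grad_integral[where 'n='n and q="?n"] n by auto
    define P where "P = enn2real (\<integral>\<^sup>+x. ennreal (\<bar>f x\<bar> powr ?p) \<partial>(lborel :: (real ^ 'n) measure))"
    have P: "(\<integral>\<^sup>+x. ennreal (\<bar>f x\<bar> powr ?p) \<partial>(lborel :: (real ^ 'n) measure)) = ennreal P" "P \<ge> 0"
      using D10D(4)[OF f n] by (auto simp: P_def)
    have "(\<lambda>j. \<integral>\<^sup>+x. ennreal ((norm (lcut_grad (d j) x))\<^sup>2 * (f x)\<^sup>2) \<partial>(lborel :: (real ^ 'n) measure)) \<longlonglongrightarrow> 0"
    proof (rule ennreal_tendsto_0I)
      fix e :: real assume e: "e > 0"
      \<comment> \<open>Chosen so that the term with \<open>f\<close> takes at most half of
        \<open>e\<close>; the 1 keeps the denominator positive when P = 0. The other half is left to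
        the cutoff, whose coefficient \<open>K\<close> is then fixed.\<close>
      define \<eta> where "\<eta> = e / (2 * (P + 1))"
      have eta: "\<eta> > 0" using e P by (simp add: \<eta>_def)
      have etaP: "\<eta> * P \<le> e / 2" using e P(2) by (simp add: \<eta>_def divide_le_eq mult_left_mono)
      define K where "K = \<eta> powr (- (real ?n - 2) / 2)"
      have K: "K \<ge> 0" by (simp add: K_def)
      have "(\<lambda>j. K * (C * d j)) \<longlonglongrightarrow> K * (C * 0)" by (intro tendsto_mult tendsto_const d0)
      then have "eventually (\<lambda>j. K * (C * d j) < e / 2) sequentially" using e by (intro order_tendstoD) auto
      then show "eventually (\<lambda>j. (\<integral>\<^sup>+x. ennreal ((norm (lcut_grad (d j) x))\<^sup>2 * (f x)\<^sup>2) \<partial>(lborel :: (real ^ 'n) measure)) \<le> ennreal e) sequentially"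
      proof eventually_elim
        case (elim j)
        have "(\<integral>\<^sup>+x. ennreal ((norm (lcut_grad (d j) x))\<^sup>2 * (f x)\<^sup>2) \<partial>(lborel :: (real ^ 'n) measure)) \<le>
          (\<integral>\<^sup>+x. ennreal \<eta> * ennreal (\<bar>f x\<bar> powr ?p) + ennreal K * ennreal (norm (lcut_grad (d j) x) ^ ?n) \<partial>(lborel :: (real ^ 'n) measure))"
        proof (rule nn_integral_mono)
          fix x :: "real ^ 'n"
          have "(norm (lcut_grad (d j) x))\<^sup>2 * (f x)\<^sup>2 \<le> \<eta> * \<bar>f x\<bar> powr ?p + K * norm (lcut_grad (d j) x) ^ ?n"
            using weighted_young[OF norm_ge_zero abs_ge_zero eta n, of "lcut_grad (d j) x" "f x"] by (simp add: K_def)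
          then show "ennreal ((norm (lcut_grad (d j) x))\<^sup>2 * (f x)\<^sup>2) \<le> ennreal \<eta> * ennreal (\<bar>f x\<bar> powr ?p) + ennreal K * ennreal (norm (lcut_grad (d j) x) ^ ?n)"
            using eta K by (simp add: ennreal_mult[symmetric] ennreal_plus[symmetric] ennreal_leI del: ennreal_plus)
        qed
        also have "\<dots> = ennreal \<eta> * ennreal P + ennreal K * (\<integral>\<^sup>+x. ennreal (norm (lcut_grad (d j) (x :: real ^ 'n)) ^ ?n) \<partial>(lborel :: (real ^ 'n) measure))"
          by (simp add: nn_integral_add nn_integral_cmult P(1))
        also have "\<dots> \<le> ennreal \<eta> * ennreal P + ennreal K * ennreal (C * d j)"
          by (intro add_left_mono mult_left_mono C d) simp
        also have "\<dots> = ennreal (\<eta> * P + K * (C * d j))"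
          using eta P(2) K C(1) d(1)[of j] by (simp add: ennreal_mult[symmetric] ennreal_plus[symmetric] less_imp_le del: ennreal_plus)
        also have "\<dots> \<le> ennreal e" using etaP elim by (intro ennreal_leI) linarith
        finally show ?case .
      qed
    qed
    then show ?thesis by (simp add: d_def)
  qed
qed

section \<open>Removing the cutoff and the mollification\<close>

text \<open>The compact fields of \<open>cutoff_field\<close> have divergences \<open>w j\<close>
  converging to \<open>f\<close> in D^1_0, and their sup norm bound 1 + 36 d tends to 1, so the
  constant in front of \<tau> is sharp in the limit.\<close>

lemma TV_bound_smooth_field:
  fixes Z :: "real ^ 'n::finite \<Rightarrow> real ^ 'n"
  assumes g: "g \<in> Dm1" and tau: "TV g = ereal \<tau>"
    and Z: "\<And>i. C1_grad (\<lambda>x. Z x $ i) (G i)" and Z1: "\<And>x. norm (Z x) \<le> 1"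
    and f: "\<And>x. f x = (\<Sum>i\<in>UNIV. G i x $ i)" and fM: "\<And>x. \<bar>f x\<bar> \<le> M"
    and fF: "C1_grad f F" and fD: "f \<in> D10"
  shows "- g f \<le> \<tau>"
proof -
  define d where "d = (\<lambda>j. 1 / real (Suc j))"
  have d: "0 < d j" "d j \<le> 1" for j by (auto simp: d_def)
  have d0: "d \<longlonglongrightarrow> 0" unfolding d_def using LIMSEQ_inverse_real_of_nat by (simp add: inverse_eq_divide)
  \<comment> \<open>A name for the whole conjunction, so that choosing the four objects for every
    \<open>j\<close> is a single application of choice.\<close>
  define Q where "Q = (\<lambda>C t \<Phi> R e E. \<Phi> \<in> borel_measurable borel \<and>
    (\<forall>x. norm (\<Phi> x) \<le> 1 + 36 * t) \<and> (\<forall>x. \<Phi> x \<noteq> 0 \<longrightarrow> norm x \<le> R) \<and>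
    has_weak_divergence \<Phi> (\<lambda>x. lcut t x * f x + e x) \<and> C1_grad e E \<and> (\<forall>x. e x \<noteq> 0 \<longrightarrow> norm x \<le> R) \<and>
    energy E \<le> ennreal (C * t))"
  have "\<exists>C\<ge>0. \<forall>t. 0 < t \<longrightarrow> t \<le> 1 \<longrightarrow> (\<exists>\<Phi> R e E. Q C t \<Phi> R e E)"
    unfolding Q_def by (rule cutoff_field[OF Z Z1 f fM])
  then obtain C where C: "C \<ge> 0" and ex: "\<And>t. 0 < t \<Longrightarrow> t \<le> 1 \<Longrightarrow> \<exists>\<Phi> R e E. Q C t \<Phi> R e E"
    by blast
  have "\<forall>j. \<exists>\<Phi> R e E. Q C (d j) \<Phi> R e E"
    by (intro allI ex d)
  then obtain \<Phi> R e E where Q: "\<And>j. Q C (d j) (\<Phi> j) (R j) (e j) (E j)"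
    unfolding choice_iff by blast
  have Phi: "\<Phi> j \<in> borel_measurable borel" "norm (\<Phi> j x) \<le> 1 + 36 * d j"
    "\<Phi> j x \<noteq> 0 \<Longrightarrow> norm x \<le> R j" "has_weak_divergence (\<Phi> j) (\<lambda>x. lcut (d j) x * f x + e j x)"
    and e: "C1_grad (e j) (E j)" "e j x \<noteq> 0 \<Longrightarrow> norm x \<le> R j" "energy (E j) \<le> ennreal (C * d j)" for j x
    using Q[of j] unfolding Q_def by blast+
  define w where "w = (\<lambda>j x. lcut (d j) x * f x + e j x)"
  \<comment> \<open>W - F splits into (cutoff - 1) F, \<open>f\<close> times the gradient of the
    cutoff, and E; the three energies tend to 0 by dominated convergence, by
    \<open>lcut_grad_product_small\<close> and by the bound C d.\<close>
  define W where "W = (\<lambda>j x. lcut (d j) x *\<^sub>R F x + f x *\<^sub>R lcut_grad (d j) x + E j x)"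
  have wW: "C1_grad (w j) (W j)" for j
    unfolding w_def W_def by (intro C1_grad_add C1_grad_mult C1_grad_lcut fF e)
  have wD: "w j \<in> D10" for j
  proof (rule compact_support_D10(1)[OF wW])
    fix x assume "w j x \<noteq> 0"
    then have "lcut (d j) x \<noteq> 0 \<or> e j x \<noteq> 0" by (auto simp: w_def)
    then show "norm x \<le> max (exp (2 / d j)) (R j)" using lcut_support[OF d(1), of j x] e(2)[of j x] by auto
  qed
  have bound: "- g (w j) \<le> (1 + 36 * d j) * \<tau>" for j
    by (rule TV_bound_compact_field[OF g tau Phi(1,2,3)[of j] _ _ wD]) (use Phi(4)[of j] d(1)[of j] in \<open>auto simp: w_def\<close>)
  have diff: "energy (\<lambda>x. W j x - F x) = ennreal ((D10_norm (\<lambda>x. w j x - f x))\<^sup>2)" for j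
    by (rule D10_norm_energy[OF D10_diff[OF wD fD] has_weak_gradient_C1[OF C1_grad_diff[OF wW fF]]])
  have [measurable]: "F \<in> borel_measurable borel" "f \<in> borel_measurable borel" using C1_grad_measurable[OF fF] by auto
  have [measurable]: "(lcut t :: real ^ 'n \<Rightarrow> _) \<in> borel_measurable borel" "(lcut_grad t :: real ^ 'n \<Rightarrow> _) \<in> borel_measurable borel" for t
    by (rule C1_grad_measurable[OF C1_grad_lcut])+
  have [measurable]: "E j \<in> borel_measurable borel" for j using C1_grad_measurable[OF e(1)] by auto
  have Ffin: "energy F < \<infinity>" using D10_norm_energy[OF fD has_weak_gradient_C1[OF fF]] by simp
  define a where "a = (\<lambda>j. \<integral>\<^sup>+x. ennreal ((lcut (d j) x - 1)\<^sup>2 * (norm (F x))\<^sup>2) \<partial>(lborel :: (real ^ 'n) measure))"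
  define b where "b = (\<lambda>j. \<integral>\<^sup>+x. ennreal ((norm (lcut_grad (d j) x))\<^sup>2 * (f x)\<^sup>2) \<partial>(lborel :: (real ^ 'n) measure))"
  have "a \<longlonglongrightarrow> (\<integral>\<^sup>+x. ennreal 0 \<partial>(lborel :: (real ^ 'n) measure))"
    unfolding a_def
  proof (rule nn_integral_dominated_convergence[where w="\<lambda>x. ennreal ((norm (F x))\<^sup>2)"])
    show "AE x :: real ^ 'n in lborel. ennreal ((lcut (d j) x - 1)\<^sup>2 * (norm (F x))\<^sup>2) \<le> ennreal ((norm (F x))\<^sup>2)" for j
    proof (rule AE_I2, rule ennreal_leI)
      fix x :: "real ^ 'n"
      have "(lcut (d j) x - 1)\<^sup>2 \<le> 1" using lcut_bounds[of "d j" x] by (simp add: abs_square_le_1)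
      then show "(lcut (d j) x - 1)\<^sup>2 * (norm (F x))\<^sup>2 \<le> (norm (F x))\<^sup>2" by (simp add: mult_left_le_one_le)
    qed
    show "(\<integral>\<^sup>+x. ennreal ((norm (F x))\<^sup>2) \<partial>(lborel :: (real ^ 'n) measure)) < \<infinity>" using Ffin by (simp add: energy_def)
    show "AE x :: real ^ 'n in lborel. (\<lambda>j. ennreal ((lcut (d j) x - 1)\<^sup>2 * (norm (F x))\<^sup>2)) \<longlonglongrightarrow> ennreal 0"
    proof (rule AE_I2)
      fix x :: "real ^ 'n"
      have "(\<lambda>j. ennreal ((lcut (d j) x - 1)\<^sup>2 * (norm (F x))\<^sup>2)) \<longlonglongrightarrow> ennreal ((1 - 1)\<^sup>2 * (norm (F x))\<^sup>2)"
        by (intro tendsto_ennrealI tendsto_mult tendsto_power tendsto_diff tendsto_const lcut_tendsto_1 d0)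
      then show "(\<lambda>j. ennreal ((lcut (d j) x - 1)\<^sup>2 * (norm (F x))\<^sup>2)) \<longlonglongrightarrow> ennreal 0" by simp
    qed
  qed measurable
  then have a0: "a \<longlonglongrightarrow> 0" by simp
  have b0: "b \<longlonglongrightarrow> 0" unfolding b_def d_def by (rule lcut_grad_product_small[OF fD fM])
  have "(\<lambda>j. ennreal (C * d j)) \<longlonglongrightarrow> ennreal (C * 0)" by (intro tendsto_ennrealI tendsto_mult tendsto_const d0)
  then have c0: "(\<lambda>j. ennreal (C * d j)) \<longlonglongrightarrow> 0" by simp
  have "(\<lambda>j. 3 * (a j + b j + ennreal (C * d j))) \<longlonglongrightarrow> 3 * (0 + 0 + 0)"
    by (intro tendsto_mult_ennreal tendsto_const tendsto_add a0 b0 c0) auto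
  then have lim: "(\<lambda>j. 3 * (a j + b j + ennreal (C * d j))) \<longlonglongrightarrow> 0" by simp
  have le: "ennreal ((D10_norm (\<lambda>x. w j x - f x))\<^sup>2) \<le> 3 * (a j + b j + ennreal (C * d j))" for j
  proof -
    have sq: "(norm (p + q + r))\<^sup>2 \<le> 3 * ((norm p)\<^sup>2 + (norm q)\<^sup>2 + (norm r)\<^sup>2)" for p q r :: "real ^ 'n"
    proof -
      have "0 \<le> (p - q) \<bullet> (p - q) + (p - r) \<bullet> (p - r) + (q - r) \<bullet> (q - r)" by simp
      then show ?thesis by (simp add: power2_norm_eq_inner inner_simps inner_commute)
    qed
    have "energy (\<lambda>x. W j x - F x) \<le> (\<integral>\<^sup>+x. 3 * (ennreal ((lcut (d j) x - 1)\<^sup>2 * (norm (F x))\<^sup>2)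
        + ennreal ((norm (lcut_grad (d j) x))\<^sup>2 * (f x)\<^sup>2) + ennreal ((norm (E j x))\<^sup>2)) \<partial>(lborel :: (real ^ 'n) measure))"
      unfolding energy_def
    proof (rule nn_integral_mono)
      fix x :: "real ^ 'n"
      have eq: "W j x - F x = (lcut (d j) x - 1) *\<^sub>R F x + f x *\<^sub>R lcut_grad (d j) x + E j x"
        by (simp add: W_def algebra_simps)
      have "(norm (W j x - F x))\<^sup>2 \<le> 3 * ((norm ((lcut (d j) x - 1) *\<^sub>R F x))\<^sup>2 + (norm (f x *\<^sub>R lcut_grad (d j) x))\<^sup>2 + (norm (E j x))\<^sup>2)"
        unfolding eq by (rule sq)
      also have "\<dots> = 3 * ((lcut (d j) x - 1)\<^sup>2 * (norm (F x))\<^sup>2 + (norm (lcut_grad (d j) x))\<^sup>2 * (f x)\<^sup>2 + (norm (E j x))\<^sup>2)"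
        by (simp add: power_mult_distrib mult.commute)
      finally show "ennreal ((norm (W j x - F x))\<^sup>2) \<le> 3 * (ennreal ((lcut (d j) x - 1)\<^sup>2 * (norm (F x))\<^sup>2)
        + ennreal ((norm (lcut_grad (d j) x))\<^sup>2 * (f x)\<^sup>2) + ennreal ((norm (E j x))\<^sup>2))"
        using ennreal_leI by (simp add: ennreal_plus[symmetric] ennreal_numeral[symmetric] ennreal_mult[symmetric] del: ennreal_plus ennreal_numeral)
    qed
    also have "\<dots> = 3 * (a j + b j + energy (E j))"
      by (simp add: nn_integral_cmult nn_integral_add a_def b_def energy_def)
    also have "\<dots> \<le> 3 * (a j + b j + ennreal (C * d j))"
      by (intro mult_left_mono add_left_mono e) simp
    finally show ?thesis by (simp add: diff)
  qed
  have "(\<lambda>j. ennreal ((D10_norm (\<lambda>x. w j x - f x))\<^sup>2)) \<longlonglongrightarrow> ennreal 0"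
    using ennreal_squeeze_0[OF lim le] by simp
  then have "(\<lambda>j. (D10_norm (\<lambda>x. w j x - f x))\<^sup>2) \<longlonglongrightarrow> 0"
    by (subst (asm) tendsto_ennreal_iff) auto
  then have "(\<lambda>j. sqrt ((D10_norm (\<lambda>x. w j x - f x))\<^sup>2)) \<longlonglongrightarrow> sqrt 0" by (rule tendsto_real_sqrt)
  then have conv: "(\<lambda>j. D10_norm (\<lambda>x. w j x - f x)) \<longlonglongrightarrow> 0" by (simp add: D10_norm_nonneg)
  have "(\<lambda>j. - g (w j)) \<longlonglongrightarrow> - g f"
    by (intro tendsto_minus Dm1_continuous[OF g wD fD conv])
  moreover have "(\<lambda>j. (1 + 36 * d j) * \<tau>) \<longlonglongrightarrow> (1 + 36 * 0) * \<tau>"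
    by (intro tendsto_mult tendsto_add tendsto_const d0)
  ultimately have "- g f \<le> (1 + 36 * 0) * \<tau>"
    by (rule LIMSEQ_le) (use bound in blast)
  then show ?thesis by simp
qed

text \<open>Mollification preserves |Z| \<le> 1 and commutes with the divergence, so the smooth case
  applies to each mollified field, and continuity of \<open>g\<close> gives the limit.\<close>

lemma TV_bound_field:
  fixes Z :: "real ^ 'n::finite \<Rightarrow> real ^ 'n"
  assumes g: "g \<in> Dm1" and Z: "AE x in lborel. norm (Z x) \<le> 1" and div: "has_weak_divergence Z f" and f: "f \<in> D10"
  shows "ereal (- g f) \<le> TV g"
proof (cases "TV g")
  case (real \<tau>)
  have li: "locally_integrable Z" using div by (simp add: has_weak_divergence_def)
  note [measurable] = locally_integrable_measurable[OF li]
  note lii = locally_integrable_nth[OF li]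
  have "- g (conv f (mol k)) \<le> \<tau>" for k
  proof -
    let ?Z = "\<lambda>x. \<chi> i. conv (\<lambda>y. Z y $ i) (mol k) x"
    define G where "G = (\<lambda>i x. \<chi> j. conv (\<lambda>y. Z y $ i) (partial_deriv j (mol k)) x)"
    have G: "C1_grad (\<lambda>x. ?Z x $ i) (G i)" for i
      using conv_partial_deriv[OF lii test_function_mol] by (simp add: G_def)
    have fG: "conv f (mol k) x = (\<Sum>i\<in>UNIV. G i x $ i)" for x
      using fun_cong[OF divergence_conv[OF div test_function_mol], of k x] C1_grad_partial[OF G]
      by (simp add: divergence_def)
    \<comment> \<open>The divergence of \<open>Z\<close> itself may be unbounded; after
      mollification the derivative falls on the mollifier, and \<open>Z\<close> is bounded. The
      bound depends on \<open>k\<close>, which is harmless because \<open>k\<close> is fixed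
      here.\<close>
    have "\<exists>M. \<forall>x. \<bar>conv f (mol k) x\<bar> \<le> M"
    proof -
      have "\<exists>M. \<forall>x. \<bar>conv (\<lambda>y. Z y $ i) (partial_deriv i (mol k)) x\<bar> \<le> M" for i
      proof (intro exI allI)
        fix x
        let ?q = "partial_deriv i (mol k) :: real ^ 'n \<Rightarrow> real"
        note tq = test_function_partial_deriv[OF test_function_mol, of i k]
        note cq = C1_grad_continuous[OF test_function_C1_grad[OF tq]]
        obtain r where r: "\<And>x. ?q x \<noteq> 0 \<Longrightarrow> norm x \<le> r" using test_functionE[OF tq] by metis
        have qi: "integrable lborel ?q" by (rule continuous_compact_support_integrable[OF cq r])
        have ci: "integrable lborel (\<lambda>y. Z y $ i *\<^sub>R ?q (x - y))" by (rule conv_integrable[OF lii cq r])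
        have "\<bar>conv (\<lambda>y. Z y $ i) ?q x\<bar> \<le> (\<integral>y. norm (Z y $ i *\<^sub>R ?q (x - y)) \<partial>lborel)"
          unfolding conv_def using integral_norm_bound[of lborel "\<lambda>y. Z y $ i *\<^sub>R ?q (x - y)"] by simp
        also have "\<dots> \<le> (\<integral>y. norm (?q (x - y)) \<partial>lborel)"
        proof (rule integral_mono_AE[OF integrable_norm[OF ci] integrable_norm[OF integrable_lborel_reflect[OF qi]]])
          show "AE y in lborel. norm (Z y $ i *\<^sub>R ?q (x - y)) \<le> norm (?q (x - y))"
            using Z
          proof eventually_elim
            case (elim y)
            have "\<bar>Z y $ i\<bar> \<le> 1" using component_le_norm_cart[of "Z y" i] elim by linarith
            then show ?case by (simp add: abs_mult mult_left_le_one_le)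
          qed
        qed
        also have "\<dots> = (\<integral>y. norm (?q y) \<partial>lborel)" by (rule integral_lborel_reflect[of "\<lambda>y. norm (?q y)" x])
        finally show "\<bar>conv (\<lambda>y. Z y $ i) ?q x\<bar> \<le> (\<integral>y. norm (?q y) \<partial>lborel)" .
      qed
      then obtain m where m: "\<And>i x. \<bar>conv (\<lambda>y. Z y $ i) (partial_deriv i (mol k)) x\<bar> \<le> m i" by metis
      have "\<bar>conv f (mol k) x\<bar> \<le> (\<Sum>i\<in>UNIV. m i)" for x
        unfolding fG by (rule order_trans[OF sum_abs]) (auto simp: G_def intro!: sum_mono m)
      then show ?thesis by blast
    qed
    then obtain M where M: "\<And>x. \<bar>conv f (mol k) x\<bar> \<le> M" by blast
    show ?thesis
    proof (rule TV_bound_smooth_field[OF g real G _ fG M])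
      show "norm (?Z x) \<le> 1" for x by (rule conv_mol_AE_bound[OF _ Z]) simp
      show "C1_grad (conv f (mol k)) (\<lambda>x. \<chi> i. conv f (partial_deriv i (mol k)) x)"
        by (rule conv_partial_deriv[OF D10D(3)[OF f] test_function_mol])
      show "conv f (mol k) \<in> D10" by (rule mollify_D10(1)[OF f])
    qed
  qed
  moreover have "(\<lambda>k. - g (conv f (mol k))) \<longlonglongrightarrow> - g f"
    by (intro tendsto_minus Dm1_continuous[OF g mollify_D10(1) f mollify_D10(3)] f)
  ultimately have "- g f \<le> \<tau>" by (intro LIMSEQ_le_const2) auto
  then show ?thesis by (simp add: real)
qed (use TV_nonneg[OF g] in auto)

theorem theorem14:
  fixes u v :: "(real ^ 'n::finite \<Rightarrow> real) \<Rightarrow> real"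
  assumes "u \<in> Dm1" and "v \<in> Dm1"
  shows "v \<in> subdifferential TV u \<longleftrightarrow>
    (\<exists>(Z :: real ^ 'n \<Rightarrow> real ^ 'n) divZ.
       Z \<in> Linfty \<and> has_weak_divergence Z divZ \<and> divZ \<in> D10 \<and>
       (AE x in lborel. norm (Z x) \<le> 1) \<and>
       v = laplacian divZ \<and>
       ereal (- u divZ) = TV u)"
proof
  assume "v \<in> subdifferential TV u"
  from subdifferential_calibrated[OF assms this]
  show "\<exists>(Z :: real ^ 'n \<Rightarrow> real ^ 'n) divZ. Z \<in> Linfty \<and> has_weak_divergence Z divZ \<and> divZ \<in> D10 \<and>
       (AE x in lborel. norm (Z x) \<le> 1) \<and> v = laplacian divZ \<and> ereal (- u divZ) = TV u"
    unfolding Linfty_def by fastforce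
next
  assume "\<exists>(Z :: real ^ 'n \<Rightarrow> real ^ 'n) divZ. Z \<in> Linfty \<and> has_weak_divergence Z divZ \<and> divZ \<in> D10 \<and>
       (AE x in lborel. norm (Z x) \<le> 1) \<and> v = laplacian divZ \<and> ereal (- u divZ) = TV u"
  then obtain Z :: "real ^ 'n \<Rightarrow> real ^ 'n" and f where Z: "has_weak_divergence Z f" "AE x in lborel. norm (Z x) \<le> 1"
    and f: "f \<in> D10" and v: "v = laplacian f" and u: "ereal (- u f) = TV u" by blast
  have "TV u + ereal (Dm1_inner v (\<lambda>h. g h - u h)) \<le> TV g" if g: "g \<in> Dm1" for g
  proof -
    have gu: "(\<lambda>h. g h - u h) \<in> Dm1" using Dm1_diff[OF g assms(1), of 1 "-1"] by simp
    define w where "w = inv_into D10 neg_laplacian (\<lambda>h. g h - u h)"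
    have w: "w \<in> D10" "neg_laplacian w = (\<lambda>h. g h - u h)"
      unfolding w_def using neg_laplacian_inv[OF gu] by auto
    \<comment> \<open>The pairing becomes -(g f - u f); since \<open>TV u\<close> equals
      \<open>- u f\<close>, the terms with \<open>u\<close> cancel and the subgradient inequality is
      reduced to \<open>TV_bound_field\<close>.\<close>
    have "Dm1_inner v (\<lambda>h. g h - u h) = - D10_inner f w"
      unfolding Dm1_inner_def w_def[symmetric] v laplacian_def neg_laplacian_def using w(1) by simp
    also have "\<dots> = - (g f - u f)"
      using fun_cong[OF w(2), of f] f by (simp add: neg_laplacian_def D10_inner_commute[of f w])
    finally have "TV u + ereal (Dm1_inner v (\<lambda>h. g h - u h)) = ereal (- g f)" by (simp add: u[symmetric])
    then show ?thesis using TV_bound_field[OF g Z(2,1) f] by simp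
  qed
  moreover have "TV u < \<infinity>" by (simp add: u[symmetric])
  ultimately show "v \<in> subdifferential TV u" using assms(2) by (simp add: subdifferential_def)
qed

end
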